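(* Assume that $\Lambda(z)=1+\lambda_1 z+\lambda_2 z^2+\cdots$ is analytic at $z=0$ with $\lambda_1>0$ and that all $\Lambda$-FMs of size $n$ are equally likely to be selected. Then the dimension $X_n$ of a random matrix is asymptotically normally distributed with mean and variance both linear in $n$, namely, \[ \frac{X_n-\mu n}{\sigma\sqrt{n}} \xrightarrow{d} \mathscr{N}(0,1), \quad\text{with}\quad (\mu,\sigma^2):=\left(\frac{6}{\pi^2}, \frac{3(12-\pi^2)}{\pi^4}\right), \] where $\xrightarrow{d}$ denotes convergence in distribution and $\mathscr{N}(0,1)$ the standard normal distribution.
   Context: A Fishburn matrix (FM) is an upper-triangular square matrix with nonnegative integer entries such that no row and no column consists exclusively of zeros. Its size is the sum of all its entries and its dimension is the number of its rows. Given a multiset $\Lambda$ of nonnegative integers with generating function $\Lambda(z)=1+\lambda_1 z+\lambda_2 z^2+\cdots$ (so $\lambda_j$ is the multiplicity of $j$ in $\Lambda$), a $\Lambda$-FM is an FM whose entries are taken from $\Lambda$ (weighted by the multiplicities $\lambda_j$); the original FMs correspond to all $\lambda_j=1$ and primitive FMs (0/1 entries) to $\Lambda(z)=1+z$. The coefficients $\lambda_j$ may more generally be arbitrary nonnegative reals. The bivariate generating function of $\Lambda$-FMs with $z$ marking size and $v$ marking dimension is \[ F(z,v)=\sum_{n\ge0}P_n(v)z^n=\sum_{k\ge0}\prod_{1\le j\le k}\left(1-\frac{1}{1+v(\Lambda(z)^j-1)}\right), \] and $X_n$ has probability generating function $P_n(v)/P_n(1)$. *)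

theory Defs
  imports
    "HOL-Probability.Probability"
    "HOL-Complex_Analysis.Complex_Analysis"
    "Jordan_Normal_Form.Matrix"
begin

definition fishburn_matrix :: "nat mat \<Rightarrow> bool" where
  "fishburn_matrix A \<longleftrightarrow> square_mat A \<and> upper_triangular A
     \<and> (\<forall>i<dim_row A. \<exists>j<dim_col A. A $$ (i, j) \<noteq> 0)
     \<and> (\<forall>j<dim_col A. \<exists>i<dim_row A. A $$ (i, j) \<noteq> 0)"

text \<open>The empty (0 by 0) matrix counts as the only Fishburn matrix of size 0.\<close>

definition fishburn_matrices :: "nat \<Rightarrow> nat mat set" where
  "fishburn_matrices n = {A. fishburn_matrix A \<and> sum_mat A = n}"

text \<open>
  A multiset of nonnegative integers is encoded by its multiplicity function \<open>lam\<close>: there are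
  \<open>lam j\<close> copies of the number \<open>j\<close>, and only one copy of 0. Choosing a copy for each entry on
  or above the diagonal, a Fishburn matrix \<open>A\<close> underlies exactly \<open>FM_weight lam A\<close> matrices
  with entries from the multiset (none, if some entry has multiplicity 0). Equally likely
  selection among those of size \<open>n\<close> thus chooses \<open>A\<close> with probability proportional to
  its weight, which also makes sense for arbitrary nonnegative real multiplicities.
\<close>

definition FM_weight :: "(nat \<Rightarrow> real) \<Rightarrow> nat mat \<Rightarrow> real" where
  "FM_weight lam A = (\<Prod>j<dim_col A. \<Prod>i\<le>j. lam (A $$ (i, j)))"

definition random_FM :: "(nat \<Rightarrow> real) \<Rightarrow> nat \<Rightarrow> nat mat pmf" where
  "random_FM lam n = embed_pmf (\<lambda>A. if A \<in> fishburn_matrices n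
     then FM_weight lam A / (\<Sum>B\<in>fishburn_matrices n. FM_weight lam B) else 0)"

definition FM_dimension :: "(nat \<Rightarrow> real) \<Rightarrow> nat \<Rightarrow> nat pmf" where
  "FM_dimension lam n = map_pmf dim_row (random_FM lam n)"

text \<open>
  The remaining facts show that \<open>random_FM\<close> is well defined: there are finitely many Fishburn
  matrices of each size and their total weight is positive, so \<open>embed_pmf\<close> is applied to a
  genuine probability mass function.
\<close>

lemma entry_le_sum_mat:
  fixes A :: "nat mat"
  assumes "i < dim_row A" "j < dim_col A"
  shows "A $$ (i, j) \<le> sum_mat A"
  unfolding sum_mat_def by (rule member_le_sum) (use assms in auto)

lemma fishburn_matrix_dim_le:
  assumes "fishburn_matrix A"
  shows "dim_row A \<le> sum_mat A"
proof -
  have "dim_row A = (\<Sum>i<dim_row A. 1)" by simp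
  also have "\<dots> \<le> (\<Sum>i<dim_row A. \<Sum>j<dim_col A. A $$ (i, j))"
  proof (rule sum_mono)
    fix i assume "i \<in> {..<dim_row A}"
    then obtain j where j: "j < dim_col A" "A $$ (i, j) \<noteq> 0"
      using assms by (auto simp: fishburn_matrix_def)
    have "A $$ (i, j) \<le> (\<Sum>j<dim_col A. A $$ (i, j))"
      by (rule member_le_sum) (use j in auto)
    with j show "1 \<le> (\<Sum>j<dim_col A. A $$ (i, j))" by linarith
  qed
  also have "\<dots> = sum_mat A"
    by (simp add: sum_mat_def sum.cartesian_product lessThan_atLeast0)
  finally show ?thesis .
qed

lemma finite_fishburn_matrices: "finite (fishburn_matrices n)"
proof (rule finite_subset)
  let ?E = "\<lambda>d. PiE ({..<d} \<times> {..<d}) (\<lambda>_. {..n})"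
  show "finite (\<Union>d\<le>n. mat d d ` ?E d)"
    by (intro finite_UN_I finite_imageI finite_PiE) auto
  show "fishburn_matrices n \<subseteq> (\<Union>d\<le>n. mat d d ` ?E d)"
  proof
    fix A assume "A \<in> fishburn_matrices n"
    hence A: "fishburn_matrix A" "sum_mat A = n" by (auto simp: fishburn_matrices_def)
    define d where "d = dim_row A"
    have dc: "dim_col A = d" using A by (auto simp: fishburn_matrix_def d_def)
    define f where "f = restrict (\<lambda>ij. A $$ ij) ({..<d} \<times> {..<d})"
    have "f \<in> ?E d"
      unfolding f_def
    proof (rule restrict_PiE_iff[THEN iffD2], rule ballI)
      fix ij assume "ij \<in> {..<d} \<times> {..<d}"
      then obtain i j where "ij = (i, j)" "i < dim_row A" "j < dim_col A"
        unfolding dc d_def by auto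
      then show "A $$ ij \<in> {..n}"
        using entry_le_sum_mat[of i A j] A(2) by simp
    qed
    moreover have "A = mat d d f"
      by (rule eq_matI) (auto simp: f_def d_def[symmetric] dc)
    moreover have "d \<le> n" using fishburn_matrix_dim_le[OF A(1)] A(2) d_def by simp
    ultimately show "A \<in> (\<Union>d\<le>n. mat d d ` ?E d)" by blast
  qed
qed

lemma FM_weight_nonneg:
  assumes "\<And>j. 0 \<le> lam j"
  shows "0 \<le> FM_weight lam A"
  unfolding FM_weight_def by (intro prod_nonneg ballI assms)

lemma one_mat_fishburn: "1\<^sub>m n \<in> fishburn_matrices n"
proof -
  have "sum_mat (1\<^sub>m n :: nat mat) = (\<Sum>i<n. \<Sum>j<n. if i = j then 1 else 0)"
    unfolding sum_mat_def sum.cartesian_product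
    by (rule sum.cong) (auto simp: lessThan_atLeast0)
  then show ?thesis
    by (auto simp: fishburn_matrices_def fishburn_matrix_def upper_triangular_def)
qed

lemma FM_total_weight_pos:
  assumes "lam 0 = 1" "0 < lam 1" "\<And>j. 0 \<le> lam j"
  shows "0 < (\<Sum>A\<in>fishburn_matrices n. FM_weight lam A)"
proof (rule sum_pos2[OF finite_fishburn_matrices one_mat_fishburn])
  show "0 < FM_weight lam (1\<^sub>m n)"
    unfolding FM_weight_def
  proof (intro prod_pos ballI)
    fix j i assume "j \<in> {..<dim_col (1\<^sub>m n :: nat mat)}" "i \<in> {..j}"
    thus "0 < lam (1\<^sub>m n $$ (i, j))" using assms by (cases "i = j") auto
  qed
qed (rule FM_weight_nonneg[OF assms(3)])

lemma pmf_random_FM: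
  assumes "lam 0 = 1" "0 < lam 1" "\<And>j. 0 \<le> lam j"
  shows "pmf (random_FM lam n) A = (if A \<in> fishburn_matrices n
     then FM_weight lam A / (\<Sum>B\<in>fishburn_matrices n. FM_weight lam B) else 0)"
  unfolding random_FM_def
proof (rule pmf_embed_pmf)
  let ?S = "fishburn_matrices n"
  let ?T = "\<Sum>B\<in>?S. FM_weight lam B"
  let ?f = "\<lambda>A. if A \<in> ?S then FM_weight lam A / ?T else 0"
  have T: "0 < ?T" by (rule FM_total_weight_pos[OF assms])
  show nonneg: "0 \<le> ?f A" for A
    using T FM_weight_nonneg[OF assms(3)] by simp
  have "(\<integral>\<^sup>+A. ennreal (?f A) \<partial>count_space UNIV) = (\<Sum>A\<in>?S. ennreal (?f A))"
    by (rule nn_integral_count_space'[OF finite_fishburn_matrices]) auto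
  also have "\<dots> = ennreal (\<Sum>A\<in>?S. ?f A)"
    by (rule sum_ennreal) (rule nonneg)
  also have "(\<Sum>A\<in>?S. ?f A) = 1"
    using T by (simp add: sum_divide_distrib[symmetric])
  finally show "(\<integral>\<^sup>+A. ennreal (?f A) \<partial>count_space UNIV) = 1" by simp
qed

end

theory Submission
  imports Defs
begin

text \<open>
  Put \<open>q = \<Lambda>(z)\<close>. Expanding the generating function of the matrices over the dimension and
  transforming the resulting \<open>q\<close>-series gives the sum over \<open>k\<close> of the terms
  \<open>q ^ (k + 1) * v ^ k * \<Prod>\<^sub>j (q ^ j - 1)\<^sup>2 * \<Prod>\<^sub>j 1 / (1 - (v - 1) * (q ^ j - 1))\<close>. For \<open>v\<close> near 1
  these terms do not cancel each other. The \<open>n\<close>-th coefficient of each one is a Cauchy integral over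
  the circle on which \<open>\<Lambda> ^ k\<close> reaches 2. It passes near the saddle point for the dominant indices
  \<open>k \<approx> \<kappa> n\<close>, where \<open>\<kappa> = 6 ln 2 / \<pi>\<^sup>2\<close> arises from \<open>\<Sum>\<^sub>j ln (\<Lambda> ^ j - 1)\<close> as a Riemann sum of a
  dilogarithm integral.

  With \<open>v = exp (s / sqrt n)\<close>, \<open>k = \<kappa> n + x sqrt n\<close> and angle \<open>y / sqrt n\<close>, the sum over \<open>k\<close> of the
  Cauchy integrals becomes a double integral over \<open>x\<close> and \<open>y\<close>, whose integrand is dominated by and
  converges to a Gaussian; small \<open>k\<close> contribute an exponentially small amount. So the moment
  generating function of \<open>(X\<^sub>n - \<mu> n) / sqrt n\<close> converges to \<open>exp (\<sigma>\<^sup>2 s\<^sup>2 / 2)\<close> for every complex \<open>s\<close>.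
  Imaginary \<open>s\<close> yield the central limit theorem through Levy's theorem; real \<open>s\<close> control the first
  two moments.
\<close>

section \<open>A transformation of the generating function\<close>

text \<open>The number of matrices grows factorially, so the generating function diverges away from
  0 and offers no singularity to analyse; each summand needs its own radius, of order 1/k. In the
  sum of the products of 1 - 1 / (1 + v (q^j - 1)) the coefficients have mixed signs and cancel
  heavily. In the transformed summands at v = 1 they are nonnegative, so the modulus on a circle is
  largest on the positive axis, as a saddle point argument requires. The value 2 comes from
  stationarity in k: passing from k - 1 to k multiplies the summand by about (q^k - 1)^2, which is 1
  at q^k = 2. Stationarity in z then asks for 2 \<Sum>_j t_j / (1 - exp (- t_j)) = n with t_j = j ln
  2 / k, that is, k / \<kappa> = n. The weights enter only through Ln (Lam z) / z, whose relative
  variation O(1/k) on the circle is too small to affect the limit; hence the constants are the same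
  for every \<open>Lam\<close>. The mean is \<kappa> n / ln 2 rather than \<kappa> n, since besides
  v^k the last product also depends on v and contributes \<Sum>_j (q^j - 1), about k (1 / ln 2 -
  1).\<close>

lemma fps_X_dvd_power_minus_one:
  fixes q :: "'a::field fps"
  assumes "fps_nth q 0 = 1"
  shows "fps_X dvd q ^ j - 1"
proof -
  have "fps_nth (q ^ j - 1) 0 = 0" using assms by (simp add: fps_power_zeroth)
  then have "q ^ j - 1 = fps_X * fps_shift 1 (q ^ j - 1)"
    by (intro fps_ext) (simp del: fps_sub_nth)
  then show ?thesis by (rule dvdI)
qed

lemma fps_X_power_dvd_prod:
  fixes f :: "nat \<Rightarrow> 'a::field fps"
  assumes "\<And>j. j \<in> {1..k} \<Longrightarrow> fps_X dvd f j"
  shows "fps_X ^ k dvd (\<Prod>j=1..k. f j)"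
  using assms
proof (induction k)
  case (Suc k)
  have "fps_X ^ k dvd (\<Prod>j=1..k. f j)" using Suc by auto
  moreover have "fps_X dvd f (Suc k)" using Suc.prems[of "Suc k"] by auto
  ultimately show ?case by (simp add: mult_dvd_mono mult.commute[of fps_X])
qed auto

lemma fps_nth_eq_0_if_X_power_dvd:
  fixes f :: "'a::field fps"
  assumes "fps_X ^ N dvd f" "n < N"
  shows "fps_nth f n = 0"
  using assms by (auto simp: dvd_def fps_X_power_mult_nth)

text \<open>This is 1 - 1 / (1 + v (q^j - 1)), the factor in the generating function over the
  dimension. The product form shows that it is divisible by \<open>fps_X\<close> when q has constant
  term 1.\<close>

definition fishburn_factor :: "'a::field fps \<Rightarrow> 'a \<Rightarrow> nat \<Rightarrow> 'a fps" where
  "fishburn_factor q v j = fps_const v * (q ^ j - 1) * inverse (1 + fps_const v * (q ^ j - 1))"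

definition fishburn_term :: "'a::field fps \<Rightarrow> 'a \<Rightarrow> nat \<Rightarrow> 'a fps" where
  "fishburn_term q v k = q ^ (k + 1) * fps_const v ^ k * (\<Prod>j=1..k. (q ^ j - 1)\<^sup>2)
     * (\<Prod>j=1..k+1. inverse (1 - fps_const (v - 1) * (q ^ j - 1)))"

text \<open>Each q^j - 1 occurs squared and is divisible by \<open>fps_X\<close>. Hence only indices
  with 2 k \<le> n reach coefficient n, which later caps the window of summation.\<close>

lemma fps_X_power_dvd_fishburn_term:
  assumes "fps_nth q 0 = 1"
  shows "fps_X ^ (2 * k) dvd fishburn_term q v k"
proof -
  have "fps_X ^ k dvd (\<Prod>j=1..k. q ^ j - 1)"
    by (rule fps_X_power_dvd_prod) (rule fps_X_dvd_power_minus_one[OF assms])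
  then have "(fps_X ^ k)\<^sup>2 dvd (\<Prod>j=1..k. q ^ j - 1)\<^sup>2"
    by (rule dvd_power_same)
  then show ?thesis
    unfolding fishburn_term_def prod_power_distrib[symmetric]
    by (simp add: power_mult[symmetric] mult.commute[of 2] dvd_mult dvd_mult2)
qed

text \<open>
  The sums \<open>G m\<close> generalise the right-hand side and satisfy \<open>G m = 1 + u (m + 1) * G (m + 1)\<close> up
  to high order, which is the recursion of the left-hand side.
\<close>

lemma fishburn_transformation:
  fixes q :: "'a::field fps" and v :: 'a
  assumes q0: "fps_nth q 0 = 1"
  shows "fps_X ^ N dvd (\<Sum>k<N. \<Prod>j=1..k. fishburn_factor q v j) - (\<Sum>k<N. fishburn_term q v k)"
proof -
  define V where "V = fps_const v"
  define d where "d m = 1 + V * (q ^ m - 1)" for m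
  define e where "e m = 1 - fps_const (v - 1) * (q ^ m - 1)" for m
  define P where "P m n = (\<Prod>i=1..n. q ^ (m + i) - 1)" for m n
  define I where "I n = (\<Prod>j=1..n. inverse (e j))" for n
  define t where "t m n = V ^ n * P m n * P 0 n * I n" for m n
  define g where "g m n = q ^ (n + 1) * V ^ n * P m n * P 0 n * I (n + 1)" for m n
  define G where "G m = d m * (\<Sum>n<N. g m n)" for m
  define u where "u = fishburn_factor q v"
  have nz: "fps_nth (q ^ m - 1) 0 = 0" for m using q0 by (simp add: fps_power_zeroth)
  have inv_e: "inverse (e m) * e m = 1" for m
    by (rule inverse_mult_eq_1) (simp add: e_def fps_sub_nth[of 1] nz del: fps_sub_nth)
  have inv_d: "inverse (d m) * d m = 1" for m
    by (rule inverse_mult_eq_1) (simp add: d_def nz del: fps_sub_nth)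
  have e_alt: "e m = q ^ m - V * (q ^ m - 1)" for m
    by (simp add: e_def V_def algebra_simps fps_const_sub[symmetric] del: fps_const_sub)
  have P_Suc: "P m (Suc n) = P m n * (q ^ (m + Suc n) - 1)" for m n by (simp add: P_def)
  have P_shift: "P m (Suc n) = (q ^ Suc m - 1) * P (Suc m) n" for m n
    by (induction n) (simp_all add: P_Suc mult.assoc, simp_all add: P_def)
  have I_Suc: "I (Suc n) = I n * inverse (e (Suc n))" for n by (simp add: I_def)
  have uG: "u (Suc m) * d (Suc m) = V * (q ^ Suc m - 1)" for m
    unfolding u_def fishburn_factor_def using inv_d[of "Suc m"]
    by (simp add: V_def d_def mult.assoc)
  \<comment> \<open>The terms \<open>t\<close> are the telescoping certificate: after factoring out
    \<open>I (Suc n)\<close>, the bracket splits into \<open>e (Suc n)\<close>, which cancels the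
    newest inverse, and the product of the two factors that extend \<open>P m\<close> and
    \<open>P 0\<close>.\<close>
  have step: "d m * g m n - V * (q ^ Suc m - 1) * g (Suc m) n = t m n - t m (Suc n)" for m n
  proof -
    have "d m * g m n - V * (q ^ Suc m - 1) * g (Suc m) n =
        V ^ n * P 0 n * I (Suc n) * q ^ (n + 1) * (d m * P m n - V * ((q ^ Suc m - 1) * P (Suc m) n))"
      by (simp add: g_def algebra_simps)
    also have "\<dots> = V ^ n * P 0 n * I (Suc n) * P m n * (q ^ Suc n * (d m - V * (q ^ (m + Suc n) - 1)))"
      unfolding P_shift[symmetric] P_Suc by (simp add: algebra_simps)
    also have "q ^ Suc n * (d m - V * (q ^ (m + Suc n) - 1))
        = e (Suc n) - V * (q ^ (m + Suc n) - 1) * (q ^ Suc n - 1)"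
      unfolding d_def e_alt power_add by (simp add: algebra_simps)
    also have "V ^ n * P 0 n * I (Suc n) * P m n * \<dots> = 
        V ^ n * P 0 n * P m n * I n * (inverse (e (Suc n)) * e (Suc n)) -
        V ^ n * V * P 0 n * (q ^ Suc n - 1) * (P m n * (q ^ (m + Suc n) - 1)) * I (Suc n)"
      unfolding I_Suc by (simp add: algebra_simps)
    also have "\<dots> = t m n - t m (Suc n)"
      unfolding inv_e t_def P_Suc by (simp add: algebra_simps)
    finally show ?thesis .
  qed
  \<comment> \<open>Telescoping leaves \<open>t m 0 = 1\<close> and the boundary term
    \<open>t m N\<close>; the latter contains N factors without constant term, so it vanishes to
    order N.\<close>
  have rec: "G m - u (Suc m) * G (Suc m) = 1 - t m N" for m
  proof -
    have "G m - u (Suc m) * G (Suc m) = d m * (\<Sum>n<N. g m n) - V * (q ^ Suc m - 1) * (\<Sum>n<N. g (Suc m) n)"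
      unfolding G_def mult.assoc[symmetric] uG ..
    also have "\<dots> = (\<Sum>n<N. d m * g m n - V * (q ^ Suc m - 1) * g (Suc m) n)"
      by (simp add: sum_subtractf sum_distrib_left)
    also have "\<dots> = t m 0 - t m N" unfolding step by (rule sum_lessThan_telescope')
    finally show ?thesis by (simp add: t_def P_def I_def)
  qed
  have dvd_t: "fps_X ^ N dvd t m N" for m
  proof -
    have "fps_X ^ N dvd P 0 N"
      unfolding P_def by (rule fps_X_power_dvd_prod) (simp add: fps_X_dvd_power_minus_one[OF q0])
    then show ?thesis unfolding t_def by (simp add: dvd_mult dvd_mult2)
  qed
  define U where "U k = (\<Prod>j=1..k. u j)" for k
  have dvd_U: "fps_X ^ k dvd U k" for k
    unfolding U_def
    by (rule fps_X_power_dvd_prod)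
       (simp add: u_def fishburn_factor_def fps_X_dvd_power_minus_one[OF q0] dvd_mult dvd_mult2)
  \<comment> \<open>The recursion is unrolled M times; at M = N both remainders,
    \<open>U m * t m N\<close> and \<open>U N * G N\<close>, are divisible by X^N.\<close>
  have "(\<Sum>m<M. U m * (1 - t m N)) = G 0 - U M * G M" for M
  proof (induction M)
    case (Suc M)
    have "U M * (1 - t M N) = U M * G M - U (Suc M) * G (Suc M)"
      unfolding rec[symmetric] by (simp add: U_def algebra_simps)
    then show ?case using Suc by simp
  qed (simp add: U_def)
  then have "(\<Sum>m<N. U m) - G 0 = (\<Sum>m<N. U m * t m N) - U N * G N"
    by (simp add: algebra_simps sum_subtractf)
  moreover have "fps_X ^ N dvd (\<Sum>m<N. U m * t m N) - U N * G N"
    by (intro dvd_diff dvd_sum dvd_mult dvd_t dvd_mult2 dvd_U)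
  moreover have "G 0 = (\<Sum>k<N. fishburn_term q v k)"
    unfolding G_def d_def g_def fishburn_term_def P_def I_def e_def V_def
    by (simp add: power2_eq_square prod.distrib mult_ac)
  ultimately show ?thesis by (simp add: U_def u_def)
qed

section \<open>Enumeration of Fishburn matrices\<close>

text \<open>Generates signed choices of rows, one column at a time: m counts the rows chosen among
  the first d. A new column contributes q^m - 1, with m counted after the decision about the new
  row; choosing the row comes from m - 1, rejecting it costs a sign.\<close>

fun fishburn_walk :: "'a::field fps \<Rightarrow> 'a \<Rightarrow> nat \<Rightarrow> nat \<Rightarrow> 'a fps" where
  "fishburn_walk q v 0 m = (if m = 0 then 1 else 0)"
| "fishburn_walk q v (Suc d) m = (if m = 0 then 0
     else fps_const v * (q ^ m - 1) * (fishburn_walk q v d (m - 1) - fishburn_walk q v d m))"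

lemma fps_X_power_dvd_fishburn_walk:
  assumes "fps_nth q 0 = 1"
  shows "fps_X ^ d dvd fishburn_walk q v d m"
proof (induction d arbitrary: m)
  case (Suc d)
  have "fps_X * fps_X ^ d dvd (q ^ m - 1) * (fishburn_walk q v d (m - 1) - fishburn_walk q v d m)"
    by (intro mult_dvd_mono fps_X_dvd_power_minus_one[OF assms] dvd_diff Suc)
  then show ?case by (simp add: mult.assoc)
qed auto

lemma fishburn_walk_eq_0: "d < m \<Longrightarrow> fishburn_walk q v d m = 0"
  by (induction d arbitrary: m) auto

text \<open>Summing the recursion over all d gives S (m + 1) = w (S m - S (m + 1)), so a step in m
  multiplies by w / (1 + w), which is \<open>fishburn_factor\<close>. The cut-off at N leaves only
  walks of length N + 1, divisible by X^(N+1).\<close>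

lemma fishburn_walk_sum:
  fixes q :: "'a::field fps"
  assumes q0: "fps_nth q 0 = 1"
  shows "fps_X ^ Suc N dvd (\<Sum>d\<le>N. fishburn_walk q v d m) - (\<Prod>j=1..m. fishburn_factor q v j)"
proof (induction m)
  case 0
  have "fishburn_walk q v d 0 = (if d = 0 then 1 else 0)" for d by (cases d) auto
  then show ?case by simp
next
  case (Suc m)
  define S where "S m = (\<Sum>d\<le>N. fishburn_walk q v d m)" for m
  define w where "w = fps_const v * (q ^ Suc m - 1)"
  define u where "u = fishburn_factor q v (Suc m)"
  define D where "D = inverse (1 + w)"
  have w0: "fps_nth w 0 = 0" using q0 unfolding w_def by (simp add: fps_power_zeroth del: power_Suc)
  have D: "D * (1 + w) = 1" unfolding D_def by (rule inverse_mult_eq_1) (simp add: w0)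
  have u: "u = w * D" by (simp add: u_def w_def D_def fishburn_factor_def)
  have "S (Suc m) + fishburn_walk q v (Suc N) (Suc m) = (\<Sum>d\<le>Suc N. fishburn_walk q v d (Suc m))"
    by (simp add: S_def)
  also have "\<dots> = (\<Sum>d\<le>N. fishburn_walk q v (Suc d) (Suc m))"
    by (subst sum.atMost_Suc_shift) simp
  also have "\<dots> = w * (S m - S (Suc m))"
    unfolding S_def fishburn_walk.simps w_def
    by (simp add: sum_distrib_left sum_subtractf right_diff_distrib)
  finally have "(1 + w) * S (Suc m) = w * S m - fishburn_walk q v (Suc N) (Suc m)"
    by (simp add: algebra_simps)
  then have "D * (1 + w) * S (Suc m) = D * (w * S m - fishburn_walk q v (Suc N) (Suc m))"
    by (simp add: mult.assoc)
  then have "S (Suc m) = u * S m - D * fishburn_walk q v (Suc N) (Suc m)"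
    unfolding D u by (simp add: algebra_simps)
  then have "S (Suc m) - (\<Prod>j=1..Suc m. fishburn_factor q v j) =
      u * (S m - (\<Prod>j=1..m. fishburn_factor q v j)) - D * fishburn_walk q v (Suc N) (Suc m)"
    by (simp add: u_def algebra_simps)
  also have "fps_X ^ Suc N dvd \<dots>"
    by (intro dvd_diff[OF dvd_mult dvd_mult] Suc[folded S_def] fps_X_power_dvd_fishburn_walk[OF q0])
  finally show ?case by (simp add: S_def)
qed

lemma sum_Pow_Suc:
  fixes f :: "nat set \<Rightarrow> 'b::comm_monoid_add"
  shows "(\<Sum>M | M \<subseteq> {..<Suc d} \<and> card M = Suc m. f M)
    = (\<Sum>M | M \<subseteq> {..<d} \<and> card M = Suc m. f M) + (\<Sum>M | M \<subseteq> {..<d} \<and> card M = m. f (insert d M))"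
proof -
  let ?A = "{M. M \<subseteq> {..<d} \<and> card M = Suc m}" and ?B = "{M. M \<subseteq> {..<d} \<and> card M = m}"
  have fin: "finite ?A" "finite ?B" by (rule finite_subset[of _ "Pow {..<d}"]; auto)+
  have card_insert: "card (insert d M) = Suc (card M)" if "M \<subseteq> {..<d}" for M
    using that by (intro card_insert_disjoint finite_subset[OF that]) auto
  have eq: "{M. M \<subseteq> {..<Suc d} \<and> card M = Suc m} = ?A \<union> insert d ` ?B"
  proof (intro equalityI subsetI)
    fix M assume M: "M \<in> {M. M \<subseteq> {..<Suc d} \<and> card M = Suc m}"
    then have "finite M" using finite_subset by blast
    show "M \<in> ?A \<union> insert d ` ?B"
    proof (cases "d \<in> M")
      case True
      then have "M = insert d (M - {d})" "card (M - {d}) = m" "M - {d} \<subseteq> {..<d}"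
        using M \<open>finite M\<close> by (auto simp: lessThan_Suc)
      then show ?thesis by blast
    next
      case False
      then show ?thesis using M by (auto simp: lessThan_Suc)
    qed
  qed (use card_insert in \<open>auto simp: lessThan_Suc\<close>)
  have inj: "inj_on (insert d) ?B"
  proof (rule inj_onI)
    fix M M' assume "M \<in> ?B" "M' \<in> ?B" "insert d M = insert d M'"
    moreover from this have "d \<notin> M" "d \<notin> M'" by auto
    ultimately show "M = M'" by (metis insert_ident)
  qed
  have "?A \<inter> insert d ` ?B = {}" by auto
  with fin inj show ?thesis unfolding eq
    by (subst sum.union_disjoint) (auto simp: sum.reindex)
qed

text \<open>The walk decides about rows 0, 1, ... in turn, so a walk ending at m is a set M of m
  rows, and column j sees the chosen rows up to j.\<close>

lemma fishburn_walk_eq_sum: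
  fixes q :: "'a::field fps"
  shows "fishburn_walk q v d m = (\<Sum>M | M \<subseteq> {..<d} \<and> card M = m.
     (-1) ^ (d - m) * fps_const v ^ d * (\<Prod>j<d. q ^ card (M \<inter> {..j}) - 1))"
proof (induction d arbitrary: m)
  case 0
  have "{M. M \<subseteq> {..<0::nat} \<and> card M = m} = (if m = 0 then {{}} else {})" by auto
  then show ?case by simp
next
  case (Suc d)
  show ?case
  proof (cases m)
    case 0
    have "{M. M \<subseteq> {..<Suc d} \<and> card M = m} = {{}}"
      using finite_subset[OF _ finite_lessThan] by (auto simp: 0)
    then show ?thesis using 0 by simp
  next
    case (Suc k)
    have cap: "M \<inter> {..d} = M" if "M \<subseteq> {..<d}" for M using that by auto
    have cap': "insert d M \<inter> {..d} = insert d M" if "M \<subseteq> {..<d}" for M using that by auto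
    have cap'': "insert d M \<inter> {..j} = M \<inter> {..j}" if "j < d" for M j using that by auto
    have card_insert: "card (insert d M) = Suc (card M)" if "M \<subseteq> {..<d}" for M
      using that by (intro card_insert_disjoint finite_subset[OF that]) auto
    define h where "h M = fps_const v ^ d * (\<Prod>j<d. q ^ card (M \<inter> {..j}) - 1)" for M
    have h: "(\<Prod>j<Suc d. q ^ card (M \<inter> {..j}) - 1) * fps_const v ^ Suc d
        = fps_const v * (q ^ card (M \<inter> {..d}) - 1) * h M" for M
      by (simp add: h_def mult_ac)
    have h_insert: "h (insert d M) = h M" for M by (simp add: h_def cap'')
    \<comment> \<open>A set of k + 1 elements below d forces k < d; this keeps truncated subtraction
      from spoiling the sign.\<close>
    have sgn: "(-1) ^ (d - k) = - ((-1 :: 'a fps) ^ (d - Suc k))" if "M \<subseteq> {..<d}" "card M = Suc k" for M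
    proof -
      have "Suc k \<le> d" using that card_mono[OF finite_lessThan that(1)] by simp
      then have "d - k = Suc (d - Suc k)" by simp
      then show ?thesis by simp
    qed
    have "(\<Sum>M | M \<subseteq> {..<Suc d} \<and> card M = m.
       (-1) ^ (Suc d - m) * fps_const v ^ Suc d * (\<Prod>j<Suc d. q ^ card (M \<inter> {..j}) - 1))
      = (\<Sum>M | M \<subseteq> {..<Suc d} \<and> card M = Suc k.
       (-1) ^ (d - k) * (fps_const v * (q ^ card (M \<inter> {..d}) - 1) * h M))"
      unfolding h[symmetric] by (simp add: Suc mult_ac del: prod.lessThan_Suc power_Suc)
    also have "\<dots> = (\<Sum>M | M \<subseteq> {..<d} \<and> card M = Suc k. fps_const v * (q ^ m - 1) * 
           (- ((-1) ^ (d - Suc k) * h M)))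
      + (\<Sum>M | M \<subseteq> {..<d} \<and> card M = k. fps_const v * (q ^ m - 1) * ((-1) ^ (d - k) * h M))"
      unfolding sum_Pow_Suc
    proof (intro arg_cong2[of _ _ _ _ "(+)"] sum.cong refl, goal_cases)
      case (1 M)
      then have M: "M \<subseteq> {..<d}" "card M = Suc k" by auto
      show ?case unfolding sgn[OF M] cap[OF M(1)] M(2) Suc by (simp add: mult_ac)
    next
      case (2 M)
      then show ?case using cap'[of M] card_insert[of M] by (simp add: Suc h_insert mult_ac)
    qed
    also have "\<dots> = fishburn_walk q v (Suc d) m"
      using Suc by (simp add: Suc.IH h_def sum_distrib_left sum_negf right_diff_distrib mult.assoc)
    finally show ?thesis ..
  qed
qed

section \<open>Inclusion-exclusion over zero rows and zero columns\<close>

lemma inclusion_exclusion_none: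
  assumes "finite A"
  shows "(if \<forall>i\<in>A. \<not> P i then 1 else 0 :: 'a::comm_ring_1)
    = (\<Sum>M\<in>Pow A. (-1) ^ card (A - M) * (if \<forall>i\<in>A - M. P i then 1 else 0))"
proof -
  have prod_if: "(\<Prod>i\<in>B. if Q i then 1 else 0 :: 'a) = (if \<forall>i\<in>B. Q i then 1 else 0)" if "finite B" for B Q
    using that by induction auto
  have "(if \<forall>i\<in>A. \<not> P i then 1 else 0 :: 'a) = (\<Prod>i\<in>A. if \<not> P i then 1 else 0)"
    using prod_if[OF assms, of "\<lambda>i. \<not> P i"] by simp
  also have "\<dots> = (\<Prod>i\<in>A. 1 + (-1) * (if P i then 1 else 0))"
    by (rule prod.cong) auto
  also have "\<dots> = (\<Sum>M\<in>Pow A. (\<Prod>i\<in>M. 1) * (\<Prod>i\<in>A - M. (-1) * (if P i then 1 else 0)))"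
    by (rule prod_add[OF assms])
  also have "\<dots> = (\<Sum>M\<in>Pow A. (-1) ^ card (A - M) * (if \<forall>i\<in>A - M. P i then 1 else 0))"
    using assms by (intro sum.cong refl) (simp only: prod.distrib prod_constant power_one mult_1 prod_if finite_Diff)
  finally show ?thesis .
qed

text \<open>A cell is a pair of a column index \<open>j\<close> and a row index \<open>i \<le> j\<close>, in this order.\<close>

definition upper_cells :: "nat \<Rightarrow> (nat \<times> nat) set" where
  "upper_cells d = (SIGMA j:{..<d}. {..j})"

lemma finite_upper_cells [simp]: "finite (upper_cells d)"
  by (auto simp: upper_cells_def)

definition row_nonzero :: "nat \<Rightarrow> (nat \<times> nat \<Rightarrow> nat) \<Rightarrow> nat \<Rightarrow> bool" where
  "row_nonzero d f i \<longleftrightarrow> (\<exists>j. (j, i) \<in> upper_cells d \<and> f (j, i) \<noteq> 0)"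

definition col_nonzero :: "nat \<Rightarrow> (nat \<times> nat \<Rightarrow> nat) \<Rightarrow> nat \<Rightarrow> bool" where
  "col_nonzero d f j \<longleftrightarrow> (\<exists>i. (j, i) \<in> upper_cells d \<and> f (j, i) \<noteq> 0)"

text \<open>Forcing rows outside M and columns outside K to vanish is a condition on each cell
  separately, so the sum over all fillings factorises. A forced cell contributes
  \<open>g 0 = 1\<close>, a free one the full sum of g, and column j has
  \<open>card (M \<inter> {..j})\<close> free cells.\<close>

lemma sum_cells_restricted:
  fixes g :: "nat \<Rightarrow> 'a::comm_ring_1"
  assumes g0: "g 0 = 1" and M: "M \<subseteq> {..<d}" and K: "K \<subseteq> {..<d}"
  shows "(\<Sum>f\<in>PiE (upper_cells d) (\<lambda>_. {..n}). (\<Prod>c\<in>upper_cells d. g (f c)) *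
      ((if \<forall>i\<in>{..<d} - M. \<not> row_nonzero d f i then 1 else 0) *
       (if \<forall>j\<in>{..<d} - K. \<not> col_nonzero d f j then 1 else 0)))
    = (\<Prod>j\<in>K. (\<Sum>a\<le>n. g a) ^ card (M \<inter> {..j}))" (is "?L = _")
proof -
  let ?C = "upper_cells d"
  define allow where "allow c \<longleftrightarrow> fst c \<in> K \<and> snd c \<in> M" for c :: "nat \<times> nat"
  have prod_if: "(\<Prod>i\<in>B. if Q i then 1 else 0 :: 'a) = (if \<forall>i\<in>B. Q i then 1 else 0)" if "finite B" for B and Q :: "nat \<times> nat \<Rightarrow> bool"
    using that by induction auto
  have "?L = (\<Sum>f\<in>PiE ?C (\<lambda>_. {..n}). \<Prod>c\<in>?C. g (f c) * (if allow c \<or> f c = 0 then 1 else 0))"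
  proof (rule sum.cong[OF refl])
    fix f :: "nat \<times> nat \<Rightarrow> nat"
    have "(\<forall>i\<in>{..<d} - M. \<not> row_nonzero d f i) \<and> (\<forall>j\<in>{..<d} - K. \<not> col_nonzero d f j)
        \<longleftrightarrow> (\<forall>c\<in>?C. allow c \<or> f c = 0)"
    proof -
      have "fst c < d" "snd c < d" if "c \<in> ?C" for c using that by (auto simp: upper_cells_def)
      moreover have "i \<notin> M \<Longrightarrow> \<not> allow (j, i)" "j \<notin> K \<Longrightarrow> \<not> allow (j, i)" for i j
        by (auto simp: allow_def)
      moreover have "allow (j, i) \<longleftrightarrow> j \<in> K \<and> i \<in> M" for i j by (simp add: allow_def)
      ultimately show ?thesis
        unfolding row_nonzero_def col_nonzero_def by (metis DiffE DiffI lessThan_iff prod.collapse)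
    qed
    then show "(\<Prod>c\<in>?C. g (f c)) *
      ((if \<forall>i\<in>{..<d} - M. \<not> row_nonzero d f i then 1 else 0) *
       (if \<forall>j\<in>{..<d} - K. \<not> col_nonzero d f j then 1 else 0)) =
       (\<Prod>c\<in>?C. g (f c) * (if allow c \<or> f c = 0 then 1 else 0))"
      unfolding prod.distrib prod_if[OF finite_upper_cells] by auto
  qed
  also have "\<dots> = (\<Prod>c\<in>?C. \<Sum>a\<le>n. g a * (if allow c \<or> a = 0 then 1 else 0))"
    by (rule prod_sum_PiE[symmetric]) auto
  also have "\<dots> = (\<Prod>c\<in>?C. if allow c then (\<Sum>a\<le>n. g a) else 1)"
  proof (rule prod.cong[OF refl])
    fix c
    have "(\<Sum>a\<le>n. g a * (if a = 0 then 1 else 0)) = (\<Sum>a\<in>{0}. g a * (if a = 0 then 1 else 0))"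
      by (rule sum.mono_neutral_right) auto
    then show "(\<Sum>a\<le>n. g a * (if allow c \<or> a = 0 then 1 else 0)) = (if allow c then (\<Sum>a\<le>n. g a) else 1)"
      by (simp add: g0)
  qed
  also have "\<dots> = (\<Prod>j<d. \<Prod>i\<le>j. if j \<in> K \<and> i \<in> M then (\<Sum>a\<le>n. g a) else 1)"
    unfolding upper_cells_def by (subst prod.Sigma) (auto simp: allow_def case_prod_unfold)
  also have "\<dots> = (\<Prod>j<d. if j \<in> K then (\<Sum>a\<le>n. g a) ^ card (M \<inter> {..j}) else 1)"
  proof (rule prod.cong[OF refl])
    fix j
    have "(\<Prod>i\<le>j. if i \<in> M then (\<Sum>a\<le>n. g a) else 1) = (\<Prod>i\<in>M \<inter> {..j}. (\<Sum>a\<le>n. g a))"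
      by (rule prod.mono_neutral_cong_right) auto
    then show "(\<Prod>i\<le>j. if j \<in> K \<and> i \<in> M then (\<Sum>a\<le>n. g a) else 1)
        = (if j \<in> K then (\<Sum>a\<le>n. g a) ^ card (M \<inter> {..j}) else 1)" by simp
  qed
  also have "\<dots> = (\<Prod>j\<in>K. (\<Sum>a\<le>n. g a) ^ card (M \<inter> {..j}))"
    using K by (intro prod.mono_neutral_cong_right) auto
  finally show ?thesis .
qed

lemma sum_cells_fishburn:
  fixes g :: "nat \<Rightarrow> 'a::comm_ring_1"
  assumes g0: "g 0 = 1"
  shows "(\<Sum>f\<in>PiE (upper_cells d) (\<lambda>_. {..n}). (\<Prod>c\<in>upper_cells d. g (f c)) *
      (if (\<forall>i<d. row_nonzero d f i) \<and> (\<forall>j<d. col_nonzero d f j) then 1 else 0))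
    = (\<Sum>M\<in>Pow {..<d}. (-1) ^ card ({..<d} - M) * (\<Prod>j<d. (\<Sum>a\<le>n. g a) ^ card (M \<inter> {..j}) - 1))"
proof -
  let ?F = "PiE (upper_cells d) (\<lambda>_. {..n})"
  let ?w = "\<lambda>f. \<Prod>c\<in>upper_cells d. g (f c)"
  let ?r = "\<lambda>M f. if \<forall>i\<in>{..<d} - M. \<not> row_nonzero d f i then 1 else 0 :: 'a"
  let ?c = "\<lambda>K f. if \<forall>j\<in>{..<d} - K. \<not> col_nonzero d f j then 1 else 0 :: 'a"
  let ?s = "\<lambda>M. (-1) ^ card ({..<d} - M) :: 'a"
  have "(\<Sum>f\<in>?F. ?w f * (if (\<forall>i<d. row_nonzero d f i) \<and> (\<forall>j<d. col_nonzero d f j) then 1 else 0))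
     = (\<Sum>f\<in>?F. ?w f * ((\<Sum>M\<in>Pow {..<d}. ?s M * ?r M f) * (\<Sum>K\<in>Pow {..<d}. ?s K * ?c K f)))"
    by (subst (1 2) inclusion_exclusion_none[symmetric]) (auto intro!: sum.cong)
  also have "\<dots> = (\<Sum>f\<in>?F. \<Sum>M\<in>Pow {..<d}. \<Sum>K\<in>Pow {..<d}. ?s M * (?s K * (?w f * (?r M f * ?c K f))))"
    unfolding sum_product unfolding sum_distrib_left by (intro sum.cong refl) (simp only: mult_ac)
  also have "\<dots> = (\<Sum>M\<in>Pow {..<d}. \<Sum>K\<in>Pow {..<d}. \<Sum>f\<in>?F. ?s M * (?s K * (?w f * (?r M f * ?c K f))))"
    by (subst sum.swap, rule sum.cong[OF refl], rule sum.swap)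
  also have "\<dots> = (\<Sum>M\<in>Pow {..<d}. \<Sum>K\<in>Pow {..<d}. ?s M * (?s K * (\<Sum>f\<in>?F. ?w f * (?r M f * ?c K f))))"
    unfolding sum_distrib_left ..
  also have "\<dots> = (\<Sum>M\<in>Pow {..<d}. \<Sum>K\<in>Pow {..<d}. ?s M * (?s K * (\<Prod>j\<in>K. (\<Sum>a\<le>n. g a) ^ card (M \<inter> {..j}))))"
    by (intro sum.cong refl, subst sum_cells_restricted[of g]) (auto simp: g0)
  \<comment> \<open>The signed sum over K is the expansion of a product over the columns; resumming
    it gives one factor of the form (power - 1) per column and leaves only the row subsets.\<close>
  also have "\<dots> = (\<Sum>M\<in>Pow {..<d}. ?s M * (\<Prod>j<d. (\<Sum>a\<le>n. g a) ^ card (M \<inter> {..j}) + (-1)))"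
    unfolding prod_add[OF finite_lessThan] sum_distrib_left prod_constant
    by (intro sum.cong refl) (simp only: mult_ac)
  finally show ?thesis by simp
qed

section \<open>Matrices as fillings of the upper cells\<close>

definition cells_of_mat :: "nat mat \<Rightarrow> nat \<times> nat \<Rightarrow> nat" where
  "cells_of_mat A = restrict (\<lambda>(j, i). A $$ (i, j)) (upper_cells (dim_row A))"

definition mat_of_cells :: "nat \<Rightarrow> (nat \<times> nat \<Rightarrow> nat) \<Rightarrow> nat mat" where
  "mat_of_cells d f = mat d d (\<lambda>(i, j). if i \<le> j then f (j, i) else 0)"

lemma sum_mat_upper_triangular:
  assumes "upper_triangular A" "dim_row A = d" "dim_col A = d"
  shows "sum_mat A = (\<Sum>c\<in>upper_cells d. cells_of_mat A c)"
proof -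
  have "(\<Sum>c\<in>upper_cells d. cells_of_mat A c) = (\<Sum>j<d. \<Sum>i\<le>j. A $$ (i, j))"
    unfolding cells_of_mat_def assms upper_cells_def by (subst sum.Sigma) (auto intro!: sum.cong)
  also have "\<dots> = (\<Sum>j<d. \<Sum>i<d. A $$ (i, j))"
    using assms by (intro sum.cong sum.mono_neutral_left refl) (auto simp: upper_triangular_def)
  also have "\<dots> = (\<Sum>i<d. \<Sum>j<d. A $$ (i, j))" by (rule sum.swap)
  also have "\<dots> = sum_mat A"
    unfolding sum_mat_def assms by (simp add: sum.cartesian_product lessThan_atLeast0)
  finally show ?thesis by simp
qed

text \<open>An entry of a matrix of size n is at most n, so fillings can be taken from a finite
  function space; \<open>cells_of_mat\<close> is extensional so that \<open>mat_of_cells\<close>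
  inverts it exactly.\<close>

lemma fishburn_matrices_cells_bij:
  "bij_betw cells_of_mat {A \<in> fishburn_matrices n. dim_row A = d}
    {f \<in> PiE (upper_cells d) (\<lambda>_. {..n}). (\<Sum>c\<in>upper_cells d. f c) = n \<and>
       (\<forall>i<d. row_nonzero d f i) \<and> (\<forall>j<d. col_nonzero d f j)}" (is "bij_betw _ ?A ?F")
proof (rule bij_betw_byWitness[where f' = "mat_of_cells d"])
  have A: "upper_triangular A" "dim_row A = d" "dim_col A = d" "sum_mat A = n" "fishburn_matrix A"
    if "A \<in> ?A" for A
    using that by (auto simp: fishburn_matrices_def fishburn_matrix_def)
  show "\<forall>A\<in>?A. mat_of_cells d (cells_of_mat A) = A"
  proof
    fix A assume "A \<in> ?A"
    note A = A[OF this]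
    show "mat_of_cells d (cells_of_mat A) = A"
      by (rule eq_matI) (use A in \<open>auto simp: mat_of_cells_def cells_of_mat_def upper_cells_def upper_triangular_def\<close>)
  qed
  have F: "cells_of_mat (mat_of_cells d f) = f" if "f \<in> PiE (upper_cells d) (\<lambda>_. {..n})" for f
  proof
    fix c
    show "cells_of_mat (mat_of_cells d f) c = f c"
    proof (cases "c \<in> upper_cells d")
      case True
      then show ?thesis by (auto simp: mat_of_cells_def cells_of_mat_def upper_cells_def)
    next
      case False
      then show ?thesis using PiE_arb[OF that False] by (simp add: mat_of_cells_def cells_of_mat_def)
    qed
  qed
  then show "\<forall>f\<in>?F. cells_of_mat (mat_of_cells d f) = f" by blast
  have rc: "(\<forall>i<d. \<exists>j<d. A $$ (i, j) \<noteq> 0) \<longleftrightarrow> (\<forall>i<d. row_nonzero d (cells_of_mat A) i)"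
    "(\<forall>j<d. \<exists>i<d. A $$ (i, j) \<noteq> 0) \<longleftrightarrow> (\<forall>j<d. col_nonzero d (cells_of_mat A) j)"
    if "upper_triangular A" "dim_row A = d" "dim_col A = d" for A
  proof -
    have low: "A $$ (i, j) = 0" if "i < d" "j < i" for i j
      using that \<open>upper_triangular A\<close> \<open>dim_row A = d\<close> by (auto simp: upper_triangular_def)
    have "row_nonzero d (cells_of_mat A) i \<longleftrightarrow> (\<exists>j<d. i \<le> j \<and> A $$ (i, j) \<noteq> 0)" for i
      unfolding row_nonzero_def cells_of_mat_def \<open>dim_row A = d\<close> by (auto simp: upper_cells_def)
    then have "(\<exists>j<d. A $$ (i, j) \<noteq> 0) \<longleftrightarrow> row_nonzero d (cells_of_mat A) i" if "i < d" for i
      using low[OF that] not_le_imp_less by (metis (full_types))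
    then show "(\<forall>i<d. \<exists>j<d. A $$ (i, j) \<noteq> 0) \<longleftrightarrow> (\<forall>i<d. row_nonzero d (cells_of_mat A) i)" by blast
    have "col_nonzero d (cells_of_mat A) j \<longleftrightarrow> (\<exists>i\<le>j. A $$ (i, j) \<noteq> 0)" if "j < d" for j
      unfolding col_nonzero_def cells_of_mat_def \<open>dim_row A = d\<close> using that by (auto simp: upper_cells_def)
    then have "(\<exists>i<d. A $$ (i, j) \<noteq> 0) \<longleftrightarrow> col_nonzero d (cells_of_mat A) j" if "j < d" for j
      using that low[of _ j] not_le_imp_less by (metis (full_types) le_less_trans)
    then show "(\<forall>j<d. \<exists>i<d. A $$ (i, j) \<noteq> 0) \<longleftrightarrow> (\<forall>j<d. col_nonzero d (cells_of_mat A) j)" by blast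
  qed
  show "cells_of_mat ` ?A \<subseteq> ?F"
  proof
    fix f assume "f \<in> cells_of_mat ` ?A"
    then obtain A' where A': "A' \<in> ?A" "f = cells_of_mat A'" by blast
    note A = A[OF A'(1)]
    have "f c \<le> n" if "c \<in> upper_cells d" for c
      using sum_mat_upper_triangular[OF A(1-3)] member_le_sum[OF that, of f] A(4) A'(2) by simp
    moreover have "f \<in> extensional (upper_cells d)" unfolding A' cells_of_mat_def A(2) by simp
    moreover have "(\<Sum>c\<in>upper_cells d. f c) = n" using sum_mat_upper_triangular[OF A(1-3)] A(4) A'(2) by simp
    moreover have "(\<forall>i<d. row_nonzero d f i) \<and> (\<forall>j<d. col_nonzero d f j)"
      using A(5) unfolding fishburn_matrix_def A(2,3) rc[OF A(1-3)] A'(2) by simp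
    ultimately show "f \<in> ?F" by (auto simp: PiE_def)
  qed
  show "mat_of_cells d ` ?F \<subseteq> ?A"
  proof
    fix A assume "A \<in> mat_of_cells d ` ?F"
    then obtain f where f: "f \<in> ?F" "A = mat_of_cells d f" by blast
    have A: "upper_triangular A" "dim_row A = d" "dim_col A = d"
      unfolding f mat_of_cells_def by (auto simp: upper_triangular_def)
    have cA: "cells_of_mat A = f" using F[of f] f by simp
    have "fishburn_matrix A"
      using f(1) unfolding fishburn_matrix_def A(2,3) rc[OF A] cA by (simp add: A)
    moreover have "sum_mat A = n" using sum_mat_upper_triangular[OF A] f(1) unfolding cA by simp
    ultimately show "A \<in> ?A" using A by (auto simp: fishburn_matrices_def)
  qed
qed

lemma FM_weight_cells:
  assumes "A \<in> fishburn_matrices n" "dim_row A = d"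
  shows "FM_weight lam A = (\<Prod>c\<in>upper_cells d. lam (cells_of_mat A c))"
proof -
  have "dim_col A = d" using assms by (auto simp: fishburn_matrices_def fishburn_matrix_def)
  then show ?thesis unfolding FM_weight_def cells_of_mat_def upper_cells_def \<open>dim_row A = d\<close>
    by (subst prod.Sigma) (auto intro!: prod.cong)
qed

section \<open>Congruences modulo a divisor\<close>

lemma dvd_diff_mult_cong:
  fixes a b c d e :: "'a::comm_ring_1"
  assumes "e dvd a - b" "e dvd c - d"
  shows "e dvd a * c - b * d"
proof -
  have "a * c - b * d = a * (c - d) + (a - b) * d" by (simp add: algebra_simps)
  then show ?thesis using assms by (simp add: dvd_mult dvd_mult2)
qed

lemma dvd_diff_power_cong:
  fixes a b e :: "'a::comm_ring_1"
  assumes "e dvd a - b"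
  shows "e dvd a ^ n - b ^ n"
  by (induction n) (auto intro: dvd_diff_mult_cong assms)

lemma dvd_diff_prod_cong:
  fixes f g :: "'b \<Rightarrow> 'a::comm_ring_1"
  assumes "\<And>x. x \<in> A \<Longrightarrow> e dvd f x - g x"
  shows "e dvd prod f A - prod g A"
  using assms by (induction A rule: infinite_finite_induct) (auto intro: dvd_diff_mult_cong)

lemma dvd_diff_inverse_cong:
  fixes f g :: "'a::field fps"
  assumes "e dvd f - g" "fps_nth f 0 \<noteq> 0" "fps_nth g 0 \<noteq> 0"
  shows "e dvd inverse f - inverse g"
proof -
  have "inverse f - inverse g = (inverse g * g) * inverse f - (inverse f * f) * inverse g"
    using assms by (simp add: inverse_mult_eq_1)
  also have "\<dots> = inverse f * inverse g * (g - f)" by (simp add: algebra_simps)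
  finally show ?thesis using assms(1) by (metis dvd_mult minus_diff_eq dvd_minus_iff)
qed

lemma fishburn_term_cong:
  fixes q q' :: "'a::field fps"
  assumes "fps_nth q 0 = 1" "fps_nth q' 0 = 1" and e: "e dvd q - q'"
  shows "e dvd fishburn_term q v k - fishburn_term q' v k"
proof -
  have pow: "e dvd (q ^ j - 1) - (q' ^ j - 1)" for j
    using dvd_diff_power_cong[OF e, of j] by simp
  have c: "e dvd 1 - fps_const (v - 1) * (q ^ j - 1) - (1 - fps_const (v - 1) * (q' ^ j - 1))" for j
  proof -
    have "1 - fps_const (v - 1) * (q ^ j - 1) - (1 - fps_const (v - 1) * (q' ^ j - 1))
       = - fps_const (v - 1) * ((q ^ j - 1) - (q' ^ j - 1))"
      by (simp only: right_diff_distrib mult_minus_left minus_diff_eq) simp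
    then show ?thesis using dvd_mult[OF pow] by simp
  qed
  have nz: "fps_nth (1 - fps_const (v - 1) * (p ^ j - 1)) 0 \<noteq> 0" if "fps_nth p 0 = 1" for p :: "'a fps" and j
    using that by (simp add: fps_power_zeroth)
  show ?thesis
    unfolding fishburn_term_def
    by (intro dvd_diff_mult_cong dvd_diff_power_cong e dvd_diff_prod_cong pow dvd_diff_inverse_cong c nz assms)
       simp
qed

lemma sum_Pow_card:
  "(\<Sum>M\<in>Pow {..<d}. f M) = (\<Sum>m\<le>d. \<Sum>M | M \<subseteq> {..<d} \<and> card M = m. f M)"
proof -
  have "(\<Sum>M\<in>Pow {..<d}. f M) = (\<Sum>m\<le>d. \<Sum>M | M \<in> Pow {..<d} \<and> card M = m. f M)"
    using card_mono[OF finite_lessThan[of d]] by (intro sum.group[symmetric]) auto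
  then show ?thesis by simp
qed

lemma fishburn_matrices_gf:
  fixes lam :: "nat \<Rightarrow> real" and v :: complex
  assumes lam0: "lam 0 = 1"
  defines "q \<equiv> Abs_fps (\<lambda>j. complex_of_real (lam j))"
  shows "(\<Sum>A\<in>fishburn_matrices n. of_real (FM_weight lam A) * v ^ dim_row A)
    = (\<Sum>k\<le>n. fps_nth (fishburn_term q v k) n)"
proof -
  \<comment> \<open>One factor \<open>g\<close> per entry records its weight and its contribution to
    the size, so the product over the cells is the weight times X^size and coefficient n selects
    size n.\<close>
  define g where "g a = fps_const (complex_of_real (lam a)) * fps_X ^ a" for a
  \<comment> \<open>Entries are bounded by n, so the truncation p of q appears in the enumeration;
    the two agree modulo X^(n+1), which decides coefficient n.\<close>
  define p where "p = (\<Sum>a\<le>n. g a)"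
  have p_nth: "fps_nth p m = (if m \<le> n then of_real (lam m) else 0)" for m
    unfolding p_def g_def by (simp add: fps_sum_nth if_distrib cong: if_cong)
  have "q - p = fps_X ^ Suc n * fps_shift (Suc n) (q - p)"
    by (intro fps_ext) (auto simp: fps_X_power_mult_nth p_nth q_def simp del: power_Suc)
  then have dvd: "fps_X ^ Suc n dvd q - p" by (rule dvdI)
  have p0: "fps_nth p 0 = 1" and q0: "fps_nth q 0 = 1" by (simp_all add: p_nth q_def lam0)
  have g0: "g 0 = 1" by (simp add: g_def lam0)
  define ind where "ind d f = (if (\<forall>i<d. row_nonzero d f i) \<and> (\<forall>j<d. col_nonzero d f j) then 1 else 0 :: complex fps)" for d f
  have dim: "(\<Sum>A | A \<in> fishburn_matrices n \<and> dim_row A = d. of_real (FM_weight lam A) * v ^ d)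
      = fps_nth (\<Sum>m\<le>n. fishburn_walk p v d m) n" if "d \<le> n" for d
  proof -
    let ?C = "upper_cells d"
    let ?P = "PiE ?C (\<lambda>_. {..n})"
    let ?F = "{f \<in> ?P. sum f ?C = n \<and> (\<forall>i<d. row_nonzero d f i) \<and> (\<forall>j<d. col_nonzero d f j)}"
    have prod_g: "(\<Prod>c\<in>?C. g (f c)) = fps_const (of_real (\<Prod>c\<in>?C. lam (f c))) * fps_X ^ (sum f ?C)" for f
    proof -
      have "(\<Prod>c\<in>B. fps_const (complex_of_real (lam (f c)))) = fps_const (of_real (\<Prod>c\<in>B. lam (f c)))" for B
        by (induction B rule: infinite_finite_induct) simp_all
      then show ?thesis unfolding g_def prod.distrib power_sum[symmetric] by simp
    qed
    have fin: "finite ?P" by (intro finite_PiE) auto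
    have "(\<Sum>A | A \<in> fishburn_matrices n \<and> dim_row A = d. of_real (FM_weight lam A))
        = (\<Sum>A | A \<in> fishburn_matrices n \<and> dim_row A = d. complex_of_real (\<Prod>c\<in>?C. lam (cells_of_mat A c)))"
      by (rule sum.cong) (auto simp: FM_weight_cells)
    also have "\<dots> = (\<Sum>f\<in>?F. complex_of_real (\<Prod>c\<in>?C. lam (f c)))"
      by (rule sum.reindex_bij_betw[OF fishburn_matrices_cells_bij])
    also have "\<dots> = (\<Sum>f\<in>?F. fps_nth ((\<Prod>c\<in>?C. g (f c)) * ind d f) n)"
      by (rule sum.cong) (auto simp: prod_g ind_def fps_mult_left_const_nth)
    also have "\<dots> = (\<Sum>f\<in>?P. fps_nth ((\<Prod>c\<in>?C. g (f c)) * ind d f) n)"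
      using fin by (intro sum.mono_neutral_left) (auto simp: prod_g ind_def fps_mult_left_const_nth)
    also have "\<dots> = fps_nth (\<Sum>f\<in>?P. (\<Prod>c\<in>?C. g (f c)) * ind d f) n"
      by (simp add: fps_sum_nth)
    also have "\<dots> = fps_nth (\<Sum>M\<in>Pow {..<d}. (-1) ^ card ({..<d} - M) * (\<Prod>j<d. p ^ card (M \<inter> {..j}) - 1)) n"
      unfolding p_def ind_def sum_cells_fishburn[of g, OF g0] ..
    finally have "(\<Sum>A | A \<in> fishburn_matrices n \<and> dim_row A = d. of_real (FM_weight lam A)) * v ^ d
        = fps_nth (fps_const (v ^ d) * (\<Sum>M\<in>Pow {..<d}. (-1) ^ card ({..<d} - M) * (\<Prod>j<d. p ^ card (M \<inter> {..j}) - 1))) n"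
      by (simp only: fps_mult_left_const_nth mult.commute)
    also have "fps_const (v ^ d) * (\<Sum>M\<in>Pow {..<d}. (-1) ^ card ({..<d} - M) * (\<Prod>j<d. p ^ card (M \<inter> {..j}) - 1))
        = (\<Sum>M\<in>Pow {..<d}. (-1) ^ (d - card M) * fps_const v ^ d * (\<Prod>j<d. p ^ card (M \<inter> {..j}) - 1))"
      unfolding sum_distrib_left
      by (intro sum.cong refl) (auto simp: card_Diff_subset finite_subset mult_ac)
    also have "\<dots> = (\<Sum>m\<le>d. fishburn_walk p v d m)"
      unfolding sum_Pow_card fishburn_walk_eq_sum by (intro sum.cong refl) auto
    also have "\<dots> = (\<Sum>m\<le>n. fishburn_walk p v d m)"
      using that by (intro sum.mono_neutral_left) (auto simp: fishburn_walk_eq_0)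
    finally show ?thesis by (simp add: sum_distrib_right)
  qed
  have "(\<Sum>A\<in>fishburn_matrices n. of_real (FM_weight lam A) * v ^ dim_row A)
     = (\<Sum>d\<le>n. \<Sum>A | A \<in> fishburn_matrices n \<and> dim_row A = d. of_real (FM_weight lam A) * v ^ dim_row A)"
    using fishburn_matrix_dim_le
    by (intro sum.group[symmetric]) (auto simp: finite_fishburn_matrices, auto simp: fishburn_matrices_def)
  also have "\<dots> = (\<Sum>d\<le>n. fps_nth (\<Sum>m\<le>n. fishburn_walk p v d m) n)"
  proof (rule sum.cong[OF refl])
    fix d assume "d \<in> {..n}"
    have "(\<Sum>A | A \<in> fishburn_matrices n \<and> dim_row A = d. of_real (FM_weight lam A) * v ^ dim_row A)
      = (\<Sum>A | A \<in> fishburn_matrices n \<and> dim_row A = d. of_real (FM_weight lam A) * v ^ d)"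
      by (rule sum.cong) auto
    then show "(\<Sum>A | A \<in> fishburn_matrices n \<and> dim_row A = d. of_real (FM_weight lam A) * v ^ dim_row A) = fps_nth (\<Sum>m\<le>n. fishburn_walk p v d m) n"
      using dim[of d] \<open>d \<in> {..n}\<close> by simp
  qed
  \<comment> \<open>The sums over the dimension d and the row count m are exchanged: for fixed m,
    the sum over d is a product of \<open>fishburn_factor\<close> terms by
    \<open>fishburn_walk_sum\<close>.\<close>
  also have "\<dots> = fps_nth (\<Sum>m\<le>n. \<Sum>d\<le>n. fishburn_walk p v d m) n"
    by (subst sum.swap) (simp add: fps_sum_nth)
  also have "\<dots> = fps_nth (\<Sum>k\<le>n. fishburn_term q v k) n"
  proof -
    have 1: "fps_X ^ Suc n dvd (\<Sum>m\<le>n. \<Sum>d\<le>n. fishburn_walk p v d m) - (\<Sum>m\<le>n. \<Prod>j=1..m. fishburn_factor p v j)"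
      unfolding sum_subtractf[symmetric] by (intro dvd_sum fishburn_walk_sum p0)
    have 2: "fps_X ^ Suc n dvd (\<Sum>m\<le>n. \<Prod>j=1..m. fishburn_factor p v j) - (\<Sum>k\<le>n. fishburn_term p v k)"
      using fishburn_transformation[OF p0, of "Suc n" v] by (simp add: lessThan_Suc_atMost)
    have 3: "fps_X ^ Suc n dvd (\<Sum>k\<le>n. fishburn_term q v k) - (\<Sum>k\<le>n. fishburn_term p v k)"
      unfolding sum_subtractf[symmetric] by (intro dvd_sum fishburn_term_cong dvd p0 q0)
    have "fps_X ^ Suc n dvd (\<Sum>m\<le>n. \<Sum>d\<le>n. fishburn_walk p v d m) - (\<Sum>k\<le>n. fishburn_term q v k)"
      using dvd_diff[OF dvd_add[OF 1 2] 3] by simp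
    from fps_nth_eq_0_if_X_power_dvd[OF this, of n] show ?thesis by simp
  qed
  finally show ?thesis by (simp add: fps_sum_nth)
qed

section \<open>Riemann sums and the dilogarithm\<close>

text \<open>The alternating sum is the full sum minus twice its even part, and the even part is a
  quarter of the full sum: pi^2/6 - 2 pi^2/24.\<close>

lemma alternating_inverse_squares_sums:
  "(\<lambda>n. (-1) ^ n / real (Suc n) ^ 2) sums (pi\<^sup>2 / 12)"
proof -
  have S: "(\<lambda>n. 1 / real (Suc n) ^ 2) sums (pi\<^sup>2 / 6)"
    using inverse_squares_sums by (simp add: add.commute)
  have "(\<lambda>n. if even (Suc n) then 1 / real (Suc n) ^ 2 else 0) sums (pi\<^sup>2 / 24)"
  proof -
    have "(\<lambda>n. 1 / real (2 * n + 1 + 1) ^ 2) sums (pi\<^sup>2 / 24)"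
      using sums_mult[OF S, of "1/4"] by (simp add: field_simps power2_eq_square)
    then show ?thesis
      by (subst sums_mono_reindex[of "\<lambda>n. 2 * n + 1", symmetric])
         (auto simp: strict_mono_def image_iff o_def, presburger)
  qed
  from sums_diff[OF S sums_mult[OF this, of 2]]
  have "(\<lambda>n. 1 / real (Suc n) ^ 2 - 2 * (if even (Suc n) then 1 / real (Suc n) ^ 2 else 0))
    sums (pi\<^sup>2 / 12)" by simp
  moreover have "(\<lambda>n. 1 / real (Suc n) ^ 2 - 2 * (if even (Suc n) then 1 / real (Suc n) ^ 2 else 0))
    = (\<lambda>n. (-1) ^ n / real (Suc n) ^ 2)" by (rule ext) auto
  ultimately show ?thesis by simp
qed

text \<open>The dilogarithm - Li_2 (- u). The series still converges at the endpoint u = 1, the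
  value that matters later.\<close>

definition dilog_minus :: "real \<Rightarrow> real" where
  "dilog_minus u = (\<Sum>n. (-1) ^ n / real (Suc n) ^ 2 * u ^ Suc n)"

lemma summable_inverse_Suc_squares: "summable (\<lambda>n. 1 / real (Suc n) ^ 2)"
  using inverse_squares_sums by (auto simp: sums_iff add.commute)

lemma dilog_minus_0: "dilog_minus 0 = 0"
  by (simp add: dilog_minus_def)

lemma dilog_minus_1: "dilog_minus 1 = pi\<^sup>2 / 12"
  using alternating_inverse_squares_sums by (simp add: dilog_minus_def sums_iff)

lemma continuous_on_dilog_minus: "continuous_on {0..1} dilog_minus"
  unfolding dilog_minus_def
proof (rule uniform_limit_theorem)
  show "uniform_limit {0..1} (\<lambda>n u. \<Sum>i<n. (-1) ^ i / real (Suc i) ^ 2 * u ^ Suc i)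
     (\<lambda>u. \<Sum>i. (-1) ^ i / real (Suc i) ^ 2 * u ^ Suc i) sequentially"
  proof (rule Weierstrass_m_test[OF _ summable_inverse_Suc_squares])
    fix n u assume u: "u \<in> {0..1::real}"
    then have "\<bar>u\<bar> ^ Suc n \<le> 1" by (intro power_le_one) auto
    then show "norm ((-1) ^ n / real (Suc n) ^ 2 * u ^ Suc n) \<le> 1 / real (Suc n) ^ 2"
      by (simp add: abs_mult power_abs divide_right_mono del: power_Suc)
  qed
qed (auto intro!: always_eventually continuous_intros)

lemma dilog_minus_deriv:
  assumes u: "0 < u" "u < 1"
  shows "(dilog_minus has_real_derivative ln (1 + u) / u) (at u)"
proof -
  have "((\<lambda>u. \<Sum>n. (-1) ^ n / real (Suc n) ^ 2 * u ^ Suc n) has_real_derivative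
      (\<Sum>n. (-1) ^ n / real (Suc n) ^ 2 * real (Suc n) * u ^ n)) (at u)"
  proof (rule DERIV_power_series'[where R = 1])
    fix x :: real assume x: "x \<in> {-1<..<1}"
    show "summable (\<lambda>n. (-1) ^ n / real (Suc n) ^ 2 * real (Suc n) * x ^ n)"
    proof (rule summable_comparison_test')
      show "summable (\<lambda>n. \<bar>x\<bar> ^ n)" using x by (intro summable_geometric) auto
      fix n :: nat
      have "norm ((-1) ^ n / real (Suc n) ^ 2 * real (Suc n) * x ^ n) = \<bar>x\<bar> ^ n / real (Suc n)"
        by (simp add: abs_mult power_abs power2_eq_square)
      also have "\<dots> \<le> \<bar>x\<bar> ^ n" by (simp add: divide_le_eq mult_le_cancel_left1)
      finally show "norm ((-1) ^ n / real (Suc n) ^ 2 * real (Suc n) * x ^ n) \<le> \<bar>x\<bar> ^ n" .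
    qed
  qed (use u in auto)
  moreover have "(\<Sum>n. (-1) ^ n / real (Suc n) ^ 2 * real (Suc n) * u ^ n) = ln (1 + u) / u"
  proof -
    have "(\<lambda>n. (-1) ^ n * (1 / real (n + 1)) * u ^ Suc n) sums ln (1 + u)"
    proof -
      have "(\<lambda>n. - ((- u) ^ Suc n) / real (Suc n)) sums ln (1 + u)"
        using ln_series'[of u] u by (subst sums_Suc_iff) simp
      moreover have "- ((- u) ^ Suc n) / real (Suc n) = (-1) ^ n * (1 / real (n + 1)) * u ^ Suc n" for n
        by (subst power_minus) simp
      ultimately show ?thesis by (simp only:)
    qed
    from sums_divide[OF this, of u]
    moreover have "(-1) ^ n * (1 / real (n + 1)) * u ^ Suc n / u = (-1) ^ n / real (Suc n) ^ 2 * real (Suc n) * u ^ n" for n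
      using u by (simp add: power2_eq_square)
    ultimately have "(\<lambda>n. (-1) ^ n / real (Suc n) ^ 2 * real (Suc n) * u ^ n) sums (ln (1 + u) / u)"
      by (simp only:)
    then show ?thesis by (simp add: sums_iff)
  qed
  ultimately show ?thesis unfolding dilog_minus_def[abs_def] by simp
qed

text \<open>Since todd (j x) is x times the derivative of ln (exp (j x) - 1) in x, this function
  governs how the products of q^j - 1 react to a change of the radius. The value 1 at 0 is the
  continuous extension.\<close>

definition todd :: "real \<Rightarrow> real" where
  "todd t = (if t = 0 then 1 else t / (1 - exp (- t)))"

text \<open>An antiderivative of \<open>todd\<close>: the substitution u = exp t - 1 turns it into
  the integral of ln (1 + u) / u. The endpoint t = ln 2, where q^k = 2, becomes u = 1.\<close>

definition todd_int :: "real \<Rightarrow> real" where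
  "todd_int t = dilog_minus (exp t - 1)"

lemma todd_int_0: "todd_int 0 = 0" by (simp add: todd_int_def dilog_minus_0)

lemma todd_int_ln2: "todd_int (ln 2) = pi\<^sup>2 / 12" by (simp add: todd_int_def dilog_minus_1)

lemma exp_le_2_iff: "exp t \<le> 2 \<longleftrightarrow> t \<le> ln (2::real)"
  by (simp add: ln_ge_iff)

lemma continuous_on_todd_int: "continuous_on {0..ln 2} todd_int"
  unfolding todd_int_def
  by (rule continuous_on_compose2[OF continuous_on_dilog_minus])
     (auto intro!: continuous_intros simp: exp_le_2_iff)

lemma todd_int_deriv:
  assumes t: "0 < t" "t < ln 2"
  shows "(todd_int has_real_derivative todd t) (at t)"
proof -
  have e: "0 < exp t - 1" "exp t - 1 < 1" using t by (auto simp: exp_less_cancel_iff[of t "ln 2", symmetric])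
  have "(todd_int has_real_derivative (ln (1 + (exp t - 1)) / (exp t - 1)) * exp t) (at t)"
    unfolding todd_int_def
    by (rule DERIV_chain2[where f = dilog_minus and g = "\<lambda>t. exp t - 1", OF dilog_minus_deriv[OF e]]) (auto intro!: derivative_eq_intros)
  moreover have "(ln (1 + (exp t - 1)) / (exp t - 1)) * exp t = todd t"
    using t e by (simp add: todd_def exp_minus field_simps)
  ultimately show ?thesis by simp
qed

text \<open>Only differentiability inside the interval is needed, so singular endpoints of \<open>F'\<close> are harmless.\<close>

lemma Riemann_sum_Lipschitz:
  fixes f F :: "real \<Rightarrow> 'a::real_inner"
  assumes L: "0 < L" and k: "0 < k"
    and cont: "continuous_on {0..L} F"
    and deriv: "\<And>t. 0 < t \<Longrightarrow> t < L \<Longrightarrow> (F has_vector_derivative f t) (at t)"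
    and lip: "\<And>s t. s \<in> {0..L} \<Longrightarrow> t \<in> {0..L} \<Longrightarrow> norm (f s - f t) \<le> B * \<bar>s - t\<bar>"
  shows "norm ((\<Sum>j=1..k. f (real j * (L / k))) - (k / L) *\<^sub>R (F L - F 0)) \<le> B * L"
proof -
  define h where "h = L / k"
  have h: "0 < h" "k * h = L" using L k by (auto simp: h_def)
  have B: "0 \<le> B"
  proof -
    have "0 \<le> norm (f 0 - f L)" by simp
    also have "\<dots> \<le> B * \<bar>0 - L\<bar>" by (rule lip) (use L in auto)
    finally show ?thesis using L by (simp add: zero_le_mult_iff)
  qed
  have step: "norm (F (Suc j * h) - F (j * h) - h *\<^sub>R f (Suc j * h)) \<le> B * h ^ 2" if "j < k" for j
  proof -
    define a where "a = j * h"
    define b where "b = Suc j * h"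
    have ab: "a < b" "0 \<le> a" "b \<le> L" "b - a = h"
    proof -
      have "Suc j * h \<le> k * h" using that h by (intro mult_right_mono) auto
      then show "a < b" "0 \<le> a" "b \<le> L" "b - a = h" using h by (auto simp: a_def b_def algebra_simps)
    qed
    \<comment> \<open>Subtracting the line of slope \<open>f b\<close> leaves a function whose
      derivative \<open>f x - f b\<close> is small by the Lipschitz bound; each cell then
      contributes an error of order h^2.\<close>
    have "\<exists>x\<in>{a<..<b}. norm ((F b - b *\<^sub>R f b) - (F a - a *\<^sub>R f b)) \<le> norm ((b - a) *\<^sub>R (f x - f b))"
    proof (rule mvt_general[where f = "\<lambda>t. F t - t *\<^sub>R f b" and f' = "\<lambda>x y. y *\<^sub>R (f x - f b)"])
      show "continuous_on {a..b} (\<lambda>t. F t - t *\<^sub>R f b)"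
        using ab by (intro continuous_intros continuous_on_subset[OF cont]) auto
      fix x assume x: "a < x" "x < b"
      have "((\<lambda>t. F t - t *\<^sub>R f b) has_vector_derivative f x - f b) (at x)"
        using deriv[of x] x ab by (auto intro!: derivative_eq_intros)
      then show "((\<lambda>t. F t - t *\<^sub>R f b) has_derivative (\<lambda>y. y *\<^sub>R (f x - f b))) (at x)"
        by (simp add: has_vector_derivative_def)
    qed (use ab in auto)
    then obtain x where x: "a < x" "x < b" "norm ((F b - b *\<^sub>R f b) - (F a - a *\<^sub>R f b)) \<le> norm ((b - a) *\<^sub>R (f x - f b))"
      by auto
    have "norm ((b - a) *\<^sub>R (f x - f b)) \<le> h * (B * h)"
    proof -
      have "norm (f x - f b) \<le> B * \<bar>x - b\<bar>" by (rule lip) (use x ab in auto)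
      also have "\<dots> \<le> B * h" using x ab B by (intro mult_left_mono) auto
      finally show ?thesis using h ab by (simp add: mult_left_mono)
    qed
    note order_trans[OF x(3) this]
    moreover have "(F b - b *\<^sub>R f b) - (F a - a *\<^sub>R f b) = F b - F a - h *\<^sub>R f b"
      using ab(4) by (simp add: algebra_simps scaleR_left_diff_distrib[symmetric])
    ultimately have "norm (F b - F a - h *\<^sub>R f b) \<le> h * (B * h)" by simp
    then show ?thesis by (simp add: a_def b_def power2_eq_square mult_ac)
  qed
  have "norm (\<Sum>j<k. F (Suc j * h) - F (j * h) - h *\<^sub>R f (Suc j * h)) \<le> (\<Sum>j<k. B * h ^ 2)"
    by (rule order_trans[OF norm_sum]) (intro sum_mono step, auto)
  also have "(\<Sum>j<k. F (Suc j * h) - F (j * h) - h *\<^sub>R f (Suc j * h)) = (F L - F 0) - h *\<^sub>R (\<Sum>j=1..k. f (real j * h))"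
  proof -
    have "(\<Sum>j<k. F (Suc j * h) - F (j * h)) = F L - F 0"
      using sum_lessThan_telescope[of "\<lambda>j. F (real j * h)" k] h by simp
    moreover have "(\<Sum>j<k. f (Suc j * h)) = (\<Sum>j=1..k. f (real j * h))"
      by (rule sum.reindex_bij_witness[of _ "\<lambda>j. j - 1" Suc]) auto
    ultimately show ?thesis by (simp add: sum_subtractf scaleR_sum_right[symmetric])
  qed
  finally have "norm ((F L - F 0) - h *\<^sub>R (\<Sum>j=1..k. f (real j * h))) \<le> B * L * h"
    using h by (simp add: power2_eq_square mult_ac)
  then have "norm ((1 / h) *\<^sub>R ((F L - F 0) - h *\<^sub>R (\<Sum>j=1..k. f (real j * h)))) \<le> B * L"
    using h by (simp add: divide_le_eq)
  moreover have "(1 / h) *\<^sub>R ((F L - F 0) - h *\<^sub>R (\<Sum>j=1..k. f (real j * h))) = 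
     - ((\<Sum>j=1..k. f (real j * h)) - (k / L) *\<^sub>R (F L - F 0))"
    using h L k by (simp add: scaleR_right_diff_distrib h_def)
  ultimately show ?thesis by (simp only: norm_minus_cancel h_def)
qed

lemma todd_ge_1: "0 \<le> t \<Longrightarrow> 1 \<le> todd t"
  using exp_ge_add_one_self[of "-t"] by (auto simp: todd_def le_divide_eq)

lemma todd_diff_le:
  assumes "0 \<le> s" "s \<le> t"
  shows "\<bar>todd t - todd s\<bar> \<le> t - s"
proof (cases "s = 0 \<or> s = t")
  case True
  show ?thesis
  proof (cases "s = t")
    case False
    then have s: "s = 0" "0 < t" using True assms by auto
    have "(1 + t) * exp (- t) \<le> exp t * exp (- t)"
      by (intro mult_right_mono) auto
    then have "(1 + t) * exp (- t) \<le> 1" by (simp add: mult_exp_exp)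
    then have "todd t \<le> 1 + t" using s
      by (simp add: todd_def pos_divide_le_eq algebra_simps)
    then show ?thesis using s todd_ge_1[of t] by (simp add: todd_def)
  qed simp
next
  case False
  then have st: "0 < s" "s < t" using assms by auto
  define D where "D x = (1 - exp (- x) - x * exp (- x)) / (1 - exp (- x)) ^ 2" for x :: real
  have deriv: "(todd has_real_derivative D x) (at x)" if "0 < x" for x
  proof -
    have "((\<lambda>t. t / (1 - exp (- t))) has_real_derivative D x) (at x)"
      unfolding D_def using that
      by (auto intro!: derivative_eq_intros simp: power2_eq_square)
    then show ?thesis
      by (rule DERIV_cong_ev[THEN iffD1, rotated -1, OF _ refl _ refl])
         (use that in \<open>auto simp: todd_def eventually_nhds intro!: exI[of _ "{0<..}"]\<close>)
  qed
  \<comment> \<open>Both inequalities are 1 + y \<le> exp y, at y = x for the sign and at y = - x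
    for the upper bound.\<close>
  have D: "\<bar>D x\<bar> \<le> 1" if "0 < x" for x
  proof -
    have "(1 + x) * exp (- x) \<le> exp x * exp (- x)"
      by (intro mult_right_mono) auto
    then have "0 \<le> 1 - exp (- x) - x * exp (- x)" by (simp add: algebra_simps exp_minus)
    moreover have "(1 - x) * exp (- x) \<le> exp (- x) * exp (- x)"
      using exp_ge_add_one_self[of "-x"] by (intro mult_right_mono) auto
    then have "1 - exp (- x) - x * exp (- x) \<le> (1 - exp (- x)) ^ 2"
      by (simp add: algebra_simps power2_eq_square)
    ultimately show ?thesis using that by (simp add: D_def divide_le_eq)
  qed
  obtain x where "s < x" "x < t" "todd t - todd s = (t - s) * D x"
    using MVT2[of s t todd D] deriv st by auto
  then show ?thesis using D[of x] st by (simp add: abs_mult mult_left_le)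
qed

lemma todd_Lipschitz:
  assumes "0 \<le> s" "0 \<le> t"
  shows "\<bar>todd s - todd t\<bar> \<le> \<bar>s - t\<bar>"
  using todd_diff_le[of s t] todd_diff_le[of t s] assms by (cases "s \<le> t") auto

lemma ln2_pos: "0 < ln (2::real)" by simp

text \<open>The constant is the mean value of \<open>todd\<close> over [0, ln 2], namely (pi^2/12) /
  ln 2 = 1 / (2 fb_kappa). The error stays bounded in k because each of the k cells is off by
  O(1/k).\<close>

lemma sum_todd:
  assumes "0 < k"
  shows "\<bar>(\<Sum>j=1..k. todd (real j * (ln 2 / k))) - k * (pi\<^sup>2 / (12 * ln 2))\<bar> \<le> ln 2"
proof -
  have "norm ((\<Sum>j=1..k. todd (real j * (ln 2 / k))) - (k / ln 2) *\<^sub>R (todd_int (ln 2) - todd_int 0)) \<le> 1 * ln 2"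
    by (rule Riemann_sum_Lipschitz[where B = 1])
       (use assms in \<open>auto simp: continuous_on_todd_int todd_int_deriv has_real_derivative_iff_has_vector_derivative[symmetric] intro!: todd_Lipschitz\<close>)
  then show ?thesis by (simp add: todd_int_0 todd_int_ln2 field_simps)
qed

section \<open>The logarithm of the product of q^j - 1\<close>

definition log_qprod :: "nat \<Rightarrow> real \<Rightarrow> real" where
  "log_qprod k x = (\<Sum>j=1..k. ln (exp (real j * x) - 1))"

lemma log_qprod_deriv:
  assumes "0 < x"
  shows "(log_qprod k has_real_derivative (\<Sum>j=1..k. todd (real j * x)) / x) (at x)"
proof -
  have "((\<lambda>x. ln (exp (real j * x) - 1)) has_real_derivative todd (real j * x) / x) (at x)" if "j \<in> {1..k}" for j
    using assms that
    by (auto intro!: derivative_eq_intros simp: todd_def exp_minus field_simps)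
  then show ?thesis unfolding log_qprod_def[abs_def] sum_divide_distrib by (intro DERIV_sum)
qed

text \<open>
  Since \<open>exp (ln 2) - 1 = 1\<close>, the new factor at \<open>x = ln 2 / (k + 1)\<close> is 1, and only the change of
  \<open>x\<close> contributes.
\<close>

lemma log_qprod_step:
  assumes k: "0 < k"
  shows "\<bar>log_qprod (Suc k) (ln 2 / Suc k) - log_qprod k (ln 2 / k) + pi\<^sup>2 / (12 * ln 2)\<bar>
    \<le> (2 * ln 2 + pi\<^sup>2 / (12 * ln 2)) / k"
proof -
  define L where "L = ln (2::real)"
  define I where "I = pi\<^sup>2 / (12 * L)"
  define a where "a = L / Suc k"
  define b where "b = L / k"
  have L: "0 < L" by (simp add: L_def)
  have I: "0 \<le> I" using L by (simp add: I_def)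
  have ab: "0 < a" "a < b" using k L by (auto simp: a_def b_def field_simps)
  have "log_qprod (Suc k) a = log_qprod k a"
    by (simp add: log_qprod_def a_def L_def)
  obtain x where x: "a < x" "x < b" "log_qprod k b - log_qprod k a = (b - a) * ((\<Sum>j=1..k. todd (real j * x)) / x)"
    using MVT2[OF ab(2), of "log_qprod k" "\<lambda>x. (\<Sum>j=1..k. todd (real j * x)) / x"] log_qprod_deriv ab by force
  define S where "S = (\<Sum>j=1..k. todd (real j * x))"
  \<comment> \<open>Between \<open>a\<close> and \<open>b\<close> the position x changes by a factor
    (k+1)/k at most, so R is squeezed between 1/(k+1) and 1/k, and R * S is the mean value of
    \<open>todd\<close> up to O(1/k).\<close>
  define R where "R = (b - a) / x"
  have ba: "b - a = L / (real k * real (Suc k))" using k by (simp add: a_def b_def field_simps)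
  have R1: "R \<le> 1 / k"
  proof -
    have "R \<le> (b - a) / a" unfolding R_def using x ab by (intro divide_left_mono mult_pos_pos) auto
    also have "\<dots> = 1 / k" unfolding ba using k L by (simp add: a_def del: of_nat_Suc)
    finally show ?thesis .
  qed
  have R2: "1 / Suc k \<le> R"
  proof -
    have "(b - a) / b \<le> R" unfolding R_def using x ab by (intro divide_left_mono mult_pos_pos) auto
    moreover have "(b - a) / b = 1 / Suc k" unfolding ba using k L by (simp add: b_def del: of_nat_Suc)
    ultimately show ?thesis by simp
  qed
  have "\<bar>S - (\<Sum>j=1..k. todd (real j * b))\<bar> \<le> (\<Sum>j=1..k. \<bar>todd (real j * x) - todd (real j * b)\<bar>)"
    unfolding S_def sum_subtractf[symmetric] by (rule sum_abs)
  also have "\<dots> \<le> (\<Sum>j=1..k. k * (b - a))"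
  proof (rule sum_mono)
    fix j assume j: "j \<in> {1..k}"
    have "\<bar>todd (real j * x) - todd (real j * b)\<bar> \<le> \<bar>real j * x - real j * b\<bar>"
      by (rule todd_Lipschitz) (use x ab in auto)
    also have "\<dots> = j * (b - x)" using x by (simp add: abs_mult right_diff_distrib[symmetric])
    also have "\<dots> \<le> k * (b - a)" using j x by (intro mult_mono) auto
    finally show "\<bar>todd (real j * x) - todd (real j * b)\<bar> \<le> k * (b - a)" .
  qed
  also have "\<dots> = L * (k / Suc k)" unfolding ba using k by (simp add: divide_simps del: of_nat_Suc)
  also have "\<dots> \<le> L * 1" using L by (intro mult_left_mono) auto
  finally have "\<bar>S - k * I\<bar> \<le> 2 * L"
    using sum_todd[OF k] unfolding b_def L_def[symmetric] I_def by (simp add: mult_ac) 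
  have "\<bar>R * S - I\<bar> \<le> R * \<bar>S - k * I\<bar> + \<bar>R * k - 1\<bar> * I"
  proof -
    have "R * S - I = R * (S - k * I) + (R * k - 1) * I" by (simp add: algebra_simps)
    also have "\<bar>\<dots>\<bar> \<le> \<bar>R * (S - k * I)\<bar> + \<bar>(R * k - 1) * I\<bar>" by (rule abs_triangle_ineq)
    finally show ?thesis using I R2 by (simp add: abs_mult order_trans[OF _ R2])
  qed
  also have "\<dots> \<le> (1 / k) * (2 * L) + (1 / k) * I"
  proof (intro add_mono mult_mono R1 \<open>\<bar>S - k * I\<bar> \<le> 2 * L\<close>)
    have "R * k \<le> 1" using R1 k by (simp add: field_simps)
    moreover have "k / Suc k \<le> R * k" using mult_right_mono[OF R2, of k] by simp
    moreover have "1 - k / Suc k \<le> 1 / k" using k by (simp add: field_simps)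
    ultimately show "\<bar>R * k - 1\<bar> \<le> 1 / k" by linarith
  qed (use I in auto)
  finally have "\<bar>R * S - I\<bar> \<le> (2 * L + I) / k" by (simp add: add_divide_distrib)
  moreover have "log_qprod (Suc k) a - log_qprod k b = - (R * S)"
    using x(3) \<open>log_qprod (Suc k) a = log_qprod k a\<close> by (simp add: R_def S_def)
  ultimately show ?thesis
    unfolding L_def[symmetric] I_def[symmetric] a_def[symmetric] b_def[symmetric] by linarith
qed

section \<open>Local expansion at the saddle point\<close>

definition expm1_quot :: "complex \<Rightarrow> complex" where
  "expm1_quot z = (if z = 0 then 1 else (exp z - 1) / z)"

lemma expm1_quot_holomorphic: "expm1_quot holomorphic_on UNIV"
proof (rule pole_theorem_open_0[where a = 0 and g = "\<lambda>z. exp z - 1"])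
  show "expm1_quot 0 = deriv (\<lambda>z. exp z - 1) 0"
    by (subst DERIV_imp_deriv[where f' = 1]) (auto intro!: derivative_eq_intros simp: expm1_quot_def)
qed (auto intro!: holomorphic_intros simp: expm1_quot_def)

lemma expm1_quot_nonzero:
  assumes "norm z < 2"
  shows "expm1_quot z \<noteq> 0"
proof
  assume "expm1_quot z = 0"
  then have z: "z \<noteq> 0" "exp z = 1" by (auto simp: expm1_quot_def split: if_splits)
  then obtain n :: int where n: "Re z = 0" "Im z = of_int (2 * n) * pi" by (auto simp: exp_eq_1)
  have "n \<noteq> 0" using z n by (auto simp: complex_eq_iff)
  then have "1 \<le> \<bar>real_of_int n\<bar>" by linarith
  then have "2 * pi \<le> \<bar>Im z\<bar>" unfolding n by (simp add: abs_mult)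
  also have "\<dots> < 2" using abs_Im_le_cmod[of z] assms by simp
  finally show False using pi_gt_zero pi_ge_two by linarith
qed

lemma ex_log_expm1_quot:
  "\<exists>l. l holomorphic_on ball 0 2 \<and> (\<forall>z\<in>ball 0 2. exp (l z) = expm1_quot z)"
proof -
  have hol: "expm1_quot holomorphic_on ball 0 2"
    by (rule holomorphic_on_subset[OF expm1_quot_holomorphic]) simp
  have nz: "expm1_quot x \<noteq> 0" if "x \<in> ball 0 2" for x
    using that by (intro expm1_quot_nonzero) simp
  have "0 \<in> ball (0::complex) 2" by simp
  obtain g where "g holomorphic_on ball 0 2" "\<And>x. x \<in> ball 0 2 \<Longrightarrow> exp (g x) = expm1_quot x"
    by (rule holomorphic_logarithm_exists[OF convex_ball open_ball hol nz \<open>0 \<in> ball 0 2\<close>]; blast)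
  then show ?thesis by blast
qed

text \<open>Dividing by z keeps the function regular at 0, where the nodes accumulate as k grows.
  The branch is fixed only up to a multiple of 2 pi i, which is harmless: only derivatives and
  differences of values enter.\<close>

definition log_expm1_quot :: "complex \<Rightarrow> complex" where
  "log_expm1_quot = (SOME l. l holomorphic_on ball 0 2 \<and> (\<forall>z\<in>ball 0 2. exp (l z) = expm1_quot z))"

lemma log_expm1_quot_holomorphic: "log_expm1_quot holomorphic_on ball 0 2"
  and exp_log_expm1_quot: "norm z < 2 \<Longrightarrow> exp (log_expm1_quot z) = expm1_quot z"
  using someI_ex[OF ex_log_expm1_quot] unfolding log_expm1_quot_def[symmetric] by auto

lemma log_expm1_quot_deriv_higher:
  assumes "norm z < 2"
  shows "((deriv ^^ i) log_expm1_quot has_field_derivative (deriv ^^ Suc i) log_expm1_quot z) (at z)"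
proof -
  have "(deriv ^^ i) log_expm1_quot holomorphic_on ball 0 2"
    by (rule holomorphic_higher_deriv[OF log_expm1_quot_holomorphic open_ball])
  then have "((deriv ^^ i) log_expm1_quot has_field_derivative deriv ((deriv ^^ i) log_expm1_quot) z) (at z)"
    by (rule holomorphic_derivI[OF _ open_ball]) (use assms in auto)
  then show ?thesis by simp
qed

text \<open>Logarithmic differentiation: t times the derivative of ln (exp t - 1) is
  \<open>todd t\<close>, and dividing by t subtracts 1. This makes the node sums of derivatives
  computable.\<close>

lemma log_expm1_quot_deriv_real:
  assumes "0 < t" "t < 2"
  shows "of_real t * deriv log_expm1_quot (of_real t) = of_real (todd t - 1)"
proof -
  let ?l = log_expm1_quot and ?z = "complex_of_real t"
  have z: "norm ?z < 2" "?z \<noteq> 0" using assms by auto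
  have "exp t \<noteq> 1" using assms by simp
  then have e: "exp ?z \<noteq> 1" by (metis exp_of_real of_real_eq_1_iff)
  have "((\<lambda>z. exp (?l z)) has_field_derivative exp (?l ?z) * deriv ?l ?z) (at ?z)"
    using log_expm1_quot_deriv_higher[OF z(1), of 0] by (auto intro!: derivative_eq_intros)
  moreover have "((\<lambda>z. exp (?l z)) has_field_derivative (exp ?z * ?z - (exp ?z - 1)) / ?z ^ 2) (at ?z)"
  proof (rule DERIV_cong_ev[THEN iffD1, OF refl _ refl])
    show "((\<lambda>z. (exp z - 1) / z) has_field_derivative (exp ?z * ?z - (exp ?z - 1)) / ?z ^ 2) (at ?z)"
      using z(2) by (auto intro!: derivative_eq_intros simp: power2_eq_square)
    have "\<forall>\<^sub>F w in nhds ?z. w \<in> ball 0 2 - {0}"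
      using z by (intro eventually_nhds_in_open) auto
    then show "\<forall>\<^sub>F w in nhds ?z. (exp w - 1) / w = exp (?l w)"
      by eventually_elim (simp add: exp_log_expm1_quot expm1_quot_def)
  qed
  ultimately have "exp (?l ?z) * deriv ?l ?z = (exp ?z * ?z - (exp ?z - 1)) / ?z ^ 2"
    by (rule DERIV_unique)
  then have "(exp ?z - 1) / ?z * deriv ?l ?z = (exp ?z * ?z - (exp ?z - 1)) / ?z ^ 2"
    using z by (simp add: exp_log_expm1_quot expm1_quot_def)
  then have "((exp ?z - 1) / ?z * deriv ?l ?z) * ?z ^ 2 = exp ?z * ?z - (exp ?z - 1)"
    using z(2) by simp
  moreover have "((exp ?z - 1) / ?z * deriv ?l ?z) * ?z ^ 2 = (exp ?z - 1) * (?z * deriv ?l ?z)"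
    using z(2) by (simp add: power2_eq_square)
  ultimately have "?z * deriv ?l ?z = (exp ?z * ?z - (exp ?z - 1)) / (exp ?z - 1)"
    using e by (simp add: eq_divide_eq mult.commute)
  also have "\<dots> = of_real ((exp t * t - (exp t - 1)) / (exp t - 1))"
    by (simp flip: exp_of_real)
  also have "(exp t * t - (exp t - 1)) / (exp t - 1) = todd t - 1"
    using assms by (simp add: todd_def exp_minus field_simps)
  finally show ?thesis .
qed

lemma log_expm1_quot_deriv_bounded:
  "\<exists>B>0. \<forall>z\<in>cball 0 1. norm ((deriv ^^ i) log_expm1_quot z) \<le> B"
proof -
  have "continuous_on (cball 0 1) ((deriv ^^ i) log_expm1_quot)"
    by (rule continuous_on_subset[OF holomorphic_on_imp_continuous_on[OF
          holomorphic_higher_deriv[OF log_expm1_quot_holomorphic open_ball]]]) auto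
  then have "bounded ((deriv ^^ i) log_expm1_quot ` cball 0 1)"
    by (intro compact_imp_bounded compact_continuous_image) auto
  then show ?thesis by (auto simp: bounded_pos)
qed

text \<open>Kept on the unit disc and for a general f, since it is applied both to
  \<open>log_expm1_quot\<close> and, after rescaling by 2, to \<open>Ln\<close>.\<close>

lemma complex_Taylor_cubic:
  fixes f f' f'' g :: "complex \<Rightarrow> complex"
  assumes der: "\<And>x. norm x \<le> 1 \<Longrightarrow> (f has_field_derivative f' x) (at x)"
     "\<And>x. norm x \<le> 1 \<Longrightarrow> (f' has_field_derivative f'' x) (at x)"
     "\<And>x. norm x \<le> 1 \<Longrightarrow> (f'' has_field_derivative g x) (at x)"
    and B: "\<And>x. norm x \<le> 1 \<Longrightarrow> norm (g x) \<le> B" and B0: "0 \<le> B"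
    and wz: "norm w \<le> 1" "norm z \<le> 1"
  shows "norm (f z - f w - f' w * (z - w) - f'' w * (z - w)\<^sup>2 / 2) \<le> B * norm (z - w) ^ 3"
proof -
  define F where "F i = (if i = 0 then f else if i = 1 then f' else if i = 2 then f'' else g)" for i :: nat
  have "norm (F 0 z - (\<Sum>i\<le>2. F i w * (z - w) ^ i / fact i)) \<le> B * norm (z - w) ^ Suc 2 / fact 2"
  proof (rule complex_Taylor[where S = "cball 0 1"])
    fix i :: nat and x assume "x \<in> cball (0::complex) 1" "i \<le> 2"
    then consider "i = 0" | "i = 1" | "i = 2" by linarith
    then show "(F i has_field_derivative F (Suc i) x) (at x within cball 0 1)"
      using der[of x] \<open>x \<in> cball 0 1\<close> by cases (auto simp: F_def intro: has_field_derivative_at_within)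
  next
    fix x :: complex assume "x \<in> cball 0 1"
    then show "norm (F (Suc 2) x) \<le> B" using B[of x] by (simp add: F_def)
  qed (use wz in simp_all)
  also have "(\<Sum>i\<le>2. F i w * (z - w) ^ i / fact i) = f w + f' w * (z - w) + f'' w * (z - w)\<^sup>2 / 2"
    by (simp add: F_def numeral_2_eq_2)
  also have "B * norm (z - w) ^ Suc 2 / fact 2 \<le> B * norm (z - w) ^ 3"
  proof -
    have "Suc 2 = 3" "fact 2 = (2::real)" by simp_all
    then show ?thesis using B0 by simp
  qed
  finally show ?thesis by (simp add: F_def diff_diff_eq)
qed

lemma log_expm1_quot_Taylor:
  "\<exists>B>0. \<forall>w z. norm w \<le> 1 \<longrightarrow> norm z \<le> 1 \<longrightarrow>
    norm (log_expm1_quot z - log_expm1_quot w - deriv log_expm1_quot w * (z - w)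
      - deriv (deriv log_expm1_quot) w * (z - w)\<^sup>2 / 2) \<le> B * norm (z - w) ^ 3"
proof -
  let ?l = log_expm1_quot
  have der: "(?l has_field_derivative deriv ?l x) (at x)"
    "(deriv ?l has_field_derivative deriv (deriv ?l) x) (at x)"
    "(deriv (deriv ?l) has_field_derivative deriv (deriv (deriv ?l)) x) (at x)" if "norm x \<le> 1" for x
    using that log_expm1_quot_deriv_higher[of x 0] log_expm1_quot_deriv_higher[of x 1]
      log_expm1_quot_deriv_higher[of x 2] by (simp_all add: eval_nat_numeral)
  have "\<exists>B>0. \<forall>z\<in>cball 0 1. norm (deriv (deriv (deriv ?l)) z) \<le> B"
    using log_expm1_quot_deriv_bounded[of 3] by (simp add: eval_nat_numeral)
  then obtain B where B: "B > 0" "\<forall>z\<in>cball 0 1. norm (deriv (deriv (deriv ?l)) z) \<le> B"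
    by blast
  show ?thesis
  proof (intro exI[of _ B] conjI allI impI B(1))
    fix w z :: complex assume "norm w \<le> 1" "norm z \<le> 1"
    then show "norm (?l z - ?l w - deriv ?l w * (z - w) - deriv (deriv ?l) w * (z - w)\<^sup>2 / 2) \<le> B * norm (z - w) ^ 3"
      using B by (intro complex_Taylor_cubic[where g = "deriv (deriv (deriv ?l))"] der) auto
  qed
qed

text \<open>The ratio k / n at the dominant summand. The mean value of \<open>todd\<close> on
  [0, ln 2] is 1 / (2 fb_kappa), so on the logarithmic scale the summands behave like n ln k - k /
  fb_kappa, which is stationary at k = fb_kappa n.\<close>

definition fb_kappa :: real where "fb_kappa = 6 * ln 2 / pi\<^sup>2"

lemma fb_kappa_pos: "0 < fb_kappa" by (simp add: fb_kappa_def)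

lemma norm_power_minus_one_le:
  fixes y :: complex
  shows "norm ((1 + y) ^ m - 1) \<le> (1 + norm y) ^ m - 1"
proof (induction m)
  case (Suc m)
  have "norm ((1 + y) ^ Suc m - 1) = norm ((1 + y) * ((1 + y) ^ m - 1) + y)"
    by (simp add: algebra_simps)
  also have "\<dots> \<le> (1 + norm y) * ((1 + norm y) ^ m - 1) + norm y"
    by (rule order_trans[OF norm_triangle_ineq])
       (intro add_mono order_refl, simp add: norm_mult, intro mult_mono Suc, auto intro: order_trans[OF norm_triangle_ineq])
  also have "\<dots> = (1 + norm y) ^ Suc m - 1" by (simp add: algebra_simps)
  finally show ?case .
qed simp

lemma power_one_plus_tendsto_1:
  fixes r :: "nat \<Rightarrow> complex"
  assumes "(\<lambda>n. real (m n) * norm (r n)) \<longlonglongrightarrow> 0"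
  shows "(\<lambda>n. (1 + r n) ^ m n) \<longlonglongrightarrow> 1"
proof -
  have "(\<lambda>n. (1 + r n) ^ m n - 1) \<longlonglongrightarrow> 0"
  proof (rule Lim_null_comparison)
    show "\<forall>\<^sub>F n in sequentially. norm ((1 + r n) ^ m n - 1) \<le> exp (real (m n) * norm (r n)) - 1"
    proof (intro always_eventually allI)
      fix n
      have "(1 + norm (r n)) ^ m n \<le> exp (norm (r n)) ^ m n"
        by (intro power_mono exp_ge_add_one_self) auto
      then show "norm ((1 + r n) ^ m n - 1) \<le> exp (real (m n) * norm (r n)) - 1"
        using norm_power_minus_one_le[of "r n" "m n"] by (simp add: exp_of_nat_mult)
    qed
    show "(\<lambda>n. exp (real (m n) * norm (r n)) - 1) \<longlonglongrightarrow> 0"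
      using tendsto_diff[OF tendsto_exp[OF assms] tendsto_const[of 1]] by simp
  qed
  then show ?thesis by (rule LIM_zero_cancel)
qed

text \<open>The logarithm of Lam^j on the positive axis at radius \<open>rad k\<close>, where Lam^k
  = 2. For j from 1 to k these are the right endpoints of k equal cells of [0, ln 2].\<close>

abbreviation node :: "nat \<Rightarrow> nat \<Rightarrow> real" where "node k j \<equiv> real j * (ln 2 / real k)"

lemma node_bounds: "j \<in> {1..k} \<Longrightarrow> 0 < node k j \<and> node k j \<le> ln 2"
  by (auto simp: field_simps)

section \<open>Node sums of the first two derivatives\<close>

lemma sum_log_deriv:
  assumes "0 < k"
  shows "norm ((\<Sum>j=1..k. of_real (node k j) * deriv log_expm1_quot (of_real (node k j)))
     - of_real (real k * (1 / (2 * fb_kappa) - 1))) \<le> ln 2"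
proof -
  have "(\<Sum>j=1..k. of_real (node k j) * deriv log_expm1_quot (of_real (node k j)))
      = (\<Sum>j=1..k. complex_of_real (todd (node k j) - 1))"
  proof (rule sum.cong[OF refl])
    fix j assume "j \<in> {1..k}"
    then have "0 < node k j" "node k j < 2" using node_bounds[of j k] ln_2_less_1 by auto
    then show "of_real (node k j) * deriv log_expm1_quot (of_real (node k j)) = complex_of_real (todd (node k j) - 1)"
      by (rule log_expm1_quot_deriv_real)
  qed
  also have "\<dots> - of_real (real k * (1 / (2 * fb_kappa) - 1))
      = complex_of_real ((\<Sum>j=1..k. todd (node k j)) - k * (pi\<^sup>2 / (12 * ln 2)))"
    by (simp add: fb_kappa_def sum_subtractf algebra_simps)
  finally show ?thesis using sum_todd[OF assms] by (simp only: norm_of_real)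
qed

text \<open>Integration by parts: the antiderivative of t^2 l'' is t^2 l' - 2 \<integral> t l', and
  t l' = todd t - 1 has a dilogarithmic antiderivative. At the endpoint, todd (ln 2) = 2 ln
  2.\<close>

lemma sum_log_deriv2:
  "\<exists>B. \<forall>k>0. norm ((\<Sum>j=1..k. (of_real (node k j))\<^sup>2 * deriv (deriv log_expm1_quot) (of_real (node k j)))
     - of_real (real k * (2 * ln 2 + 1 - 1 / fb_kappa))) \<le> B"
proof -
  let ?l = log_expm1_quot and ?L = "ln 2 :: real"
  define f where "f z = z ^ 2 * deriv (deriv ?l) z" for z
  define F where "F t = (of_real t)\<^sup>2 * deriv ?l (of_real t) - 2 * complex_of_real (todd_int t - t)" for t
  have "f holomorphic_on ball 0 2" unfolding f_def
    by (intro holomorphic_intros holomorphic_deriv log_expm1_quot_holomorphic open_ball)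
  then have "deriv f holomorphic_on ball 0 2" by (intro holomorphic_deriv open_ball)
  then have "continuous_on (cball 0 1) (deriv f)"
    by (rule continuous_on_subset[OF holomorphic_on_imp_continuous_on]) auto
  then have "bounded (deriv f ` cball 0 1)"
    by (intro compact_imp_bounded compact_continuous_image) auto
  then have "\<exists>B. \<forall>z\<in>cball 0 1. norm (deriv f z) \<le> B" by (simp add: bounded_iff)
  then obtain B where B: "\<forall>z\<in>cball 0 1. norm (deriv f z) \<le> B" ..
  have lip: "norm (f z - f w) \<le> B * norm (z - w)" if "z \<in> cball 0 1" "w \<in> cball 0 1" for z w
  proof (rule field_differentiable_bound[where f = f and f' = "deriv f" and S = "cball 0 1"])
    fix x :: complex assume x: "x \<in> cball 0 1"
    then show "(f has_field_derivative deriv f x) (at x within cball 0 1)"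
      by (intro has_field_derivative_at_within[OF holomorphic_derivI[OF \<open>f holomorphic_on ball 0 2\<close> open_ball]]) auto
    show "norm (deriv f x) \<le> B" using B x by blast
  qed (use that in simp_all)
  have "norm ((\<Sum>j=1..k. f (of_real (node k j))) - (k / ?L) *\<^sub>R (F ?L - F 0)) \<le> B * ?L" if k: "0 < k" for k
  proof (rule Riemann_sum_Lipschitz[where f = "\<lambda>t. f (of_real t)", OF ln2_pos k])
    have "continuous_on {0..?L} (\<lambda>t. deriv ?l (of_real t))"
      by (rule continuous_on_compose2[of "ball 0 2" "deriv ?l", OF holomorphic_on_imp_continuous_on])
         (use ln_2_less_1 in \<open>auto intro!: holomorphic_deriv log_expm1_quot_holomorphic continuous_intros\<close>)
    then show "continuous_on {0..?L} F"
      unfolding F_def by (intro continuous_intros continuous_on_todd_int)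
    fix t :: real assume t: "0 < t" "t < ?L"
    have t2: "norm (complex_of_real t) < 2" "t < 2" using t ln_2_less_1 by auto
    have d: "(deriv ?l has_field_derivative deriv (deriv ?l) (of_real t)) (at (of_real t))"
      using log_expm1_quot_deriv_higher[OF t2(1), of 1] by simp
    have "((\<lambda>t. (of_real t)\<^sup>2 * deriv ?l (of_real t)) has_vector_derivative
       (2 * of_real t * deriv ?l (of_real t) + (of_real t)\<^sup>2 * deriv (deriv ?l) (of_real t))) (at t)"
    proof -
      have "((\<lambda>z. z\<^sup>2 * deriv ?l z) has_field_derivative
       (2 * of_real t * deriv ?l (of_real t) + (of_real t)\<^sup>2 * deriv (deriv ?l) (of_real t))) (at (of_real t))"
        using d by (auto intro!: derivative_eq_intros)
      then show ?thesis by (rule has_vector_derivative_real_field)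
    qed
    moreover have "((\<lambda>t. complex_of_real (todd_int t - t)) has_vector_derivative of_real (todd t - 1)) (at t)"
      using todd_int_deriv[OF t]
      by (intro has_vector_derivative_of_real) (auto intro!: derivative_eq_intros)
    ultimately have "(F has_vector_derivative (2 * of_real t * deriv ?l (of_real t) + (of_real t)\<^sup>2 * deriv (deriv ?l) (of_real t))
        - 2 * of_real (todd t - 1)) (at t)"
      unfolding F_def by (intro has_vector_derivative_diff has_vector_derivative_mult_right)
    then show "(F has_vector_derivative f (of_real t)) (at t)"
      using log_expm1_quot_deriv_real[OF t(1) t2(2)] by (simp add: f_def mult.assoc)
  next
    fix s t :: real assume "s \<in> {0..?L}" "t \<in> {0..?L}"
    then have "norm (f (of_real s) - f (of_real t)) \<le> B * norm (complex_of_real s - of_real t)"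
      using ln_2_less_1 by (intro lip) auto
    then show "norm (f (of_real s) - f (of_real t)) \<le> B * \<bar>s - t\<bar>"
      by (simp flip: of_real_diff)
  qed
  moreover have "(k / ?L) *\<^sub>R (F ?L - F 0) = of_real (real k * (2 * ln 2 + 1 - 1 / fb_kappa))" for k
  proof -
    have "todd ?L = 2 * ?L" by (simp add: todd_def exp_minus)
    then have l: "of_real ?L * deriv ?l (of_real ?L) = of_real (2 * ?L - 1)"
      using log_expm1_quot_deriv_real[of ?L] ln_2_less_1 by simp
    have "F ?L - F 0 = of_real ?L * (of_real ?L * deriv ?l (of_real ?L)) - 2 * of_real (pi\<^sup>2 / 12 - ?L)"
      by (simp add: F_def todd_int_0 todd_int_ln2 power2_eq_square)
    also have "\<dots> = of_real (2 * ?L ^ 2 + ?L - pi\<^sup>2 / 6)"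
      unfolding l by (simp add: power2_eq_square algebra_simps)
    finally show ?thesis by (simp add: fb_kappa_def scaleR_conv_of_real power2_eq_square field_simps flip: of_real_mult of_real_divide)
  qed
  ultimately show ?thesis unfolding f_def by (intro exI[of _ "B * ?L"]) simp
qed

lemma tendsto_bounded_div:
  fixes S :: "nat \<Rightarrow> 'a::real_normed_field" and k :: "nat \<Rightarrow> nat"
  assumes "\<And>n. norm (S n - of_real (real (k n) * m)) \<le> B" "(\<lambda>n. real (k n) / n) \<longlonglongrightarrow> K"
  shows "(\<lambda>n. S n / of_nat n) \<longlonglongrightarrow> of_real (K * m)"
proof -
  have "(\<lambda>n. (S n - of_real (real (k n) * m)) / of_nat n) \<longlonglongrightarrow> 0"
  proof (rule Lim_null_comparison)
    show "\<forall>\<^sub>F n in sequentially. norm ((S n - of_real (real (k n) * m)) / of_nat n) \<le> B / real n"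
    proof (intro always_eventually allI)
      fix n
      show "norm ((S n - of_real (real (k n) * m)) / of_nat n) \<le> B / real n"
        unfolding norm_divide norm_of_nat by (rule divide_right_mono[OF assms(1)]) simp
    qed
    show "(\<lambda>n. B / real n) \<longlonglongrightarrow> 0" by real_asymp
  qed
  moreover have "(\<lambda>n. of_real (real (k n) / n * m)) \<longlonglongrightarrow> (of_real (K * m) :: 'a)"
    by (intro tendsto_intros assms)
  ultimately have "(\<lambda>n. (S n - of_real (real (k n) * m)) / of_nat n + of_real (real (k n) / n * m)) \<longlonglongrightarrow> 0 + of_real (K * m)"
    by (rule tendsto_add)
  then show ?thesis by (simp add: diff_divide_distrib)
qed

lemma tendsto_bounded_mult:
  fixes a b :: "nat \<Rightarrow> 'a::real_normed_field"
  assumes "\<And>n. norm (a n) \<le> B" "b \<longlonglongrightarrow> 0"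
  shows "(\<lambda>n. a n * b n) \<longlonglongrightarrow> 0"
proof (rule Lim_null_comparison)
  show "\<forall>\<^sub>F n in sequentially. norm (a n * b n) \<le> B * norm (b n)"
    using assms(1) by (intro always_eventually allI) (simp add: norm_mult mult_right_mono)
  show "(\<lambda>n. B * norm (b n)) \<longlonglongrightarrow> 0"
    using tendsto_mult[OF tendsto_const tendsto_norm[OF assms(2)], of B] by simp
qed

text \<open>
  The window around the saddle point: \<open>k\<close> is the summation index, \<open>t\<close> the angle on the circle of
  integration, and \<open>\<zeta>\<close> the ratio of \<open>log \<Lambda>\<close> at angle \<open>t\<close> and at angle 0.
\<close>

locale saddle_window =
  fixes k :: "nat \<Rightarrow> nat" and t :: "nat \<Rightarrow> real" and r \<zeta> :: "nat \<Rightarrow> complex" and x y :: real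
  assumes k_pos: "\<And>n. 0 < k n"
    and k_lim: "(\<lambda>n. (real (k n) - fb_kappa * n) / sqrt n) \<longlonglongrightarrow> x"
    and t_lim: "(\<lambda>n. sqrt n * t n) \<longlonglongrightarrow> y"
    and r_lim: "(\<lambda>n. of_nat n * r n) \<longlonglongrightarrow> 0"
  defines "\<zeta> \<equiv> \<lambda>n. cis (t n) * (1 + r n)"
begin

lemma k_div_lim: "(\<lambda>n. real (k n) / n) \<longlonglongrightarrow> fb_kappa"
proof -
  have "(\<lambda>n. (real (k n) - fb_kappa * n) / sqrt n * (1 / sqrt n) + fb_kappa) \<longlonglongrightarrow> x * 0 + fb_kappa"
    by (intro tendsto_intros k_lim) real_asymp
  moreover have "\<forall>\<^sub>F n in sequentially. (real (k n) - fb_kappa * n) / sqrt n * (1 / sqrt n) + fb_kappa = real (k n) / n"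
    using eventually_gt_at_top[of 0] by eventually_elim (simp add: field_simps)
  ultimately have "(\<lambda>n. real (k n) / n) \<longlonglongrightarrow> x * 0 + fb_kappa"
    by (rule Lim_transform_eventually)
  then show ?thesis by simp
qed

lemma t_lim_0: "t \<longlonglongrightarrow> 0"
proof -
  have "(\<lambda>n. (sqrt n * t n) * (1 / sqrt n)) \<longlonglongrightarrow> y * 0"
    by (intro tendsto_mult t_lim) real_asymp
  moreover have "\<forall>\<^sub>F n in sequentially. (sqrt n * t n) * (1 / sqrt n) = t n"
    using eventually_gt_at_top[of 0] by eventually_elim simp
  ultimately have "t \<longlonglongrightarrow> y * 0"
    by (rule Lim_transform_eventually)
  then show ?thesis by simp
qed

definition \<delta> :: "nat \<Rightarrow> complex" where "\<delta> n = \<zeta> n - 1"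

text \<open>Precision o(1/n) is needed, since \<delta> is later multiplied by node sums of order n.
  The cubic remainder of \<open>cis\<close> is harmless because n t^3 = (sqrt n t)^2 t tends to
  0.\<close>

lemma \<delta>_expansion: "(\<lambda>n. of_nat n * (\<delta> n - \<i> * t n + (t n)\<^sup>2 / 2)) \<longlonglongrightarrow> 0"
proof -
  define e where "e n = cis (t n) - 1 - \<i> * t n + (t n)\<^sup>2 / 2" for n
  have e: "norm (e n) \<le> \<bar>t n\<bar> ^ 3" for n
  proof -
    have "norm (iexp (t n) - (\<Sum>k\<le>2. (\<i> * t n) ^ k / fact k)) \<le> \<bar>t n\<bar> ^ Suc 2 / fact (Suc 2)"
      by (rule iexp_approx1)
    also have "iexp (t n) - (\<Sum>k\<le>2. (\<i> * t n) ^ k / fact k) = e n"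
      by (simp add: e_def cis_conv_exp numeral_2_eq_2 power_mult_distrib)
    also have "\<bar>t n\<bar> ^ Suc 2 / fact (Suc 2) \<le> \<bar>t n\<bar> ^ 3"
    proof -
      have "Suc 2 = 3" "fact 3 = (6::real)" by (simp_all add: fact_numeral)
      then show ?thesis by (simp del: power_abs)
    qed
    finally show ?thesis .
  qed
  have "(\<lambda>n. of_nat n * e n) \<longlonglongrightarrow> 0"
  proof (rule Lim_null_comparison)
    show "\<forall>\<^sub>F n in sequentially. norm (of_nat n * e n) \<le> (sqrt n * \<bar>t n\<bar>) ^ 2 * \<bar>t n\<bar>"
    proof (intro always_eventually allI)
      fix n
      have "norm (of_nat n * e n) \<le> n * \<bar>t n\<bar> ^ 3" using e[of n] by (simp add: norm_mult mult_left_mono)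
      also have "\<dots> = (sqrt n * \<bar>t n\<bar>) ^ 2 * \<bar>t n\<bar>" by (simp add: power_mult_distrib eval_nat_numeral)
      finally show "norm (of_nat n * e n) \<le> (sqrt n * \<bar>t n\<bar>) ^ 2 * \<bar>t n\<bar>" .
    qed
    have "(\<lambda>n. \<bar>sqrt n * t n\<bar> ^ 2 * \<bar>t n\<bar>) \<longlonglongrightarrow> \<bar>y\<bar> ^ 2 * \<bar>0\<bar>"
      by (intro tendsto_intros t_lim t_lim_0)
    then show "(\<lambda>n. (sqrt n * \<bar>t n\<bar>) ^ 2 * \<bar>t n\<bar>) \<longlonglongrightarrow> 0" by (simp add: abs_mult)
  qed
  moreover have "(\<lambda>n. cis (t n) * (of_nat n * r n)) \<longlonglongrightarrow> 0"
    by (rule tendsto_bounded_mult[where B = 1]) (auto simp: r_lim)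
  ultimately have "(\<lambda>n. of_nat n * e n + cis (t n) * (of_nat n * r n)) \<longlonglongrightarrow> 0 + 0" by (rule tendsto_add)
  moreover have "of_nat n * e n + cis (t n) * (of_nat n * r n) = of_nat n * (\<delta> n - \<i> * t n + (t n)\<^sup>2 / 2)" for n
    by (simp add: e_def \<delta>_def \<zeta>_def algebra_simps)
  ultimately show ?thesis by simp
qed

lemma \<delta>_lim: "(\<lambda>n. complex_of_real (sqrt n) * \<delta> n) \<longlonglongrightarrow> \<i> * y"
proof -
  have *: "(\<lambda>n. of_real (1 / sqrt n) * (of_nat n * (\<delta> n - \<i> * t n + (t n)\<^sup>2 / 2))
     + \<i> * of_real (sqrt n * t n) - of_real (sqrt n * t n) * of_real (t n) / 2)
     \<longlonglongrightarrow> of_real 0 * 0 + \<i> * of_real y - of_real y * of_real 0 / 2"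
    by (intro tendsto_intros \<delta>_expansion t_lim t_lim_0) (real_asymp, simp)
  have "\<forall>\<^sub>F n in sequentially. of_real (1 / sqrt n) * (of_nat n * (\<delta> n - \<i> * t n + (t n)\<^sup>2 / 2))
     + \<i> * of_real (sqrt n * t n) - of_real (sqrt n * t n) * of_real (t n) / 2 = complex_of_real (sqrt n) * \<delta> n"
    using eventually_gt_at_top[of 0]
  proof eventually_elim
    case (elim n)
    have "complex_of_real (1 / sqrt n) * of_nat n = of_real (1 / sqrt n * n)" by simp
    also have "1 / sqrt n * n = sqrt n" using elim by (simp add: field_simps)
    finally have "of_real (1 / sqrt n) * (of_nat n * (\<delta> n - \<i> * t n + (t n)\<^sup>2 / 2))
       = of_real (sqrt n) * (\<delta> n - \<i> * t n + (t n)\<^sup>2 / 2)" by (simp add: mult.assoc[symmetric])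
    then show ?case by (simp add: algebra_simps power2_eq_square)
  qed
  from Lim_transform_eventually[OF * this] show ?thesis by simp
qed

lemma \<delta>_lim_0: "\<delta> \<longlonglongrightarrow> 0"
proof -
  have "(\<lambda>n. of_real (1 / sqrt n) * (complex_of_real (sqrt n) * \<delta> n)) \<longlonglongrightarrow> of_real 0 * (\<i> * y)"
    by (intro tendsto_intros \<delta>_lim) real_asymp
  moreover have "\<forall>\<^sub>F n in sequentially. of_real (1 / sqrt n) * (complex_of_real (sqrt n) * \<delta> n) = \<delta> n"
    using eventually_gt_at_top[of 0] by eventually_elim simp
  ultimately have "\<delta> \<longlonglongrightarrow> of_real 0 * (\<i> * y)"
    by (rule Lim_transform_eventually)
  then show ?thesis by simp
qed

end

text \<open>The function is rescaled to - Ln (1 - z / 2), whose third derivative is at most 2 on the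
  unit disc; z = 2 b turns 2 |2 b|^3 into the constant 16.\<close>

lemma Ln_cubic:
  assumes "norm b \<le> 1 / 2"
  shows "norm (- Ln (1 - b) - b - b\<^sup>2 / 2) \<le> 16 * norm b ^ 3"
proof -
  define f where "f z = - Ln (1 - z / 2)" for z
  define f1 where "f1 z = (1 / 2) / (1 - z / 2)" for z :: complex
  define f2 where "f2 z = (1 / 4) / (1 - z / 2)\<^sup>2" for z :: complex
  define f3 where "f3 z = (1 / 4) / (1 - z / 2) ^ 3" for z :: complex
  have re: "1 / 2 \<le> Re (1 - z / 2)" if "norm z \<le> 1" for z
    using abs_Re_le_cmod[of z] that by simp
  have nz: "1 - z / 2 \<noteq> 0" if "norm z \<le> 1" for z :: complex
  proof
    assume "1 - z / 2 = 0"
    then have "Re (1 - z / 2) = 0" by (simp only: zero_complex.sel)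
    then show False using re[OF that] by linarith
  qed
  have np: "1 - z / 2 \<notin> \<real>\<^sub>\<le>\<^sub>0" if "norm z \<le> 1" for z :: complex
    using re[OF that] by (auto simp: complex_nonpos_Reals_iff)
  have "norm (f (2 * b) - f 0 - f1 0 * (2 * b - 0) - f2 0 * (2 * b - 0)\<^sup>2 / 2) \<le> 2 * norm (2 * b - 0) ^ 3"
  proof (rule complex_Taylor_cubic[where g = f3])
    fix z :: complex assume z: "norm z \<le> 1"
    show "(f has_field_derivative f1 z) (at z)"
      unfolding f_def f1_def using np[OF z] nz[OF z] by (auto intro!: derivative_eq_intros simp: field_simps)
    show "(f1 has_field_derivative f2 z) (at z)"
      unfolding f1_def f2_def using nz[OF z]
      by (auto intro!: derivative_eq_intros simp: power2_eq_square) (simp add: algebra_simps)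
    show "(f2 has_field_derivative f3 z) (at z)"
      unfolding f2_def f3_def using nz[OF z] by (auto intro!: derivative_eq_intros simp: eval_nat_numeral divide_simps)
    have "1 / 2 \<le> norm (1 - z / 2)" using re[OF z] complex_Re_le_cmod[of "1 - z / 2"] by linarith
    then have "(1 / 2) ^ 3 \<le> norm (1 - z / 2) ^ 3" by (intro power_mono) auto
    then have "1 / 8 \<le> norm (1 - z / 2) ^ 3" by (simp add: power_divide)
    moreover have "norm (f3 z) = (1 / 4) / norm (1 - z / 2) ^ 3"
      unfolding f3_def norm_divide norm_power by simp
    ultimately show "norm (f3 z) \<le> 2"
      using frac_le[of "1 / 4" "1 / 4" "1 / 8" "norm (1 - z / 2) ^ 3"] by simp
  qed (use assms in \<open>auto simp: norm_mult\<close>)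
  then show ?thesis by (simp add: f_def f1_def f2_def norm_mult power_mult_distrib)
qed

lemma exp_node_factor:
  assumes w: "0 < w" "w < 2" and z: "z \<noteq> 0" "norm (of_real w * z) < 2"
  shows "(exp (of_real w * z) - 1) / (exp (of_real w) - 1)
    = z * exp (log_expm1_quot (of_real w * z) - log_expm1_quot (of_real w))"
proof -
  have 1: "exp (of_real w * z) - 1 = of_real w * z * exp (log_expm1_quot (of_real w * z))"
    using w z by (simp add: exp_log_expm1_quot expm1_quot_def)
  have 2: "exp (complex_of_real w) - 1 = of_real w * exp (log_expm1_quot (of_real w))"
    using w by (simp add: exp_log_expm1_quot expm1_quot_def)
  show ?thesis unfolding 1 2 exp_diff using w by simp
qed

lemma norm_sqrt_cube:
  assumes "0 < n"
  shows "norm (complex_of_real (sqrt (real n)) * z) ^ 3 * (1 / sqrt (real n)) = real n * norm z ^ 3"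
proof -
  have "sqrt (real n) ^ 3 = real n * sqrt (real n)" by (simp add: power3_eq_cube)
  then have "norm (complex_of_real (sqrt (real n)) * z) ^ 3 = real n * sqrt (real n) * norm z ^ 3"
    by (simp add: norm_mult power_mult_distrib)
  then show ?thesis using assms by simp
qed

context saddle_window
begin

lemma \<zeta>_lim: "\<zeta> \<longlonglongrightarrow> 1"
  using \<delta>_lim_0 unfolding \<delta>_def[abs_def] by (rule LIM_zero_cancel)

text \<open>As the nodes are at most ln 2, a modulus below 1 / ln 2 keeps node times \<zeta> in the
  unit disc, where the Taylor bound holds.\<close>

lemma ev_\<zeta>: "\<forall>\<^sub>F n in sequentially. \<zeta> n \<noteq> 0 \<and> norm (\<zeta> n) < 1 / ln 2"
proof -
  have "(\<lambda>n. norm (\<zeta> n)) \<longlonglongrightarrow> 1" using tendsto_norm[OF \<zeta>_lim] by simp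
  moreover have "1 < 1 / ln (2::real)" using ln_2_less_1 by simp
  ultimately show ?thesis
    by (intro eventually_conj tendsto_imp_eventually_ne[OF \<zeta>_lim] order_tendstoD) auto
qed

text \<open>Each factor is \<zeta> exp (l (w \<zeta>) - l w), with l =
  \<open>log_expm1_quot\<close>, and l is expanded to second order in \<delta>. The terms linear in
  t are i t (2 k - n + 2 S1) with S1 close to k (1 / (2 fb_kappa) - 1): the bracket is close to k /
  fb_kappa - n, so the large contributions cancel and i x y / fb_kappa remains. The quadratic terms
  come from the - t^2/2 in \<delta> and from the second derivative.\<close>

lemma phase_limit:
  "(\<lambda>n. (\<Prod>j=1..k n. (exp (node (k n) j * \<zeta> n) - 1) / (exp (complex_of_real (node (k n) j)) - 1))\<^sup>2
     * cis (- (real n * t n))) \<longlonglongrightarrow> exp (\<i> * x * y / of_real fb_kappa - of_real ((2 * ln 2 * fb_kappa - 1 / 2) * y\<^sup>2))"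
proof -
  let ?l = log_expm1_quot and ?K = fb_kappa
  define S1 where "S1 n = (\<Sum>j=1..k n. of_real (node (k n) j) * deriv ?l (of_real (node (k n) j)))" for n
  define S2 where "S2 n = (\<Sum>j=1..k n. (of_real (node (k n) j))\<^sup>2 * deriv (deriv ?l) (of_real (node (k n) j)))" for n
  define E where "E n = (\<Sum>j=1..k n. ?l (node (k n) j * \<zeta> n) - ?l (of_real (node (k n) j)))" for n
  \<comment> \<open>\<open>S1\<close> differs from its linear approximation by a bounded amount,
    which vanishes when multiplied by t; an error of order sqrt n would survive in the
    limit.\<close>
  define A where "A n = S1 n - of_real (real (k n) * (1 / (2 * ?K) - 1))" for n
  define \<epsilon> where "\<epsilon> n = \<delta> n - \<i> * t n + (t n)\<^sup>2 / 2" for n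
  define R where "R n = 2 * E n - 2 * \<delta> n * S1 n - (\<delta> n)\<^sup>2 * S2 n" for n
  define X where "X n = \<i> * t n * (2 * real (k n) - real n) + 2 * E n" for n
  have A: "norm (A n) \<le> ln 2" for n
    unfolding A_def S1_def by (rule sum_log_deriv[OF k_pos])
  obtain B2 where B2: "\<And>n. norm (S2 n - of_real (real (k n) * (2 * ln 2 + 1 - 1 / ?K))) \<le> B2"
    using sum_log_deriv2 k_pos unfolding S2_def by blast
  have S1_lim: "(\<lambda>n. S1 n / of_nat n) \<longlonglongrightarrow> of_real (?K * (1 / (2 * ?K) - 1))"
    by (rule tendsto_bounded_div[OF A[unfolded A_def] k_div_lim])
  have S2_lim: "(\<lambda>n. S2 n / of_nat n) \<longlonglongrightarrow> of_real (?K * (2 * ln 2 + 1 - 1 / ?K))"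
    by (rule tendsto_bounded_div[OF B2 k_div_lim])
  have R_lim: "R \<longlonglongrightarrow> 0"
  proof -
    obtain B where B: "\<And>w z. norm w \<le> 1 \<Longrightarrow> norm z \<le> 1 \<Longrightarrow>
      norm (?l z - ?l w - deriv ?l w * (z - w) - deriv (deriv ?l) w * (z - w)\<^sup>2 / 2) \<le> B * norm (z - w) ^ 3" and B0: "0 < B"
      using log_expm1_quot_Taylor by blast
    show ?thesis
    proof (rule Lim_null_comparison)
      show "\<forall>\<^sub>F n in sequentially. norm (R n) \<le> 2 * B * (real (k n) / n) * norm (of_real (sqrt n) * \<delta> n) ^ 3 * (1 / sqrt n)"
        using ev_\<zeta> eventually_gt_at_top[of 0]
      proof eventually_elim
        case (elim n)
        have R_sum: "R n = 2 * (\<Sum>j=1..k n. ?l (node (k n) j * \<zeta> n) - ?l (of_real (node (k n) j))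
            - deriv ?l (of_real (node (k n) j)) * (node (k n) j * \<delta> n)
            - deriv (deriv ?l) (of_real (node (k n) j)) * (node (k n) j * \<delta> n)\<^sup>2 / 2)"
          unfolding R_def E_def S1_def S2_def
          by (simp only: sum_subtractf sum_distrib_left right_diff_distrib) (simp add: mult_ac power_mult_distrib power_divide)
        have "norm (R n) \<le> 2 * (\<Sum>j=1..k n. B * norm (\<delta> n) ^ 3)"
          unfolding R_sum norm_mult norm_numeral
        proof (intro mult_left_mono order_trans[OF norm_sum] sum_mono)
          fix j assume j: "j \<in> {1..k n}"
          note w = node_bounds[OF j]
          have d: "of_real (node (k n) j) * \<zeta> n - of_real (node (k n) j) = node (k n) j * \<delta> n"
            by (simp add: \<delta>_def right_diff_distrib)
          have "norm (of_real (node (k n) j) * \<zeta> n) \<le> ln 2 * (1 / ln 2)"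
            unfolding norm_mult norm_of_real using w elim by (intro mult_mono) auto
          then have "norm (?l (node (k n) j * \<zeta> n) - ?l (of_real (node (k n) j))
            - deriv ?l (of_real (node (k n) j)) * (node (k n) j * \<delta> n)
            - deriv (deriv ?l) (of_real (node (k n) j)) * (node (k n) j * \<delta> n)\<^sup>2 / 2)
            \<le> B * norm (node (k n) j * \<delta> n) ^ 3"
          proof -
            have "norm (complex_of_real (node (k n) j)) \<le> 1"
              unfolding norm_of_real using w ln_2_less_1 by linarith
            moreover have "norm (of_real (node (k n) j) * \<zeta> n) \<le> 1"
              using \<open>_ \<le> ln 2 * (1 / ln 2)\<close> by simp
            ultimately show ?thesis unfolding d[symmetric] by (rule B)
          qed
          also have "\<dots> \<le> B * norm (\<delta> n) ^ 3"
          proof (intro mult_left_mono power_mono)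
            have "norm (of_real (node (k n) j) * \<delta> n) \<le> 1 * norm (\<delta> n)"
              unfolding norm_mult norm_of_real using w ln_2_less_1 by (intro mult_right_mono norm_ge_zero) linarith
            then show "norm (of_real (node (k n) j) * \<delta> n) \<le> norm (\<delta> n)" by simp
          qed (use B0 in auto)
          finally show "norm (?l (node (k n) j * \<zeta> n) - ?l (of_real (node (k n) j))
            - deriv ?l (of_real (node (k n) j)) * (node (k n) j * \<delta> n)
            - deriv (deriv ?l) (of_real (node (k n) j)) * (node (k n) j * \<delta> n)\<^sup>2 / 2) \<le> B * norm (\<delta> n) ^ 3" .
        qed auto
        also have "\<dots> = 2 * B * (real (k n) / n) * norm (of_real (sqrt n) * \<delta> n) ^ 3 * (1 / sqrt n)"
        proof -
          have "2 * B * (real (k n) / n) * norm (of_real (sqrt n) * \<delta> n) ^ 3 * (1 / sqrt n)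
            = 2 * B * (real (k n) / n) * (n * norm (\<delta> n) ^ 3)"
            unfolding norm_sqrt_cube[OF \<open>0 < n\<close>, symmetric] by (simp only: mult.assoc)
          also have "\<dots> = 2 * B * (real (k n) / n * n) * norm (\<delta> n) ^ 3" by (simp only: mult.assoc)
          also have "real (k n) / n * n = k n" using \<open>0 < n\<close> by simp
          finally show ?thesis by (simp add: mult_ac)
        qed
        finally show ?case .
      qed
      have "(\<lambda>n. 2 * B * (real (k n) / n) * norm (of_real (sqrt n) * \<delta> n) ^ 3 * (1 / sqrt n))
         \<longlonglongrightarrow> 2 * B * ?K * norm (\<i> * y) ^ 3 * 0"
        by (intro tendsto_intros k_div_lim \<delta>_lim) real_asymp
      then show "(\<lambda>n. 2 * B * (real (k n) / n) * norm (of_real (sqrt n) * \<delta> n) ^ 3 * (1 / sqrt n)) \<longlonglongrightarrow> 0"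
        by simp
    qed
  qed
  have X_lim: "X \<longlonglongrightarrow> \<i> * x * y / of_real ?K - of_real ((2 * ln 2 * ?K - 1 / 2) * y\<^sup>2)"
  proof -
    define w where "w = \<i> * complex_of_real y"
    note \<delta>_lim' = \<delta>_lim[folded w_def]
    have "(\<lambda>n. \<i> * of_real (sqrt n * t n) * of_real ((real (k n) - ?K * n) / sqrt n) / ?K
        + 2 * (A n * (\<i> * t n)) - (of_real (sqrt n * t n))\<^sup>2 * (S1 n / of_nat n)
        + 2 * (of_nat n * \<epsilon> n) * (S1 n / of_nat n) + (of_real (sqrt n) * \<delta> n)\<^sup>2 * (S2 n / of_nat n) + R n)
      \<longlonglongrightarrow> \<i> * of_real y * of_real x / ?K + 2 * 0 - (of_real y)\<^sup>2 * of_real (?K * (1 / (2 * ?K) - 1))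
        + 2 * 0 * of_real (?K * (1 / (2 * ?K) - 1)) + w\<^sup>2 * of_real (?K * (2 * ln 2 + 1 - 1 / ?K)) + 0"
    proof (intro tendsto_intros t_lim k_lim S1_lim S2_lim \<delta>_lim' R_lim)
      have "(\<lambda>n. \<i> * complex_of_real (t n)) \<longlonglongrightarrow> \<i> * of_real 0" by (intro tendsto_intros t_lim_0)
      then show "(\<lambda>n. A n * (\<i> * t n)) \<longlonglongrightarrow> 0" by (intro tendsto_bounded_mult[OF A]) simp
      show "(\<lambda>n. of_nat n * \<epsilon> n) \<longlonglongrightarrow> 0" unfolding \<epsilon>_def by (rule \<delta>_expansion)
    qed (use fb_kappa_pos in auto)
    also have "\<i> * of_real y * of_real x / ?K + 2 * 0 - (of_real y)\<^sup>2 * of_real (?K * (1 / (2 * ?K) - 1))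
        + 2 * 0 * of_real (?K * (1 / (2 * ?K) - 1)) + w\<^sup>2 * of_real (?K * (2 * ln 2 + 1 - 1 / ?K)) + 0
        = \<i> * x * y / ?K - of_real (?K * (1 / (2 * ?K) - 1) + ?K * (2 * ln 2 + 1 - 1 / ?K)) * y\<^sup>2"
      by (simp add: w_def power_mult_distrib algebra_simps)
    also have "?K * (1 / (2 * ?K) - 1) + ?K * (2 * ln 2 + 1 - 1 / ?K) = 2 * ln 2 * ?K - 1 / 2"
      using fb_kappa_pos by (simp add: field_simps)
    finally have lim: "(\<lambda>n. \<i> * of_real (sqrt n * t n) * of_real ((real (k n) - ?K * n) / sqrt n) / ?K
        + 2 * (A n * (\<i> * t n)) - (of_real (sqrt n * t n))\<^sup>2 * (S1 n / of_nat n)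
        + 2 * (of_nat n * \<epsilon> n) * (S1 n / of_nat n) + (of_real (sqrt n) * \<delta> n)\<^sup>2 * (S2 n / of_nat n) + R n)
      \<longlonglongrightarrow> \<i> * x * y / ?K - of_real (2 * ln 2 * ?K - 1 / 2) * y\<^sup>2" .
    have ev: "\<forall>\<^sub>F n in sequentially. \<i> * of_real (sqrt n * t n) * of_real ((real (k n) - ?K * n) / sqrt n) / ?K
        + 2 * (A n * (\<i> * t n)) - (of_real (sqrt n * t n))\<^sup>2 * (S1 n / of_nat n)
        + 2 * (of_nat n * \<epsilon> n) * (S1 n / of_nat n) + (of_real (sqrt n) * \<delta> n)\<^sup>2 * (S2 n / of_nat n) + R n = X n"
      using eventually_gt_at_top[of 0]
    proof eventually_elim
      case (elim n)
      have e1: "\<i> * of_real (sqrt n * t n) * of_real ((real (k n) - ?K * n) / sqrt n) / complex_of_real ?K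
         = \<i> * of_real (t n * (real (k n) / ?K - n))"
      proof -
        have "sqrt n * t n * ((real (k n) - ?K * n) / sqrt n) / ?K = t n * (real (k n) / ?K - n)"
          using elim fb_kappa_pos by (simp add: field_simps)
        then show ?thesis by (simp only: of_real_mult[symmetric] of_real_divide[symmetric] mult.assoc times_divide_eq_right[symmetric] mult_ac)
      qed
      have e2: "(complex_of_real (sqrt n * t n))\<^sup>2 * (S1 n / of_nat n) = (of_real (t n))\<^sup>2 * S1 n"
        using elim by (simp add: power_mult_distrib flip: of_real_power)
      have e3: "(of_real (sqrt n) * \<delta> n)\<^sup>2 * (S2 n / of_nat n) = (\<delta> n)\<^sup>2 * S2 n"
        using elim by (simp add: power_mult_distrib flip: of_real_power)
      have e4: "2 * (of_nat n * \<epsilon> n) * (S1 n / of_nat n) = 2 * \<epsilon> n * S1 n"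
        using elim by simp
      have e5: "complex_of_real (real (k n) * (1 / (2 * ?K) - 1)) = of_real (real (k n) / ?K) / 2 - of_nat (k n)"
        by (simp add: algebra_simps)
      have e6: "complex_of_real (real (k n) / ?K - n) = of_real (real (k n) / ?K) - of_nat n" by simp
      show ?case
        unfolding e1 e2 e3 e4 unfolding X_def R_def \<epsilon>_def A_def e5 e6 by (simp add: algebra_simps)
    qed
    from Lim_transform_eventually[OF lim ev] show ?thesis by simp
  qed
  \<comment> \<open>The factor (1 + r)^(2 k) is split off: k r tends to 0, so it tends to 1 and
    \<open>X\<close> carries the limit.\<close>
  have "(\<lambda>n. (1 + r n) ^ (2 * k n) * exp (X n)) \<longlonglongrightarrow> 1 * exp (\<i> * x * y / of_real ?K - of_real ((2 * ln 2 * ?K - 1 / 2) * y\<^sup>2))"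
  proof (intro tendsto_intros X_lim power_one_plus_tendsto_1)
    have "(\<lambda>n. 2 * (real (k n) / n) * norm (of_nat n * r n)) \<longlonglongrightarrow> 2 * ?K * norm (0::complex)"
      by (intro tendsto_intros k_div_lim r_lim)
    moreover have "\<forall>\<^sub>F n in sequentially. 2 * (real (k n) / n) * norm (of_nat n * r n) = real (2 * k n) * norm (r n)"
      using eventually_gt_at_top[of 0] by eventually_elim (simp add: norm_mult)
    ultimately have "(\<lambda>n. real (2 * k n) * norm (r n)) \<longlonglongrightarrow> 2 * ?K * norm (0::complex)"
      by (rule Lim_transform_eventually)
    then show "(\<lambda>n. real (2 * k n) * norm (r n)) \<longlonglongrightarrow> 0" by simp
  qed
  moreover have "\<forall>\<^sub>F n in sequentially. (1 + r n) ^ (2 * k n) * exp (X n) =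
    (\<Prod>j=1..k n. (exp (node (k n) j * \<zeta> n) - 1) / (exp (complex_of_real (node (k n) j)) - 1))\<^sup>2
     * cis (- (real n * t n))"
    using ev_\<zeta>
  proof eventually_elim
    case (elim n)
    have "(\<Prod>j=1..k n. (exp (node (k n) j * \<zeta> n) - 1) / (exp (complex_of_real (node (k n) j)) - 1))
       = (\<Prod>j=1..k n. \<zeta> n * exp (?l (node (k n) j * \<zeta> n) - ?l (of_real (node (k n) j))))"
    proof (rule prod.cong[OF refl])
      fix j assume j: "j \<in> {1..k n}"
      note w = node_bounds[OF j]
      have "norm (of_real (node (k n) j) * \<zeta> n) \<le> ln 2 * (1 / ln 2)"
        unfolding norm_mult norm_of_real using w elim by (intro mult_mono) auto
      then show "(exp (node (k n) j * \<zeta> n) - 1) / (exp (complex_of_real (node (k n) j)) - 1)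
        = \<zeta> n * exp (?l (node (k n) j * \<zeta> n) - ?l (of_real (node (k n) j)))"
        using w elim ln_2_less_1 by (intro exp_node_factor) auto
    qed
    also have "\<dots> = \<zeta> n ^ k n * exp (E n)"
      unfolding prod.distrib E_def by (simp add: exp_sum)
    finally have "(\<Prod>j=1..k n. (exp (node (k n) j * \<zeta> n) - 1) / (exp (complex_of_real (node (k n) j)) - 1))\<^sup>2
      = \<zeta> n ^ (2 * k n) * exp (2 * E n)"
      by (simp only: power_mult_distrib power_mult[symmetric] exp_double mult.commute[of _ 2])
    also have "\<zeta> n ^ (2 * k n) = exp (\<i> * t n * (2 * real (k n))) * (1 + r n) ^ (2 * k n)"
    proof -
      have "cis (t n) ^ (2 * k n) = cis (real (2 * k n) * t n)" by (rule Complex.DeMoivre)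
      also have "\<dots> = exp (\<i> * t n * (2 * real (k n)))"
        unfolding cis_conv_exp by (rule arg_cong[where f = exp]) simp
      finally show ?thesis unfolding \<zeta>_def power_mult_distrib by (simp only:)
    qed
    also have "exp (\<i> * t n * (2 * real (k n))) * (1 + r n) ^ (2 * k n) * exp (2 * E n) * cis (- (real n * t n))
      = (1 + r n) ^ (2 * k n) * exp (X n)"
      unfolding X_def cis_conv_exp by (simp add: algebra_simps exp_add[symmetric] mult_exp_exp)
    finally show ?case by simp
  qed
  ultimately have "(\<lambda>n. (\<Prod>j=1..k n. (exp (node (k n) j * \<zeta> n) - 1) / (exp (complex_of_real (node (k n) j)) - 1))\<^sup>2
     * cis (- (real n * t n))) \<longlonglongrightarrow> 1 * exp (\<i> * x * y / of_real ?K - of_real ((2 * ln 2 * ?K - 1 / 2) * y\<^sup>2))"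
    by (rule Lim_transform_eventually)
  then show ?thesis by simp
qed

end

section \<open>Node sums for the dependence on v\<close>

lemma real_Riemann_sum:
  fixes f F f' :: "real \<Rightarrow> real"
  assumes k: "0 < k"
    and F: "\<And>t. (F has_real_derivative f t) (at t)"
    and f: "\<And>t. (f has_real_derivative f' t) (at t)"
    and B: "\<And>t. t \<in> {0..ln 2} \<Longrightarrow> \<bar>f' t\<bar> \<le> B"
  shows "\<bar>(\<Sum>j=1..k. f (node k j)) - k * ((F (ln 2) - F 0) / ln 2)\<bar> \<le> B * ln 2"
proof -
  have "norm ((\<Sum>j=1..k. f (node k j)) - (k / ln 2) *\<^sub>R (F (ln 2) - F 0)) \<le> B * ln 2"
  proof (rule Riemann_sum_Lipschitz[OF ln2_pos k])
    show "continuous_on {0..ln 2} F" by (rule DERIV_continuous_on) (rule has_field_derivative_at_within[OF F])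
    show "(F has_vector_derivative f t) (at t)" for t
      using F by (simp add: has_real_derivative_iff_has_vector_derivative)
    show "norm (f s - f t) \<le> B * \<bar>s - t\<bar>" if "s \<in> {0..ln 2}" "t \<in> {0..ln 2}" for s t
    proof -
      have "norm (f s - f t) \<le> B * norm (s - t)"
        by (rule field_differentiable_bound[OF _ has_field_derivative_at_within[OF f] _ that]) (auto simp: B)
      then show ?thesis by simp
    qed
  qed
  then show ?thesis by (simp add: field_simps)
qed

lemma exp_le_2: "t \<in> {0..ln 2} \<Longrightarrow> exp t \<le> (2::real)"
  by (simp add: exp_le_2_iff)

lemma sum_exp_node:
  assumes "0 < k"
  shows "\<bar>(\<Sum>j=1..k. exp (node k j) - 1) - k * (1 / ln 2 - 1)\<bar> \<le> 2 * ln 2"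
proof -
  have "\<bar>(\<Sum>j=1..k. exp (node k j) - 1) - k * (((exp (ln 2) - ln 2) - (exp 0 - 0)) / ln 2)\<bar> \<le> 2 * ln 2"
    by (rule real_Riemann_sum[OF assms, where f' = exp]) (use exp_le_2 in \<open>auto intro!: derivative_eq_intros\<close>)
  then show ?thesis by (simp add: diff_divide_distrib)
qed

lemma sum_node_exp_node:
  assumes "0 < k"
  shows "\<bar>(\<Sum>j=1..k. node k j * exp (node k j)) - k * (2 - 1 / ln 2)\<bar> \<le> 4 * ln 2"
proof -
  have "\<bar>(\<Sum>j=1..k. node k j * exp (node k j)) - k * (((ln 2 - 1) * exp (ln 2) - (0 - 1) * exp 0) / ln 2)\<bar> \<le> 4 * ln 2"
  proof (rule real_Riemann_sum[OF assms, where f' = "\<lambda>t. (1 + t) * exp t"])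
    fix t :: real assume t: "t \<in> {0..ln 2}"
    then have "(1 + t) * exp t \<le> 2 * 2" using exp_le_2[OF t] ln_2_less_1 by (intro mult_mono) auto
    then show "\<bar>(1 + t) * exp t\<bar> \<le> 4" using t by simp
  qed (auto intro!: derivative_eq_intros simp: algebra_simps)
  then show ?thesis by (simp add: field_simps)
qed

lemma sum_exp_node_sq:
  assumes "0 < k"
  shows "\<bar>(\<Sum>j=1..k. (exp (node k j) - 1)\<^sup>2) - k * (1 - 1 / (2 * ln 2))\<bar> \<le> 4 * ln 2"
proof -
  have "\<bar>(\<Sum>j=1..k. (exp (node k j) - 1)\<^sup>2) - k * ((((exp (ln 2))\<^sup>2 / 2 - 2 * exp (ln 2) + ln 2) - ((exp 0)\<^sup>2 / 2 - 2 * exp 0 + 0)) / ln 2)\<bar> \<le> 4 * ln 2"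
  proof (rule real_Riemann_sum[OF assms, where f' = "\<lambda>t. 2 * (exp t - 1) * exp t"])
    fix t :: real assume t: "t \<in> {0..ln 2}"
    then have "(exp t - 1) * exp t \<le> 1 * 2" using exp_le_2[OF t] by (intro mult_mono) auto
    moreover have "0 \<le> (exp t - 1) * exp t" using t by simp
    moreover have "2 * (exp t - 1) * exp t = 2 * ((exp t - 1) * exp t)" by (rule mult.assoc)
    ultimately show "\<bar>2 * (exp t - 1) * exp t\<bar> \<le> 4" by linarith
  qed (auto intro!: derivative_eq_intros simp: algebra_simps power2_eq_square)
  then show ?thesis by (simp add: field_simps)
qed

text \<open>The products below run up to \<open>k + 1\<close>, hence the nodes up to \<open>2 * ln 2\<close>.\<close>

lemma node_bounds_Suc: "0 < k \<Longrightarrow> j \<in> {1..k+1} \<Longrightarrow> 0 < node k j \<and> node k j \<le> 2"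
proof -
  assume k: "0 < k" and j: "j \<in> {1..k+1}"
  have "node k j \<le> real (2 * k) * (ln 2 / k)" using j k by (intro mult_right_mono) auto
  also have "\<dots> \<le> 2" using k ln_2_less_1 by simp
  finally show "0 < node k j \<and> node k j \<le> 2" using j k by simp
qed

lemma extend_sum_bound:
  fixes g :: "nat \<Rightarrow> real"
  assumes "\<bar>(\<Sum>j=1..k. g j) - c\<bar> \<le> B" "\<bar>g (k + 1)\<bar> \<le> D"
  shows "\<bar>(\<Sum>j=1..k+1. g j) - c\<bar> \<le> B + D"
  using assms by simp

lemma exp_node_last_le: "0 < k \<Longrightarrow> exp (node k (k + 1)) \<le> 8"
proof -
  assume k: "0 < k"
  have "exp (node k (k + 1)) \<le> exp (3 * ln 2)"
    using k by (simp add: field_simps)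
  also have "\<dots> = (exp (ln 2)) ^ 3" by (subst exp_of_nat_mult[symmetric]) simp
  finally show ?thesis by simp
qed

context saddle_window
begin

text \<open>The logarithm of the product is the sum of b + b^2 / 2 with b = u (q^j - 1), up to
  cubes. To first order this adds s / sqrt n times \<Sum> (exp w - 1), about k (1 / ln 2 - 1), to
  the s k / sqrt n in front; centring at (fb_kappa / ln 2) n leaves s x / ln 2. The angle enters
  through w exp w, hence the mixed term in s y. The s^2 term collects the second order of u and the
  squares of b.\<close>

lemma weight_limit:
  fixes s :: complex
  defines "u \<equiv> \<lambda>n. exp (s / of_real (sqrt n)) - 1"
  shows "(\<lambda>n. exp (s * (real (k n) - fb_kappa / ln 2 * n) / of_real (sqrt n))
      * (\<Prod>j=1..k n + 1. inverse (1 - u n * (exp (node (k n) j * \<zeta> n) - 1))))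
    \<longlonglongrightarrow> exp (s * x / of_real (ln 2) + \<i> * s * y * of_real (fb_kappa * (2 - 1 / ln 2)) + s\<^sup>2 * of_real (fb_kappa / (4 * ln 2)))"
proof -
  let ?K = fb_kappa and ?N = "\<lambda>n. {1..k n + 1}"
  define b where "b n j = u n * (exp (node (k n) j * \<zeta> n) - 1)" for n j
  define W0 where "W0 n = (\<Sum>j\<in>?N n. exp (node (k n) j) - 1)" for n
  define W1 where "W1 n = (\<Sum>j\<in>?N n. node (k n) j * exp (node (k n) j))" for n
  define W2 where "W2 n = (\<Sum>j\<in>?N n. (exp (node (k n) j) - 1)\<^sup>2)" for n
  have W0: "\<bar>W0 n - real (k n) * (1 / ln 2 - 1)\<bar> \<le> 2 * ln 2 + 7" for n
    unfolding W0_def by (rule extend_sum_bound[OF sum_exp_node[OF k_pos]])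
       (use exp_node_last_le[OF k_pos, of n] exp_gt_zero[of "node (k n) (k n + 1)"] in linarith)
  have W1: "\<bar>W1 n - real (k n) * (2 - 1 / ln 2)\<bar> \<le> 4 * ln 2 + 16" for n
    unfolding W1_def
  proof (rule extend_sum_bound[OF sum_node_exp_node[OF k_pos]])
    have "node (k n) (k n + 1) * exp (node (k n) (k n + 1)) \<le> 2 * 8"
      using node_bounds_Suc[OF k_pos, of "k n + 1" n] exp_node_last_le[OF k_pos, of n] by (intro mult_mono) auto
    then show "\<bar>node (k n) (k n + 1) * exp (node (k n) (k n + 1))\<bar> \<le> 16"
      using node_bounds_Suc[OF k_pos, of "k n + 1" n] by (simp add: abs_mult)
  qed
  have W2: "\<bar>W2 n - real (k n) * (1 - 1 / (2 * ln 2))\<bar> \<le> 4 * ln 2 + 49" for n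
    unfolding W2_def
  proof (rule extend_sum_bound[OF sum_exp_node_sq[OF k_pos]])
    have "(exp (node (k n) (k n + 1)) - 1)\<^sup>2 \<le> 7 ^ 2"
      using node_bounds_Suc[OF k_pos, of "k n + 1" n] exp_node_last_le[OF k_pos, of n] by (intro power_mono) auto
    then show "\<bar>(exp (node (k n) (k n + 1)) - 1)\<^sup>2\<bar> \<le> 49" by simp
  qed
  have W0_lim: "(\<lambda>n. W0 n / of_nat n) \<longlonglongrightarrow> of_real (?K * (1 / ln 2 - 1))"
    by (rule tendsto_bounded_div[OF _ k_div_lim]) (use W0 in simp)
  have W1_lim: "(\<lambda>n. W1 n / of_nat n) \<longlonglongrightarrow> of_real (?K * (2 - 1 / ln 2))"
    by (rule tendsto_bounded_div[OF _ k_div_lim]) (use W1 in simp)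
  have W2_lim: "(\<lambda>n. W2 n / of_nat n) \<longlonglongrightarrow> of_real (?K * (1 - 1 / (2 * ln 2)))"
    by (rule tendsto_bounded_div[OF _ k_div_lim]) (use W2 in simp)
  have sqrt_0: "(\<lambda>n. complex_of_real (1 / sqrt n)) \<longlonglongrightarrow> of_real 0"
    by (intro tendsto_intros) real_asymp
  have u_exp: "(\<lambda>n. of_nat n * (u n - s / of_real (sqrt n))) \<longlonglongrightarrow> s\<^sup>2 / 2"
  proof -
    have "(\<lambda>n. of_nat n * (u n - s / of_real (sqrt n)) - s\<^sup>2 / 2) \<longlonglongrightarrow> 0"
    proof (rule Lim_null_comparison)
      show "\<forall>\<^sub>F n in sequentially. norm (of_nat n * (u n - s / of_real (sqrt n)) - s\<^sup>2 / 2)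
          \<le> exp (norm s) * norm s ^ 3 * (1 / sqrt n)"
        using eventually_gt_at_top[of 0]
      proof eventually_elim
        case (elim n)
        define z where "z = s / of_real (sqrt n)"
        have nz: "norm z = norm s / sqrt n" by (simp add: z_def norm_divide)
        have z2: "of_nat n * z\<^sup>2 = s\<^sup>2" using elim by (simp add: z_def power_divide flip: of_real_power)
        have "norm z \<le> norm s" unfolding nz using elim by (simp add: divide_le_eq mult_le_cancel_left1)
        then have re: "\<bar>Re z\<bar> \<le> norm s" using abs_Re_le_cmod[of z] by linarith
        have "norm (exp z - (\<Sum>k\<le>2. z ^ k / fact k)) \<le> exp \<bar>Re z\<bar> * norm z ^ Suc 2 / fact 2"
          by (rule Taylor_exp)
        also have "(\<Sum>k\<le>2. z ^ k / fact k) = 1 + z + z\<^sup>2 / 2" by (simp add: numeral_2_eq_2)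
        also have "exp \<bar>Re z\<bar> * norm z ^ Suc 2 / fact 2 \<le> exp (norm s) * norm z ^ 3"
        proof -
          have "exp \<bar>Re z\<bar> * norm z ^ 3 \<le> exp (norm s) * norm z ^ 3" using re by (intro mult_right_mono) auto
          moreover have "0 \<le> exp \<bar>Re z\<bar> * norm z ^ 3" by simp
          moreover have "exp \<bar>Re z\<bar> * norm z ^ Suc 2 / fact 2 = exp \<bar>Re z\<bar> * norm z ^ 3 / 2"
            by (simp add: numeral_3_eq_3 numeral_2_eq_2)
          ultimately show ?thesis by linarith
        qed
        finally have "n * norm (exp z - (1 + z + z\<^sup>2 / 2)) \<le> n * (exp (norm s) * norm z ^ 3)"
          by (intro mult_left_mono) auto
        also have "\<dots> = exp (norm s) * norm s ^ 3 * (1 / sqrt n)"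
        proof -
          have "n * norm z ^ 3 = norm (of_real (sqrt n) * z) ^ 3 * (1 / sqrt n)"
            using norm_sqrt_cube[OF elim, of z] by simp
          moreover have "of_real (sqrt n) * z = s" using elim by (simp add: z_def)
          ultimately have "n * norm z ^ 3 = norm s ^ 3 * (1 / sqrt n)" by (simp only:)
          moreover have "n * (exp (norm s) * norm z ^ 3) = exp (norm s) * (n * norm z ^ 3)" by (simp only: mult_ac)
          ultimately show ?thesis by (simp only: mult_ac)
        qed
        finally have "norm (of_nat n * (exp z - (1 + z + z\<^sup>2 / 2))) \<le> exp (norm s) * norm s ^ 3 * (1 / sqrt n)"
          by (simp add: norm_mult)
        moreover have "of_nat n * (exp z - (1 + z + z\<^sup>2 / 2)) = of_nat n * (u n - z) - s\<^sup>2 / 2"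
          unfolding z2[symmetric] u_def z_def[symmetric] by (simp add: algebra_simps)
        ultimately show ?case by (simp add: z_def)
      qed
      show "(\<lambda>n. exp (norm s) * norm s ^ 3 * (1 / sqrt n)) \<longlonglongrightarrow> 0" by real_asymp
    qed
    then show ?thesis by (rule LIM_zero_cancel)
  qed
  have u_lim: "(\<lambda>n. of_real (sqrt n) * u n) \<longlonglongrightarrow> s"
  proof -
    have lim: "(\<lambda>n. of_real (1 / sqrt n) * (of_nat n * (u n - s / of_real (sqrt n))) + s) \<longlonglongrightarrow> of_real 0 * (s\<^sup>2 / 2) + s"
      by (intro tendsto_add tendsto_mult sqrt_0 u_exp tendsto_const)
    have ev: "\<forall>\<^sub>F n in sequentially. of_real (1 / sqrt n) * (of_nat n * (u n - s / of_real (sqrt n))) + s = of_real (sqrt n) * u n"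
      using eventually_gt_at_top[of 0]
    proof eventually_elim
      case (elim n)
      have "complex_of_real (1 / sqrt n) * of_nat n = of_real (1 / sqrt n * n)" by simp
      also have "1 / sqrt n * n = sqrt n" using elim by (simp add: field_simps)
      finally have "of_real (1 / sqrt n) * (of_nat n * (u n - s / of_real (sqrt n)))
        = of_real (sqrt n) * (u n - s / of_real (sqrt n))" by (simp add: mult.assoc[symmetric])
      then show ?case using elim by (simp add: right_diff_distrib)
    qed
    from Lim_transform_eventually[OF lim ev] show ?thesis by simp
  qed
  have u_lim_0: "u \<longlonglongrightarrow> 0"
  proof -
    have lim: "(\<lambda>n. of_real (1 / sqrt n) * (of_real (sqrt n) * u n)) \<longlonglongrightarrow> of_real 0 * s"
      by (intro tendsto_mult sqrt_0 u_lim)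
    have ev: "\<forall>\<^sub>F n in sequentially. of_real (1 / sqrt n) * (of_real (sqrt n) * u n) = u n"
      using eventually_gt_at_top[of 0] by eventually_elim simp
    from Lim_transform_eventually[OF lim ev] show ?thesis by simp
  qed
  \<comment> \<open>Nodes are at most 2 and |\<zeta>| is at most 2, so the exponents have norm at
    most 4; the 1 allows for subtracting 1.\<close>
  define C :: real where "C = exp 4 + 1"
  have C: "0 < C" "1 \<le> C" by (simp_all add: C_def add_pos_pos)
  \<comment> \<open>The three errors: \<open>r1\<close> linearises in \<delta>, \<open>r2\<close>
    sets \<delta> = 0 in the squares, \<open>r3\<close> cuts the logarithm after the square. They
    must be o(sqrt n), o(n) and o(1).\<close>
  define r1 where "r1 n = (\<Sum>j\<in>?N n. exp (node (k n) j * \<zeta> n) - 1) - W0 n - \<delta> n * W1 n" for n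
  define r2 where "r2 n = (\<Sum>j\<in>?N n. (exp (node (k n) j * \<zeta> n) - 1)\<^sup>2) - W2 n" for n
  define r3 where "r3 n = (\<Sum>j\<in>?N n. - Ln (1 - b n j) - b n j - (b n j)\<^sup>2 / 2)" for n
  have k1_lim: "(\<lambda>n. (real (k n) + 1) / n) \<longlonglongrightarrow> ?K"
  proof -
    have "(\<lambda>n. real (k n) / n + 1 / n) \<longlonglongrightarrow> ?K + 0"
      by (intro tendsto_add k_div_lim) real_asymp
    then show ?thesis by (simp add: add_divide_distrib)
  qed
  have ev: "\<forall>\<^sub>F n in sequentially. norm (\<delta> n) < 1 / 2 \<and> norm (u n) < 1 / (2 * C) \<and> 0 < n"
    using C order_tendstoD(2)[OF tendsto_norm_zero[OF \<delta>_lim_0], of "1 / 2"]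
      order_tendstoD(2)[OF tendsto_norm_zero[OF u_lim_0], of "1 / (2 * C)"]
    by (intro eventually_conj eventually_gt_at_top) auto
  have e_bound: "norm (exp (node (k n) j * \<zeta> n) - 1) \<le> C" if "norm (\<delta> n) < 1 / 2" "j \<in> ?N n" for n j
  proof -
    note w = node_bounds_Suc[OF k_pos that(2)]
    have "norm (\<zeta> n) \<le> 1 + norm (\<delta> n)" using norm_triangle_ineq[of 1 "\<delta> n"] by (simp add: \<delta>_def)
    then have "norm (of_real (node (k n) j) * \<zeta> n) \<le> 2 * 2"
      unfolding norm_mult norm_of_real using w that(1) by (intro mult_mono) auto
    then have "norm (exp (node (k n) j * \<zeta> n)) \<le> exp 4"
      using norm_exp[of "node (k n) j * \<zeta> n"] order_trans[OF _ exp_le_cancel_iff[THEN iffD2]] by fastforce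
    moreover have "norm (1::complex) = 1" by simp
    ultimately show ?thesis using norm_triangle_ineq4[of "exp (node (k n) j * \<zeta> n)" 1] unfolding C_def by linarith
  qed
  have split: "exp (node (k n) j * \<zeta> n) = exp (of_real (node (k n) j)) * exp (node (k n) j * \<delta> n)" for n j
    by (simp add: \<delta>_def right_diff_distrib exp_diff)
  \<comment> \<open>The Taylor polynomials of degree 1 and 0 are written as sums so that the single
    bound \<open>exp_d\<close> serves both this identity and \<open>quad\<close>.\<close>
  have lin: "exp (of_real a) * e - 1 - of_real (exp a - 1) - d * of_real (a * exp a)
      = exp (of_real a) * (e - (\<Sum>i\<le>1. (of_real a * d) ^ i / fact i))" for a :: real and d e :: complex
    by (simp add: exp_of_real algebra_simps)
  have quad: "(exp (of_real a) * e - 1)\<^sup>2 - of_real ((exp a - 1)\<^sup>2)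
      = exp (of_real a) * (e - (\<Sum>i\<le>0. (of_real a * d) ^ i / fact i)) * ((exp (of_real a) * e - 1) + (exp (of_real a) - 1))"
      for a :: real and d e :: complex
    by (simp add: exp_of_real power2_eq_square algebra_simps)
  have exp_w: "norm (exp (complex_of_real (node (k n) j))) \<le> C" if "j \<in> ?N n" for n j
  proof -
    have "exp (node (k n) j) \<le> exp 4" using node_bounds_Suc[OF k_pos that] by simp
    then show ?thesis unfolding C_def norm_exp_eq_Re Re_complex_of_real by linarith
  qed
  have exp_d: "norm (exp (node (k n) j * \<delta> n) - (\<Sum>i\<le>m. (node (k n) j * \<delta> n) ^ i / fact i)) \<le> C * (2 * norm (\<delta> n)) ^ Suc m"
    if d: "norm (\<delta> n) < 1 / 2" and j: "j \<in> ?N n" for n j m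
  proof -
    define z where "z = node (k n) j * \<delta> n"
    have z: "norm z \<le> 2 * norm (\<delta> n)"
      unfolding z_def norm_mult norm_of_real using node_bounds_Suc[OF k_pos j] by (intro mult_right_mono) auto
    then have "\<bar>Re z\<bar> \<le> 4" using abs_Re_le_cmod[of z] d by linarith
    then have "exp \<bar>Re z\<bar> \<le> C" by (simp add: C_def add_increasing2)
    then have "exp \<bar>Re z\<bar> * norm z ^ Suc m \<le> C * (2 * norm (\<delta> n)) ^ Suc m"
      using z C by (intro mult_mono power_mono) auto
    moreover have "exp \<bar>Re z\<bar> * norm z ^ Suc m / fact m \<le> exp \<bar>Re z\<bar> * norm z ^ Suc m"
      using divide_left_mono[of 1 "fact m" "exp \<bar>Re z\<bar> * norm z ^ Suc m"] by simp
    ultimately show ?thesis using Taylor_exp[of z m] unfolding z_def by linarith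
  qed
  have r1_lim: "(\<lambda>n. of_real (1 / sqrt n) * r1 n) \<longlonglongrightarrow> 0"
  proof (rule Lim_null_comparison)
    show "\<forall>\<^sub>F n in sequentially. norm (of_real (1 / sqrt n) * r1 n)
      \<le> ((real (k n) + 1) / n) * (C * C * 4 * norm (of_real (sqrt n) * \<delta> n) ^ 2) * (1 / sqrt n)"
      using ev
    proof eventually_elim
      case (elim n)
      have r1_sum: "r1 n = (\<Sum>j\<in>?N n. exp (of_real (node (k n) j)) * (exp (node (k n) j * \<delta> n) - (\<Sum>i\<le>1. (node (k n) j * \<delta> n) ^ i / fact i)))"
        unfolding r1_def W0_def W1_def of_real_sum sum_distrib_left sum_subtractf[symmetric]
        by (intro sum.cong refl) (simp only: split lin)
      have "norm (r1 n) \<le> (\<Sum>j\<in>?N n. C * (C * (2 * norm (\<delta> n)) ^ Suc 1))"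
        unfolding r1_sum using elim C
        by (intro order_trans[OF norm_sum] sum_mono) (simp only: norm_mult, intro mult_mono exp_w exp_d, auto)
      also have "\<dots> = (real (k n) + 1) * (C * C * 4 * norm (\<delta> n) ^ 2)"
        by (simp add: power2_eq_square)
      finally have "norm (of_real (1 / sqrt n) * r1 n) \<le> (1 / sqrt n) * ((real (k n) + 1) * (C * C * 4 * norm (\<delta> n) ^ 2))"
        by (simp add: norm_mult norm_divide divide_right_mono)
      then show ?case using elim by (simp add: norm_mult power_mult_distrib)
    qed
    have "(\<lambda>n. ((real (k n) + 1) / n) * (C * C * 4 * norm (of_real (sqrt n) * \<delta> n) ^ 2) * (1 / sqrt n))
      \<longlonglongrightarrow> ?K * (C * C * 4 * norm (\<i> * y) ^ 2) * 0"
      by (intro tendsto_intros k1_lim \<delta>_lim) real_asymp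
    then show "(\<lambda>n. ((real (k n) + 1) / n) * (C * C * 4 * norm (of_real (sqrt n) * \<delta> n) ^ 2) * (1 / sqrt n)) \<longlonglongrightarrow> 0"
      by simp
  qed
  have r2_lim: "(\<lambda>n. r2 n / of_nat n) \<longlonglongrightarrow> 0"
  proof (rule Lim_null_comparison)
    show "\<forall>\<^sub>F n in sequentially. norm (r2 n / of_nat n) \<le> ((real (k n) + 1) / n) * (C * (C * (2 * norm (\<delta> n))) * (2 * C))"
      using ev
    proof eventually_elim
      case (elim n)
      have r2_sum: "r2 n = (\<Sum>j\<in>?N n. exp (of_real (node (k n) j)) * (exp (node (k n) j * \<delta> n) - (\<Sum>i\<le>0. (node (k n) j * \<delta> n) ^ i / fact i))
          * ((exp (node (k n) j * \<zeta> n) - 1) + (exp (of_real (node (k n) j)) - 1)))"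
        unfolding r2_def W2_def split of_real_sum sum_subtractf[symmetric]
        by (intro sum.cong refl) (simp only: quad)
      have "norm (r2 n) \<le> (\<Sum>j\<in>?N n. C * (C * (2 * norm (\<delta> n)) ^ Suc 0) * (2 * C))"
        unfolding r2_sum
      proof (intro order_trans[OF norm_sum] sum_mono)
        fix j assume j: "j \<in> ?N n"
        have "norm (exp (complex_of_real (node (k n) j)) - 1) \<le> C"
        proof -
          have "exp (node (k n) j) \<le> exp 4" "1 \<le> exp (node (k n) j)" using node_bounds_Suc[OF k_pos j] by auto
          moreover have "norm (exp (complex_of_real (node (k n) j)) - 1) = \<bar>exp (node (k n) j) - 1\<bar>"
            by (metis exp_of_real norm_of_real of_real_1 of_real_diff)
          ultimately show ?thesis unfolding C_def by linarith
        qed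
        then have "norm ((exp (node (k n) j * \<zeta> n) - 1) + (exp (of_real (node (k n) j)) - 1)) \<le> 2 * C"
          using e_bound[OF _ j] elim by (intro order_trans[OF norm_triangle_ineq]) auto
        then show "norm (exp (of_real (node (k n) j)) * (exp (node (k n) j * \<delta> n) - (\<Sum>i\<le>0. (node (k n) j * \<delta> n) ^ i / fact i))
          * ((exp (node (k n) j * \<zeta> n) - 1) + (exp (of_real (node (k n) j)) - 1))) \<le> C * (C * (2 * norm (\<delta> n)) ^ Suc 0) * (2 * C)"
          unfolding norm_mult using elim C j by (intro mult_mono exp_w exp_d) auto
      qed
      also have "\<dots> = (real (k n) + 1) * (C * (C * (2 * norm (\<delta> n))) * (2 * C))" by simp
      finally show ?case by (simp add: norm_divide divide_right_mono)
    qed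
    have "(\<lambda>n. ((real (k n) + 1) / n) * (C * (C * (2 * norm (\<delta> n))) * (2 * C))) \<longlonglongrightarrow> ?K * (C * (C * (2 * norm (0::complex))) * (2 * C))"
      by (intro tendsto_intros k1_lim \<delta>_lim_0)
    then show "(\<lambda>n. ((real (k n) + 1) / n) * (C * (C * (2 * norm (\<delta> n))) * (2 * C))) \<longlonglongrightarrow> 0" by simp
  qed
  have b_bound: "norm (b n j) \<le> norm (u n) * C" if "norm (\<delta> n) < 1 / 2" "j \<in> ?N n" for n j
    unfolding b_def norm_mult using e_bound[OF that] by (intro mult_left_mono) auto
  have b_half: "norm (b n j) \<le> 1 / 2" if "norm (\<delta> n) < 1 / 2" "j \<in> ?N n" "norm (u n) < 1 / (2 * C)" for n j
  proof -
    have "norm (u n) * C \<le> 1 / (2 * C) * C" using that C by (intro mult_right_mono) auto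
    also have "\<dots> = 1 / 2" using C by simp
    finally show ?thesis using b_bound[OF that(1,2)] by simp
  qed
  have r3_lim: "r3 \<longlonglongrightarrow> 0"
  proof (rule Lim_null_comparison)
    show "\<forall>\<^sub>F n in sequentially. norm (r3 n) \<le> ((real (k n) + 1) / n) * (16 * C ^ 3 * norm (of_real (sqrt n) * u n) ^ 3) * (1 / sqrt n)"
      using ev
    proof eventually_elim
      case (elim n)
      have "norm (r3 n) \<le> (\<Sum>j\<in>?N n. 16 * (norm (u n) * C) ^ 3)"
        unfolding r3_def
      proof (intro order_trans[OF norm_sum] sum_mono)
        fix j assume j: "j \<in> ?N n"
        have "norm (b n j) ^ 3 \<le> (norm (u n) * C) ^ 3"
          using b_bound[OF _ j] elim by (intro power_mono) auto
        then show "norm (- Ln (1 - b n j) - b n j - (b n j)\<^sup>2 / 2) \<le> 16 * (norm (u n) * C) ^ 3"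
          using Ln_cubic[OF b_half[OF _ j]] elim by force
      qed
      also have "\<dots> = ((real (k n) + 1) / n) * (16 * C ^ 3 * norm (of_real (sqrt n) * u n) ^ 3) * (1 / sqrt n)"
      proof -
        have "((real (k n) + 1) / n) * (16 * C ^ 3 * norm (of_real (sqrt n) * u n) ^ 3) * (1 / sqrt n)
          = ((real (k n) + 1) / n) * (16 * C ^ 3) * (norm (of_real (sqrt n) * u n) ^ 3 * (1 / sqrt n))"
          by (simp only: mult_ac)
        also have "\<dots> = (real (k n) + 1) * (16 * C ^ 3 * norm (u n) ^ 3)"
          using elim norm_sqrt_cube[of n "u n"] by simp
        finally show ?thesis by (simp add: power_mult_distrib mult_ac)
      qed
      finally show ?case .
    qed
    have "(\<lambda>n. ((real (k n) + 1) / n) * (16 * C ^ 3 * norm (of_real (sqrt n) * u n) ^ 3) * (1 / sqrt n))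
      \<longlonglongrightarrow> ?K * (16 * C ^ 3 * norm s ^ 3) * 0"
      by (intro tendsto_intros k1_lim u_lim) real_asymp
    then show "(\<lambda>n. ((real (k n) + 1) / n) * (16 * C ^ 3 * norm (of_real (sqrt n) * u n) ^ 3) * (1 / sqrt n)) \<longlonglongrightarrow> 0"
      by simp
  qed
  define Y where "Y n = s * (real (k n) - ?K / ln 2 * n) / of_real (sqrt n) + (\<Sum>j\<in>?N n. - Ln (1 - b n j))" for n
  have Y_lim: "Y \<longlonglongrightarrow> s * x / of_real (ln 2) + \<i> * s * y * of_real (?K * (2 - 1 / ln 2)) + s\<^sup>2 * of_real (?K / (4 * ln 2))"
  proof -
    define m where "m = 1 / ln 2 - (1::real)"
    define w where "w = \<i> * complex_of_real y"
    note \<delta>_lim' = \<delta>_lim[folded w_def]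
    have W0_0: "(\<lambda>n. of_real (W0 n - real (k n) * m) * u n) \<longlonglongrightarrow> 0"
      by (rule tendsto_bounded_mult[where B = "2 * ln 2 + 7"]) (use W0 u_lim_0 in \<open>simp_all only: m_def norm_of_real\<close>)
    have lim: "(\<lambda>n. s / of_real (ln 2) * of_real ((real (k n) - ?K * n) / sqrt n) + of_real (W0 n - real (k n) * m) * u n
        + (of_nat n * (u n - s / of_real (sqrt n))) * of_real (real (k n) / n) * of_real m
        + (of_real (sqrt n) * u n) * (of_real (sqrt n) * \<delta> n) * of_real (W1 n / n)
        + (of_real (sqrt n) * u n) * (of_real (1 / sqrt n) * r1 n)
        + (of_real (sqrt n) * u n)\<^sup>2 / 2 * of_real (W2 n / n)
        + (of_real (sqrt n) * u n)\<^sup>2 / 2 * (r2 n / of_nat n) + r3 n)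
      \<longlonglongrightarrow> s / of_real (ln 2) * of_real x + 0 + (s\<^sup>2 / 2) * of_real ?K * of_real m + s * w * of_real (?K * (2 - 1 / ln 2))
        + s * 0 + s\<^sup>2 / 2 * of_real (?K * (1 - 1 / (2 * ln 2))) + s\<^sup>2 / 2 * 0 + 0"
      using W1_lim W2_lim
      by (intro tendsto_add tendsto_mult tendsto_divide tendsto_power tendsto_of_real tendsto_const k_lim W0_0 u_exp k_div_lim u_lim \<delta>_lim' r1_lim r2_lim r3_lim)
         (simp_all)
    have ev_eq: "\<forall>\<^sub>F n in sequentially. s / of_real (ln 2) * of_real ((real (k n) - ?K * n) / sqrt n) + of_real (W0 n - real (k n) * m) * u n
        + (of_nat n * (u n - s / of_real (sqrt n))) * of_real (real (k n) / n) * of_real m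
        + (of_real (sqrt n) * u n) * (of_real (sqrt n) * \<delta> n) * of_real (W1 n / n)
        + (of_real (sqrt n) * u n) * (of_real (1 / sqrt n) * r1 n)
        + (of_real (sqrt n) * u n)\<^sup>2 / 2 * of_real (W2 n / n)
        + (of_real (sqrt n) * u n)\<^sup>2 / 2 * (r2 n / of_nat n) + r3 n = Y n"
      using eventually_gt_at_top[of 0]
    proof eventually_elim
      case (elim n)
      have sq: "complex_of_real (sqrt n) * of_real (sqrt n) = of_nat n"
        by (metis of_real_mult of_real_of_nat_eq real_sqrt_mult_self abs_of_nat)
      have nz: "complex_of_real (sqrt n) \<noteq> 0" "complex_of_nat n \<noteq> 0" using elim by auto
      have 1: "(\<Sum>j\<in>?N n. - Ln (1 - b n j)) = r3 n + (\<Sum>j\<in>?N n. b n j) + (\<Sum>j\<in>?N n. (b n j)\<^sup>2) / 2"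
        unfolding r3_def by (simp add: sum_subtractf sum_divide_distrib del: sum.cl_ivl_Suc)
      have 2: "(\<Sum>j\<in>?N n. b n j) = u n * (W0 n + \<delta> n * W1 n + r1 n)"
        unfolding b_def sum_distrib_left[symmetric] r1_def by (simp del: sum.cl_ivl_Suc)
      have 3: "(\<Sum>j\<in>?N n. (b n j)\<^sup>2) = (u n)\<^sup>2 * (W2 n + r2 n)"
        unfolding b_def power_mult_distrib sum_distrib_left[symmetric] r2_def by (simp del: sum.cl_ivl_Suc)
      have 4: "(of_nat n * (u n - s / of_real (sqrt n))) * of_real (real (k n) / n) * of_real m
        = u n * of_real (real (k n) * m) - s * of_real (real (k n) * m) / of_real (sqrt n)"
        using nz by (simp add: field_simps)
      have 5: "(of_real (sqrt n) * u n) * (of_real (sqrt n) * \<delta> n) * of_real (W1 n / n) = u n * \<delta> n * W1 n"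
      proof -
        have "(of_real (sqrt n) * u n) * (of_real (sqrt n) * \<delta> n) * of_real (W1 n / n)
          = (of_real (sqrt n) * of_real (sqrt n)) * (u n * \<delta> n * of_real (W1 n / n))" by (simp only: mult_ac)
        then show ?thesis unfolding sq using nz by simp
      qed
      have 6: "(of_real (sqrt n) * u n) * (of_real (1 / sqrt n) * r1 n) = u n * r1 n" using nz by simp
      have 7: "(of_real (sqrt n) * u n)\<^sup>2 / 2 * z = of_nat n * ((u n)\<^sup>2 / 2 * z)" for z
        by (simp add: power2_eq_square sq[symmetric])
      have 8: "s / of_real (ln 2) * of_real ((real (k n) - ?K * n) / sqrt n)
        = s * (real (k n) - ?K / ln 2 * n) / of_real (sqrt n) + s * of_real (real (k n) * m) / of_real (sqrt n)"
        unfolding m_def using nz by (simp add: field_simps)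
      show ?case unfolding Y_def 1 2 3 4 5 6 7 8 using nz by (simp add: algebra_simps)
    qed
    have "s / of_real (ln 2) * of_real x + 0 + (s\<^sup>2 / 2) * of_real ?K * of_real m + s * w * of_real (?K * (2 - 1 / ln 2))
        + s * 0 + s\<^sup>2 / 2 * of_real (?K * (1 - 1 / (2 * ln 2))) + s\<^sup>2 / 2 * 0 + 0
      = s * x / of_real (ln 2) + \<i> * s * y * of_real (?K * (2 - 1 / ln 2)) + s\<^sup>2 / 2 * (?K * of_real (m + 1 - 1 / (2 * ln 2)))"
      by (simp add: w_def algebra_simps)
    also have "m + 1 - 1 / (2 * ln 2) = 1 / (2 * ln 2)" by (simp add: m_def field_simps)
    also have "s\<^sup>2 / 2 * of_real (?K * of_real (1 / (2 * ln 2))) = s\<^sup>2 * complex_of_real (?K / (4 * ln 2))" by simp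
    finally have lim_eq: "s / of_real (ln 2) * of_real x + 0 + (s\<^sup>2 / 2) * of_real ?K * of_real m + s * w * of_real (?K * (2 - 1 / ln 2))
        + s * 0 + s\<^sup>2 / 2 * of_real (?K * (1 - 1 / (2 * ln 2))) + s\<^sup>2 / 2 * 0 + 0
      = s * x / of_real (ln 2) + \<i> * s * y * of_real (?K * (2 - 1 / ln 2)) + s\<^sup>2 * of_real (?K / (4 * ln 2))" .
    show ?thesis using Lim_transform_eventually[OF lim ev_eq] unfolding lim_eq .
  qed
  have "\<forall>\<^sub>F n in sequentially. exp (Y n) = exp (s * (real (k n) - ?K / ln 2 * n) / of_real (sqrt n))
      * (\<Prod>j\<in>?N n. inverse (1 - b n j))"
    using ev
  proof eventually_elim
    case (elim n)
    have nz: "1 - b n j \<noteq> 0" if "j \<in> ?N n" for j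
      using b_half[OF _ that] elim by auto
    have "exp (\<Sum>j\<in>?N n. - Ln (1 - b n j)) = (\<Prod>j\<in>?N n. inverse (1 - b n j))"
      unfolding exp_sum[OF finite_atLeastAtMost] using nz by (intro prod.cong refl) (simp add: exp_minus)
    then show ?case by (simp add: Y_def exp_add)
  qed
  from Lim_transform_eventually[OF tendsto_exp[OF Y_lim] this]
  show ?thesis unfolding b_def .
qed

end

section \<open>Gaussian bounds\<close>

lemma norm_sinh_le:
  fixes z :: complex
  shows "norm (sinh z) \<le> sinh (norm z)"
proof (rule norm_sums_le)
  show "(\<lambda>n. if even n then 0 else z ^ n /\<^sub>R fact n) sums sinh z" by (rule sinh_converges)
  show "(\<lambda>n. if even n then 0 else norm z ^ n /\<^sub>R fact n) sums sinh (norm z)" by (rule sinh_converges)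
qed (simp add: norm_power)

text \<open>In exp z - 1 = 2 exp (z / 2) sinh (z / 2), the sinh is largest on the positive axis
  since its coefficients are nonnegative. The gain exp ((Re z - |z|) / 2) is the source of the
  Gaussian decay in the angle.\<close>

lemma norm_exp_minus_one_le:
  fixes z :: complex
  shows "norm (exp z - 1) \<le> exp ((Re z - norm z) / 2) * (exp (norm z) - 1)"
proof -
  have 1: "exp z - 1 = exp (z / 2) * (2 * sinh (z / 2))"
  proof -
    have "2 * sinh (z / 2) = exp (z / 2) - exp (- (z / 2))"
      by (simp add: sinh_def scaleR_conv_of_real)
    moreover have "exp (z / 2) * exp (z / 2) = exp z" by (simp add: mult_exp_exp)
    moreover have "exp (z / 2) * exp (- (z / 2)) = 1" by (simp add: mult_exp_exp)
    ultimately show ?thesis by (simp add: right_diff_distrib)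
  qed
  have 2: "exp (norm z) - 1 = exp (norm z / 2) * (2 * sinh (norm z / 2))"
  proof -
    have "2 * sinh (norm z / 2) = exp (norm z / 2) - exp (- (norm z / 2))"
      by (simp add: sinh_def)
    moreover have "exp (norm z / 2) * exp (norm z / 2) = exp (norm z)" by (simp add: mult_exp_exp)
    moreover have "exp (norm z / 2) * exp (- (norm z / 2)) = 1" by (simp add: mult_exp_exp)
    ultimately show ?thesis by (simp add: right_diff_distrib)
  qed
  have "norm (exp z - 1) \<le> exp (Re z / 2) * (2 * sinh (norm z / 2))"
    unfolding 1 norm_mult using norm_sinh_le[of "z / 2"] by (simp add: norm_exp_eq_Re norm_divide)
  also have "\<dots> = exp ((Re z - norm z) / 2) * (exp (norm z / 2) * (2 * sinh (norm z / 2)))"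
    unfolding mult.assoc[symmetric] by (simp add: mult_exp_exp field_simps)
  finally show ?thesis unfolding 2 .
qed

text \<open>Allows a modulus 1 + d slightly above 1. With d = O(1/k) the extra factor stays bounded
  when k of them are multiplied.\<close>

lemma exp_scaled_minus_one_le:
  fixes w d :: real
  assumes w: "0 < w" and d: "0 \<le> d"
  shows "exp (w * (1 + d)) - 1 \<le> (1 + d) * exp (w * d) * (exp w - 1)"
proof -
  have "exp (w * d) * (1 + w * (- d)) \<le> exp (w * d) * exp (- (w * d))"
    using exp_ge_add_one_self[of "- (w * d)"] by (intro mult_left_mono) auto
  then have "exp (w * d) - w * d * exp (w * d) \<le> 1"
    by (simp add: mult_exp_exp algebra_simps)
  moreover have "w * d * exp (w * d) \<le> (exp w - 1) * d * exp (w * d)"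
  proof -
    have "w \<le> exp w - 1" using exp_ge_add_one_self[of w] by linarith
    then show ?thesis using d by (intro mult_right_mono) auto
  qed
  moreover have "exp (w * (1 + d)) = exp w * exp (w * d)" by (simp add: distrib_left exp_add)
  ultimately show ?thesis by (simp add: algebra_simps)
qed

text \<open>For x = |t| / 2 \<le> 2 the bound x - x^3 / 6 \<le> sin x gives x / 3 \<le> sin x, and 1
  - cos t = 2 (sin x)^2 yields 2 (|t| / 6)^2.\<close>

lemma one_minus_cos_ge:
  assumes "\<bar>t\<bar> \<le> pi"
  shows "t\<^sup>2 / 18 \<le> 1 - cos t"
proof -
  define x where "x = \<bar>t\<bar> / 2"
  have x: "0 \<le> x" "x \<le> 2" using assms pi_less_4 by (auto simp: x_def)
  have "x - x ^ 3 / 6 \<le> sin x"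
  proof -
    have "(\<Sum>m<3. sin_coeff m * x ^ m) = x" by (simp add: sin_coeff_def eval_nat_numeral)
    moreover have "inverse (fact 3) * \<bar>x\<bar> ^ 3 = x ^ 3 / 6" using x by (simp add: fact_numeral)
    ultimately show "x - x ^ 3 / 6 \<le> sin x"
      using Maclaurin_sin_bound[of x 3] by linarith
  qed
  moreover have "x ^ 3 \<le> 4 * x"
  proof -
    have "x * x \<le> 2 * 2" using x by (intro mult_mono) auto
    then have "x * (x * x) \<le> x * 4" using x by (intro mult_left_mono) auto
    then show ?thesis by (simp add: power3_eq_cube)
  qed
  ultimately have "x / 3 \<le> sin x" using x by linarith
  then have "(x / 3)\<^sup>2 \<le> (sin x)\<^sup>2" using x by (intro power_mono) auto
  moreover have "cos t = 1 - 2 * (sin x)\<^sup>2"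
  proof -
    have "cos t = cos (2 * x)" by (simp add: x_def)
    also have "\<dots> = 1 - 2 * (sin x)\<^sup>2" by (rule cos_double_sin)
    finally show ?thesis .
  qed
  ultimately show ?thesis by (simp add: x_def power_divide)
qed

lemma sum_node: "0 < k \<Longrightarrow> (\<Sum>j=1..k. node k j) = ln 2 * (real k + 1) / 2"
proof -
  assume k: "0 < k"
  have S: "(\<Sum>j=1..k. real j) = real k * (real k + 1) / 2"
    by (induction k) (auto simp: field_simps)
  show "(\<Sum>j=1..k. node k j) = ln 2 * (real k + 1) / 2"
    unfolding sum_distrib_right[symmetric] S using k by simp
qed

text \<open>Each factor gains exp (w (cos t - 1) / 2), and the nodes w sum to ln 2 (k + 1) / 2.
  After squaring, the exponent falls by at least (k ln 2 / 2) (t^2 / 18), hence the 36. The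
  deviation d = |r| \<le> R / k costs at most 6 d k in the exponent.\<close>

lemma phase_bound:
  assumes k: "0 < k" and t: "\<bar>t\<bar> \<le> pi" and r: "norm r \<le> R / k" "norm r \<le> 1"
  shows "norm ((\<Prod>j=1..k. (exp (node k j * (cis t * (1 + r))) - 1) / (exp (complex_of_real (node k j)) - 1))\<^sup>2)
    \<le> exp (6 * R) * exp (- (ln 2 / 36 * k * t\<^sup>2))"
proof -
  define d where "d = norm r"
  have d: "0 \<le> d" "d \<le> R / k" "d \<le> 1" using r by (auto simp: d_def)
  define \<zeta> where "\<zeta> = cis t * (1 + r)"
  have z: "norm \<zeta> \<le> 1 + d" "1 - d \<le> norm \<zeta>" "Re \<zeta> \<le> cos t + d"
  proof -
    have e: "\<zeta> = cis t + cis t * r" by (simp add: \<zeta>_def algebra_simps)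
    have n: "norm (cis t * r) = d" by (simp add: norm_mult d_def)
    show "norm \<zeta> \<le> 1 + d" unfolding e using norm_triangle_ineq[of "cis t" "cis t * r"] n by simp
    show "1 - d \<le> norm \<zeta>" unfolding e using norm_triangle_ineq2[of "cis t" "- (cis t * r)"] n by simp
    show "Re \<zeta> \<le> cos t + d" unfolding e using complex_Re_le_cmod[of "cis t * r"] n by simp
  qed
  have factor: "norm ((exp (node k j * \<zeta>) - 1) / (exp (complex_of_real (node k j)) - 1))
     \<le> exp (node k j * (cos t - 1 + 2 * d) / 2 + 2 * d)" if j: "j \<in> {1..k}" for j
  proof -
    define w where "w = node k j"
    have w: "0 < w" "w \<le> 1" using node_bounds[OF j] ln_2_less_1 by (auto simp: w_def)
    have nz: "norm (of_real w * \<zeta>) = w * norm \<zeta>" using w by (simp add: norm_mult)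
    have re: "Re (of_real w * \<zeta>) = w * Re \<zeta>" by simp
    have "norm (exp (of_real w * \<zeta>) - 1) \<le> exp ((w * Re \<zeta> - w * norm \<zeta>) / 2) * (exp (w * norm \<zeta>) - 1)"
      using norm_exp_minus_one_le[of "of_real w * \<zeta>"] unfolding nz re .
    also have "\<dots> \<le> exp (w * (cos t - 1 + 2 * d) / 2) * ((1 + d) * exp (w * d) * (exp w - 1))"
    proof (rule mult_mono)
      have "w * (Re \<zeta> - norm \<zeta>) \<le> w * (cos t - 1 + 2 * d)"
        using z w by (intro mult_left_mono) auto
      then show "exp ((w * Re \<zeta> - w * norm \<zeta>) / 2) \<le> exp (w * (cos t - 1 + 2 * d) / 2)"
        by (simp add: right_diff_distrib)
      have "exp (w * norm \<zeta>) \<le> exp (w * (1 + d))" using z w by simp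
      then show "exp (w * norm \<zeta>) - 1 \<le> (1 + d) * exp (w * d) * (exp w - 1)"
        using exp_scaled_minus_one_le[OF w(1) d(1)] by linarith
    qed (use w in auto)
    also have "\<dots> \<le> exp (w * (cos t - 1 + 2 * d) / 2) * (exp (2 * d) * (exp w - 1))"
    proof (intro mult_left_mono mult_right_mono)
      have "(1 + d) * exp (w * d) \<le> exp d * exp (1 * d)"
        using w d by (intro mult_mono exp_ge_add_one_self exp_le_cancel_iff[THEN iffD2] mult_right_mono) auto
      then show "(1 + d) * exp (w * d) \<le> exp (2 * d)" by (simp add: mult_exp_exp)
    qed (use w in auto)
    finally have "norm (exp (of_real w * \<zeta>) - 1) \<le> exp (w * (cos t - 1 + 2 * d) / 2 + 2 * d) * (exp w - 1)"
      by (simp add: exp_add mult.assoc)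
    moreover have "norm (exp (complex_of_real w) - 1) = exp w - 1"
    proof -
      have "exp (complex_of_real w) - 1 = of_real (exp w - 1)" by (simp add: exp_of_real)
      moreover have "0 \<le> exp w - 1" using w by simp
      ultimately show ?thesis by (simp only: norm_of_real abs_of_nonneg)
    qed
    ultimately show ?thesis
      unfolding norm_divide w_def[symmetric] using w by (simp add: divide_le_eq)
  qed
  have "norm (\<Prod>j=1..k. (exp (node k j * \<zeta>) - 1) / (exp (complex_of_real (node k j)) - 1))
    \<le> (\<Prod>j=1..k. exp (node k j * (cos t - 1 + 2 * d) / 2 + 2 * d))"
    unfolding prod_norm[symmetric] by (intro prod_mono conjI norm_ge_zero factor)
  also have "\<dots> = exp (ln 2 * (real k + 1) / 2 * (cos t - 1 + 2 * d) / 2 + 2 * d * k)"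
  proof -
    have "(\<Sum>j=1..k. node k j * (cos t - 1 + 2 * d) / 2) = (\<Sum>j=1..k. node k j) * (cos t - 1 + 2 * d) / 2"
      by (simp only: sum_distrib_right sum_divide_distrib)
    then show ?thesis
      unfolding exp_sum[OF finite_atLeastAtMost, symmetric] sum.distrib by (simp only: sum_node[OF k]) simp
  qed
  finally have "norm ((\<Prod>j=1..k. (exp (node k j * \<zeta>) - 1) / (exp (complex_of_real (node k j)) - 1))\<^sup>2)
    \<le> (exp (ln 2 * (real k + 1) / 2 * (cos t - 1 + 2 * d) / 2 + 2 * d * k))\<^sup>2"
    unfolding norm_power by (intro power_mono norm_ge_zero)
  also have "\<dots> = exp (ln 2 * (real k + 1) / 2 * (cos t - 1 + 2 * d) + 4 * d * k)"
    unfolding power2_eq_square mult_exp_exp by (simp add: field_simps)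
  also have "\<dots> \<le> exp (6 * R - ln 2 / 36 * k * t\<^sup>2)"
  proof -
    have dk: "d * k \<le> R" using d k by (simp add: field_simps)
    have c: "t\<^sup>2 / 18 \<le> 1 - cos t" by (rule one_minus_cos_ge[OF t])
    have "ln 2 * k / 2 * (t\<^sup>2 / 18) \<le> ln 2 * (real k + 1) / 2 * (1 - cos t)"
      using c by (intro mult_mono) (auto intro: divide_right_mono)
    moreover have "ln 2 * ((real k + 1) * d) \<le> 1 * (2 * (d * k))"
    proof (rule mult_mono)
      have "d \<le> d * k" using d k by (simp add: mult_le_cancel_left1)
      then show "(real k + 1) * d \<le> 2 * (d * k)" by (simp add: algebra_simps)
    qed (use d ln_2_less_1 in auto)
    moreover have "ln 2 * (real k + 1) / 2 * (cos t - 1 + 2 * d)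
        = - (ln 2 * (real k + 1) / 2 * (1 - cos t)) + ln 2 * ((real k + 1) * d)"
      by (simp add: field_simps)
    moreover have "ln 2 * k / 2 * (t\<^sup>2 / 18) = ln 2 / 36 * k * t\<^sup>2" by simp
    ultimately have "ln 2 * (real k + 1) / 2 * (cos t - 1 + 2 * d) + 4 * d * k \<le> 6 * (d * k) - ln 2 / 36 * k * t\<^sup>2"
      by linarith
    then show ?thesis unfolding exp_le_cancel_iff using dk by linarith
  qed
  also have "\<dots> = exp (6 * R) * exp (- (ln 2 / 36 * k * t\<^sup>2))" by (simp add: mult_exp_exp)
  finally show ?thesis unfolding \<zeta>_def .
qed

text \<open>The first order is kept exactly as \<open>Re b\<close>: the sum of the b is of order
  sqrt n and must cancel against the centring, whereas the squares sum to O(1). The 9 covers 1/2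
  from the square and 8 from the cubic remainder.\<close>

lemma norm_inverse_one_minus_le:
  fixes b :: complex
  assumes "norm b \<le> 1 / 2"
  shows "norm (inverse (1 - b)) \<le> exp (Re b + 9 * (norm b)\<^sup>2)"
proof -
  have nz: "1 - b \<noteq> 0" using assms by auto
  define e where "e = - Ln (1 - b) - b - b\<^sup>2 / 2"
  have "norm e \<le> 16 * norm b ^ 3" unfolding e_def by (rule Ln_cubic[OF assms])
  also have "\<dots> \<le> 8 * (norm b)\<^sup>2"
  proof -
    have "(norm b)\<^sup>2 * norm b \<le> (norm b)\<^sup>2 * (1 / 2)" using assms by (intro mult_left_mono) auto
    then show ?thesis by (simp add: power3_eq_cube power2_eq_square)
  qed
  finally have e: "norm e \<le> 8 * (norm b)\<^sup>2" .
  have "Re (- Ln (1 - b)) = Re b + Re (b\<^sup>2 / 2 + e)" by (simp add: e_def)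
  also have "Re (b\<^sup>2 / 2 + e) \<le> norm (b\<^sup>2 / 2 + e)" by (rule complex_Re_le_cmod)
  also have "\<dots> \<le> norm (b\<^sup>2 / 2) + norm e" by (rule norm_triangle_ineq)
  also have "norm (b\<^sup>2 / 2) = (norm b)\<^sup>2 / 2" by (simp add: norm_power norm_divide)
  also have "(norm b)\<^sup>2 / 2 + norm e \<le> 9 * (norm b)\<^sup>2" using e zero_le_power2[of "norm b"] by linarith
  finally have "Re (- Ln (1 - b)) \<le> Re b + 9 * (norm b)\<^sup>2" by simp
  moreover have "inverse (1 - b) = exp (- Ln (1 - b))" using nz by (simp add: exp_minus)
  ultimately show ?thesis by (simp only: norm_exp_eq_Re exp_le_cancel_iff)
qed

lemma norm_cis_minus_one_le: "norm (cis t - 1) \<le> \<bar>t\<bar>"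
  using iexp_approx1[of t 0] by (simp add: cis_conv_exp)

lemma norm_exp_scaled_le:
  fixes s :: complex and n :: nat
  assumes "0 < n"
  shows "norm (exp (s / of_real (sqrt n)) - 1) \<le> norm s * exp (norm s) / sqrt n"
    and "norm (exp (s / of_real (sqrt n)) - 1 - s / of_real (sqrt n)) \<le> (norm s)\<^sup>2 * exp (norm s) / n"
proof -
  define z where "z = s / complex_of_real (sqrt n)"
  have nz: "norm z = norm s / sqrt n" by (simp add: z_def norm_divide)
  have "norm z \<le> norm s" unfolding nz using assms by (simp add: divide_le_eq mult_le_cancel_left1)
  then have re: "exp \<bar>Re z\<bar> \<le> exp (norm s)" using abs_Re_le_cmod[of z] by simp
  have "norm (exp z - 1) \<le> exp \<bar>Re z\<bar> * norm z" using Taylor_exp[of z 0] by simp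
  also have "\<dots> \<le> exp (norm s) * norm z" using re by (intro mult_right_mono) auto
  finally show "norm (exp (s / of_real (sqrt n)) - 1) \<le> norm s * exp (norm s) / sqrt n"
    unfolding z_def[symmetric] nz by (simp add: mult.commute)
  have "norm (exp z - 1 - z) \<le> exp \<bar>Re z\<bar> * (norm z)\<^sup>2"
    using Taylor_exp[of z 1] by (simp add: power2_eq_square diff_diff_eq)
  also have "\<dots> \<le> exp (norm s) * (norm z)\<^sup>2" using re by (intro mult_right_mono) auto
  also have "(norm z)\<^sup>2 = (norm s)\<^sup>2 / n" unfolding nz by (simp add: power_divide)
  finally show "norm (exp (s / of_real (sqrt n)) - 1 - s / of_real (sqrt n)) \<le> (norm s)\<^sup>2 * exp (norm s) / n"
    unfolding z_def[symmetric] by (simp add: mult.commute)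
qed

text \<open>The dominating counterpart of \<open>weight_limit\<close>: only the part s k m / sqrt n
  of the sum of the b, with m = 1 / ln 2 - 1, is large, and with the centring it becomes s / ln 2
  times the rescaled index. All else is bounded or of order sqrt n |t|, so the exponent is linear in
  the rescaled variables and loses to the Gaussian decay of the other factors.\<close>

lemma weight_bound:
  fixes s :: complex and R :: real
  assumes R: "0 \<le> R"
  shows "\<exists>A B (N::nat). 0 \<le> A \<and> 0 \<le> B \<and> (\<forall>n\<ge>N. \<forall>k t r. 0 < k \<longrightarrow> k \<le> n \<longrightarrow> norm r \<le> R * \<bar>t\<bar> \<longrightarrow> norm r \<le> 1 \<longrightarrow>
    norm (exp (s * (real k - fb_kappa / ln 2 * n) / of_real (sqrt n))
      * (\<Prod>j=1..k + 1. inverse (1 - (exp (s / of_real (sqrt n)) - 1) * (exp (node k j * (cis t * (1 + r))) - 1))))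
    \<le> exp (A + B * (\<bar>real k - fb_kappa * n\<bar> / sqrt n) + B * (sqrt n * \<bar>t\<bar>)))"
proof -
  define C :: real where "C = exp 4 + 1"
  \<comment> \<open>exp 2 bounds the exponential of a node and exp 6 that of a node times \<delta>,
    as |\<delta>| \<le> 3; the 2 bounds the node itself.\<close>
  define C1 :: real where "C1 = 2 * exp 8"
  define U where "U = norm s * exp (norm s)"
  define U2 where "U2 = (norm s)\<^sup>2 * exp (norm s)"
  define m where "m = 1 / ln 2 - (1::real)"
  have C: "1 \<le> C" by (simp add: C_def)
  have nonneg: "0 \<le> U" "0 \<le> U2" "0 \<le> C1" by (simp_all add: U_def U2_def C1_def)
  have m: "0 \<le> m" using ln_2_less_1 by (simp add: m_def field_simps)
  \<comment> \<open>The summands come from u - s / sqrt n, from the bounded error of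
    \<open>W0\<close> (2 ln 2 + 7 \<le> 9), and from the squares of the b, at most 2 (U C)^2 in
    total.\<close>
  define A where "A = U2 * m + 9 * U + 18 * (U * C)\<^sup>2"
  define B where "B = norm s / ln 2 + 2 * U * C1 * (1 + R)"
  have "\<forall>\<^sub>F n in sequentially. U * C / sqrt (real n) < 1 / 2"
  proof (rule order_tendstoD)
    show "(\<lambda>n. U * C / sqrt (real n)) \<longlonglongrightarrow> 0" by real_asymp
  qed simp
  then have "\<forall>\<^sub>F n in sequentially. 0 < n \<and> U * C / sqrt (real n) < 1 / 2"
    by (intro eventually_conj eventually_gt_at_top)
  then obtain N where N: "\<And>n. n \<ge> N \<Longrightarrow> 0 < n \<and> U * C / sqrt (real n) < 1 / 2"
    by (auto simp: eventually_sequentially)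
  have main: "norm (exp (s * (real k - fb_kappa / ln 2 * n) / of_real (sqrt n))
      * (\<Prod>j=1..k + 1. inverse (1 - (exp (s / of_real (sqrt n)) - 1) * (exp (node k j * (cis t * (1 + r))) - 1))))
    \<le> exp (A + B * (\<bar>real k - fb_kappa * n\<bar> / sqrt n) + B * (sqrt n * \<bar>t\<bar>))"
    if n: "n \<ge> N" and k: "0 < k" "k \<le> n" and r: "norm r \<le> R * \<bar>t\<bar>" "norm r \<le> 1" for n k t and r :: complex
  proof -
    define u where "u = exp (s / of_real (sqrt n)) - 1"
    define \<zeta> where "\<zeta> = cis t * (1 + r)"
    define \<delta> where "\<delta> = \<zeta> - 1"
    define b where "b j = u * (exp (node k j * \<zeta>) - 1)" for j
    have n0: "0 < n" "U * C / sqrt n < 1 / 2" using N[OF n] by auto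
    have u: "norm u \<le> U / sqrt n" "norm (u - s / of_real (sqrt n)) \<le> U2 / n"
      using norm_exp_scaled_le[OF n0(1), of s] unfolding u_def U_def U2_def by auto
    have \<zeta>: "norm \<zeta> \<le> 2"
      unfolding \<zeta>_def norm_mult using norm_triangle_ineq[of 1 r] r(2) by simp
    have \<delta>: "norm \<delta> \<le> (1 + R) * \<bar>t\<bar>" "norm \<delta> \<le> 3"
    proof -
      have "\<delta> = (cis t - 1) + cis t * r" by (simp add: \<delta>_def \<zeta>_def algebra_simps)
      then have "norm \<delta> \<le> norm (cis t - 1) + norm (cis t * r)" using norm_triangle_ineq by metis
      then show "norm \<delta> \<le> (1 + R) * \<bar>t\<bar>"
        using norm_cis_minus_one_le[of t] r(1) by (simp add: norm_mult algebra_simps)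
      show "norm \<delta> \<le> 3" unfolding \<delta>_def using norm_triangle_ineq4[of \<zeta> 1] \<zeta> by simp
    qed
    have e_bound: "norm (exp (node k j * \<zeta>) - 1) \<le> C" if j: "j \<in> {1..k+1}" for j
    proof -
      have "norm (of_real (node k j) * \<zeta>) \<le> 2 * 2"
        unfolding norm_mult norm_of_real using node_bounds_Suc[OF k(1) j] \<zeta> by (intro mult_mono) auto
      then have "exp (norm (of_real (node k j) * \<zeta>)) \<le> exp 4" by simp
      then have "norm (exp (of_real (node k j) * \<zeta>)) \<le> exp 4"
        using norm_exp[of "of_real (node k j) * \<zeta>"] by linarith
      moreover have "norm (1::complex) = 1" by simp
      ultimately show ?thesis using norm_triangle_ineq4[of "exp (node k j * \<zeta>)" 1] unfolding C_def by linarith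
    qed
    have d_bound: "norm (exp (node k j * \<zeta>) - exp (of_real (node k j))) \<le> C1 * norm \<delta>" if j: "j \<in> {1..k+1}" for j
    proof -
      define z where "z = of_real (node k j) * \<delta>"
      have z: "norm z \<le> 2 * norm \<delta>"
        unfolding z_def norm_mult norm_of_real using node_bounds_Suc[OF k(1) j] by (intro mult_right_mono) auto
      then have "\<bar>Re z\<bar> \<le> 6" using abs_Re_le_cmod[of z] \<delta>(2) by linarith
      then have "exp \<bar>Re z\<bar> * norm z \<le> exp 6 * (2 * norm \<delta>)"
        using z by (intro mult_mono) auto
      then have "norm (exp z - 1) \<le> exp 6 * (2 * norm \<delta>)" using Taylor_exp[of z 0] by simp
      moreover have "norm (exp (complex_of_real (node k j))) \<le> exp 2"
        using node_bounds_Suc[OF k(1) j] unfolding norm_exp_eq_Re Re_complex_of_real by simp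
      ultimately have "norm (exp (complex_of_real (node k j)) * (exp z - 1)) \<le> exp 2 * (exp 6 * (2 * norm \<delta>))"
        unfolding norm_mult by (intro mult_mono) auto
      moreover have "exp (complex_of_real (node k j)) * (exp z - 1) = exp (node k j * \<zeta>) - exp (of_real (node k j))"
        unfolding z_def \<delta>_def right_diff_distrib mult_exp_exp by simp
      ultimately show ?thesis by (simp add: C1_def mult_exp_exp mult.assoc[symmetric])
    qed
    have b: "norm (b j) \<le> U * C / sqrt n" if j: "j \<in> {1..k+1}" for j
    proof -
      have "norm (b j) \<le> (U / sqrt n) * C"
        unfolding b_def norm_mult using u e_bound[OF j] C nonneg by (intro mult_mono) auto
      then show ?thesis by simp
    qed
    have "norm (\<Prod>j=1..k+1. inverse (1 - b j)) \<le> (\<Prod>j=1..k+1. exp (Re (b j) + 9 * (norm (b j))\<^sup>2))"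
      unfolding prod_norm[symmetric]
    proof (intro prod_mono conjI norm_ge_zero norm_inverse_one_minus_le)
      fix j assume "j \<in> {1..k+1}"
      from b[OF this] show "norm (b j) \<le> 1 / 2" using n0(2) by linarith
    qed
    also have "\<dots> = exp (Re (\<Sum>j=1..k+1. b j) + 9 * (\<Sum>j=1..k+1. (norm (b j))\<^sup>2))"
      unfolding exp_sum[OF finite_atLeastAtMost, symmetric] Re_sum sum_distrib_left sum.distrib ..
    finally have P: "norm (\<Prod>j=1..k+1. inverse (1 - b j)) \<le> exp (Re (\<Sum>j=1..k+1. b j) + 9 * (\<Sum>j=1..k+1. (norm (b j))\<^sup>2))" .
    have kn: "real k + 1 \<le> 2 * n" using k n0 by linarith
    have sq: "(\<Sum>j=1..k+1. (norm (b j))\<^sup>2) \<le> 2 * (U * C)\<^sup>2"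
    proof -
      have "(\<Sum>j=1..k+1. (norm (b j))\<^sup>2) \<le> (\<Sum>j=1..k+1. (U * C / sqrt n)\<^sup>2)"
        by (intro sum_mono power_mono b) auto
      also have "\<dots> = (real k + 1) * ((U * C)\<^sup>2 / n)" by (simp add: power_divide)
      also have "\<dots> \<le> (2 * n) * ((U * C)\<^sup>2 / n)" using kn by (intro mult_right_mono) auto
      finally show ?thesis using n0 by simp
    qed
    define W0 where "W0 = (\<Sum>j=1..k+1. exp (node k j) - 1)"
    have W0: "\<bar>W0 - real k * m\<bar> \<le> 9"
    proof -
      have "\<bar>W0 - real k * (1 / ln 2 - 1)\<bar> \<le> 2 * ln 2 + 7"
        unfolding W0_def by (rule extend_sum_bound[OF sum_exp_node[OF k(1)]])
          (use exp_node_last_le[OF k(1)] exp_gt_zero[of "node k (k + 1)"] in linarith)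
      then show ?thesis using ln_2_less_1 unfolding m_def by linarith
    qed
    define D where "D = (\<Sum>j=1..k+1. exp (node k j * \<zeta>) - exp (of_real (node k j)))"
    have D: "norm D \<le> 2 * n * (C1 * ((1 + R) * \<bar>t\<bar>))"
    proof -
      have "norm D \<le> (\<Sum>j=1..k+1. C1 * norm \<delta>)"
        unfolding D_def by (intro order_trans[OF norm_sum] sum_mono d_bound)
      also have "\<dots> = (real k + 1) * (C1 * norm \<delta>)" by simp
      also have "\<dots> \<le> 2 * n * (C1 * ((1 + R) * \<bar>t\<bar>))"
        using kn \<delta> nonneg by (intro mult_mono) auto
      finally show ?thesis .
    qed
    have split: "e - 1 = of_real (exp a - 1) + (e - exp (of_real a))" for a :: real and e :: complex
      by (simp add: exp_of_real)
    have sum_b: "(\<Sum>j=1..k+1. b j) = s * of_real (real k * m) / of_real (sqrt n)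
       + ((u - s / of_real (sqrt n)) * of_real (real k * m) + u * of_real (W0 - real k * m) + u * D)"
    proof -
      have "(\<Sum>j=1..k+1. b j) = u * (of_real W0 + D)"
        unfolding b_def sum_distrib_left[symmetric] W0_def D_def of_real_sum sum.distrib[symmetric]
        by (intro arg_cong2[of _ _ _ _ "(*)"] sum.cong refl) (simp only: split)
      then show ?thesis by (simp add: algebra_simps)
    qed
    have err: "norm ((u - s / of_real (sqrt n)) * of_real (real k * m) + u * of_real (W0 - real k * m) + u * D)
      \<le> U2 * m + 9 * U + 2 * U * C1 * (1 + R) * (sqrt n * \<bar>t\<bar>)"
    proof -
      have "norm ((u - s / of_real (sqrt n)) * of_real (real k * m)) \<le> (U2 / n) * (n * m)"
        unfolding norm_mult norm_of_real abs_mult using u k m nonneg by (intro mult_mono) auto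
      moreover have "(U2 / n) * (n * m) = U2 * m" using n0 by simp
      moreover have "norm (u * of_real (W0 - real k * m)) \<le> U * 9"
        unfolding norm_mult norm_of_real
      proof (rule mult_mono[OF _ W0])
        have "U / sqrt n \<le> U / 1" using n0 nonneg by (intro divide_left_mono) auto
        then show "norm u \<le> U" using u(1) by simp
      qed (use nonneg in auto)
      moreover have "norm (u * D) \<le> (U / sqrt n) * (2 * n * (C1 * ((1 + R) * \<bar>t\<bar>)))"
        unfolding norm_mult using u D nonneg by (intro mult_mono) auto
      moreover have "(U / sqrt n) * (2 * n * (C1 * ((1 + R) * \<bar>t\<bar>))) = 2 * U * C1 * (1 + R) * (sqrt n * \<bar>t\<bar>)"
      proof -
        have "real n / sqrt n = sqrt n" using n0 by (simp add: real_div_sqrt)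
        moreover have "(U / sqrt n) * (2 * n * (C1 * ((1 + R) * \<bar>t\<bar>))) = 2 * U * C1 * (1 + R) * ((real n / sqrt n) * \<bar>t\<bar>)"
          by simp
        ultimately show ?thesis by (simp only:)
      qed
      ultimately show ?thesis
        using norm_triangle_ineq[of "(u - s / of_real (sqrt n)) * of_real (real k * m) + u * of_real (W0 - real k * m)" "u * D"]
          norm_triangle_ineq[of "(u - s / of_real (sqrt n)) * of_real (real k * m)" "u * of_real (W0 - real k * m)"] by linarith
    qed
    define x where "x = (real k - fb_kappa * n) / sqrt n"
    \<comment> \<open>Exact cancellation: 1 + m = 1 / ln 2, so k + k m - (fb_kappa / ln 2) n is (k -
      fb_kappa n) / ln 2.\<close>
    have main: "s * (real k - fb_kappa / ln 2 * n) / of_real (sqrt n) + s * of_real (real k * m) / of_real (sqrt n) = s * of_real (x / ln 2)"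
    proof -
      have "real k - fb_kappa / ln 2 * n + real k * m = (real k - fb_kappa * n) / ln 2"
        by (simp add: m_def field_simps)
      then have "(real k - fb_kappa / ln 2 * n) / sqrt n + real k * m / sqrt n = x / ln 2"
        unfolding x_def add_divide_distrib[symmetric] by simp
      then have "complex_of_real (x / ln 2) = of_real (real k - fb_kappa / ln 2 * n) / of_real (sqrt n) + of_real (real k * m) / of_real (sqrt n)"
        by (metis of_real_add of_real_divide)
      then show ?thesis by (simp only: distrib_left times_divide_eq_right)
    qed
    have "norm (exp (s * (real k - fb_kappa / ln 2 * n) / of_real (sqrt n)) * (\<Prod>j=1..k+1. inverse (1 - b j)))
      \<le> exp (Re (s * (real k - fb_kappa / ln 2 * n) / of_real (sqrt n))) * exp (Re (\<Sum>j=1..k+1. b j) + 9 * (\<Sum>j=1..k+1. (norm (b j))\<^sup>2))"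
      unfolding norm_mult norm_exp_eq_Re by (intro mult_left_mono P) auto
    also have "\<dots> = exp (Re (s * of_real (x / ln 2)) + Re ((u - s / of_real (sqrt n)) * of_real (real k * m) + u * of_real (W0 - real k * m) + u * D)
       + 9 * (\<Sum>j=1..k+1. (norm (b j))\<^sup>2))"
      unfolding mult_exp_exp sum_b main[symmetric] plus_complex.sel by (simp only: add.assoc)
    also have "\<dots> \<le> exp (A + B * \<bar>x\<bar> + B * (sqrt n * \<bar>t\<bar>))"
    proof -
      have "Re (s * of_real (x / ln 2)) \<le> norm (s * of_real (x / ln 2))" by (rule complex_Re_le_cmod)
      also have "\<dots> = (norm s / ln 2) * \<bar>x\<bar>" by (simp add: norm_mult norm_divide)
      also have "\<dots> \<le> B * \<bar>x\<bar>" unfolding B_def using nonneg R by (intro mult_right_mono) auto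
      finally have 1: "Re (s * of_real (x / ln 2)) \<le> B * \<bar>x\<bar>" .
      have "2 * U * C1 * (1 + R) * (sqrt n * \<bar>t\<bar>) \<le> B * (sqrt n * \<bar>t\<bar>)"
        unfolding B_def by (intro mult_right_mono) auto
      then have 2: "Re ((u - s / of_real (sqrt n)) * of_real (real k * m) + u * of_real (W0 - real k * m) + u * D)
          \<le> U2 * m + 9 * U + B * (sqrt n * \<bar>t\<bar>)"
        using err complex_Re_le_cmod[of "(u - s / of_real (sqrt n)) * of_real (real k * m) + u * of_real (W0 - real k * m) + u * D"] by linarith
      show ?thesis unfolding exp_le_cancel_iff A_def using 1 2 sq by linarith
    qed
    finally show ?thesis unfolding x_def b_def u_def \<zeta>_def by (simp add: abs_divide)
  qed
  have nonneg': "0 \<le> A" "0 \<le> B" unfolding A_def B_def using nonneg m R by auto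
  show ?thesis
    by (intro exI[of _ A] exI[of _ B] exI[of _ N] conjI allI impI nonneg' main; assumption)
qed

section \<open>Size of the summands as a function of the index\<close>

lemma log_qprod_diff:
  "\<exists>C\<ge>0. \<forall>m k k'. 0 < m \<longrightarrow> m \<le> real k \<longrightarrow> m \<le> real k' \<longrightarrow>
    \<bar>2 * log_qprod k (ln 2 / k) - 2 * log_qprod k' (ln 2 / k') + (real k - real k') / fb_kappa\<bar> \<le> C * \<bar>real k - real k'\<bar> / m"
proof -
  define H where "H k = 2 * log_qprod k (ln 2 / k) + real k / fb_kappa" for k
  define C where "C = 2 * (2 * ln 2 + pi\<^sup>2 / (12 * ln 2))"
  have C: "0 \<le> C" by (simp add: C_def)
  have kap: "1 / fb_kappa = 2 * (pi\<^sup>2 / (12 * ln 2))" by (simp add: fb_kappa_def)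
  \<comment> \<open>Adding k / fb_kappa removes the drift found in \<open>log_qprod_step\<close>, as
    1 / fb_kappa is twice its constant; the increments of \<open>H\<close> are then O(1/k) and can
    be summed above m.\<close>
  have step: "\<bar>H (Suc k) - H k\<bar> \<le> C / k" if "0 < k" for k
  proof -
    have "H (Suc k) - H k = 2 * (log_qprod (Suc k) (ln 2 / Suc k) - log_qprod k (ln 2 / k)) + 1 / fb_kappa"
      by (simp add: H_def add_divide_distrib)
    also have "\<dots> = 2 * (log_qprod (Suc k) (ln 2 / Suc k) - log_qprod k (ln 2 / k) + pi\<^sup>2 / (12 * ln 2))"
      unfolding kap by simp
    also have "\<bar>\<dots>\<bar> \<le> 2 * ((2 * ln 2 + pi\<^sup>2 / (12 * ln 2)) / k)"
      using mult_left_mono[OF log_qprod_step[OF that], of 2] unfolding abs_mult by (simp only: abs_numeral)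
    also have "\<dots> = C / k" by (simp add: C_def)
    finally show ?thesis .
  qed
  have up: "\<bar>H (a + i) - H a\<bar> \<le> i * (C / m)" if m: "0 < m" "m \<le> real a" for m a i
  proof (induction i)
    case (Suc i)
    have "\<bar>H (Suc (a + i)) - H (a + i)\<bar> \<le> C / real (a + i)"
      using m by (intro step) linarith
    also have "\<dots> \<le> C / m" using m C by (intro divide_left_mono) auto
    finally have "\<bar>H (Suc (a + i)) - H (a + i)\<bar> \<le> C / m" .
    moreover have "real (Suc i) * (C / m) = i * (C / m) + C / m" unfolding of_nat_Suc distrib_right by simp
    ultimately show ?case using Suc unfolding add_Suc_right by linarith
  qed simp
  have "\<bar>H k - H k'\<bar> \<le> C * \<bar>real k - real k'\<bar> / m" if m: "0 < m" "m \<le> real k" "m \<le> real k'" for m k k'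
  proof (cases "k' \<le> k")
    case True
    then show ?thesis using up[OF m(1,3), of "k - k'"] by (simp add: of_nat_diff mult.commute)
  next
    case False
    then show ?thesis using up[OF m(1,2), of "k' - k"] by (simp add: of_nat_diff mult.commute abs_minus_commute)
  qed
  moreover have "2 * log_qprod k (ln 2 / k) - 2 * log_qprod k' (ln 2 / k') + (real k - real k') / fb_kappa = H k - H k'" for k k'
    by (simp add: H_def diff_divide_distrib)
  ultimately show ?thesis using C by (intro exI[of _ C]) simp
qed

text \<open>The difference t - t^2 / 4 - ln (1 + t) has derivative t (1 - t) / (2 (1 + t)), which
  has the sign of t up to t = 1; the coefficient 1/4 instead of 1/2 pays for this range.\<close>

lemma ln_one_plus_le:
  fixes t :: real
  assumes "- 1 < t" "t \<le> 1"
  shows "ln (1 + t) \<le> t - t\<^sup>2 / 4"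
proof -
  define f where "f t = t - t\<^sup>2 / 4 - ln (1 + t)" for t :: real
  have d: "(f has_real_derivative (t * (1 - t) / (2 * (1 + t)))) (at t)" if "- 1 < t" for t
    unfolding f_def using that by (auto intro!: derivative_eq_intros simp: field_simps power2_eq_square)
  have "f 0 \<le> f t"
  proof (cases "0 \<le> t")
    case True
    show ?thesis
    proof (rule DERIV_nonneg_imp_nondecreasing[OF True, of f])
      fix x assume x: "0 \<le> x" "x \<le> t"
      then show "\<exists>y. (f has_real_derivative y) (at x) \<and> 0 \<le> y"
        using d[of x] assms by (intro exI[of _ "x * (1 - x) / (2 * (1 + x))"]) auto
    qed
  next
    case False
    show ?thesis
    proof (rule DERIV_nonpos_imp_nonincreasing[of t 0 f])
      show "t \<le> 0" using False by simp
      fix x assume x: "t \<le> x" "x \<le> 0"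
      then show "\<exists>y. (f has_real_derivative y) (at x) \<and> y \<le> 0"
        using d[of x] assms by (intro exI[of _ "x * (1 - x) / (2 * (1 + x))"])
          (auto intro!: divide_nonpos_pos mult_nonpos_nonneg)
    qed
  qed
  then show ?thesis by (simp add: f_def)
qed

lemma ln_second_order_limit:
  fixes y :: "nat \<Rightarrow> real"
  assumes y: "(\<lambda>n. sqrt n * y n) \<longlonglongrightarrow> z"
  shows "(\<lambda>n. n * (ln (1 + y n) - y n)) \<longlonglongrightarrow> - z\<^sup>2 / 2"
proof -
  have y0: "y \<longlonglongrightarrow> 0"
  proof -
    have "(\<lambda>n. 1 / sqrt n * (sqrt n * y n)) \<longlonglongrightarrow> 0 * z"
      by (intro tendsto_mult y) real_asymp
    moreover have "\<forall>\<^sub>F n in sequentially. 1 / sqrt n * (sqrt n * y n) = y n"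
      using eventually_gt_at_top[of 0] by eventually_elim simp
    ultimately have "y \<longlonglongrightarrow> 0 * z" by (rule Lim_transform_eventually)
    then show ?thesis by simp
  qed
  have ev: "\<forall>\<^sub>F n in sequentially. \<bar>y n\<bar> < 1 / 2"
    using order_tendstoD(2)[OF tendsto_rabs[OF y0], of "1 / 2"] by simp
  have "(\<lambda>n. n * (ln (1 + y n) - y n) + (sqrt n * y n)\<^sup>2 / 2) \<longlonglongrightarrow> 0"
  proof (rule Lim_null_comparison)
    show "\<forall>\<^sub>F n in sequentially. norm (n * (ln (1 + y n) - y n) + (sqrt n * y n)\<^sup>2 / 2) \<le> 16 * (sqrt n * y n)\<^sup>2 * \<bar>y n\<bar>"
      using ev
    proof eventually_elim
      case (elim n)
      \<comment> \<open>The real estimate is the complex cubic bound for \<open>Ln\<close> at b = -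
        y.\<close>
      have "norm (- Ln (1 - complex_of_real (- y n)) - of_real (- y n) - (of_real (- y n))\<^sup>2 / 2) \<le> 16 * norm (complex_of_real (- y n)) ^ 3"
        by (rule Ln_cubic) (use elim in simp)
      moreover have "- Ln (1 - complex_of_real (- y n)) - of_real (- y n) - (of_real (- y n))\<^sup>2 / 2
          = of_real (- (ln (1 + y n) - y n + (y n)\<^sup>2 / 2))"
      proof -
        have "1 - complex_of_real (- y n) = of_real (1 + y n)" by simp
        then have "Ln (1 - complex_of_real (- y n)) = of_real (ln (1 + y n))" using elim by (simp only: Ln_of_real)
        then show ?thesis by simp
      qed
      ultimately have b: "\<bar>ln (1 + y n) - y n + (y n)\<^sup>2 / 2\<bar> \<le> 16 * \<bar>y n\<bar> ^ 3"
        by (simp only: norm_of_real abs_minus_cancel)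
      have "norm (n * (ln (1 + y n) - y n) + (sqrt n * y n)\<^sup>2 / 2) = n * \<bar>ln (1 + y n) - y n + (y n)\<^sup>2 / 2\<bar>"
      proof -
        have "n * (ln (1 + y n) - y n) + (sqrt n * y n)\<^sup>2 / 2 = n * (ln (1 + y n) - y n + (y n)\<^sup>2 / 2)"
          by (simp add: power_mult_distrib algebra_simps)
        then show ?thesis by (simp only: real_norm_def abs_mult abs_of_nat)
      qed
      also have "\<dots> \<le> n * (16 * \<bar>y n\<bar> ^ 3)" using b by (intro mult_left_mono) auto
      also have "\<dots> = 16 * (sqrt n * y n)\<^sup>2 * \<bar>y n\<bar>"
        by (simp add: power_mult_distrib power3_eq_cube power2_eq_square)
      finally show ?case .
    qed
    have "(\<lambda>n. 16 * (sqrt n * y n)\<^sup>2 * \<bar>y n\<bar>) \<longlonglongrightarrow> 16 * z\<^sup>2 * \<bar>0\<bar>"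
      by (intro tendsto_intros y y0)
    then show "(\<lambda>n. 16 * (sqrt n * y n)\<^sup>2 * \<bar>y n\<bar>) \<longlonglongrightarrow> 0" by simp
  qed
  from tendsto_diff[OF this tendsto_divide[OF tendsto_power[OF y, of 2] tendsto_const[of 2]]]
  show ?thesis by simp
qed

text \<open>The logarithm of the size of the \<open>k\<close>-th summand at its saddle point, up to factors that vary
  little with \<open>k\<close>; it is maximal near \<open>saddle_idx n\<close>.\<close>

definition saddle_log :: "nat \<Rightarrow> nat \<Rightarrow> real" where
  "saddle_log n k = 2 * log_qprod k (ln 2 / k) + n * ln k"

text \<open>The + 1 makes the index positive for every n and strictly larger than fb_kappa
  n.\<close>

definition saddle_idx :: "nat \<Rightarrow> nat" where
  "saddle_idx n = nat \<lfloor>fb_kappa * n\<rfloor> + 1"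

lemma saddle_idx_bounds: "fb_kappa * n < saddle_idx n" "saddle_idx n \<le> fb_kappa * n + 1"
proof -
  have "0 \<le> fb_kappa * n" using fb_kappa_pos by simp
  then have "real (saddle_idx n) = of_int \<lfloor>fb_kappa * n\<rfloor> + 1" by (simp add: saddle_idx_def)
  then show "fb_kappa * n < saddle_idx n" "saddle_idx n \<le> fb_kappa * n + 1" by linarith+
qed

text \<open>Together with 2 k \<le> n this gives k \<le> 2 fb_kappa n, so the relative deviation
  from the saddle index is at most 1, where \<open>ln_one_plus_le\<close> applies.\<close>

lemma fb_kappa_gt: "1 / 4 < fb_kappa"
proof -
  have "pi\<^sup>2 < 4\<^sup>2" using pi_less_4 pi_gt_zero by (intro power_strict_mono) auto
  then have "pi\<^sup>2 < 24 * ln 2" using ln2_ge_two_thirds by simp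
  then show ?thesis by (simp add: fb_kappa_def field_simps)
qed

text \<open>With l the saddle index, the drift - (k - l) / fb_kappa of the product cancels the
  linear term of n ln (k / l) up to O(1), because l is within 1 of fb_kappa n, and the quadratic
  term supplies the Gaussian. The lower bound \<epsilon> n on k keeps the error C |k - l| /
  (\<epsilon> n) bounded.\<close>

lemma saddle_log_bound:
  assumes \<epsilon>: "0 < \<epsilon>" "\<epsilon> \<le> fb_kappa"
  shows "\<exists>A\<ge>0. \<forall>n>0. \<forall>k. \<epsilon> * n \<le> real k \<longrightarrow> 2 * k \<le> n \<longrightarrow>
    saddle_log n k - saddle_log n (saddle_idx n) \<le> A - (real k - real (saddle_idx n))\<^sup>2 / (4 * (fb_kappa + 1)\<^sup>2 * n)"
proof -
  obtain C where C: "0 \<le> C" "\<And>m k k'. 0 < m \<Longrightarrow> m \<le> real k \<Longrightarrow> m \<le> real k' \<Longrightarrow>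
    \<bar>2 * log_qprod k (ln 2 / k) - 2 * log_qprod k' (ln 2 / k') + (real k - real k') / fb_kappa\<bar> \<le> C * \<bar>real k - real k'\<bar> / m"
    using log_qprod_diff by blast
  define E where "E = fb_kappa + 2"
  define A where "A = C * E / \<epsilon> + E / fb_kappa\<^sup>2"
  have A: "0 \<le> A" using C \<epsilon> fb_kappa_pos by (simp add: A_def E_def)
  have "saddle_log n k - saddle_log n (saddle_idx n) \<le> A - (real k - real (saddle_idx n))\<^sup>2 / (4 * (fb_kappa + 1)\<^sup>2 * n)"
    if n: "0 < n" and k: "\<epsilon> * n \<le> real k" "2 * k \<le> n" for n k
  proof -
    define l where "l = saddle_idx n"
    note l = saddle_idx_bounds[of n, folded l_def]
    have n1: "1 \<le> real n" using n by simp
    have en: "0 < \<epsilon> * n" using \<epsilon> n by simp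
    have ll: "\<epsilon> * n \<le> l" "fb_kappa * n \<le> l" "0 < real l"
    proof -
      have "\<epsilon> * n \<le> fb_kappa * n" using \<epsilon> by (intro mult_right_mono) auto
      then show "\<epsilon> * n \<le> l" "fb_kappa * n \<le> l" "0 < real l" using l en by linarith+
    qed
    have k0: "0 < real k" using k en by linarith
    have dkl: "\<bar>real k - real l\<bar> \<le> E * n"
    proof -
      have "real k \<le> n" "0 \<le> real k" using k by auto
      moreover have "real l \<le> (fb_kappa + 1) * n" using l n1 by (simp add: distrib_right)
      ultimately show ?thesis using ll(3) n1 unfolding E_def distrib_right by linarith
    qed
    define t where "t = (real k - l) / l"
    have t1: "1 + t = real k / l" using ll by (simp add: t_def field_simps)
    have t: "- 1 < t" "t \<le> 1"
    proof -
      have "0 < 1 + t" unfolding t1 using k0 ll by simp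
      then show "- 1 < t" by simp
      have "real k \<le> 2 * l"
      proof -
        have "real k \<le> n / 2" using k(2) by linarith
        also have "\<dots> \<le> 2 * (fb_kappa * n)" using fb_kappa_gt n1 by (simp add: field_simps)
        finally show ?thesis using ll by linarith
      qed
      then have "real k / l \<le> 2" using ll by (simp add: divide_le_eq)
      then show "t \<le> 1" using t1 by linarith
    qed
    have "saddle_log n k - saddle_log n l = (2 * log_qprod k (ln 2 / k) - 2 * log_qprod l (ln 2 / l) + (real k - real l) / fb_kappa)
        + (n * (ln k - ln l) - (real k - real l) / fb_kappa)"
      by (simp add: saddle_log_def algebra_simps)
    also have "ln (real k) - ln (real l) = ln (1 + t)" unfolding t1 using k0 ll by (simp add: ln_div)
    finally have eq: "saddle_log n k - saddle_log n l = (2 * log_qprod k (ln 2 / k) - 2 * log_qprod l (ln 2 / l) + (real k - real l) / fb_kappa)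
        + (n * ln (1 + t) - (real k - real l) / fb_kappa)" .
    have 1: "2 * log_qprod k (ln 2 / k) - 2 * log_qprod l (ln 2 / l) + (real k - real l) / fb_kappa \<le> C * E / \<epsilon>"
    proof -
      have "2 * log_qprod k (ln 2 / k) - 2 * log_qprod l (ln 2 / l) + (real k - real l) / fb_kappa \<le> C * \<bar>real k - real l\<bar> / (\<epsilon> * n)"
        using C(2)[OF en k(1) ll(1)] by linarith
      also have "\<dots> \<le> C * (E * n) / (\<epsilon> * n)" using dkl C(1) en by (intro divide_right_mono mult_left_mono) auto
      also have "\<dots> = C * E / \<epsilon>" using n by simp
      finally show ?thesis .
    qed
    have 2: "n * ln (1 + t) \<le> n * t - n * t\<^sup>2 / 4"
      using mult_left_mono[OF ln_one_plus_le[OF t], of n] by (simp add: right_diff_distrib)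
    have 3: "n * t - (real k - real l) / fb_kappa \<le> E / fb_kappa\<^sup>2"
    proof -
      have "n * t - (real k - real l) / fb_kappa = (real k - l) * (fb_kappa * n - l) / (l * fb_kappa)"
        using ll fb_kappa_pos by (simp add: t_def field_simps)
      also have "\<dots> \<le> \<bar>real k - l\<bar> * \<bar>fb_kappa * n - l\<bar> / (l * fb_kappa)"
        unfolding abs_mult[symmetric] using ll fb_kappa_pos by (intro divide_right_mono abs_ge_self) auto
      also have "\<dots> \<le> (E * n) * 1 / (fb_kappa * n * fb_kappa)"
        using dkl l ll fb_kappa_pos n by (intro frac_le mult_mono) (auto simp: E_def)
      also have "\<dots> = E / fb_kappa\<^sup>2" using n by (simp add: power2_eq_square)
      finally show ?thesis .
    qed
    have 4: "(real k - l)\<^sup>2 / (4 * (fb_kappa + 1)\<^sup>2 * n) \<le> n * t\<^sup>2 / 4"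
    proof -
      have "real l \<le> (fb_kappa + 1) * n" using l n1 by (simp add: distrib_right)
      then have "(real l)\<^sup>2 \<le> ((fb_kappa + 1) * n)\<^sup>2" using ll by (intro power_mono) auto
      then have "(real k - l)\<^sup>2 * n / (4 * ((fb_kappa + 1) * n)\<^sup>2) \<le> (real k - l)\<^sup>2 * n / (4 * (real l)\<^sup>2)"
        using ll fb_kappa_pos n by (intro divide_left_mono mult_pos_pos zero_less_power) auto
      then show ?thesis using n by (simp add: t_def power_divide power_mult_distrib power2_eq_square[of "real n"] mult_ac)
    qed
    show ?thesis using 1 2 3 4 unfolding eq l_def[symmetric] A_def by linarith
  qed
  then show ?thesis using A by (intro exI[of _ A] conjI allI impI)
qed

lemma sqrt_mult_divide: "sqrt (real n) * (a / (b * real n)) = a / sqrt (real n) / b"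
proof (cases "n = 0")
  case False
  define q where "q = sqrt (real n)"
  have q: "real n = q * q" "q \<noteq> 0" using False by (simp_all add: q_def)
  have "q * (a / (b * (q * q))) = a / q / b" using q(2) by (simp add: field_simps)
  then have "q * (a / (b * real n)) = a / q / b" by (simp only: q(1))
  then show ?thesis by (simp only: q_def)
qed simp

text \<open>Writing k = fb_kappa n (1 + y), the linear term of n ln (1 + y) cancels the drift
  exactly, and n y^2 / 2 tends to x^2 / (2 fb_kappa^2). The saddle index is expanded in the same
  way, with limit 0.\<close>

lemma saddle_log_limit:
  fixes k :: "nat \<Rightarrow> nat"
  assumes k_pos: "\<And>n. 0 < k n" and k_lim: "(\<lambda>n. (real (k n) - fb_kappa * n) / sqrt n) \<longlonglongrightarrow> x"
  shows "(\<lambda>n. saddle_log n (k n) - saddle_log n (saddle_idx n)) \<longlonglongrightarrow> - x\<^sup>2 / (2 * fb_kappa\<^sup>2)"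
proof -
  define l where "l = saddle_idx"
  have l: "fb_kappa * n < l n" "l n \<le> fb_kappa * n + 1" for n unfolding l_def by (rule saddle_idx_bounds)+
  have l_pos: "0 < l n" for n by (simp add: l_def saddle_idx_def)
  obtain C where C: "0 \<le> C" "\<And>m k k'. 0 < m \<Longrightarrow> m \<le> real k \<Longrightarrow> m \<le> real k' \<Longrightarrow>
    \<bar>2 * log_qprod k (ln 2 / k) - 2 * log_qprod k' (ln 2 / k') + (real k - real k') / fb_kappa\<bar> \<le> C * \<bar>real k - real k'\<bar> / m"
    using log_qprod_diff by blast
  define y where "y n = (real (k n) - fb_kappa * n) / (fb_kappa * n)" for n
  define y' where "y' n = (real (l n) - fb_kappa * n) / (fb_kappa * n)" for n
  have kap: "0 < fb_kappa" by (rule fb_kappa_pos)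
  have y: "(\<lambda>n. sqrt n * y n) \<longlonglongrightarrow> x / fb_kappa"
  proof -
    have "(\<lambda>n. (real (k n) - fb_kappa * n) / sqrt n / fb_kappa) \<longlonglongrightarrow> x / fb_kappa"
      by (intro tendsto_divide k_lim tendsto_const) (use kap in auto)
    moreover have "(real (k n) - fb_kappa * n) / sqrt n / fb_kappa = sqrt n * y n" for n
      unfolding y_def by (rule sqrt_mult_divide[symmetric])
    ultimately show ?thesis by simp
  qed
  have l_lim: "(\<lambda>n. (real (l n) - fb_kappa * n) / sqrt n) \<longlonglongrightarrow> 0"
  proof (rule Lim_null_comparison)
    show "\<forall>\<^sub>F n in sequentially. norm ((real (l n) - fb_kappa * n) / sqrt n) \<le> 1 / sqrt n"
    proof (intro always_eventually allI)
      fix n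
      have "\<bar>real (l n) - fb_kappa * n\<bar> \<le> 1" using l(1)[of n] l(2)[of n] by linarith
      then show "norm ((real (l n) - fb_kappa * n) / sqrt n) \<le> 1 / sqrt n"
        by (simp add: abs_divide divide_right_mono)
    qed
    show "(\<lambda>n. 1 / sqrt (real n)) \<longlonglongrightarrow> 0" by real_asymp
  qed
  have y': "(\<lambda>n. sqrt n * y' n) \<longlonglongrightarrow> 0"
  proof -
    have "(\<lambda>n. (real (l n) - fb_kappa * n) / sqrt n / fb_kappa) \<longlonglongrightarrow> 0 / fb_kappa"
      by (intro tendsto_divide l_lim tendsto_const) (use kap in auto)
    moreover have "(real (l n) - fb_kappa * n) / sqrt n / fb_kappa = sqrt n * y' n" for n
      unfolding y'_def by (rule sqrt_mult_divide[symmetric])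
    ultimately show ?thesis by simp
  qed
  define P where "P n = 2 * log_qprod (k n) (ln 2 / k n) - 2 * log_qprod (l n) (ln 2 / l n) + (real (k n) - real (l n)) / fb_kappa" for n
  have P: "P \<longlonglongrightarrow> 0"
  proof (rule Lim_null_comparison)
    have "(\<lambda>n. (real (k n) - fb_kappa * n) / sqrt n * (1 / sqrt n)) \<longlonglongrightarrow> x * 0"
      by (intro tendsto_mult k_lim) real_asymp
    then have "\<forall>\<^sub>F n in sequentially. - (fb_kappa / 2) < (real (k n) - fb_kappa * n) / sqrt n * (1 / sqrt n)"
      using order_tendstoD(1)[of _ "x * 0" sequentially "- (fb_kappa / 2)"] kap by simp
    then show "\<forall>\<^sub>F n in sequentially. norm (P n) \<le> 2 * C / fb_kappa * (\<bar>(real (k n) - fb_kappa * n) / sqrt n - (real (l n) - fb_kappa * n) / sqrt n\<bar> * (1 / sqrt n))"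
      using eventually_gt_at_top[of 0]
    proof eventually_elim
      case (elim n)
      have m: "0 < fb_kappa / 2 * n" using kap elim by simp
      have "- (fb_kappa / 2) < (real (k n) - fb_kappa * n) / n" using elim by simp
      then have mk: "fb_kappa / 2 * n \<le> real (k n)" using elim by (simp add: field_simps)
      have ml: "fb_kappa / 2 * n \<le> real (l n)" using l(1)[of n] m by linarith
      have "norm (P n) \<le> C * \<bar>real (k n) - real (l n)\<bar> / (fb_kappa / 2 * n)"
        unfolding P_def real_norm_def by (rule C(2)[OF m mk ml])
      also have "\<dots> = 2 * C / fb_kappa * (\<bar>real (k n) - real (l n)\<bar> / n)" by simp
      also have "\<bar>real (k n) - real (l n)\<bar> / n = \<bar>(real (k n) - fb_kappa * n) / sqrt n - (real (l n) - fb_kappa * n) / sqrt n\<bar> * (1 / sqrt n)"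
        unfolding diff_divide_distrib[symmetric] abs_divide using elim by simp
      finally show ?case .
    qed
    have "(\<lambda>n. 2 * C / fb_kappa * (\<bar>(real (k n) - fb_kappa * n) / sqrt n - (real (l n) - fb_kappa * n) / sqrt n\<bar> * (1 / sqrt n))) \<longlonglongrightarrow> 2 * C / fb_kappa * (\<bar>x - 0\<bar> * 0)"
      by (intro tendsto_mult tendsto_const tendsto_rabs tendsto_diff k_lim l_lim) real_asymp
    then show "(\<lambda>n. 2 * C / fb_kappa * (\<bar>(real (k n) - fb_kappa * n) / sqrt n - (real (l n) - fb_kappa * n) / sqrt n\<bar> * (1 / sqrt n))) \<longlonglongrightarrow> 0"
      by simp
  qed
  have lim: "(\<lambda>n. P n + n * (ln (1 + y n) - y n) - n * (ln (1 + y' n) - y' n)) \<longlonglongrightarrow> 0 + - (x / fb_kappa)\<^sup>2 / 2 - - 0\<^sup>2 / 2"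
    by (intro tendsto_add tendsto_diff P ln_second_order_limit y y')
  have ev: "\<forall>\<^sub>F n in sequentially. P n + n * (ln (1 + y n) - y n) - n * (ln (1 + y' n) - y' n)
      = saddle_log n (k n) - saddle_log n (saddle_idx n)"
    using eventually_gt_at_top[of 0]
  proof eventually_elim
    case (elim n)
    have kn: "0 < fb_kappa * n" using elim kap by simp
    have ln_quot: "ln (a / b) = ln a - ln b" if "0 < a" "0 < b" for a b :: real
      using that by (simp add: ln_div)
    have "1 + y n = k n / (fb_kappa * n)" "1 + y' n = l n / (fb_kappa * n)"
      using kap elim by (simp_all add: y_def y'_def diff_divide_distrib)
    then have ln: "ln (1 + y n) = ln (k n) - ln (fb_kappa * n)" "ln (1 + y' n) = ln (l n) - ln (fb_kappa * n)"
      using k_pos[of n] l_pos[of n] kn by (simp_all only: ln_quot of_nat_0_less_iff)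
    have "n * y n - n * y' n = (real (k n) - real (l n)) / fb_kappa"
      using elim kap by (simp add: y_def y'_def field_simps)
    then show ?case unfolding ln P_def saddle_log_def l_def[symmetric] by (simp add: algebra_simps)
  qed
  from Lim_transform_eventually[OF lim ev] show ?thesis by (simp add: power_divide mult.commute)
qed

section \<open>The circles of integration\<close>

locale fishburn_weights =
  fixes Lam :: "complex \<Rightarrow> complex" and lam :: "nat \<Rightarrow> real"
  assumes Lam_analytic: "Lam analytic_on {0}"
    and Lam_expansion: "fps_expansion Lam 0 = Abs_fps (\<lambda>j. complex_of_real (lam j))"
    and lam_0: "lam 0 = 1"
    and lam_1: "0 < lam 1"
    and lam_nonneg: "\<And>j. 0 \<le> lam j"
begin

lemma Lam_series:
  "\<exists>R>0. Lam holomorphic_on ball 0 R \<and> (\<forall>z\<in>ball 0 R. (\<lambda>n. of_real (lam n) * z ^ n) sums Lam z)"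
proof -
  obtain R where R: "0 < R" "Lam holomorphic_on ball 0 R"
    using Lam_analytic by (auto simp: analytic_on_def)
  have "(\<lambda>n. of_real (lam n) * z ^ n) sums Lam z" if "z \<in> ball 0 R" for z
  proof -
    have "(deriv ^^ n) Lam 0 / fact n = of_real (lam n)" for n
      using arg_cong[OF Lam_expansion, of "\<lambda>f. fps_nth f n"] by (simp add: fps_expansion_def)
    then show ?thesis using holomorphic_power_series[OF R(2) that] by simp
  qed
  with R show ?thesis by blast
qed

text \<open>Some radius on which the series represents \<open>Lam\<close>, fixed once and for all;
  it may be smaller than the radius of convergence that the name suggests.\<close>

definition rad_conv :: real where
  "rad_conv = (SOME R. 0 < R \<and> Lam holomorphic_on ball 0 R \<and> (\<forall>z\<in>ball 0 R. (\<lambda>n. of_real (lam n) * z ^ n) sums Lam z))"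

lemma rad_conv: "0 < rad_conv" "Lam holomorphic_on ball 0 rad_conv"
  "norm z < rad_conv \<Longrightarrow> (\<lambda>n. of_real (lam n) * z ^ n) sums Lam z"
  using someI_ex[OF Lam_series[unfolded Bex_def]] unfolding rad_conv_def[symmetric] by auto

lemma Lam_expands: "Lam has_fps_expansion Abs_fps (\<lambda>j. complex_of_real (lam j))"
  using has_fps_expansion_fps_expansion[OF open_ball _ rad_conv(2)] rad_conv(1) Lam_expansion by simp

definition rLam :: "real \<Rightarrow> real" where "rLam x = (\<Sum>n. lam n * x ^ n)"

lemma rLam_sums:
  assumes "\<bar>x\<bar> < rad_conv"
  shows "(\<lambda>n. lam n * x ^ n) sums rLam x"
proof -
  have "(\<lambda>n. of_real (lam n * x ^ n)) sums Lam (of_real x)" using rad_conv(3)[of "of_real x"] assms by simp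
  then have "(\<lambda>n. Re (of_real (lam n * x ^ n))) sums Re (Lam (of_real x))" by (rule sums_Re)
  then show ?thesis by (simp add: rLam_def sums_iff)
qed

lemma Lam_of_real:
  assumes "\<bar>x\<bar> < rad_conv"
  shows "Lam (of_real x) = of_real (rLam x)"
proof -
  have "(\<lambda>n. of_real (lam n * x ^ n)) sums Lam (of_real x)" using rad_conv(3)[of "of_real x"] assms by simp
  moreover have "(\<lambda>n. complex_of_real (lam n * x ^ n)) sums of_real (rLam x)"
    using rLam_sums[OF assms] by (rule sums_of_real)
  ultimately show ?thesis by (rule sums_unique2)
qed

text \<open>All terms of the difference are nonnegative, so the linear one is a lower bound. Here
  lam 1 > 0 enters: a small increase of \<open>rLam\<close> forces a small increase of the
  radius.\<close>

lemma rLam_increasing: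
  assumes "0 \<le> x" "x \<le> y" "y < rad_conv"
  shows "lam 1 * (y - x) \<le> rLam y - rLam x"
proof -
  have s: "(\<lambda>n. lam n * y ^ n - lam n * x ^ n) sums (rLam y - rLam x)"
    using assms by (intro sums_diff rLam_sums) auto
  have "(\<Sum>n\<in>{1}. lam n * y ^ n - lam n * x ^ n) \<le> (\<Sum>n. lam n * y ^ n - lam n * x ^ n)"
    using s assms lam_nonneg by (intro sum_le_suminf) (auto simp: sums_iff intro!: mult_left_mono power_mono)
  then show ?thesis using s by (simp add: sums_iff right_diff_distrib)
qed

lemma rLam_0: "rLam 0 = 1"
proof -
  have "(\<lambda>n. lam n * 0 ^ n) sums lam 0" using sums_If_finite_set[of "{0}" "\<lambda>n. lam n"] by (simp add: power_0_left if_distrib cong: if_cong)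
  then show ?thesis using rLam_sums[of 0] rad_conv(1) lam_0 by (simp add: sums_iff)
qed

lemma norm_Lam_minus_one_le:
  assumes "norm z < rad_conv"
  shows "norm (Lam z - 1) \<le> rLam (norm z) - 1"
proof (rule norm_sums_le)
  have "(\<lambda>n. of_real (lam n) * z ^ n - (if n = 0 then 1 else 0)) sums (Lam z - 1)"
    by (intro sums_diff rad_conv assms sums_single)
  then show "(\<lambda>n. of_real (lam n) * z ^ n - (if n = 0 then 1 else 0)) sums (Lam z - 1)" .
  show "(\<lambda>n. lam n * norm z ^ n - (if n = 0 then 1 else 0)) sums (rLam (norm z) - 1)"
    using assms by (intro sums_diff rLam_sums sums_single) auto
  show "norm (of_real (lam n) * z ^ n - (if n = 0 then 1 else 0)) \<le> lam n * norm z ^ n - (if n = 0 then 1 else 0)" for n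
    using lam_0 lam_nonneg[of n] by (auto simp: norm_mult norm_power)
qed

text \<open>Nonnegative coefficients make the modulus of Lam^j - 1 largest on the positive axis,
  where it grows with the radius.\<close>

lemma norm_Lam_power_minus_one_le:
  assumes "norm z \<le> x" "x < rad_conv"
  shows "norm (Lam z ^ j - 1) \<le> rLam x ^ j - 1"
proof -
  have "norm (Lam z - 1) \<le> rLam (norm z) - 1" using assms by (intro norm_Lam_minus_one_le) auto
  also have "\<dots> \<le> rLam x - 1"
  proof -
    have "0 \<le> lam 1 * (x - norm z)" using assms lam_1 by (intro mult_nonneg_nonneg) auto
    then show ?thesis using rLam_increasing[OF norm_ge_zero assms] by linarith
  qed
  finally have 1: "1 + norm (Lam z - 1) \<le> rLam x" by simp
  have "norm ((1 + (Lam z - 1)) ^ j - 1) \<le> (1 + norm (Lam z - 1)) ^ j - 1" by (rule norm_power_minus_one_le)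
  also have "\<dots> \<le> rLam x ^ j - 1" using power_mono[OF 1, of j] by (simp add: add_nonneg_nonneg)
  finally show ?thesis by simp
qed

lemma rLam_continuous: "continuous_on {0..rad_conv / 2} rLam"
proof -
  have "continuous_on {0..rad_conv / 2} (\<lambda>x. Re (Lam (of_real x)))"
    by (intro continuous_intros continuous_on_compose2[OF holomorphic_on_imp_continuous_on[OF rad_conv(2)]])
       (use rad_conv(1) in auto)
  then show ?thesis
    by (rule continuous_on_cong[THEN iffD1, rotated -1]) (use rad_conv(1) in \<open>auto simp: Lam_of_real\<close>)
qed

lemma rLam_surj:
  assumes "1 < v" "v \<le> rLam (rad_conv / 2)"
  shows "\<exists>x. 0 < x \<and> x \<le> rad_conv / 2 \<and> rLam x = v"
proof -
  obtain x where "0 \<le> x" "x \<le> rad_conv / 2" "rLam x = v"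
    using IVT'[of rLam 0 v "rad_conv / 2"] rLam_0 assms rad_conv(1) rLam_continuous by auto
  then show ?thesis using rLam_0 assms by (intro exI[of _ x]) (auto simp: less_le)
qed

end

context fishburn_weights
begin

text \<open>The logarithm of \<open>Lam\<close> per unit of z, close to lam 1 near 0. The weights
  affect the asymptotics only through this function; being Lipschitz, it varies by O(1/k) on circles
  of radius O(1/k).\<close>

definition log_quot :: "complex \<Rightarrow> complex" where
  "log_quot z = (if z = 0 then deriv (\<lambda>z. Ln (Lam z)) 0 else Ln (Lam z) / z)"

lemma log_quot:
  "\<exists>x B. 0 < x \<and> x \<le> rad_conv / 2 \<and> 0 \<le> B \<and> (\<forall>z. norm z \<le> x \<longrightarrow> Lam z = exp (z * log_quot z)) \<and>
     (\<forall>z w. norm z \<le> x \<longrightarrow> norm w \<le> x \<longrightarrow> norm (log_quot z - log_quot w) \<le> B * norm (z - w))"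
proof -
  \<comment> \<open>With \<open>rLam\<close> at most 3/2, the values of \<open>Lam\<close> lie
    within 1/2 of 1, away from the branch cut of \<open>Ln\<close>.\<close>
  define v where "v = min (3 / 2) (rLam (rad_conv / 2))"
  have "0 < lam 1 * (rad_conv / 2 - 0)" using lam_1 rad_conv(1) by simp
  then have "1 < rLam (rad_conv / 2)"
    using rLam_increasing[of 0 "rad_conv / 2"] rLam_0 rad_conv(1) by simp
  then have v: "1 < v" "v \<le> rLam (rad_conv / 2)" "v \<le> 3 / 2" by (simp_all add: v_def)
  obtain x where x: "0 < x" "x \<le> rad_conv / 2" "rLam x = v" using rLam_surj[OF v(1,2)] by blast
  have half: "norm (Lam z - 1) \<le> 1 / 2" if "norm z \<le> x" for z
    using norm_Lam_power_minus_one_le[OF that, of 1] x v(3) rad_conv(1) by simp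
  have pos: "Lam z \<notin> \<real>\<^sub>\<le>\<^sub>0" if "norm z \<le> x" for z
  proof
    assume "Lam z \<in> \<real>\<^sub>\<le>\<^sub>0"
    then have "Re (Lam z) \<le> 0" by (auto simp: complex_nonpos_Reals_iff)
    then show False using half[OF that] abs_Re_le_cmod[of "Lam z - 1"] by simp
  qed
  have Lam_0: "Lam 0 = 1" using Lam_of_real[of 0] rLam_0 rad_conv(1) by simp
  have sub: "ball 0 x \<subseteq> ball (0 :: complex) rad_conv" using x rad_conv(1) by (intro subset_ball) simp
  have hol: "(\<lambda>z. Ln (Lam z)) holomorphic_on ball 0 x"
    by (intro holomorphic_intros holomorphic_on_subset[OF rad_conv(2) sub]) (use pos in force)
  have lq: "log_quot holomorphic_on ball 0 x"
    by (rule pole_theorem_open_0[OF hol open_ball, of 0]) (simp_all add: log_quot_def Lam_0)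
  have "deriv log_quot holomorphic_on ball 0 x" by (rule holomorphic_deriv[OF lq open_ball])
  moreover have sub2: "cball 0 (x / 2) \<subseteq> ball (0 :: complex) x" using x(1) by (intro subsetI) simp
  ultimately have "continuous_on (cball 0 (x / 2)) (deriv log_quot)"
    using continuous_on_subset holomorphic_on_imp_continuous_on by blast
  then have "bounded (deriv log_quot ` cball 0 (x / 2))"
    by (intro compact_imp_bounded compact_continuous_image compact_cball)
  then obtain B where B: "0 < B" "\<And>z. z \<in> cball 0 (x / 2) \<Longrightarrow> norm (deriv log_quot z) \<le> B"
    by (auto simp: bounded_pos)
  have der: "(log_quot has_field_derivative deriv log_quot z) (at z within cball 0 (x / 2))" if "z \<in> cball 0 (x / 2)" for z
    by (rule has_field_derivative_at_within[OF holomorphic_derivI[OF lq open_ball]]) (use that sub2 in blast)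
  have "norm (log_quot z - log_quot w) \<le> B * norm (z - w)" if "norm z \<le> x / 2" "norm w \<le> x / 2" for z w
    by (rule field_differentiable_bound[OF convex_cball der B(2)]) (use that in auto)
  moreover have "Lam z = exp (z * log_quot z)" if "norm z \<le> x / 2" for z
  proof (cases "z = 0")
    case False
    have "Lam z \<noteq> 0" using pos[of z] that x by auto
    then show ?thesis using False by (simp add: log_quot_def)
  qed (simp add: Lam_0)
  ultimately show ?thesis using x B(1) by (intro exI[of _ "x / 2"] exI[of _ B]) auto
qed

text \<open>The circle of radius \<open>rad k\<close>, on which \<open>Lam z ^ k\<close> reaches 2, is close to the saddle point of
  the \<open>k\<close>-th summand of the generating function.\<close>

definition rad :: "nat \<Rightarrow> real" where
  "rad k = (SOME x. 0 < x \<and> x \<le> rad_conv / 2 \<and> rLam x = exp (ln 2 / k))"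

text \<open>For Lam = exp the radius would be ln 2 / k; \<open>rad_corr\<close> is the correcting
  divisor, and it equals \<open>log_quot\<close> at \<open>rad k\<close>.\<close>

definition rad_corr :: "nat \<Rightarrow> real" where "rad_corr k = ln 2 / (k * rad k)"

text \<open>The relative change of \<open>log_quot\<close> along the circle, so that the logarithm
  of \<open>Lam\<close> at angle t is (ln 2 / k) cis t (1 + circ_corr k t). It takes the place of r
  in \<open>saddle_window\<close>.\<close>

definition circ_corr :: "nat \<Rightarrow> real \<Rightarrow> complex" where
  "circ_corr k t = log_quot (of_real (rad k) * cis t) / log_quot (of_real (rad k)) - 1"

lemma exp_diff_le:
  fixes a b :: real
  assumes "0 \<le> a" "a \<le> ln 2" "0 \<le> b" "b \<le> ln 2"
  shows "\<bar>exp a - exp b\<bar> \<le> 2 * \<bar>a - b\<bar>"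
proof -
  have *: "exp b - exp a \<le> 2 * (b - a)" if "a \<le> b" "b \<le> ln 2" for a b :: real
  proof -
    have "1 + (a - b) \<le> exp (a - b)" by (rule exp_ge_add_one_self)
    then have "1 - (b - a) \<le> exp (a - b)" by linarith
    then have "exp b * (1 - (b - a)) \<le> exp b * exp (a - b)" by (intro mult_left_mono) auto
    then have "exp b - exp a \<le> exp b * (b - a)" by (simp add: exp_diff algebra_simps)
    also have "\<dots> \<le> 2 * (b - a)" using that exp_le_2_iff[of b] by (intro mult_right_mono) auto
    finally show ?thesis .
  qed
  show ?thesis
  proof (cases "a \<le> b")
    case True
    then show ?thesis using *[of a b] assms by simp
  next
    case False
    then show ?thesis using *[of b a] assms by simp
  qed
qed

lemma rad_diff_le:
  assumes "0 \<le> x" "x < rad_conv" "0 \<le> y" "y < rad_conv"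
  shows "lam 1 * \<bar>x - y\<bar> \<le> \<bar>rLam x - rLam y\<bar>"
  using rLam_increasing[of x y] rLam_increasing[of y x] assms by (cases "x \<le> y") auto

text \<open>By \<open>rLam_increasing\<close>, rLam (rad k) = exp (ln 2 / k) forces rad k = O(1/k).
  The Lipschitz bound for \<open>log_quot\<close> then yields both estimates, along one circle and
  between two radii. K is so large that the circles lie where that bound holds.\<close>

lemma saddle_circle:
  "\<exists>K C. 0 < K \<and> 0 \<le> C \<and> (\<forall>k\<ge>K. 0 < rad k \<and> rad k < rad_conv \<and> rLam (rad k) = exp (ln 2 / k) \<and> 0 < rad_corr k
     \<and> (\<forall>t. norm (circ_corr k t) \<le> C * \<bar>t\<bar> / k)
     \<and> (\<forall>t j. Lam (of_real (rad k) * cis t) ^ j = exp (of_real (node k j) * (cis t * (1 + circ_corr k t)))))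
     \<and> (\<forall>k\<ge>K. \<forall>k'\<ge>K. \<bar>ln (rad_corr k) - ln (rad_corr k')\<bar> \<le> C * \<bar>1 / k - 1 / k'\<bar>)"
proof -
  obtain x B where x: "0 < x" "x \<le> rad_conv / 2" and B: "0 \<le> B"
    and Lam_exp: "\<And>z. norm z \<le> x \<Longrightarrow> Lam z = exp (z * log_quot z)"
    and Lip: "\<And>z w. norm z \<le> x \<Longrightarrow> norm w \<le> x \<Longrightarrow> norm (log_quot z - log_quot w) \<le> B * norm (z - w)"
    using log_quot by blast
  have l1: "0 < ln (2::real)" "ln (2::real) \<le> 1" using ln2_pos ln_le_minus_one[of 2] by simp_all
  have "0 < lam 1 * (x - 0)" using lam_1 x by simp
  then have rx: "1 < rLam x" using rLam_increasing[of 0 x] rLam_0 rad_conv(1) x by simp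
  have "(\<lambda>k. exp (ln 2 / real k)) \<longlonglongrightarrow> 1" by real_asymp
  then have "\<forall>\<^sub>F k in sequentially. exp (ln 2 / real k) < rLam x" using rx by (rule order_tendstoD(2))
  then obtain K0 where K0: "\<And>k. k \<ge> K0 \<Longrightarrow> exp (ln 2 / real k) < rLam x" by (auto simp: eventually_sequentially)
  define K where "K = max K0 1"
  have rLx: "rLam x \<le> rLam (rad_conv / 2)"
  proof -
    have "0 \<le> lam 1 * (rad_conv / 2 - x)" using lam_1 x by simp
    then show ?thesis using rLam_increasing[of x "rad_conv / 2"] x rad_conv(1) by simp
  qed
  have rad: "0 < rad k" "rad k \<le> x" "rLam (rad k) = exp (ln 2 / k)" "rad k < rad_conv" if "k \<ge> K" for k
  proof -
    have k: "0 < k" "exp (ln 2 / real k) < rLam x" using K0[of k] that by (auto simp: K_def)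
    have "\<exists>x. 0 < x \<and> x \<le> rad_conv / 2 \<and> rLam x = exp (ln 2 / k)"
      using k l1 rLx by (intro rLam_surj) auto
    from someI_ex[OF this] have r: "0 < rad k" "rad k \<le> rad_conv / 2" "rLam (rad k) = exp (ln 2 / k)"
      unfolding rad_def by auto
    show "rad k \<le> x"
    proof (rule ccontr)
      assume n: "\<not> rad k \<le> x"
      then have "0 \<le> lam 1 * (rad k - x)" using lam_1 by simp
      then show False using rLam_increasing[of x "rad k"] n x r k rad_conv(1) by simp
    qed
    show "0 < rad k" "rLam (rad k) = exp (ln 2 / k)" "rad k < rad_conv" using r rad_conv(1) by auto
  qed
  have radB: "rad k \<le> 2 / lam 1 / k" if "k \<ge> K" for k
  proof -
    have k: "0 < k" using that by (auto simp: K_def)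
    have "lam 1 * \<bar>rad k - 0\<bar> \<le> \<bar>rLam (rad k) - rLam 0\<bar>" using rad[OF that] rad_conv(1) by (intro rad_diff_le) auto
    also have "\<dots> = \<bar>exp (ln 2 / k) - exp 0\<bar>" using rad[OF that] rLam_0 by simp
    also have "\<dots> \<le> 2 * \<bar>ln 2 / k - 0\<bar>" using k l1 by (intro exp_diff_le) (auto simp: field_simps)
    finally have "lam 1 * rad k \<le> 2 * ln 2 / k" using rad(1)[OF that] k l1 by simp
    also have "\<dots> \<le> 2 / k" using l1 k by (simp add: field_simps)
    finally show ?thesis using lam_1 k by (simp add: field_simps)
  qed
  have lq: "log_quot (of_real (rad k)) = of_real (rad_corr k)" if "k \<ge> K" for k
  proof -
    have "Ln (Lam (of_real (rad k))) = of_real (ln 2 / k)"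
      using rad[OF that] by (subst Lam_of_real) (simp_all add: Ln_of_real)
    then show ?thesis using rad(1)[OF that] by (simp add: log_quot_def rad_corr_def)
  qed
  \<comment> \<open>rad k = O(1/k) bounds ln 2 / (k rad k) from below, so divisions by
    \<open>rad_corr\<close> are safe uniformly in k.\<close>
  have corr: "lam 1 * ln 2 / 2 \<le> rad_corr k" if "k \<ge> K" for k
  proof -
    have k: "0 < k" using that by (auto simp: K_def)
    have "k * rad k \<le> k * (2 / lam 1 / k)" using radB[OF that] by (intro mult_left_mono) auto
    also have "\<dots> = 2 / lam 1" using k by simp
    finally have "k * rad k \<le> 2 / lam 1" .
    then have "ln 2 / (2 / lam 1) \<le> ln 2 / (k * rad k)"
      using rad(1)[OF that] k l1 lam_1 by (intro divide_left_mono mult_pos_pos) auto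
    then show ?thesis by (simp add: rad_corr_def mult.commute)
  qed
  define c where "c = lam 1 * ln 2 / 2"
  have c: "0 < c" using lam_1 l1 by (simp add: c_def)
  define C where "C = B * (2 / lam 1) / c"
  have C: "0 \<le> C" using B lam_1 c by (simp add: C_def)
  have 1: "norm (circ_corr k t) \<le> C * \<bar>t\<bar> / k" if "k \<ge> K" for k t
  proof -
    have k: "0 < k" using that by (auto simp: K_def)
    have d: "0 < rad_corr k" using corr[OF that] c by (simp add: c_def)
    have quot: "norm (Q / of_real d - 1) = norm (Q - of_real d) / d" if "0 < d" for d :: real and Q :: complex
    proof -
      have "Q / of_real d - 1 = (Q - of_real d) / of_real d" using that by (simp add: diff_divide_distrib)
      then show ?thesis using that by (simp add: norm_divide)
    qed
    have "norm (circ_corr k t) = norm (log_quot (of_real (rad k) * cis t) - log_quot (of_real (rad k))) / rad_corr k"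
      using quot[OF d] lq[OF that] by (simp add: circ_corr_def)
    also have "\<dots> \<le> (B * norm (of_real (rad k) * cis t - of_real (rad k))) / c"
      using rad[OF that] corr[OF that] c B by (intro frac_le Lip) (auto simp: norm_mult c_def)
    also have "of_real (rad k) * cis t - of_real (rad k) = of_real (rad k) * (cis t - 1)" by (simp add: algebra_simps)
    also have "norm \<dots> = rad k * norm (cis t - 1)" using rad(1)[OF that] by (simp add: norm_mult)
    also have "B * (rad k * norm (cis t - 1)) / c \<le> B * (2 / lam 1 / k * \<bar>t\<bar>) / c"
      using c B lam_1 k by (intro divide_right_mono mult_left_mono mult_mono radB that norm_cis_minus_one_le) auto
    finally show ?thesis by (simp add: C_def field_simps)
  qed
  have 2: "Lam (of_real (rad k) * cis t) ^ j = exp (of_real (node k j) * (cis t * (1 + circ_corr k t)))" if "k \<ge> K" for k t j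
  proof -
    have k: "0 < k" using that by (auto simp: K_def)
    have d: "0 < rad_corr k" using corr[OF that] c by (simp add: c_def)
    have node: "node k j = j * (rad k * rad_corr k)" using rad(1)[OF that] k by (simp add: rad_corr_def)
    have "of_nat j * (of_real (rad k) * cis t * log_quot (of_real (rad k) * cis t)) = of_real (node k j) * (cis t * (1 + circ_corr k t))"
      unfolding node using d lq[OF that] by (simp add: circ_corr_def)
    moreover have "Lam (of_real (rad k) * cis t) = exp (of_real (rad k) * cis t * log_quot (of_real (rad k) * cis t))"
      using rad[OF that] by (intro Lam_exp) (simp add: norm_mult)
    ultimately show ?thesis by (simp only: exp_of_nat_mult[symmetric])
  qed
  define C' where "C' = B * (2 * ln 2 / lam 1) / c"
  have C': "0 \<le> C'" using B lam_1 c l1 by (simp add: C'_def)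
  have 3: "ln (rad_corr k) - ln (rad_corr k') \<le> C' * \<bar>1 / k - 1 / k'\<bar>" if "k \<ge> K" "k' \<ge> K" for k k'
  proof -
    have k: "0 < k" "0 < k'" using that by (auto simp: K_def)
    have d: "c \<le> rad_corr k'" "0 < rad_corr k" using corr that c by (force simp: c_def)+
    have "lam 1 * \<bar>rad k - rad k'\<bar> \<le> \<bar>rLam (rad k) - rLam (rad k')\<bar>" using rad[OF that(1)] rad[OF that(2)] by (intro rad_diff_le) auto
    also have "\<dots> = \<bar>exp (ln 2 / k) - exp (ln 2 / k')\<bar>" using rad that by simp
    also have "\<dots> \<le> 2 * \<bar>ln 2 / k - ln 2 / k'\<bar>" using k l1 by (intro exp_diff_le) (auto simp: field_simps)
    also have "\<bar>ln 2 / k - ln 2 / k'\<bar> = ln 2 * \<bar>1 / k - 1 / k'\<bar>"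
    proof -
      have "ln 2 / k - ln 2 / k' = ln 2 * (1 / k - 1 / k')" by (simp add: right_diff_distrib)
      then show ?thesis by (simp only: abs_mult abs_of_pos[OF l1(1)])
    qed
    finally have le: "lam 1 * \<bar>rad k - rad k'\<bar> \<le> 2 * (ln 2 * \<bar>1 / k - 1 / k'\<bar>)" .
    have "X \<le> 2 * c / l * Y" if "0 < l" "l * X \<le> 2 * (c * Y)" for X Y c l :: real
      using that by (simp add: field_simps)
    from this[OF lam_1 le] have r: "\<bar>rad k - rad k'\<bar> \<le> 2 * ln 2 / lam 1 * \<bar>1 / k - 1 / k'\<bar>" .
    have "ln (rad_corr k) - ln (rad_corr k') = ln (rad_corr k / rad_corr k')" using d c by (simp add: ln_div)
    also have "\<dots> \<le> rad_corr k / rad_corr k' - 1" using d c by (intro ln_le_minus_one) simp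
    also have "\<dots> = (rad_corr k - rad_corr k') / rad_corr k'" using d c by (simp add: diff_divide_distrib)
    also have "\<dots> \<le> (B * \<bar>rad k - rad k'\<bar>) / c"
    proof -
      have "rad_corr k - rad_corr k' \<le> norm (log_quot (of_real (rad k)) - log_quot (of_real (rad k')))"
        unfolding lq[OF that(1)] lq[OF that(2)] by (simp flip: of_real_diff)
      also have "\<dots> \<le> B * norm (complex_of_real (rad k) - of_real (rad k'))" using rad(1,2)[OF that(1)] rad(1,2)[OF that(2)] by (intro Lip) auto
      also have "\<dots> = B * \<bar>rad k - rad k'\<bar>" by (simp flip: of_real_diff)
      finally show ?thesis using d c B by (intro frac_le) auto
    qed
    also have "\<dots> \<le> B * (2 * ln 2 / lam 1 * \<bar>1 / k - 1 / k'\<bar>) / c"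
      using c B by (intro divide_right_mono mult_left_mono r) auto
    finally show ?thesis by (simp add: C'_def)
  qed
  have 4: "\<bar>ln (rad_corr k) - ln (rad_corr k')\<bar> \<le> (C + C') * \<bar>1 / k - 1 / k'\<bar>" if "k \<ge> K" "k' \<ge> K" for k k'
  proof -
    have "\<bar>ln (rad_corr k) - ln (rad_corr k')\<bar> \<le> C' * \<bar>1 / k - 1 / k'\<bar>"
      using 3[OF that] 3[OF that(2,1)] by (simp add: abs_le_iff abs_minus_commute)
    also have "\<dots> \<le> (C + C') * \<bar>1 / k - 1 / k'\<bar>" using C by (intro mult_right_mono) auto
    finally show ?thesis .
  qed
  have 5: "norm (circ_corr k t) \<le> (C + C') * \<bar>t\<bar> / k" if "k \<ge> K" for k t
    by (rule order_trans[OF 1[OF that]]) (intro divide_right_mono mult_right_mono, use C' in auto)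
  have 6: "0 < rad_corr k" if "k \<ge> K" for k using corr[OF that] c by (simp add: c_def)
  have K: "0 < K" "0 \<le> C + C'" using C C' by (simp_all add: K_def)
  have A: "\<forall>k\<ge>K. 0 < rad k \<and> rad k < rad_conv \<and> rLam (rad k) = exp (ln 2 / k) \<and> 0 < rad_corr k
     \<and> (\<forall>t. norm (circ_corr k t) \<le> (C + C') * \<bar>t\<bar> / k)
     \<and> (\<forall>t j. Lam (of_real (rad k) * cis t) ^ j = exp (of_real (node k j) * (cis t * (1 + circ_corr k t))))"
  proof (intro allI impI)
    fix k assume k: "K \<le> k"
    show "0 < rad k \<and> rad k < rad_conv \<and> rLam (rad k) = exp (ln 2 / k) \<and> 0 < rad_corr k
     \<and> (\<forall>t. norm (circ_corr k t) \<le> (C + C') * \<bar>t\<bar> / k)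
     \<and> (\<forall>t j. Lam (of_real (rad k) * cis t) ^ j = exp (of_real (node k j) * (cis t * (1 + circ_corr k t))))"
      by (intro conjI allI rad(1)[OF k] rad(3)[OF k] rad(4)[OF k] 2[OF k] 5[OF k] 6[OF k])
  qed
  have B: "\<forall>k\<ge>K. \<forall>k'\<ge>K. \<bar>ln (rad_corr k) - ln (rad_corr k')\<bar> \<le> (C + C') * \<bar>1 / k - 1 / k'\<bar>"
    by (intro allI impI 4)
  show ?thesis by (rule exI[of _ K], rule exI[of _ "C + C'"], intro conjI K A B)
qed

end

section \<open>Cauchy integrals\<close>

text \<open>The Cauchy integral, moved by periodicity from [0, 2 pi] to [- pi, pi] so that the
  saddle point at angle 0 is interior.\<close>

lemma coefficient_integral:
  fixes f :: "complex \<Rightarrow> complex"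
  assumes cont: "continuous_on (cball 0 r) f" and hol: "f holomorphic_on ball 0 r"
    and f: "f has_fps_expansion F" and r: "0 < r"
  shows "((\<lambda>t. f (of_real r * cis t) * cis (- (real n * t)) / of_real r ^ n) has_integral of_real (2 * pi) * fps_nth F n) {-pi..pi}"
proof -
  define g where "g = (\<lambda>t. f (of_real r * cis t) * cis (- (real n * t)) / of_real r ^ n)"
  have nth: "fps_nth F n = (deriv ^^ n) f 0 / fact n" using f by (rule fps_nth_fps_expansion)
  have "((\<lambda>u. f u / (u - 0) ^ Suc n) has_contour_integral (2 * pi * \<i>) / fact n * (deriv ^^ n) f 0) (circlepath 0 r)"
    using r by (intro Cauchy_has_contour_integral_higher_derivative_circlepath cont hol) auto
  then have 1: "((\<lambda>t. f (0 + r * cis t) / (0 + r * cis t - 0) ^ Suc n * r * \<i> * cis t) has_integral (2 * pi * \<i>) / fact n * (deriv ^^ n) f 0) {0..2 * pi}"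
    unfolding circlepath_def by (subst (asm) has_contour_integral_part_circlepath_iff) auto
  have 2: "f (0 + r * cis t) / (0 + r * cis t - 0) ^ Suc n * r * \<i> * cis t = \<i> * g t" for t
  proof -
    have "cis t / cis (real (Suc n) * t) = cis (- (real n * t))" by (simp add: cis_divide algebra_simps)
    then have "cis t / cis t ^ Suc n = cis (- (real n * t))" by (simp only: Complex.DeMoivre)
    moreover have "f (0 + r * cis t) / (0 + r * cis t - 0) ^ Suc n * r * \<i> * cis t = \<i> * (f (r * cis t) * (cis t / cis t ^ Suc n) / r ^ n)"
      using r by (simp add: power_mult_distrib mult_ac)
    ultimately show ?thesis by (simp only: g_def of_real_power)
  qed
  have 3: "(g has_integral of_real (2 * pi) * fps_nth F n) {0..2 * pi}"
  proof -
    have i: "- \<i> * (\<i> * Z) = Z" for Z by simp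
    have v: "P * \<i> / c * X = \<i> * (P * (X / c))" for P c X :: complex by simp
    have "((\<lambda>t. - \<i> * (\<i> * g t)) has_integral - \<i> * ((2 * pi * \<i>) / fact n * (deriv ^^ n) f 0)) {0..2 * pi}"
      by (rule has_integral_mult_right[OF 1[unfolded 2]])
    then have "(g has_integral 2 * pi * ((deriv ^^ n) f 0 / fact n)) {0..2 * pi}" unfolding i v .
    then show ?thesis by (simp only: nth)
  qed
  have per: "g (t + 2 * pi) = g t" for t
  proof -
    have g: "g t = f (of_real r * cis t) * inverse (cis t) ^ n / of_real r ^ n" for t
      by (simp add: g_def Complex.DeMoivre)
    have "cis (t + 2 * pi) = cis t" by (simp flip: cis_mult)
    then show ?thesis unfolding g by simp
  qed
  have cont_g: "continuous_on UNIV g"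
    unfolding g_def using r
    by (intro continuous_intros continuous_on_compose2[OF cont]) (auto simp: norm_mult)
  have int: "g integrable_on {a..b}" for a b
    by (rule integrable_continuous_real[OF continuous_on_subset[OF cont_g]]) simp
  have "integral {-pi..pi} g = integral {-pi..0} g + integral {0..pi} g"
    by (rule Henstock_Kurzweil_Integration.integral_combine[symmetric]) (use int in auto)
  also have "integral {-pi..0} g = integral {pi..2 * pi} g"
    using integral_shift_real_ivl[of pi "2 * pi" "2 * pi" g] by (simp add: per)
  also have "integral {pi..2 * pi} g + integral {0..pi} g = integral {0..2 * pi} g"
    by (subst add.commute, rule Henstock_Kurzweil_Integration.integral_combine) (use int in auto)
  also have "\<dots> = of_real (2 * pi) * fps_nth F n" using 3 by (rule integral_unique)
  finally show ?thesis using integrable_integral[OF int[of "-pi" pi]] unfolding g_def by simp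
qed

context fishburn_weights
begin

section \<open>The summands as analytic functions\<close>

definition lam_fps :: "complex fps" where "lam_fps = Abs_fps (\<lambda>j. complex_of_real (lam j))"

definition fb_fun :: "complex \<Rightarrow> nat \<Rightarrow> complex \<Rightarrow> complex" where
  "fb_fun v k z = Lam z ^ (k + 1) * v ^ k * (\<Prod>j=1..k. (Lam z ^ j - 1)\<^sup>2) * (\<Prod>j=1..k+1. inverse (1 - (v - 1) * (Lam z ^ j - 1)))"

lemma fb_fun_expansion: "fb_fun v k has_fps_expansion fishburn_term lam_fps v k"
proof -
  have q: "Lam has_fps_expansion lam_fps" using Lam_expands by (simp add: lam_fps_def)
  have q0: "fps_nth (1 - fps_const (v - 1) * (lam_fps ^ j - 1)) 0 \<noteq> 0" for j
    by (simp add: lam_fps_def lam_0 fps_power_zeroth)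
  have c: "(\<lambda>_. v ^ k) has_fps_expansion fps_const v ^ k" by (simp add: fps_const_power)
  show ?thesis
    unfolding fishburn_term_def fb_fun_def[abs_def]
    by (intro has_fps_expansion_mult has_fps_expansion_prod has_fps_expansion_power has_fps_expansion_inverse
        has_fps_expansion_diff has_fps_expansion_1 has_fps_expansion_const q q0 c)
qed

text \<open>The condition on v keeps |(v - 1) (Lam^j - 1)| below 1 on the closed disc, so that no
  denominator vanishes there.\<close>

lemma fb_coefficient_integral:
  assumes r: "0 < r" "r < rad_conv"
    and ne: "\<And>j. j \<in> {1..k+1} \<Longrightarrow> norm (v - 1) * (rLam r ^ j - 1) < 1"
  shows "((\<lambda>t. fb_fun v k (of_real r * cis t) * cis (- (real n * t)) / of_real r ^ n) has_integral
     of_real (2 * pi) * fps_nth (fishburn_term lam_fps v k) n) {-pi..pi}" (is ?int)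
    and "continuous_on UNIV (\<lambda>t. fb_fun v k (of_real r * cis t))" (is ?cont)
proof -
  have sub: "cball 0 r \<subseteq> ball (0 :: complex) rad_conv" using r by auto
  then have cont: "continuous_on (cball 0 r) Lam"
    using holomorphic_on_imp_continuous_on[OF rad_conv(2)] continuous_on_subset by blast
  have hol: "Lam holomorphic_on ball 0 r"
    by (rule holomorphic_on_subset[OF rad_conv(2)]) (use r in auto)
  have nz: "1 - (v - 1) * (Lam z ^ j - 1) \<noteq> 0" if "z \<in> cball 0 r" "j \<in> {1..k+1}" for z j
  proof
    assume "1 - (v - 1) * (Lam z ^ j - 1) = 0"
    then have "norm ((v - 1) * (Lam z ^ j - 1)) = norm (1 :: complex)" by (metis eq_iff_diff_eq_0)
    moreover have "norm ((v - 1) * (Lam z ^ j - 1)) \<le> norm (v - 1) * (rLam r ^ j - 1)"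
      unfolding norm_mult using that r by (intro mult_left_mono norm_Lam_power_minus_one_le) auto
    ultimately show False using ne[OF that(2)] by simp
  qed
  have cont': "continuous_on (cball 0 r) (fb_fun v k)"
    unfolding fb_fun_def[abs_def] by (intro continuous_intros cont ballI nz)
  show ?cont
    using r by (intro continuous_on_compose2[OF cont'] continuous_intros) (auto simp: norm_mult)
  show ?int
  proof (rule coefficient_integral[OF cont' _ fb_fun_expansion r(1)])
    show "fb_fun v k holomorphic_on ball 0 r"
      unfolding fb_fun_def[abs_def] by (intro holomorphic_intros hol nz) auto
  qed
qed

text \<open>On the circle of radius \<open>rad k\<close> the Cauchy integrand is \<open>fb_mass n k * fb_integrand s n k t\<close>,
  with \<open>fb_mass\<close> independent of the angle. Up to a bounded factor the integrand splits into a part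
  free of \<open>s\<close> and the part carrying \<open>v = exp (s / sqrt n)\<close>, which is already centred.\<close>

definition circ_arg :: "nat \<Rightarrow> real \<Rightarrow> complex" where "circ_arg k t = cis t * (1 + circ_corr k t)"

definition fb_phase :: "nat \<Rightarrow> nat \<Rightarrow> real \<Rightarrow> complex" where
  "fb_phase n k t = (\<Prod>j=1..k. (exp (of_real (node k j) * circ_arg k t) - 1) / (exp (complex_of_real (node k j)) - 1))\<^sup>2
     * cis (- (real n * t))"

definition fb_tilt :: "complex \<Rightarrow> nat \<Rightarrow> nat \<Rightarrow> real \<Rightarrow> complex" where
  "fb_tilt s n k t = exp (s * of_real (real k - fb_kappa / ln 2 * real n) / of_real (sqrt (real n)))
     * (\<Prod>j=1..k+1. inverse (1 - (exp (s / of_real (sqrt (real n))) - 1) * (exp (of_real (node k j) * circ_arg k t) - 1)))"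

definition fb_integrand :: "complex \<Rightarrow> nat \<Rightarrow> nat \<Rightarrow> real \<Rightarrow> complex" where
  "fb_integrand s n k t = exp (of_real (node k (k + 1)) * circ_arg k t) * fb_phase n k t * fb_tilt s n k t"

definition fb_mass :: "nat \<Rightarrow> nat \<Rightarrow> real" where
  "fb_mass n k = exp (saddle_log n k + real n * ln (rad_corr k) - real n * ln (ln 2))"

text \<open>By definition of \<open>rad_corr\<close>, n ln k + n ln (rad_corr k) - n ln (ln 2) is -
  n ln (rad k). The mass is thus the Cauchy integrand on the positive axis, without the bounded
  factor Lam^(k+1) and the factors that depend on v.\<close>

lemma fb_mass_eq:
  assumes k: "0 < k" and d: "0 < rad_corr k" and r: "0 < rad k"
  shows "of_real (fb_mass n k) = (\<Prod>j=1..k. exp (complex_of_real (node k j)) - 1)\<^sup>2 / of_real (rad k) ^ n"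
proof -
  have l: "0 < ln (2 :: real)" by (rule ln2_pos)
  have pos: "0 < exp (node k j) - 1" if "j \<in> {1..k}" for j using node_bounds[OF that] by simp
  have "exp (2 * log_qprod k (ln 2 / k)) = (exp (log_qprod k (ln 2 / k)))\<^sup>2" by (simp add: exp_double)
  also have "exp (log_qprod k (ln 2 / k)) = (\<Prod>j=1..k. exp (ln (exp (node k j) - 1)))"
    by (simp add: log_qprod_def exp_sum)
  also have "\<dots> = (\<Prod>j=1..k. exp (node k j) - 1)" using pos by (intro prod.cong refl exp_ln)
  finally have 1: "exp (2 * log_qprod k (ln 2 / k)) = (\<Prod>j=1..k. exp (node k j) - 1)\<^sup>2" .
  have lnr: "ln (rad k) = ln (ln 2) - (ln k + ln (rad_corr k))"
  proof -
    have "rad k = ln 2 / (k * rad_corr k)" using k r l by (simp add: rad_corr_def)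
    also have "ln \<dots> = ln (ln 2) - (ln k + ln (rad_corr k))"
      using k d l by (simp add: ln_div ln_mult)
    finally show ?thesis .
  qed
  have "fb_mass n k = exp (2 * log_qprod k (ln 2 / k) + - (real n * ln (rad k)))"
    unfolding fb_mass_def saddle_log_def lnr by (simp add: algebra_simps)
  also have "\<dots> = (\<Prod>j=1..k. exp (node k j) - 1)\<^sup>2 / rad k ^ n"
    using r unfolding exp_add exp_minus 1 by (simp add: exp_of_nat_mult divide_inverse)
  finally have "fb_mass n k = (\<Prod>j=1..k. exp (node k j) - 1)\<^sup>2 / rad k ^ n" .
  then show ?thesis by (simp only: of_real_divide of_real_power of_real_prod of_real_diff of_real_1 exp_of_real)
qed

lemma fb_fun_factor:
  assumes k: "0 < k" and d: "0 < rad_corr k" and r: "0 < rad k"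
    and L: "\<And>j. Lam (of_real (rad k) * cis t) ^ j = exp (of_real (node k j) * circ_arg k t)"
  shows "fb_fun (exp (s / of_real (sqrt (real n)))) k (of_real (rad k) * cis t) * cis (- (real n * t)) / of_real (rad k) ^ n
      * exp (- (s * of_real (fb_kappa / ln 2 * real n) / of_real (sqrt (real n))))
    = of_real (fb_mass n k) * fb_integrand s n k t"
proof -
  define w where "w = s / of_real (sqrt (real n))"
  have ne: "(\<Prod>j=1..k. exp (complex_of_real (node k j)) - 1) \<noteq> 0"
  proof -
    have "exp (complex_of_real (node k j)) - 1 \<noteq> 0" if "j \<in> {1..k}" for j
    proof
      assume "exp (complex_of_real (node k j)) - 1 = 0"
      then have "complex_of_real (exp (node k j)) = of_real 1" by (simp add: exp_of_real[symmetric] del: of_real_mult of_real_divide)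
      then have "exp (node k j) = 1" by (simp only: of_real_eq_iff)
      moreover have "1 < exp (node k j)" unfolding one_less_exp_iff using node_bounds[OF that] by blast
      ultimately show False by linarith
    qed
    then show ?thesis by (subst prod_zero_iff) auto
  qed
  have tilt: "exp w ^ k * exp (- (s * of_real (fb_kappa / ln 2 * real n) / of_real (sqrt (real n))))
      = exp (s * of_real (real k - fb_kappa / ln 2 * real n) / of_real (sqrt (real n)))"
    unfolding exp_of_nat_mult[symmetric] exp_add[symmetric] w_def
    by (simp add: right_diff_distrib diff_divide_distrib mult.commute)
  have alg: "X * V * P * W * c / R * D = Q\<^sup>2 / R * (X * ((P' / Q)\<^sup>2 * c) * (V * D * W))"
    if "P = P'\<^sup>2" "Q \<noteq> 0" for X V P W c R D P' Q :: complex
    using that by (simp add: power_divide)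
  show ?thesis
    unfolding fb_fun_def L fb_integrand_def fb_phase_def fb_tilt_def fb_mass_eq[OF k d r] prod_dividef
      w_def[symmetric] tilt[symmetric]
    by (rule alg[OF _ ne]) (simp add: prod_power_distrib)
qed

end

section \<open>Convergence of the rescaled sum\<close>

text \<open>The sum becomes the integral of a step function of x with steps of width 1 / c, which
  opens it to dominated convergence.\<close>

lemma sum_as_integral:
  fixes a :: "nat \<Rightarrow> complex" and c :: real and m :: nat
  assumes F: "finite F" "0 \<notin> F" and c: "0 < c"
  shows "has_bochner_integral lborel (\<lambda>x. if nat (int m + \<lfloor>x * c\<rfloor>) \<in> F then a (nat (int m + \<lfloor>x * c\<rfloor>)) else 0)
    ((\<Sum>k\<in>F. a k) / of_real c)"
proof -
  define I where "I k = {(real k - real m) / c..<(real k - real m + 1) / c}" for k :: nat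
  have I: "emeasure lborel (I k) = ennreal (1 / c)" for k
    using c unfolding I_def by (subst emeasure_lborel_Ico) (auto intro!: divide_right_mono simp: diff_divide_distrib[symmetric])
  have "has_bochner_integral lborel (\<lambda>x. \<Sum>k\<in>F. indicator (I k) x *\<^sub>R a k) (\<Sum>k\<in>F. measure lborel (I k) *\<^sub>R a k)"
    by (intro has_bochner_integral_sum has_bochner_integral_indicator) (simp_all add: I, simp add: I_def)
  moreover have "measure lborel (I k) = 1 / c" for k
    using c by (simp add: measure_def I)
  moreover have "(\<Sum>k\<in>F. indicator (I k) x *\<^sub>R a k) = (if nat (int m + \<lfloor>x * c\<rfloor>) \<in> F then a (nat (int m + \<lfloor>x * c\<rfloor>)) else 0)" for x
  proof -
    have "indicator (I k) x *\<^sub>R a k = (if nat (int m + \<lfloor>x * c\<rfloor>) = k then a k else 0)" if "k \<in> F" for k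
    proof -
      \<comment> \<open>Positivity of k excludes that \<open>nat\<close> has truncated a negative
        number to k; this is what 0 \<notin> F provides.\<close>
      have k: "0 < k" using that F(2) by (metis gr0I)
      have "nat (int m + \<lfloor>x * c\<rfloor>) = k \<longleftrightarrow> \<lfloor>x * c\<rfloor> = int k - int m" using k by linarith
      also have "\<dots> \<longleftrightarrow> real k - real m \<le> x * c \<and> x * c < real k - real m + 1" by (simp add: floor_eq_iff)
      also have "\<dots> \<longleftrightarrow> x \<in> I k" using c by (simp add: I_def field_simps)
      finally show ?thesis by (simp add: indicator_def)
    qed
    then have "(\<Sum>k\<in>F. indicator (I k) x *\<^sub>R a k) = (\<Sum>k\<in>F. if nat (int m + \<lfloor>x * c\<rfloor>) = k then a k else 0)"
      by (intro sum.cong refl)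
    then show ?thesis by (simp only: sum.delta'[OF F(1)])
  qed
  moreover have "(\<Sum>k\<in>F. (1 / c) *\<^sub>R a k) = (\<Sum>k\<in>F. a k) / of_real c"
    by (simp add: scaleR_conv_of_real sum_divide_distrib)
  ultimately show ?thesis by simp
qed

text \<open>The real part of b is a shift of the variable and the imaginary part a frequency, so an
  affine substitution reduces the integral to the characteristic function of the standard normal
  law.\<close>

lemma Gaussian_integral:
  fixes a :: real and b :: complex
  assumes a: "0 < a"
  shows "has_bochner_integral lborel (\<lambda>x::real. exp (b * of_real x - of_real (a * x\<^sup>2 / 2)))
    (of_real (sqrt (2 * pi / a)) * exp (b\<^sup>2 / of_real (2 * a)))"
proof -
  define p q where "p = Re b" and "q = Im b"
  define t where "t = q / sqrt a"
  define f where "f x = std_normal_density x *\<^sub>R exp (\<i> * of_real (t * x))" for x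
  have b: "b = of_real p + \<i> * of_real q" by (simp add: p_def q_def complex_eq)
  have int: "integrable lborel f"
  proof (rule Bochner_Integration.integrable_bound)
    show "integrable lborel std_normal_density" by simp
    show "f \<in> borel_measurable lborel" unfolding f_def by measurable
  qed (auto simp: f_def norm_exp_i_times)
  have "integral\<^sup>L lborel f = (LINT x|std_normal_distribution. exp (\<i> * of_real (t * x)))"
    unfolding f_def by (subst integral_density) auto
  also have "\<dots> = char std_normal_distribution t" by (simp add: char_def)
  also have "\<dots> = of_real (exp (- (t\<^sup>2) / 2))" by (simp add: char_std_normal_distribution)
  finally have "has_bochner_integral lborel f (of_real (exp (- (t\<^sup>2) / 2)))" using int by (simp add: has_bochner_integral_iff)
  then have "has_bochner_integral lborel (\<lambda>x. f (- (p / sqrt a) + sqrt a * x)) (of_real (exp (- (t\<^sup>2) / 2)) /\<^sub>R \<bar>sqrt a\<bar>)"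
    using a by (subst lborel_has_bochner_integral_real_affine_iff[symmetric]) auto
  then have "has_bochner_integral lborel (\<lambda>x. of_real (sqrt (2 * pi)) * exp (b\<^sup>2 / of_real (2 * a) + of_real (t\<^sup>2 / 2)) * f (- (p / sqrt a) + sqrt a * x))
     (of_real (sqrt (2 * pi)) * exp (b\<^sup>2 / of_real (2 * a) + of_real (t\<^sup>2 / 2)) * (of_real (exp (- (t\<^sup>2) / 2)) /\<^sub>R \<bar>sqrt a\<bar>))"
    by (rule has_bochner_integral_mult_right)
  moreover have "of_real (sqrt (2 * pi)) * exp (b\<^sup>2 / of_real (2 * a) + of_real (t\<^sup>2 / 2)) * f (- (p / sqrt a) + sqrt a * x)
      = exp (b * of_real x - of_real (a * x\<^sup>2 / 2))" for x
  proof -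
    define w where "w = - (p / sqrt a) + sqrt a * x"
    have w: "w\<^sup>2 = p\<^sup>2 / a - 2 * p * x + a * x\<^sup>2"
    proof -
      have "(- (p / r) + r * x)\<^sup>2 = p\<^sup>2 / r\<^sup>2 - 2 * p * x + r\<^sup>2 * x\<^sup>2" if "r \<noteq> 0" for r :: real
        using that by (simp add: power2_eq_square field_simps)
      from this[of "sqrt a"] show ?thesis using a by (simp add: w_def)
    qed
    have tw: "t * w = q * x - p * q / a" using a by (simp add: t_def w_def field_simps flip: power2_eq_square)
    have t2: "t\<^sup>2 = q\<^sup>2 / a" using a by (simp add: t_def power_divide)
    have "f w = of_real (1 / sqrt (2 * pi)) * of_real (exp (- w\<^sup>2 / 2)) * exp (\<i> * of_real (t * w))"
      by (simp add: f_def std_normal_density_def scaleR_conv_of_real)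
    then have "f w = of_real (1 / sqrt (2 * pi)) * exp (of_real (- w\<^sup>2 / 2) + \<i> * of_real (t * w))"
      by (simp only: exp_of_real exp_add mult.assoc)
    then have "of_real (sqrt (2 * pi)) * exp (b\<^sup>2 / of_real (2 * a) + of_real (t\<^sup>2 / 2)) * f w
        = exp (b\<^sup>2 / of_real (2 * a) + of_real (t\<^sup>2 / 2) + (of_real (- w\<^sup>2 / 2) + \<i> * of_real (t * w)))"
      by (simp add: exp_add)
    also have "b\<^sup>2 / of_real (2 * a) + of_real (t\<^sup>2 / 2) + (of_real (- w\<^sup>2 / 2) + \<i> * of_real (t * w)) = b * of_real x - of_real (a * x\<^sup>2 / 2)"
      using a unfolding w tw t2 b by (simp add: complex_eq_iff power2_eq_square field_simps)
    finally show ?thesis by (simp only: w_def)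
  qed
  moreover have "of_real (sqrt (2 * pi)) * exp (b\<^sup>2 / of_real (2 * a) + of_real (t\<^sup>2 / 2)) * (of_real (exp (- (t\<^sup>2) / 2)) /\<^sub>R \<bar>sqrt a\<bar>)
      = of_real (sqrt (2 * pi / a)) * exp (b\<^sup>2 / of_real (2 * a))"
  proof -
    have "exp (complex_of_real (t\<^sup>2 / 2)) * of_real (exp (- (t\<^sup>2) / 2)) = 1"
      unfolding exp_of_real[symmetric] exp_add[symmetric] by simp
    then have "X * (exp Y * exp (complex_of_real (t\<^sup>2 / 2))) * (of_real (exp (- (t\<^sup>2) / 2)) / Z) = X / Z * exp Y" for X Y Z :: complex
      by (simp add: field_simps)
    note eq = this[of "of_real (sqrt (2 * pi))" "b\<^sup>2 / of_real (2 * a)" "of_real (sqrt a)"]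
    have e1: "E /\<^sub>R \<bar>sqrt a\<bar> = E / of_real (sqrt a)" for E :: complex
      using a by (simp add: scaleR_conv_of_real divide_inverse)
    have e2: "complex_of_real (sqrt (2 * pi / a)) = of_real (sqrt (2 * pi)) / of_real (sqrt a)"
      by (simp add: real_sqrt_divide)
    show ?thesis unfolding exp_add e1 e2 by (rule eq)
  qed
  ultimately show ?thesis by simp
qed

lemma integrable_exp_neg_square:
  assumes "0 < c"
  shows "integrable lborel (\<lambda>x::real. exp (- (c * x\<^sup>2)))"
proof -
  have "integrable lborel (\<lambda>x::real. exp (0 * of_real x - of_real (2 * c * x\<^sup>2 / 2)) :: complex)"
    using Gaussian_integral[of "2 * c" 0] assms by (simp add: has_bochner_integral_iff)
  then have "integrable lborel (\<lambda>x::real. norm (exp (0 * of_real x - of_real (2 * c * x\<^sup>2 / 2)) :: complex))"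
    by (rule integrable_norm)
  then show ?thesis by (simp add: norm_exp_eq_Re)
qed

text \<open>Freezes the constants of \<open>saddle_circle\<close>, so that the estimates below share
  one K and one C.\<close>

locale fishburn_saddle = fishburn_weights +
  fixes K :: nat and C :: real
  assumes K_pos: "0 < K" and C_nonneg: "0 \<le> C"
    and rad_pos: "\<And>k. K \<le> k \<Longrightarrow> 0 < rad k"
    and rad_less: "\<And>k. K \<le> k \<Longrightarrow> rad k < rad_conv"
    and rLam_rad: "\<And>k. K \<le> k \<Longrightarrow> rLam (rad k) = exp (ln 2 / real k)"
    and rad_corr_pos: "\<And>k. K \<le> k \<Longrightarrow> 0 < rad_corr k"
    and circ_corr_le: "\<And>k t. K \<le> k \<Longrightarrow> norm (circ_corr k t) \<le> C * \<bar>t\<bar> / k"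
    and Lam_circ: "\<And>k t j. K \<le> k \<Longrightarrow> Lam (of_real (rad k) * cis t) ^ j = exp (of_real (node k j) * circ_arg k t)"
    and rad_corr_Lipschitz: "\<And>k k'. K \<le> k \<Longrightarrow> K \<le> k' \<Longrightarrow> \<bar>ln (rad_corr k) - ln (rad_corr k')\<bar> \<le> C * \<bar>1 / real k - 1 / real k'\<bar>"
begin

lemma window_facts:
  assumes "(\<lambda>n. (real (k n) - fb_kappa * real n) / sqrt (real n)) \<longlonglongrightarrow> x"
  shows "(\<lambda>n. real (k n) / real n) \<longlonglongrightarrow> fb_kappa"
    and "\<forall>\<^sub>F n in sequentially. fb_kappa / 2 * real n < real (k n) \<and> K \<le> k n"
proof -
  have "(\<lambda>n. fb_kappa + (real (k n) - fb_kappa * real n) / sqrt (real n) * (1 / sqrt (real n))) \<longlonglongrightarrow> fb_kappa + x * 0"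
    by (intro tendsto_add tendsto_mult tendsto_const assms) real_asymp
  moreover have "\<forall>\<^sub>F n in sequentially. fb_kappa + (real (k n) - fb_kappa * real n) / sqrt (real n) * (1 / sqrt (real n)) = real (k n) / real n"
    using eventually_gt_at_top[of 0] by eventually_elim (simp add: field_simps)
  ultimately have "(\<lambda>n. real (k n) / real n) \<longlonglongrightarrow> fb_kappa + x * 0" by (rule Lim_transform_eventually)
  then show lim: "(\<lambda>n. real (k n) / real n) \<longlonglongrightarrow> fb_kappa" by simp
  have "\<forall>\<^sub>F n in sequentially. fb_kappa / 2 < real (k n) / real n"
    by (rule order_tendstoD(1)[OF lim]) (use fb_kappa_pos in simp)
  moreover have "filterlim (\<lambda>n. fb_kappa / 2 * real n) at_top sequentially"
    using fb_kappa_pos by real_asymp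
  then have "\<forall>\<^sub>F n in sequentially. real K \<le> fb_kappa / 2 * real n" by (simp add: filterlim_at_top)
  ultimately show "\<forall>\<^sub>F n in sequentially. fb_kappa / 2 * real n < real (k n) \<and> K \<le> k n"
    using eventually_gt_at_top[of 0]
  proof eventually_elim
    case (elim n)
    have "fb_kappa / 2 * real n < real (k n)" using elim by (simp add: field_simps)
    with elim(2) show ?case by simp
  qed
qed

text \<open>The 2 is the limit of the factor Lam^(k+1). The correction r = \<open>circ_corr\<close>
  satisfies n r \<rightarrow> 0, as \<open>saddle_window\<close> requires, since |r| \<le> C |t| / k
  while k is of order n and t tends to 0.\<close>

lemma fb_integrand_limit:
  fixes k :: "nat \<Rightarrow> nat" and t :: "nat \<Rightarrow> real"
  assumes k_pos: "\<And>n. 0 < k n" and k_lim: "(\<lambda>n. (real (k n) - fb_kappa * real n) / sqrt (real n)) \<longlonglongrightarrow> x"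
    and t_lim: "(\<lambda>n. sqrt (real n) * t n) \<longlonglongrightarrow> y"
  shows "(\<lambda>n. fb_integrand s n (k n) (t n)) \<longlonglongrightarrow>
    2 * exp (\<i> * x * y / of_real fb_kappa - of_real ((2 * ln 2 * fb_kappa - 1 / 2) * y\<^sup>2))
      * exp (s * x / of_real (ln 2) + \<i> * s * y * of_real (fb_kappa * (2 - 1 / ln 2)) + s\<^sup>2 * of_real (fb_kappa / (4 * ln 2)))"
proof -
  have t0: "t \<longlonglongrightarrow> 0"
  proof -
    have "(\<lambda>n. sqrt (real n) * t n * (1 / sqrt (real n))) \<longlonglongrightarrow> y * 0"
      by (intro tendsto_mult t_lim) real_asymp
    moreover have "\<forall>\<^sub>F n in sequentially. sqrt (real n) * t n * (1 / sqrt (real n)) = t n"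
      using eventually_gt_at_top[of 0] by eventually_elim simp
    ultimately have "t \<longlonglongrightarrow> y * 0" by (rule Lim_transform_eventually)
    then show ?thesis by simp
  qed
  have r_lim: "(\<lambda>n. of_nat n * circ_corr (k n) (t n)) \<longlonglongrightarrow> 0"
  proof (rule Lim_null_comparison)
    show "\<forall>\<^sub>F n in sequentially. norm (of_nat n * circ_corr (k n) (t n)) \<le> 2 * C / fb_kappa * \<bar>t n\<bar>"
      using window_facts(2)[OF k_lim]
    proof eventually_elim
      case (elim n)
      have kn: "0 < k n" by (rule k_pos)
      have "norm (of_nat n * circ_corr (k n) (t n)) \<le> n * (C * \<bar>t n\<bar> / k n)"
        unfolding norm_mult using circ_corr_le[of "k n" "t n"] elim by (simp add: mult_left_mono del: times_divide_eq_right)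
      also have "\<dots> = C * \<bar>t n\<bar> * (n / k n)" by simp
      also have "\<dots> \<le> C * \<bar>t n\<bar> * (2 / fb_kappa)"
        using elim kn fb_kappa_pos C_nonneg by (intro mult_left_mono) (auto simp: field_simps)
      finally show ?case by (simp add: mult_ac)
    qed
    have "(\<lambda>n. 2 * C / fb_kappa * \<bar>t n\<bar>) \<longlonglongrightarrow> 2 * C / fb_kappa * \<bar>0\<bar>"
      by (intro tendsto_mult tendsto_const tendsto_rabs t0)
    then show "(\<lambda>n. 2 * C / fb_kappa * \<bar>t n\<bar>) \<longlonglongrightarrow> 0" by simp
  qed
  interpret saddle_window k t "\<lambda>n. circ_corr (k n) (t n)" "\<lambda>n. cis (t n) * (1 + circ_corr (k n) (t n))" x y
    by unfold_locales (use k_pos k_lim t_lim r_lim in auto)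
  have arg: "circ_arg (k n) (t n) = cis (t n) * (1 + circ_corr (k n) (t n))" for n by (simp add: circ_arg_def)
  have "(\<lambda>n. exp (of_real (node (k n) (k n + 1)) * circ_arg (k n) (t n))) \<longlonglongrightarrow> exp (of_real (1 * ln 2 + 0 * ln 2) * 1)"
  proof (intro tendsto_exp tendsto_mult tendsto_of_real)
    have inv: "(\<lambda>n. 1 / real (k n)) \<longlonglongrightarrow> 0"
    proof -
      have "(\<lambda>n. (1 / real n) / (real (k n) / real n)) \<longlonglongrightarrow> 0 / fb_kappa"
        using fb_kappa_pos by (intro tendsto_divide window_facts(1)[OF k_lim]) (real_asymp, simp)
      moreover have "\<forall>\<^sub>F n in sequentially. (1 / real n) / (real (k n) / real n) = 1 / real (k n)"
        using eventually_gt_at_top[of 0] by eventually_elim simp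
      ultimately have "(\<lambda>n. 1 / real (k n)) \<longlonglongrightarrow> 0 / fb_kappa" by (rule Lim_transform_eventually)
      then show ?thesis by simp
    qed
    have "(\<lambda>n. 1 * ln 2 + 1 / real (k n) * ln 2) \<longlonglongrightarrow> 1 * ln 2 + 0 * ln 2"
      by (intro tendsto_add tendsto_mult tendsto_const inv)
    moreover have "1 * ln 2 + 1 / real (k n) * ln 2 = node (k n) (k n + 1)" for n
      using k_pos[of n] by (simp add: field_simps)
    ultimately show "(\<lambda>n. node (k n) (k n + 1)) \<longlonglongrightarrow> 1 * ln 2 + 0 * ln 2" by simp
    show "(\<lambda>n. circ_arg (k n) (t n)) \<longlonglongrightarrow> 1" unfolding arg by (rule \<zeta>_lim)
  qed
  moreover have "exp (of_real (1 * ln 2 + 0 * ln 2) * 1) = (2 :: complex)" by (simp add: exp_of_real)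
  ultimately have 1: "(\<lambda>n. exp (of_real (node (k n) (k n + 1)) * circ_arg (k n) (t n))) \<longlonglongrightarrow> 2" by simp
  have 2: "(\<lambda>n. fb_phase n (k n) (t n)) \<longlonglongrightarrow> exp (\<i> * x * y / of_real fb_kappa - of_real ((2 * ln 2 * fb_kappa - 1 / 2) * y\<^sup>2))"
    unfolding fb_phase_def arg by (rule phase_limit)
  have 3: "(\<lambda>n. fb_tilt s n (k n) (t n)) \<longlonglongrightarrow>
      exp (s * x / of_real (ln 2) + \<i> * s * y * of_real (fb_kappa * (2 - 1 / ln 2)) + s\<^sup>2 * of_real (fb_kappa / (4 * ln 2)))"
    unfolding fb_tilt_def arg by (rule weight_limit)
  show ?thesis unfolding fb_integrand_def by (intro tendsto_mult 1 2 3)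
qed

lemma fb_mass_ratio: "fb_mass n k / fb_mass n k' = exp (saddle_log n k - saddle_log n k' + real n * (ln (rad_corr k) - ln (rad_corr k')))"
  by (simp add: fb_mass_def algebra_simps flip: exp_diff)

lemma saddle_idx_window: "(\<lambda>n. (real (saddle_idx n) - fb_kappa * real n) / sqrt (real n)) \<longlonglongrightarrow> 0"
proof (rule Lim_null_comparison)
  show "\<forall>\<^sub>F n in sequentially. norm ((real (saddle_idx n) - fb_kappa * real n) / sqrt (real n)) \<le> 1 / sqrt (real n)"
  proof (intro always_eventually allI)
    fix n :: nat
    have "\<bar>real (saddle_idx n) - fb_kappa * real n\<bar> \<le> 1" using saddle_idx_bounds[of n] by linarith
    then show "norm ((real (saddle_idx n) - fb_kappa * real n) / sqrt (real n)) \<le> 1 / sqrt (real n)"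
      by (simp add: divide_right_mono)
  qed
qed real_asymp

text \<open>The radius correction enters with weight n, but ln \<open>rad_corr\<close> is Lipschitz
  in 1 / k, and n / k has the limit 1 / fb_kappa both for k and for the saddle index; so it drops
  out.\<close>

lemma fb_mass_ratio_limit:
  fixes k :: "nat \<Rightarrow> nat"
  assumes k_pos: "\<And>n. 0 < k n" and k_lim: "(\<lambda>n. (real (k n) - fb_kappa * real n) / sqrt (real n)) \<longlonglongrightarrow> x"
  shows "(\<lambda>n. fb_mass n (k n) / fb_mass n (saddle_idx n)) \<longlonglongrightarrow> exp (- x\<^sup>2 / (2 * fb_kappa\<^sup>2))"
proof -
  have "(\<lambda>n. real n * (ln (rad_corr (k n)) - ln (rad_corr (saddle_idx n)))) \<longlonglongrightarrow> 0"
  proof (rule Lim_null_comparison)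
    define f where "f n = real (k n) / real n" for n
    define g where "g n = real (saddle_idx n) / real n" for n
    have f: "f \<longlonglongrightarrow> fb_kappa" "g \<longlonglongrightarrow> fb_kappa"
      unfolding f_def g_def by (rule window_facts(1)[OF k_lim], rule window_facts(1)[OF saddle_idx_window])
    show "\<forall>\<^sub>F n in sequentially. norm (real n * (ln (rad_corr (k n)) - ln (rad_corr (saddle_idx n)))) \<le> C * \<bar>inverse (f n) - inverse (g n)\<bar>"
      using window_facts(2)[OF k_lim] window_facts(2)[OF saddle_idx_window]
    proof eventually_elim
      case (elim n)
      have "norm (real n * (ln (rad_corr (k n)) - ln (rad_corr (saddle_idx n)))) \<le> n * (C * \<bar>1 / real (k n) - 1 / real (saddle_idx n)\<bar>)"
        unfolding real_norm_def abs_mult abs_of_nat using elim by (intro mult_left_mono rad_corr_Lipschitz) auto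
      also have "\<dots> = C * \<bar>real n * (1 / real (k n) - 1 / real (saddle_idx n))\<bar>" by (simp add: abs_mult)
      also have "real n * (1 / real (k n) - 1 / real (saddle_idx n)) = inverse (f n) - inverse (g n)"
        by (simp add: f_def g_def right_diff_distrib)
      finally show ?case .
    qed
    have "(\<lambda>n. C * \<bar>inverse (f n) - inverse (g n)\<bar>) \<longlonglongrightarrow> C * \<bar>inverse fb_kappa - inverse fb_kappa\<bar>"
      using fb_kappa_pos by (intro tendsto_mult tendsto_const tendsto_rabs tendsto_diff tendsto_inverse f) auto
    then show "(\<lambda>n. C * \<bar>inverse (f n) - inverse (g n)\<bar>) \<longlonglongrightarrow> 0" by simp
  qed
  from tendsto_add[OF saddle_log_limit[OF k_pos k_lim] this] show ?thesis
    unfolding fb_mass_ratio by (intro tendsto_exp) simp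
qed

lemma fb_integrand_bound:
  assumes \<epsilon>: "0 < \<epsilon>" "\<epsilon> \<le> fb_kappa"
  shows "\<exists>A B c (N::nat). 0 \<le> A \<and> 0 \<le> B \<and> 0 < c \<and> (\<forall>n\<ge>N. \<forall>k t. \<epsilon> * real n \<le> real k \<longrightarrow> 2 * k \<le> n \<longrightarrow> \<bar>t\<bar> \<le> pi \<longrightarrow>
    norm (of_real (fb_mass n k / fb_mass n (saddle_idx n)) * fb_integrand s n k t)
      \<le> exp (A + B * (\<bar>real k - fb_kappa * real n\<bar> / sqrt (real n)) + B * (sqrt (real n) * \<bar>t\<bar>)
         - c * ((real k - real (saddle_idx n))\<^sup>2 / n) - c * (n * t\<^sup>2)))"
proof -
  obtain A1 where A1: "0 \<le> A1" "\<And>n k. 0 < n \<Longrightarrow> \<epsilon> * real n \<le> real k \<Longrightarrow> 2 * k \<le> n \<Longrightarrow>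
      saddle_log n k - saddle_log n (saddle_idx n) \<le> A1 - (real k - real (saddle_idx n))\<^sup>2 / (4 * (fb_kappa + 1)\<^sup>2 * n)"
    using saddle_log_bound[OF \<epsilon>] by blast
  from weight_bound[OF C_nonneg, of s] obtain A2 B :: real and N2 :: nat where
    W: "0 \<le> A2 \<and> 0 \<le> B \<and> (\<forall>n\<ge>N2. \<forall>k t r. 0 < k \<longrightarrow> k \<le> n \<longrightarrow> norm r \<le> C * \<bar>t\<bar> \<longrightarrow> norm r \<le> 1 \<longrightarrow>
      norm (exp (s * (real k - fb_kappa / ln 2 * n) / of_real (sqrt n))
        * (\<Prod>j=1..k + 1. inverse (1 - (exp (s / of_real (sqrt n)) - 1) * (exp (node k j * (cis t * (1 + r))) - 1))))
      \<le> exp (A2 + B * (\<bar>real k - fb_kappa * n\<bar> / sqrt n) + B * (sqrt n * \<bar>t\<bar>)))"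
    by (elim exE) (rule that)
  note A2 = W[THEN conjunct1] W[THEN conjunct2, THEN conjunct1]
  note tilt = W[THEN conjunct2, THEN conjunct2, rule_format]
  define R where "R = C * pi"
  \<comment> \<open>The smaller of the two Gaussian rates: from \<open>saddle_log_bound\<close> in
    the index, and from \<open>phase_bound\<close> with k \<ge> \<epsilon> n in the angle.\<close>
  define c where "c = min (1 / (4 * (fb_kappa + 1)\<^sup>2)) (ln 2 / 36 * \<epsilon>)"
  have c: "0 < c" "c \<le> 1 / (4 * (fb_kappa + 1)\<^sup>2)" "c \<le> ln 2 / 36 * \<epsilon>"
    using fb_kappa_pos \<epsilon> ln2_pos by (auto simp: c_def intro!: mult_pos_pos divide_pos_pos zero_less_power)
  define A where "A = A1 + C / \<epsilon> + 4 + 6 * R + A2"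
  have R: "0 \<le> R" using C_nonneg by (simp add: R_def)
  have A: "0 \<le> A" using A1 A2 R C_nonneg \<epsilon> by (simp add: A_def)
  \<comment> \<open>Forces k \<ge> \<epsilon> n past both K and R, so that the circle estimates hold
    and \<open>circ_corr\<close> has norm at most 1.\<close>
  obtain N3 :: nat where N3: "max K R + 1 \<le> \<epsilon> * N3"
    using real_arch_simple[of "(max K R + 1) / \<epsilon>"] \<epsilon> by (auto simp: field_simps)
  define N where "N = max (max N2 N3) 1"
  have main: "norm (of_real (fb_mass n k / fb_mass n (saddle_idx n)) * fb_integrand s n k t)
      \<le> exp (A + B * (\<bar>real k - fb_kappa * real n\<bar> / sqrt (real n)) + B * (sqrt (real n) * \<bar>t\<bar>)
         - c * ((real k - real (saddle_idx n))\<^sup>2 / n) - c * (n * t\<^sup>2))"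
    if n: "N \<le> n" and k: "\<epsilon> * real n \<le> real k" "2 * k \<le> n" and t: "\<bar>t\<bar> \<le> pi" for n k t
  proof -
    have n': "0 < n" "N2 \<le> n" "N3 \<le> n" using n by (auto simp: N_def)
    have "\<epsilon> * N3 \<le> \<epsilon> * n" using n' \<epsilon> by simp
    then have en: "max K R + 1 \<le> \<epsilon> * n" using N3 by linarith
    then have "K + 1 \<le> \<epsilon> * n" "R + 1 \<le> \<epsilon> * n" by simp_all
    then have Kk: "K \<le> k" "R \<le> k" "0 < k" using k(1) R by linarith+
    have "\<epsilon> * n \<le> fb_kappa * n" using \<epsilon> by (intro mult_right_mono) auto
    then have l: "\<epsilon> * n \<le> saddle_idx n" using saddle_idx_bounds(1)[of n] by linarith
    have Kl: "K \<le> saddle_idx n" using l en by linarith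
    define r where "r = circ_corr k t"
    have r: "norm r \<le> C * \<bar>t\<bar> / k" unfolding r_def using Kk by (intro circ_corr_le)
    have r1: "norm r \<le> C * \<bar>t\<bar>"
    proof -
      have "C * \<bar>t\<bar> / k \<le> C * \<bar>t\<bar> / 1" using Kk C_nonneg by (intro divide_left_mono) auto
      then show ?thesis using r by simp
    qed
    have r2: "norm r \<le> R / k"
      by (rule order_trans[OF r]) (use t C_nonneg in \<open>auto simp: R_def intro!: divide_right_mono mult_left_mono\<close>)
    have r3: "norm r \<le> 1" by (rule order_trans[OF r2]) (use Kk in simp)
    have arg: "circ_arg k t = cis t * (1 + r)" by (simp add: circ_arg_def r_def)
    have mass: "fb_mass n k / fb_mass n (saddle_idx n) \<le> exp (A1 + C / \<epsilon> - c * ((real k - real (saddle_idx n))\<^sup>2 / n))"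
    proof -
      have "real n * (ln (rad_corr k) - ln (rad_corr (saddle_idx n))) \<le> n * (C * (1 / (\<epsilon> * n)))"
      proof (intro mult_left_mono)
        have inv: "1 / real k \<le> 1 / (\<epsilon> * n)" "1 / real (saddle_idx n) \<le> 1 / (\<epsilon> * n)"
          using k(1) l \<epsilon> n' Kk Kl K_pos by (intro divide_left_mono mult_pos_pos; simp)+
        have "0 \<le> 1 / real k" "0 \<le> 1 / real (saddle_idx n)" by simp_all
        then have "\<bar>1 / real k - 1 / real (saddle_idx n)\<bar> \<le> 1 / (\<epsilon> * n)" using inv by linarith
        then have "C * \<bar>1 / real k - 1 / real (saddle_idx n)\<bar> \<le> C * (1 / (\<epsilon> * n))" using C_nonneg by (rule mult_left_mono)
        then show "ln (rad_corr k) - ln (rad_corr (saddle_idx n)) \<le> C * (1 / (\<epsilon> * n))"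
          using rad_corr_Lipschitz[OF Kk(1) Kl] by linarith
      qed simp
      also have "n * (C * (1 / (\<epsilon> * n))) = C / \<epsilon>" using n' by simp
      finally have 1: "real n * (ln (rad_corr k) - ln (rad_corr (saddle_idx n))) \<le> C / \<epsilon>" .
      have "c * ((real k - real (saddle_idx n))\<^sup>2 / n) \<le> 1 / (4 * (fb_kappa + 1)\<^sup>2) * ((real k - real (saddle_idx n))\<^sup>2 / n)"
        by (intro mult_right_mono c) auto
      also have "\<dots> = (real k - real (saddle_idx n))\<^sup>2 / (4 * (fb_kappa + 1)\<^sup>2 * n)" by simp
      finally show ?thesis using A1(2)[OF n'(1) k] 1 unfolding fb_mass_ratio by (simp only: exp_le_cancel_iff)
    qed
    have last: "norm (exp (of_real (node k (k + 1)) * circ_arg k t)) \<le> exp 4"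
    proof -
      have nd: "0 < node k (k + 1) \<and> node k (k + 1) \<le> 2" by (rule node_bounds_Suc) (use Kk in auto)
      have "norm (circ_arg k t) \<le> norm (1 :: complex) + norm r" unfolding arg norm_mult by (simp only: norm_cis mult_1 norm_triangle_ineq)
      also have "\<dots> \<le> 2" using r3 by simp
      finally have "norm (complex_of_real (node k (k + 1)) * circ_arg k t) \<le> 2 * 2"
        unfolding norm_mult norm_of_real using nd by (intro mult_mono) auto
      then have "Re (complex_of_real (node k (k + 1)) * circ_arg k t) \<le> 4"
        using complex_Re_le_cmod order_trans by fastforce
      then show ?thesis unfolding norm_exp_eq_Re by (simp only: exp_le_cancel_iff)
    qed
    have phase: "norm (fb_phase n k t) \<le> exp (6 * R - c * (n * t\<^sup>2))"
    proof -
      have "norm (fb_phase n k t) \<le> exp (6 * R) * exp (- (ln 2 / 36 * k * t\<^sup>2))"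
        using phase_bound[OF Kk(3) t r2 r3] unfolding fb_phase_def arg norm_mult norm_cis mult_1_right .
      also have "\<dots> = exp (6 * R - ln 2 / 36 * k * t\<^sup>2)" by (simp flip: exp_add)
      also have "\<dots> \<le> exp (6 * R - c * (n * t\<^sup>2))"
      proof -
        have "c * (n * t\<^sup>2) \<le> ln 2 / 36 * \<epsilon> * (n * t\<^sup>2)" by (intro mult_right_mono c) auto
        also have "\<dots> = ln 2 / 36 * t\<^sup>2 * (\<epsilon> * n)" by simp
        also have "\<dots> \<le> ln 2 / 36 * t\<^sup>2 * k" using ln2_pos by (intro mult_left_mono k) auto
        finally show ?thesis by (simp add: mult_ac)
      qed
      finally show ?thesis .
    qed
    have tlt: "norm (fb_tilt s n k t) \<le> exp (A2 + B * (\<bar>real k - fb_kappa * real n\<bar> / sqrt (real n)) + B * (sqrt (real n) * \<bar>t\<bar>))"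
      unfolding fb_tilt_def arg by (rule tilt) (use n' Kk k r1 r3 in auto)
    have m0: "0 \<le> fb_mass n k / fb_mass n (saddle_idx n)" by (simp add: fb_mass_def)
    have "norm (of_real (fb_mass n k / fb_mass n (saddle_idx n)) * fb_integrand s n k t)
        = fb_mass n k / fb_mass n (saddle_idx n) * (norm (exp (of_real (node k (k + 1)) * circ_arg k t)) * norm (fb_phase n k t) * norm (fb_tilt s n k t))"
      unfolding norm_mult norm_of_real fb_integrand_def abs_of_nonneg[OF m0] ..
    also have "\<dots> \<le> exp (A1 + C / \<epsilon> - c * ((real k - real (saddle_idx n))\<^sup>2 / n)) * (exp 4 * exp (6 * R - c * (n * t\<^sup>2))
        * exp (A2 + B * (\<bar>real k - fb_kappa * real n\<bar> / sqrt (real n)) + B * (sqrt (real n) * \<bar>t\<bar>)))"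
      by (intro mult_mono mass last phase tlt m0 mult_nonneg_nonneg norm_ge_zero exp_ge_zero)
    also have "\<dots> = exp (A1 + C / \<epsilon> - c * ((real k - real (saddle_idx n))\<^sup>2 / n) + (4 + (6 * R - c * (n * t\<^sup>2))
        + (A2 + B * (\<bar>real k - fb_kappa * real n\<bar> / sqrt (real n)) + B * (sqrt (real n) * \<bar>t\<bar>))))"
      by (simp only: exp_add)
    also have "A1 + C / \<epsilon> - c * ((real k - real (saddle_idx n))\<^sup>2 / n) + (4 + (6 * R - c * (n * t\<^sup>2))
        + (A2 + B * (\<bar>real k - fb_kappa * real n\<bar> / sqrt (real n)) + B * (sqrt (real n) * \<bar>t\<bar>)))
      = A + B * (\<bar>real k - fb_kappa * real n\<bar> / sqrt (real n)) + B * (sqrt (real n) * \<bar>t\<bar>)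
         - c * ((real k - real (saddle_idx n))\<^sup>2 / n) - c * (n * t\<^sup>2)"
      by (simp add: A_def)
    finally show ?thesis .
  qed
  show ?thesis
    by (intro exI[of _ A] exI[of _ B] exI[of _ c] exI[of _ N] conjI A A2(2) c(1) allI impI main)
qed

end

text \<open>From cos 1.63 < 0. The bound is just sharp enough for pi^2 < 24 (ln 2)^2 with ln 2 \<ge>
  2/3: 3.26^2 = 10.6276 against 32/3.\<close>

lemma pi_less_3_26: "pi < 326 / 100"
proof -
  obtain t where t: "cos (163 / 100 :: real) = (\<Sum>m<6. cos_coeff m * (163 / 100) ^ m) + cos (t + 1 / 2 * real 6 * pi) / fact 6 * (163 / 100) ^ 6"
    using Maclaurin_cos_expansion2[of "163 / 100" 6] by auto
  have "cos (t + 1 / 2 * real 6 * pi) \<le> 1" by (rule cos_le_one)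
  then have "cos (t + 1 / 2 * real 6 * pi) / fact 6 * (163 / 100) ^ 6 \<le> 1 / fact 6 * (163 / 100) ^ 6"
    by (intro mult_right_mono divide_right_mono) auto
  moreover have "(\<Sum>m<6. cos_coeff m * (163 / 100) ^ m) + 1 / fact 6 * (163 / 100) ^ 6 < (0 :: real)"
    by (simp add: lessThan_nat_numeral cos_coeff_def fact_numeral power_divide)
  ultimately have "cos (163 / 100 :: real) < 0" unfolding t by linarith
  then have "\<not> 163 / 100 \<le> pi / 2" using cos_ge_zero[of "163 / 100"] pi_gt3 by fastforce
  then show ?thesis by simp
qed

text \<open>The first inequality puts the dominant index inside the range 2 k \<le> n where
  coefficients survive. The second is decay in the angle: the limiting Gaussian is exp (- V y^2 / 2)
  with V = 4 ln 2 fb_kappa - 1.\<close>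

lemma fb_kappa_bounds: "fb_kappa < 1 / 2" "1 < 4 * ln 2 * fb_kappa"
proof -
  have l: "2 / 3 \<le> ln (2 :: real)" "ln (2 :: real) \<le> 25 / 36" by (rule ln2_ge_two_thirds, rule ln2_le_25_over_36)
  have "3 * 3 < pi * pi" using pi_gt3 by (intro mult_strict_mono) auto
  then have "12 * ln 2 < pi\<^sup>2" using l by (simp add: power2_eq_square)
  then show "fb_kappa < 1 / 2" by (simp add: fb_kappa_def field_simps)
  have "pi * pi < 326 / 100 * (326 / 100)" using pi_less_3_26 by (intro mult_strict_mono) auto
  moreover have "2 / 3 * (2 / 3) \<le> ln 2 * ln (2 :: real)" using l by (intro mult_mono) auto
  ultimately have "pi\<^sup>2 < 24 * (ln 2 * ln 2)" by (simp add: power2_eq_square)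
  then show "1 < 4 * ln 2 * fb_kappa" by (simp add: fb_kappa_def field_simps)
qed

text \<open>The summation index attached to the coordinate x, in the shape that
  \<open>sum_as_integral\<close> uses.\<close>

definition win_idx :: "nat \<Rightarrow> real \<Rightarrow> nat" where
  "win_idx n x = nat (int (saddle_idx n) + \<lfloor>x * sqrt (real n)\<rfloor>)"

text \<open>For fixed x the index grows like fb_kappa n, so the maximum with 1 acts only for
  finitely many n; it keeps the sequence positive throughout, as \<open>saddle_window\<close>
  demands.\<close>

lemma win_idx_lim: "(\<lambda>n. (real (max 1 (win_idx n x)) - fb_kappa * real n) / sqrt (real n)) \<longlonglongrightarrow> x"
proof (rule LIM_zero_cancel, rule Lim_null_comparison)
  have "filterlim (\<lambda>n. sqrt (real n)) at_top sequentially" by real_asymp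
  then have "\<forall>\<^sub>F n in sequentially. (\<bar>x\<bar> + 4) / fb_kappa + 1 \<le> sqrt (real n)" by (simp add: filterlim_at_top)
  then show "\<forall>\<^sub>F n in sequentially. norm ((real (max 1 (win_idx n x)) - fb_kappa * real n) / sqrt (real n) - x) \<le> 2 / sqrt (real n)"
  proof eventually_elim
    case (elim n)
    have kap: "0 < fb_kappa" by (rule fb_kappa_pos)
    define q where "q = sqrt (real n)"
    have q: "(\<bar>x\<bar> + 4) / fb_kappa \<le> q" "q * q = n" using elim by (simp_all add: q_def)
    have q1: "1 \<le> q"
    proof -
      have "0 \<le> (\<bar>x\<bar> + 4) / fb_kappa" using kap by simp
      then show ?thesis using elim unfolding q_def by linarith
    qed
    have "\<bar>x\<bar> + 4 \<le> fb_kappa * q" using q(1) kap by (simp add: field_simps)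
    then have "(\<bar>x\<bar> + 4) * q \<le> fb_kappa * q * q" using q1 by (intro mult_right_mono) auto
    then have big: "\<bar>x\<bar> * q + 4 * q \<le> fb_kappa * n" by (simp add: q(2) distrib_right mult.assoc)
    have "- (x * q) \<le> \<bar>x\<bar> * q" using q1 mult_right_mono[of "- x" "\<bar>x\<bar>" q] by simp
    then have "1 < real (saddle_idx n) + of_int \<lfloor>x * q\<rfloor>" using big q1 saddle_idx_bounds[of n] by linarith
    then have "real (max 1 (win_idx n x)) = real (saddle_idx n) + of_int \<lfloor>x * q\<rfloor>" by (simp add: win_idx_def q_def max_def)
    then have "\<bar>real (max 1 (win_idx n x)) - fb_kappa * n - x * q\<bar> \<le> 2" using saddle_idx_bounds[of n] by linarith
    then have "\<bar>real (max 1 (win_idx n x)) - fb_kappa * n - x * q\<bar> / q \<le> 2 / q" using q1 by (intro divide_right_mono) auto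
    moreover have "norm ((real (max 1 (win_idx n x)) - fb_kappa * real n) / q - x) = \<bar>real (max 1 (win_idx n x)) - fb_kappa * n - x * q\<bar> / q"
    proof -
      have "(a - b) / q - x = (a - b - x * q) / q" for a b using q1 by (simp add: field_simps)
      then show ?thesis using q1 by simp
    qed
    ultimately show ?case by (simp only: q_def)
  qed
qed real_asymp

text \<open>Rounding costs at most 1 in x sqrt n, so (k - l)^2 / n \<ge> x^2 / 2 - 1 with l the
  saddle index. The linear terms are absorbed by B |w| \<le> (c / 4) w^2 + B^2 / c, leaving the rate
  c / 4 in each variable.\<close>

lemma win_idx_exponent:
  assumes n: "0 < n" and k: "k = win_idx n x" "0 < k" and B: "0 \<le> B" and c: "0 < c"
  shows "A + B * (\<bar>real k - fb_kappa * real n\<bar> / sqrt (real n)) + B * (sqrt (real n) * \<bar>y / sqrt (real n)\<bar>)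
         - c * ((real k - real (saddle_idx n))\<^sup>2 / n) - c * (n * (y / sqrt (real n))\<^sup>2)
       \<le> A + 2 * B + c + 2 * B\<^sup>2 / c - c / 4 * x\<^sup>2 - c / 4 * y\<^sup>2"
proof -
  define q where "q = sqrt (real n)"
  have q: "0 < q" "1 \<le> q" "q\<^sup>2 = n" using n by (auto simp: q_def)
  define f where "f = real_of_int \<lfloor>x * q\<rfloor>"
  have f: "\<bar>f - x * q\<bar> \<le> 1" unfolding f_def by linarith
  have kf: "real k = real (saddle_idx n) + f" using k by (simp add: win_idx_def f_def q_def)
  have "\<bar>real k - fb_kappa * n\<bar> \<le> \<bar>x * q\<bar> + 2" using f kf saddle_idx_bounds[of n] by linarith
  also have "\<dots> \<le> (\<bar>x\<bar> + 2) * q" using q by (simp add: abs_mult distrib_right)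
  finally have 1: "\<bar>real k - fb_kappa * n\<bar> / q \<le> \<bar>x\<bar> + 2" using q by (simp add: field_simps)
  have 2: "x\<^sup>2 / 2 - 1 \<le> (real k - real (saddle_idx n))\<^sup>2 / n"
  proof -
    have "\<bar>x * q\<bar> \<le> \<bar>f\<bar> + 1" using f by linarith
    then have "\<bar>x * q\<bar>\<^sup>2 \<le> (\<bar>f\<bar> + 1)\<^sup>2" by (intro power_mono) auto
    also have "\<dots> \<le> 2 * f\<^sup>2 + 2 * 1"
      using zero_le_power2[of "\<bar>f\<bar> - 1"] by (simp add: power2_sum power2_diff)
    also have "\<dots> \<le> 2 * f\<^sup>2 + 2 * n" using n by simp
    finally have "x\<^sup>2 * n \<le> 2 * f\<^sup>2 + 2 * n" using q(3) by (simp add: power_mult_distrib)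
    then show ?thesis using n by (simp add: kf field_simps)
  qed
  have 3: "q * \<bar>y / q\<bar> = \<bar>y\<bar>" "n * (y / q)\<^sup>2 = y\<^sup>2"
    using q(1) n by (simp_all add: abs_div_pos[symmetric] power_divide q(3))
  have sq: "B * \<bar>w\<bar> \<le> c / 4 * w\<^sup>2 + B\<^sup>2 / c" for w
  proof -
    have "0 \<le> (c * \<bar>w\<bar> - 2 * B)\<^sup>2" by simp
    then have "4 * c * (B * \<bar>w\<bar>) \<le> c\<^sup>2 * w\<^sup>2 + 4 * B\<^sup>2" by (simp add: power2_diff power_mult_distrib mult_ac)
    then show ?thesis using c by (simp add: field_simps power2_eq_square)
  qed
  have "B * (\<bar>real k - fb_kappa * real n\<bar> / q) \<le> B * (\<bar>x\<bar> + 2)" using B 1 by (rule mult_left_mono[rotated])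
  moreover have "c * (x\<^sup>2 / 2 - 1) \<le> c * ((real k - real (saddle_idx n))\<^sup>2 / n)" using c 2 by (intro mult_left_mono) simp_all
  moreover have "c / 4 * y\<^sup>2 \<le> c * y\<^sup>2 - c / 4 * y\<^sup>2" using c by (simp add: field_simps)
  ultimately show ?thesis using sq[of x] sq[of y] unfolding q_def[symmetric] 3 by (simp add: algebra_simps)
qed

section \<open>The limiting Gaussian and its double integral\<close>

definition fb_limit :: "complex \<Rightarrow> real \<Rightarrow> real \<Rightarrow> complex" where
  "fb_limit s x y = of_real (exp (- x\<^sup>2 / (2 * fb_kappa\<^sup>2))) *
     (2 * exp (\<i> * x * y / of_real fb_kappa - of_real ((2 * ln 2 * fb_kappa - 1 / 2) * y\<^sup>2))
      * exp (s * x / of_real (ln 2) + \<i> * s * y * of_real (fb_kappa * (2 - 1 / ln 2)) + s\<^sup>2 * of_real (fb_kappa / (4 * ln 2))))"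

text \<open>For fixed x the exponent is quadratic in y with rate V and linear coefficient i (x /
  fb_kappa + s fb_kappa m). The square of the latter also feeds the x^2 term, whence 1 + 1 /
  V.\<close>

lemma fb_limit_integral:
  defines "V \<equiv> 4 * ln 2 * fb_kappa - 1" and "m \<equiv> 2 - 1 / ln (2 :: real)"
  shows "has_bochner_integral lborel (fb_limit s x)
    (2 * of_real (sqrt (2 * pi / V)) * exp ((s * of_real (1 / ln 2 - m / V)) * of_real x - of_real ((1 + 1 / V) / fb_kappa\<^sup>2 * x\<^sup>2 / 2)
       + s\<^sup>2 * of_real (fb_kappa / (4 * ln 2) - fb_kappa\<^sup>2 * m\<^sup>2 / (2 * V))))"
proof -
  have V: "0 < V" using fb_kappa_bounds by (simp add: V_def)
  have kap: "0 < fb_kappa" by (rule fb_kappa_pos)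
  define b where "b = \<i> * (of_real (x / fb_kappa) + s * of_real (fb_kappa * m))"
  define e where "e = of_real (- x\<^sup>2 / (2 * fb_kappa\<^sup>2)) + s * x / of_real (ln 2) + s\<^sup>2 * of_real (fb_kappa / (4 * ln 2))"
  have "has_bochner_integral lborel (\<lambda>y::real. 2 * exp e * exp (b * of_real y - of_real (V * y\<^sup>2 / 2)))
     (2 * exp e * (of_real (sqrt (2 * pi / V)) * exp (b\<^sup>2 / of_real (2 * V))))"
    by (intro has_bochner_integral_mult_right Gaussian_integral V)
  moreover have "2 * exp e * exp (b * of_real y - of_real (V * y\<^sup>2 / 2)) = fb_limit s x y" for y
  proof -
    have eq: "e + (b * of_real y - of_real (V * y\<^sup>2 / 2)) = of_real (- x\<^sup>2 / (2 * fb_kappa\<^sup>2)) + (\<i> * x * y / of_real fb_kappa - of_real ((2 * ln 2 * fb_kappa - 1 / 2) * y\<^sup>2)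
      + (s * x / of_real (ln 2) + \<i> * s * y * of_real (fb_kappa * m) + s\<^sup>2 * of_real (fb_kappa / (4 * ln 2))))"
      by (simp add: e_def b_def V_def algebra_simps diff_divide_distrib)
    have "2 * exp e * exp (b * of_real y - of_real (V * y\<^sup>2 / 2)) = 2 * exp (e + (b * of_real y - of_real (V * y\<^sup>2 / 2)))"
      by (simp only: exp_add mult.assoc)
    also have "\<dots> = fb_limit s x y"
      unfolding eq fb_limit_def m_def[symmetric] exp_of_real[symmetric] by (simp only: exp_add mult_ac)
    finally show ?thesis .
  qed
  moreover have "2 * exp e * (of_real (sqrt (2 * pi / V)) * exp (b\<^sup>2 / of_real (2 * V))) = 2 * of_real (sqrt (2 * pi / V)) * exp (e + b\<^sup>2 / of_real (2 * V))"
    by (simp only: exp_add mult_ac)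
  moreover have "e + b\<^sup>2 / of_real (2 * V) = (s * of_real (1 / ln 2 - m / V)) * of_real x - of_real ((1 + 1 / V) / fb_kappa\<^sup>2 * x\<^sup>2 / 2)
       + s\<^sup>2 * of_real (fb_kappa / (4 * ln 2) - fb_kappa\<^sup>2 * m\<^sup>2 / (2 * V))"
  proof -
    have gen: "- X\<^sup>2 / (2 * k\<^sup>2) + s * X / l + s\<^sup>2 * g + (\<i> * (X / k + s * (k * mm)))\<^sup>2 / (2 * v)
      = s * (1 / l - mm / v) * X - (1 + 1 / v) / k\<^sup>2 * X\<^sup>2 / 2 + s\<^sup>2 * (g - k\<^sup>2 * mm\<^sup>2 / (2 * v))"
      if "k \<noteq> 0" "v \<noteq> 0" "l \<noteq> 0" for X k l g v mm :: complex
    proof -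
      have sq: "(\<i> * (X / k + s * (k * mm)))\<^sup>2 = - (X\<^sup>2 / k\<^sup>2 + 2 * X * s * mm + s\<^sup>2 * k\<^sup>2 * mm\<^sup>2)"
        using that by (simp add: power_mult_distrib power2_sum power_divide)
      show ?thesis unfolding sq using that by (simp add: field_simps)
    qed
    show ?thesis
      unfolding e_def b_def of_real_add of_real_diff of_real_mult of_real_divide of_real_power of_real_minus of_real_1 of_real_numeral
      using gen[of "of_real fb_kappa" "of_real V" "of_real (ln 2)" "of_real x" "of_real (fb_kappa / (4 * ln 2))" "of_real m"] V kap ln2_pos
      by (simp only: of_real_eq_0_iff of_real_divide of_real_mult of_real_numeral)
  qed
  ultimately show ?thesis by (simp only:)
qed

text \<open>The left side is the coefficient of s^2 left by the two Gaussian integrals. V disappears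
  because the combined numerator turns out to be k (k - l) V.\<close>

lemma fb_variance_identity:
  fixes l k V m :: real
  assumes "0 < l" "0 < k" "V = 4 * l * k - 1" "0 < V" "m = 2 - 1 / l"
  shows "(1 / l - m / V)\<^sup>2 / (2 * ((1 + 1 / V) / k\<^sup>2)) + (k / (4 * l) - k\<^sup>2 * m\<^sup>2 / (2 * V)) = (k / (2 * l) + k * (k - l) / l\<^sup>2) / 2"
proof -
  have lm: "l * m = 2 * l - 1" using assms by (simp add: field_simps)
  have "1 / l - m / V = (V - l * m) / (l * V)" using assms(1,4) by (simp add: field_simps)
  also have "V - l * m = l * (2 * (2 * k - 1))" unfolding lm assms(3) by (simp add: algebra_simps)
  finally have 1: "1 / l - m / V = 2 * (2 * k - 1) / V" using assms(1) by simp
  have 2: "(1 + 1 / V) / k\<^sup>2 = 4 * l / (V * k)"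
  proof -
    have "1 + 1 / V = 4 * l * k / V" using assms by (simp add: field_simps)
    then show ?thesis using assms by (simp add: power2_eq_square)
  qed
  have 3: "k\<^sup>2 * m\<^sup>2 / (2 * V) = k\<^sup>2 * (2 * l - 1)\<^sup>2 / (2 * l\<^sup>2 * V)"
  proof -
    have "m = (2 * l - 1) / l" using assms by (simp add: field_simps)
    then show ?thesis by (simp add: power_divide)
  qed
  have 4: "(2 * (2 * k - 1) / V)\<^sup>2 / (2 * (4 * l / (V * k))) = k * (2 * k - 1)\<^sup>2 / (2 * l * V)"
    using assms(1,2,4) by (simp add: power_divide power2_eq_square field_simps)
  have 5: "k * (2 * k - 1)\<^sup>2 / (2 * l * V) - k\<^sup>2 * (2 * l - 1)\<^sup>2 / (2 * l\<^sup>2 * V) = k * (k - l) / (2 * l\<^sup>2)"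
  proof -
    have "k * (2 * k - 1)\<^sup>2 / (2 * l * V) - k\<^sup>2 * (2 * l - 1)\<^sup>2 / (2 * l\<^sup>2 * V) = (l * k * (2 * k - 1)\<^sup>2 - k\<^sup>2 * (2 * l - 1)\<^sup>2) / (2 * l\<^sup>2 * V)"
      using assms(1,2,4) by (simp add: field_simps power2_eq_square)
    also have "l * k * (2 * k - 1)\<^sup>2 - k\<^sup>2 * (2 * l - 1)\<^sup>2 = k * (k - l) * V"
      unfolding assms(3) by (simp add: algebra_simps power2_eq_square)
    finally show ?thesis using assms(4) by simp
  qed
  have 6: "(k / (2 * l) + k * (k - l) / l\<^sup>2) / 2 = k / (4 * l) + k * (k - l) / (2 * l\<^sup>2)"
    by (simp add: add_divide_distrib)
  show ?thesis unfolding 1 2 3 4 6 using 5 by linarith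
qed

lemma fb_limit_double_integral:
  defines "V \<equiv> 4 * ln 2 * fb_kappa - 1"
  shows "has_bochner_integral lborel (\<lambda>x. integral\<^sup>L lborel (fb_limit s x))
    (of_real (2 * sqrt (2 * pi / V) * sqrt (2 * pi / ((1 + 1 / V) / fb_kappa\<^sup>2)))
      * exp (s\<^sup>2 * of_real ((fb_kappa / (2 * ln 2) + fb_kappa * (fb_kappa - ln 2) / (ln 2)\<^sup>2) / 2)))"
proof -
  have V: "0 < V" using fb_kappa_bounds by (simp add: V_def)
  have kap: "0 < fb_kappa" by (rule fb_kappa_pos)
  define m where "m = 2 - 1 / ln (2 :: real)"
  define a where "a = (1 + 1 / V) / fb_kappa\<^sup>2"
  have a: "0 < a" using V kap by (simp add: a_def add_pos_pos)
  define p where "p = 1 / ln 2 - m / V"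
  define r where "r = fb_kappa / (4 * ln 2) - fb_kappa\<^sup>2 * m\<^sup>2 / (2 * V)"
  have eq: "integral\<^sup>L lborel (fb_limit s x) = 2 * of_real (sqrt (2 * pi / V)) * exp (s\<^sup>2 * of_real r) * exp ((s * of_real p) * of_real x - of_real (a * x\<^sup>2 / 2))" for x
    using has_bochner_integral_integral_eq[OF fb_limit_integral[of s x]]
    unfolding V_def[symmetric] m_def[symmetric] p_def[symmetric] a_def[symmetric] r_def[symmetric] exp_add by (simp only: mult_ac)
  have "has_bochner_integral lborel (\<lambda>x. 2 * of_real (sqrt (2 * pi / V)) * exp (s\<^sup>2 * of_real r) * exp ((s * of_real p) * of_real x - of_real (a * x\<^sup>2 / 2)))
     (2 * of_real (sqrt (2 * pi / V)) * exp (s\<^sup>2 * of_real r) * (of_real (sqrt (2 * pi / a)) * exp ((s * of_real p)\<^sup>2 / of_real (2 * a))))"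
    by (intro has_bochner_integral_mult_right Gaussian_integral a)
  moreover have "2 * of_real (sqrt (2 * pi / V)) * exp (s\<^sup>2 * of_real r) * (of_real (sqrt (2 * pi / a)) * exp ((s * of_real p)\<^sup>2 / of_real (2 * a)))
     = of_real (2 * sqrt (2 * pi / V) * sqrt (2 * pi / a)) * exp (s\<^sup>2 * of_real ((fb_kappa / (2 * ln 2) + fb_kappa * (fb_kappa - ln 2) / (ln 2)\<^sup>2) / 2))"
  proof -
    have "p\<^sup>2 / (2 * a) + r = (fb_kappa / (2 * ln 2) + fb_kappa * (fb_kappa - ln 2) / (ln 2)\<^sup>2) / 2"
      unfolding p_def a_def r_def by (rule fb_variance_identity) (use V kap ln2_pos in \<open>simp_all add: V_def m_def\<close>)
    then have "s\<^sup>2 * of_real ((fb_kappa / (2 * ln 2) + fb_kappa * (fb_kappa - ln 2) / (ln 2)\<^sup>2) / 2) = s\<^sup>2 * of_real (p\<^sup>2 / (2 * a) + r)" by (simp only:)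
    also have "\<dots> = s\<^sup>2 * of_real r + (s * of_real p)\<^sup>2 / of_real (2 * a)"
      by (simp add: power_mult_distrib distrib_left)
    finally show ?thesis by (simp only: exp_add of_real_mult of_real_numeral mult_ac)
  qed
  ultimately show ?thesis unfolding eq a_def[symmetric] by (simp only:)
qed

context fishburn_saddle
begin

text \<open>The factor common to all k: it centres the moment generating function at (fb_kappa / ln
  2) n and divides by the mass at the saddle index, which cancels on comparison with s = 0.\<close>

definition fb_center :: "complex \<Rightarrow> nat \<Rightarrow> complex" where
  "fb_center s n = exp (- (s * of_real (fb_kappa / ln 2 * real n) / of_real (sqrt (real n)))) / of_real (fb_mass n (saddle_idx n))"

definition fb_coeff :: "complex \<Rightarrow> nat \<Rightarrow> nat \<Rightarrow> complex" where
  "fb_coeff s n k = fps_nth (fishburn_term lam_fps (exp (s / of_real (sqrt (real n)))) k) n"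

lemma fb_term_integral:
  assumes n: "0 < n" and k: "K \<le> k" and u: "norm (exp (s / of_real (sqrt (real n))) - 1) * (exp 2 - 1) < 1"
  shows "has_bochner_integral lborel
    (\<lambda>y. if \<bar>y\<bar> \<le> pi * sqrt (real n) then of_real (fb_mass n k / fb_mass n (saddle_idx n)) * fb_integrand s n k (y / sqrt (real n)) else 0)
    (of_real (sqrt (real n)) * (of_real (2 * pi) * fb_coeff s n k * fb_center s n))"
proof -
  have k0: "0 < k" using k K_pos by simp
  \<comment> \<open>For j up to k + 1 the node is at most 2, so rLam (rad k)^j \<le> exp 2; this is
    the origin of exp 2 in the hypothesis on s.\<close>
  have ne: "norm (exp (s / of_real (sqrt (real n))) - 1) * (rLam (rad k) ^ j - 1) < 1" if "j \<in> {1..k+1}" for j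
  proof -
    have "rLam (rad k) ^ j = exp (node k j)" unfolding rLam_rad[OF k] exp_of_nat_mult[symmetric] by simp
    also have "\<dots> \<le> exp 2" using node_bounds_Suc[OF k0 that] by (simp only: exp_le_cancel_iff)
    finally have "norm (exp (s / of_real (sqrt (real n))) - 1) * (rLam (rad k) ^ j - 1) \<le> norm (exp (s / of_real (sqrt (real n))) - 1) * (exp 2 - 1)"
      by (intro mult_left_mono) auto
    then show ?thesis using u by linarith
  qed
  define E where "E = exp (- (s * of_real (fb_kappa / ln 2 * real n) / of_real (sqrt (real n))))"
  define M where "M = complex_of_real (fb_mass n (saddle_idx n))"
  define \<phi> where "\<phi> t = fb_fun (exp (s / of_real (sqrt (real n)))) k (of_real (rad k) * cis t) * cis (- (real n * t)) / of_real (rad k) ^ n * (E / M)" for t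
  note int = fb_coefficient_integral[OF rad_pos[OF k] rad_less[OF k] ne]
  have \<phi>: "\<phi> t = of_real (fb_mass n k / fb_mass n (saddle_idx n)) * fb_integrand s n k t" for t
  proof -
    have "fb_fun (exp (s / of_real (sqrt (real n)))) k (of_real (rad k) * cis t) * cis (- (real n * t)) / of_real (rad k) ^ n * E
      = of_real (fb_mass n k) * fb_integrand s n k t"
      unfolding E_def by (rule fb_fun_factor[OF k0 rad_corr_pos[OF k] rad_pos[OF k] Lam_circ[OF k]])
    then show ?thesis unfolding \<phi>_def times_divide_eq_right by (simp only: M_def of_real_divide times_divide_eq_left)
  qed
  have "(\<phi> has_integral (of_real (2 * pi) * fb_coeff s n k) * (E / M)) {-pi..pi}"
    unfolding \<phi>_def fb_coeff_def by (rule has_integral_mult_left[OF int(1)])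
  then have hk: "integral {-pi..pi} \<phi> = of_real (2 * pi) * fb_coeff s n k * (E / M)" by (rule integral_unique)
  have "continuous_on UNIV \<phi>"
    unfolding \<phi>_def using rad_pos[OF k] by (intro continuous_intros int(2)) auto
  then have "continuous_on {-pi..pi} \<phi>" by (rule continuous_on_subset) simp
  then have si: "set_integrable lborel {-pi..pi} \<phi>" by (rule borel_integrable_atLeastAtMost')
  have "has_bochner_integral lborel (\<lambda>t. indicator {-pi..pi} t *\<^sub>R \<phi> t) (of_real (2 * pi) * fb_coeff s n k * (E / M))"
    using si set_borel_integral_eq_integral(2)[OF si] unfolding hk
    by (simp add: has_bochner_integral_iff set_integrable_def set_lebesgue_integral_def)
  then have "has_bochner_integral lborel (\<lambda>y. indicator {-pi..pi} (0 + 1 / sqrt n * y) *\<^sub>R \<phi> (0 + 1 / sqrt n * y))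
     ((of_real (2 * pi) * fb_coeff s n k * (E / M)) /\<^sub>R \<bar>1 / sqrt n\<bar>)"
    using n by (subst lborel_has_bochner_integral_real_affine_iff[symmetric]) auto
  moreover have "indicator {-pi..pi} (0 + 1 / sqrt n * y) *\<^sub>R \<phi> (0 + 1 / sqrt n * y) =
    (if \<bar>y\<bar> \<le> pi * sqrt (real n) then of_real (fb_mass n k / fb_mass n (saddle_idx n)) * fb_integrand s n k (y / sqrt (real n)) else 0)" for y
  proof -
    have "0 + 1 / sqrt n * y \<in> {-pi..pi} \<longleftrightarrow> \<bar>y\<bar> \<le> pi * sqrt (real n)"
      using n by (auto simp: field_simps abs_le_iff)
    moreover have "0 + 1 / sqrt n * y = y / sqrt n" by simp
    ultimately show ?thesis unfolding \<phi> by (simp only: indicator_def of_bool_def if_distrib[of "\<lambda>c. c *\<^sub>R _"] scaleR_one scaleR_zero_left)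
  qed
  moreover have "(of_real (2 * pi) * fb_coeff s n k * (E / M)) /\<^sub>R \<bar>1 / sqrt n\<bar> = of_real (sqrt (real n)) * (of_real (2 * pi) * fb_coeff s n k * fb_center s n)"
  proof -
    have "Z /\<^sub>R \<bar>1 / sqrt n\<bar> = of_real (sqrt (real n)) * Z" for Z :: complex by (simp add: scaleR_conv_of_real)
    then show ?thesis by (simp only: fb_center_def E_def M_def)
  qed
  ultimately show ?thesis by (simp only:)
qed

text \<open>The sum over k is an integral over x, and each summand an integral over y. The bound D
  g(x) g(y) serves twice: dominated convergence in y for fixed x, then in x, which yields the
  iterated integral.\<close>

lemma window_sum_limit:
  assumes \<epsilon>: "0 < \<epsilon>" "\<epsilon> < fb_kappa"
  shows "(\<lambda>n. \<Sum>k | \<epsilon> * real n \<le> real k \<and> 2 * k \<le> n. of_real (2 * pi) * fb_coeff s n k * fb_center s n)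
    \<longlonglongrightarrow> integral\<^sup>L lborel (\<lambda>x. integral\<^sup>L lborel (fb_limit s x))"
proof -
  define F where "F n = {k. \<epsilon> * real n \<le> real k \<and> 2 * k \<le> n}" for n
  have fin: "finite (F n)" for n by (rule finite_subset[of _ "{..n}"]) (auto simp: F_def)
  from fb_integrand_bound[OF \<epsilon>(1) less_imp_le[OF \<epsilon>(2)], of s] obtain A B c :: real and N1 :: nat where
    W: "0 \<le> A \<and> 0 \<le> B \<and> 0 < c \<and> (\<forall>n\<ge>N1. \<forall>k t. \<epsilon> * real n \<le> real k \<longrightarrow> 2 * k \<le> n \<longrightarrow> \<bar>t\<bar> \<le> pi \<longrightarrow>
    norm (of_real (fb_mass n k / fb_mass n (saddle_idx n)) * fb_integrand s n k t)
      \<le> exp (A + B * (\<bar>real k - fb_kappa * real n\<bar> / sqrt (real n)) + B * (sqrt (real n) * \<bar>t\<bar>)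
         - c * ((real k - real (saddle_idx n))\<^sup>2 / n) - c * (n * t\<^sup>2)))"
    by (elim exE) (rule that)
  note B = W[THEN conjunct2, THEN conjunct1] and c = W[THEN conjunct2, THEN conjunct2, THEN conjunct1]
  note bound = W[THEN conjunct2, THEN conjunct2, THEN conjunct2, rule_format]
  define D where "D = exp (A + 2 * B + c + 2 * B\<^sup>2 / c)"
  define g where "g w = exp (- (c / 4 * w\<^sup>2))" for w :: real
  have g_int: "integrable lborel g" unfolding g_def using c by (intro integrable_exp_neg_square) simp
  have g: "0 \<le> g w" "g w \<le> 1" for w using c by (simp_all add: g_def)
  obtain N2 :: nat where N2: "K / \<epsilon> \<le> N2" using real_arch_simple by blast
  have "(\<lambda>n. norm s * exp (norm s) / sqrt (real n) * (exp 2 - 1)) \<longlonglongrightarrow> 0" by real_asymp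
  then have "\<forall>\<^sub>F n in sequentially. norm s * exp (norm s) / sqrt (real n) * (exp 2 - 1) < 1" by (rule order_tendstoD) simp
  then obtain N3 where N3: "\<And>n. N3 \<le> n \<Longrightarrow> norm s * exp (norm s) / sqrt (real n) * (exp 2 - 1) < 1"
    by (auto simp: eventually_sequentially)
  define N where "N = max (max N1 N2) (max N3 1)"
  have Nfacts: "0 < n" "N1 \<le> n" "norm (exp (s / of_real (sqrt (real n))) - 1) * (exp 2 - 1) < 1" "K \<le> \<epsilon> * n" if "N \<le> n" for n
  proof -
    show n: "0 < n" "N1 \<le> n" using that by (auto simp: N_def)
    have "norm (exp (s / of_real (sqrt (real n))) - 1) * (exp 2 - 1) \<le> norm s * exp (norm s) / sqrt (real n) * (exp 2 - 1)"
      using norm_exp_scaled_le(1)[of n s] n(1) by (intro mult_right_mono) auto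
    moreover have "N3 \<le> n" using that by (auto simp: N_def)
    ultimately show "norm (exp (s / of_real (sqrt (real n))) - 1) * (exp 2 - 1) < 1" using N3[of n] by linarith
    have "N2 \<le> n" using that by (auto simp: N_def)
    then have "K / \<epsilon> \<le> n" using N2 by linarith
    then show "K \<le> \<epsilon> * n" using \<epsilon> by (simp add: field_simps)
  qed
  have FK: "K \<le> k" if "N \<le> n" "k \<in> F n" for n k using Nfacts(4)[OF that(1)] that(2) by (simp add: F_def)
  define a where "a n k = (if N \<le> n then of_real (sqrt (real n)) * (of_real (2 * pi) * fb_coeff s n k * fb_center s n) else 0)" for n k
  \<comment> \<open>Zero off the window and for n < N, so that the dominating bound holds for every
    n.\<close>
  define H where "H n x y = (if N \<le> n \<and> win_idx n x \<in> F n then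
      (if \<bar>y\<bar> \<le> pi * sqrt (real n) then of_real (fb_mass n (win_idx n x) / fb_mass n (saddle_idx n)) * fb_integrand s n (win_idx n x) (y / sqrt (real n)) else 0)
      else 0)" for n x y
  define G where "G n x = (if win_idx n x \<in> F n then a n (win_idx n x) else 0)" for n x
  have H_int: "has_bochner_integral lborel (H n x) (G n x)" for n x
  proof (cases "N \<le> n \<and> win_idx n x \<in> F n")
    case True
    then have n: "N \<le> n" and w: "win_idx n x \<in> F n" by auto
    have "H n x = (\<lambda>y. if \<bar>y\<bar> \<le> pi * sqrt (real n) then of_real (fb_mass n (win_idx n x) / fb_mass n (saddle_idx n)) * fb_integrand s n (win_idx n x) (y / sqrt (real n)) else 0)"
      using n w by (simp only: H_def[abs_def] simp_thms if_True)
    moreover have "G n x = of_real (sqrt (real n)) * (of_real (2 * pi) * fb_coeff s n (win_idx n x) * fb_center s n)"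
      using n w by (simp only: G_def a_def if_True)
    ultimately show ?thesis
      using fb_term_integral[OF Nfacts(1)[OF n] FK[OF n w] Nfacts(3)[OF n]] by (simp only:)
  next
    case False
    then have "H n x = (\<lambda>_. 0)" "G n x = 0" by (auto simp: H_def G_def a_def fun_eq_iff)
    then show ?thesis by (simp add: has_bochner_integral_zero)
  qed
  have H_bound: "norm (H n x y) \<le> D * g x * g y" for n x y
  proof (cases "N \<le> n \<and> win_idx n x \<in> F n \<and> \<bar>y\<bar> \<le> pi * sqrt (real n)")
    case True
    note n = Nfacts[OF True[THEN conjunct1]]
    have k: "\<epsilon> * real n \<le> real (win_idx n x)" "2 * win_idx n x \<le> n" using True by (auto simp: F_def)
    have k0: "0 < win_idx n x" using FK[of n "win_idx n x"] True K_pos by simp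
    have t: "\<bar>y / sqrt (real n)\<bar> \<le> pi" using True n(1) by (simp add: abs_div_pos[symmetric] field_simps)
    have "norm (H n x y) = norm (of_real (fb_mass n (win_idx n x) / fb_mass n (saddle_idx n)) * fb_integrand s n (win_idx n x) (y / sqrt (real n)))"
      using True by (simp add: H_def)
    also have "\<dots> \<le> exp (A + 2 * B + c + 2 * B\<^sup>2 / c - c / 4 * x\<^sup>2 - c / 4 * y\<^sup>2)"
      by (rule order_trans[OF bound[OF n(2) k t]])
         (unfold exp_le_cancel_iff, rule win_idx_exponent[OF n(1) refl k0 B c])
    also have "\<dots> = D * g x * g y" by (simp add: D_def g_def flip: exp_add exp_diff)
    finally show ?thesis .
  next
    case False
    then have "H n x y = 0" by (auto simp: H_def)
    then show ?thesis using g by (simp add: D_def)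
  qed
  have H_lim: "(\<lambda>n. H n x y) \<longlonglongrightarrow> fb_limit s x y" for x y
  proof -
    define k where "k n = max 1 (win_idx n x)" for n
    have kw: "(\<lambda>n. (real (k n) - fb_kappa * real n) / sqrt (real n)) \<longlonglongrightarrow> x" unfolding k_def by (rule win_idx_lim)
    have kp: "0 < k n" for n by (simp add: k_def)
    have t: "(\<lambda>n. sqrt (real n) * (y / sqrt (real n))) \<longlonglongrightarrow> y"
    proof -
      have "\<forall>\<^sub>F n in sequentially. y = sqrt (real n) * (y / sqrt (real n))"
        using eventually_gt_at_top[of 0] by eventually_elim simp
      with tendsto_const show ?thesis by (rule Lim_transform_eventually)
    qed
    have "(\<lambda>n. of_real (fb_mass n (k n) / fb_mass n (saddle_idx n)) * fb_integrand s n (k n) (y / sqrt (real n))) \<longlonglongrightarrow> fb_limit s x y"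
      unfolding fb_limit_def by (intro tendsto_mult tendsto_of_real fb_mass_ratio_limit fb_integrand_limit kp kw t)
    moreover have "\<forall>\<^sub>F n in sequentially. of_real (fb_mass n (k n) / fb_mass n (saddle_idx n)) * fb_integrand s n (k n) (y / sqrt (real n)) = H n x y"
    proof -
      \<comment> \<open>As \<epsilon> < fb_kappa < 1/2, the index eventually lies strictly inside
        the window, and |y| below pi sqrt n.\<close>
      have "\<forall>\<^sub>F n in sequentially. \<epsilon> < real (k n) / real n" by (rule order_tendstoD(1)[OF window_facts(1)[OF kw] \<epsilon>(2)])
      moreover have "\<forall>\<^sub>F n in sequentially. real (k n) / real n < 1 / 2" by (rule order_tendstoD(2)[OF window_facts(1)[OF kw] fb_kappa_bounds(1)])
      moreover have "filterlim (\<lambda>n. sqrt (real n)) at_top sequentially" by real_asymp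
      then have "\<forall>\<^sub>F n in sequentially. \<bar>y\<bar> / pi \<le> sqrt (real n)" by (simp add: filterlim_at_top)
      moreover have "filterlim (\<lambda>n. \<epsilon> * real n) at_top sequentially" using \<epsilon>(1) by real_asymp
      then have "\<forall>\<^sub>F n in sequentially. 1 < \<epsilon> * real n" by (simp add: filterlim_at_top_dense)
      ultimately show ?thesis using eventually_ge_at_top[of N]
      proof eventually_elim
        case (elim n)
        have n: "0 < n" using Nfacts(1)[OF elim(5)] .
        have kb: "\<epsilon> * n < k n" "2 * k n < n" using elim(1,2) n by (auto simp: field_simps)
        then have "1 < k n" using elim(4) by linarith
        then have k: "k n = win_idx n x" by (auto simp: k_def max_def split: if_splits)
        have "win_idx n x \<in> F n" using kb by (simp add: k F_def)
        moreover have "\<bar>y\<bar> \<le> pi * sqrt (real n)" using elim(3) by (simp add: field_simps)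
        ultimately show ?case using elim(5) by (simp add: H_def k)
      qed
    qed
    ultimately show ?thesis by (rule Lim_transform_eventually)
  qed
  have fb_meas: "fb_limit s x \<in> borel_measurable lborel" for x
    using fb_limit_integral[of s x] by (auto simp: has_bochner_integral_iff)
  have G_lim: "(\<lambda>n. G n x) \<longlonglongrightarrow> integral\<^sup>L lborel (fb_limit s x)" for x
  proof -
    have "(\<lambda>n. integral\<^sup>L lborel (H n x)) \<longlonglongrightarrow> integral\<^sup>L lborel (fb_limit s x)"
    proof (rule integral_dominated_convergence)
      show "integrable lborel (\<lambda>y. D * g x * g y)" by (intro integrable_mult_right g_int)
      show "H n x \<in> borel_measurable lborel" for n using H_int[of n x] by (auto simp: has_bochner_integral_iff)
      show "fb_limit s x \<in> borel_measurable lborel" by (rule fb_meas)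
    qed (auto intro: H_bound H_lim)
    then show ?thesis by (simp only: has_bochner_integral_integral_eq[OF H_int])
  qed
  have G_bound: "norm (G n x) \<le> D * integral\<^sup>L lborel g * g x" for n x
  proof -
    have "norm (G n x) = norm (integral\<^sup>L lborel (H n x))" by (simp only: has_bochner_integral_integral_eq[OF H_int])
    also have "\<dots> \<le> integral\<^sup>L lborel (\<lambda>y. D * g x * g y)"
    proof (rule Bochner_Integration.integral_norm_bound_integral)
      show "integrable lborel (H n x)" using H_int[of n x] by (auto simp: has_bochner_integral_iff)
    qed (intro integrable_mult_right g_int H_bound)+
    also have "\<dots> = D * integral\<^sup>L lborel g * g x" by simp
    finally show ?thesis .
  qed
  have G_int: "has_bochner_integral lborel (G n) ((\<Sum>k\<in>F n. a n k) / of_real (sqrt (real n)))" if "N \<le> n" for n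
  proof -
    have "0 \<notin> F n" using FK[OF that, of 0] K_pos by auto
    from sum_as_integral[OF fin this, of "sqrt (real n)" "saddle_idx n" "a n"] Nfacts(1)[OF that]
    show ?thesis unfolding G_def[abs_def] win_idx_def by simp
  qed
  \<comment> \<open>The shift by N is made because the step function is identified with the sum, and
    seen to be measurable, only for n \<ge> N.\<close>
  have "(\<lambda>n. integral\<^sup>L lborel (G (n + N))) \<longlonglongrightarrow> integral\<^sup>L lborel (\<lambda>x. integral\<^sup>L lborel (fb_limit s x))"
  proof (rule integral_dominated_convergence)
    show "integrable lborel (\<lambda>x. D * integral\<^sup>L lborel g * g x)" by (intro integrable_mult_right g_int)
    show "G (n + N) \<in> borel_measurable lborel" for n using G_int[of "n + N"] by (auto simp: has_bochner_integral_iff)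
    show "(\<lambda>x. integral\<^sup>L lborel (fb_limit s x)) \<in> borel_measurable lborel"
      using fb_limit_double_integral[of s] by (auto simp: has_bochner_integral_iff)
    show "AE x in lborel. (\<lambda>n. G (n + N) x) \<longlonglongrightarrow> integral\<^sup>L lborel (fb_limit s x)"
      by (intro AE_I2 LIMSEQ_ignore_initial_segment G_lim)
  qed (auto intro: G_bound)
  moreover have "integral\<^sup>L lborel (G n) = (\<Sum>k\<in>F n. of_real (2 * pi) * fb_coeff s n k * fb_center s n)" if "N \<le> n" for n
    using has_bochner_integral_integral_eq[OF G_int[OF that]] Nfacts(1)[OF that] that
    by (simp add: a_def flip: sum_distrib_left)
  ultimately have "(\<lambda>n. \<Sum>k\<in>F (n + N). of_real (2 * pi) * fb_coeff s (n + N) k * fb_center s (n + N))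
      \<longlonglongrightarrow> integral\<^sup>L lborel (\<lambda>x. integral\<^sup>L lborel (fb_limit s x))" by simp
  then show ?thesis unfolding F_def by (rule LIMSEQ_offset)
qed

end

section \<open>Small summation indices\<close>

text \<open>Comparison with index 1 through \<open>log_qprod_diff\<close> gives a bound linear in n.
  A crude A suffices, since small indices k lose a factor of about (k / (fb_kappa n))^n.\<close>

lemma log_qprod_saddle_ge: "\<exists>A\<ge>0. \<forall>n>0. - 2 * log_qprod (saddle_idx n) (ln 2 / real (saddle_idx n)) \<le> A * real n"
proof -
  obtain C where C: "0 \<le> C" "\<And>m k k'. 0 < m \<Longrightarrow> m \<le> real k \<Longrightarrow> m \<le> real k' \<Longrightarrow>
      \<bar>2 * log_qprod k (ln 2 / k) - 2 * log_qprod k' (ln 2 / k') + (real k - real k') / fb_kappa\<bar> \<le> C * \<bar>real k - real k'\<bar> / m"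
    using log_qprod_diff by blast
  have kap: "0 < fb_kappa" by (rule fb_kappa_pos)
  define q where "q = 2 * log_qprod 1 (ln 2 / real 1)"
  define A where "A = \<bar>q\<bar> + 1 + C * fb_kappa"
  have "- 2 * log_qprod (saddle_idx n) (ln 2 / real (saddle_idx n)) \<le> A * real n" if n: "0 < n" for n
  proof -
    define l where "l = saddle_idx n"
    have l: "1 \<le> real l" "real l - 1 \<le> fb_kappa * n" using saddle_idx_bounds[of n] by (auto simp: l_def saddle_idx_def)
    have "\<bar>2 * log_qprod l (ln 2 / l) - q + (real l - real 1) / fb_kappa\<bar> \<le> C * \<bar>real l - real 1\<bar> / 1"
      unfolding q_def by (rule C(2)) (use l in auto)
    then have "- 2 * log_qprod l (ln 2 / l) \<le> \<bar>q\<bar> + (real l - 1) / fb_kappa + C * (real l - 1)" using l by simp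
    also have "(real l - 1) / fb_kappa \<le> n" using l kap by (simp add: field_simps)
    also have "C * (real l - 1) \<le> C * (fb_kappa * n)" using l C by (intro mult_left_mono) auto
    also have "\<bar>q\<bar> \<le> \<bar>q\<bar> * n" using n by (simp add: mult_le_cancel_left1)
    finally show ?thesis by (simp add: A_def l_def algebra_simps)
  qed
  moreover have "0 \<le> A" using C kap by (simp add: A_def)
  ultimately show ?thesis by blast
qed

context fishburn_saddle
begin

text \<open>All indices k < l share the circle of radius \<open>rad l\<close>: there |Lam^j - 1|
  \<le> 1 for j \<le> l, which controls every factor, and k + 1 \<le> l covers the last one. Apart
  from rad l^(-n), only exp (O(sqrt n)) remains.\<close>

lemma small_term_bound:
  assumes n: "0 < n" and k: "k < l" "l \<le> n" "K \<le> l"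
    and u: "norm (exp (s / of_real (sqrt (real n))) - 1) \<le> U / sqrt (real n)" "U / sqrt (real n) \<le> 1 / 2"
  shows "norm (fb_coeff s n k) \<le> 2 * exp ((norm s + 6 * U) * sqrt (real n)) / rad l ^ n"
proof -
  define v where "v = exp (s / of_real (sqrt (real n)))"
  have l: "0 < l" using k by simp
  have U: "0 \<le> U / sqrt n" using u norm_ge_zero order_trans by blast
  have r: "0 < rad l" "rad l < rad_conv" using rad_pos rad_less k by auto
  have pow: "rLam (rad l) ^ j \<le> 2" if "j \<le> l" for j
  proof -
    have "rLam (rad l) ^ j = exp (real j * (ln 2 / l))" unfolding rLam_rad[OF k(3)] exp_of_nat_mult[symmetric] ..
    also have "real j * (ln 2 / l) \<le> ln 2" using that l ln2_pos by (simp add: field_simps)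
    then have "exp (real j * (ln 2 / l)) \<le> exp (ln 2)" by (simp only: exp_le_cancel_iff)
    finally show ?thesis by simp
  qed
  have ne: "norm (v - 1) * (rLam (rad l) ^ j - 1) < 1" if "j \<in> {1..k+1}" for j
  proof -
    have "norm (v - 1) * (rLam (rad l) ^ j - 1) \<le> norm (v - 1) * 1" using pow[of j] that k by (intro mult_left_mono) auto
    also have "\<dots> \<le> 1 / 2" using u unfolding v_def by linarith
    finally show ?thesis by simp
  qed
  define Bd where "Bd = 2 * exp ((norm s + 6 * U) * sqrt (real n)) / rad l ^ n"
  have sq: "real n / sqrt n = sqrt n" by (simp add: real_div_sqrt)
  have val: "norm (fb_fun v k (of_real (rad l) * cis t) * cis (- (real n * t)) / of_real (rad l) ^ n) \<le> Bd" for t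
  proof -
    define z where "z = of_real (rad l) * cis t"
    have z: "norm z \<le> rad l" using r by (simp add: z_def norm_mult)
    have w: "norm (Lam z ^ j - 1) \<le> 1" if "j \<le> l" for j
      using norm_Lam_power_minus_one_le[OF z r(2), of j] pow[OF that] by linarith
    have 1: "norm (Lam z ^ (k + 1)) \<le> 2"
    proof -
      have "norm (1 + (Lam z ^ (k + 1) - 1)) \<le> norm (1 :: complex) + norm (Lam z ^ (k + 1) - 1)" by (rule norm_triangle_ineq)
      then show ?thesis using w[of "k + 1"] k by simp
    qed
    have 2: "norm (v ^ k) \<le> exp (norm s * sqrt n)"
    proof -
      have "norm v = exp (Re (s / of_real (sqrt n)))" by (simp add: v_def norm_exp_eq_Re)
      also have "\<dots> \<le> exp (norm s / sqrt n)" using complex_Re_le_cmod[of "s / of_real (sqrt n)"] by (simp add: norm_divide)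
      finally have "norm v ^ k \<le> exp (norm s / sqrt n) ^ k" by (intro power_mono) auto
      also have "\<dots> = exp (real k * (norm s / sqrt n))" by (simp only: exp_of_nat_mult)
      also have "\<dots> \<le> exp (real n * (norm s / sqrt n))" using k by (simp add: mult_right_mono divide_right_mono)
      also have "real n * (norm s / sqrt n) = norm s * (real n / sqrt n)" by simp
      finally show ?thesis unfolding sq norm_power .
    qed
    have 3: "norm (\<Prod>j=1..k. (Lam z ^ j - 1)\<^sup>2) \<le> 1"
      unfolding prod_norm[symmetric] by (intro prod_le_1) (use w k in \<open>auto simp: norm_power intro!: power_le_one\<close>)
    have 4: "norm (\<Prod>j=1..k+1. inverse (1 - (v - 1) * (Lam z ^ j - 1))) \<le> exp (6 * U * sqrt n)"
    proof -
      have inv: "norm (inverse (1 - (v - 1) * (Lam z ^ j - 1))) \<le> exp (6 * U / sqrt n)" if "j \<in> {1..k+1}" for j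
      proof -
        define b where "b = (v - 1) * (Lam z ^ j - 1)"
        have "norm b \<le> norm (v - 1) * 1" unfolding b_def norm_mult using w[of j] that k by (intro mult_left_mono) auto
        then have b: "norm b \<le> U / sqrt n" using u(1) unfolding v_def by linarith
        then have b2: "norm b \<le> 1 / 2" using u(2) by linarith
        have "norm (inverse (1 - b)) \<le> exp (Re b + 9 * (norm b)\<^sup>2)" by (rule norm_inverse_one_minus_le[OF b2])
        also have "\<dots> \<le> exp (6 * (U / sqrt n))"
        proof -
          have "(norm b)\<^sup>2 \<le> 1 / 2 * norm b" unfolding power2_eq_square using b2 by (intro mult_right_mono) auto
          then have "Re b + 9 * (norm b)\<^sup>2 \<le> norm b + 9 * (1 / 2 * norm b)" using complex_Re_le_cmod[of b] by linarith
          also have "\<dots> \<le> 6 * norm b" by simp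
          also have "\<dots> \<le> 6 * (U / sqrt n)" using b by simp
          finally show ?thesis by simp
        qed
        finally show ?thesis by (simp add: b_def)
      qed
      have "norm (\<Prod>j=1..k+1. inverse (1 - (v - 1) * (Lam z ^ j - 1))) \<le> (\<Prod>j=1..k+1. exp (6 * U / sqrt n))"
        unfolding prod_norm[symmetric] by (intro prod_mono conjI norm_ge_zero inv)
      also have "\<dots> = exp (real (k + 1) * (6 * U / sqrt n))" unfolding exp_of_nat_mult by simp
      also have "\<dots> \<le> exp (real n * (6 * U / sqrt n))"
      proof -
        have "real (k + 1) \<le> real n" using k by simp
        moreover have "0 \<le> 6 * U / sqrt n" using U by (simp add: zero_le_divide_iff)
        ultimately show ?thesis by (simp only: exp_le_cancel_iff mult_right_mono)
      qed
      also have "real n * (6 * U / sqrt n) = 6 * U * (real n / sqrt n)" by simp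
      finally show ?thesis unfolding sq .
    qed
    have "norm (fb_fun v k z) \<le> 2 * exp (norm s * sqrt n) * 1 * exp (6 * U * sqrt n)"
      unfolding fb_fun_def norm_mult by (intro mult_mono 1 2 3 4 mult_nonneg_nonneg norm_ge_zero exp_ge_zero) auto
    also have "\<dots> = 2 * exp ((norm s + 6 * U) * sqrt n)" by (simp add: distrib_right exp_add)
    finally have "norm (fb_fun v k z) / rad l ^ n \<le> Bd" unfolding Bd_def using r by (intro divide_right_mono) auto
    then show ?thesis using r by (simp add: norm_mult norm_divide norm_power z_def)
  qed
  have "norm (of_real (2 * pi) * fps_nth (fishburn_term lam_fps v k) n) \<le> Bd * measure lborel {-pi..pi}"
    by (rule has_integral_bound_real[OF _ finite.emptyI fb_coefficient_integral(1)[OF r ne]])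
       (use val r in \<open>auto simp: Bd_def\<close>)
  then have "2 * pi * norm (fb_coeff s n k) \<le> 2 * pi * Bd" by (simp add: norm_mult fb_coeff_def v_def mult_ac)
  moreover have "0 < 2 * pi" by simp
  ultimately have "norm (fb_coeff s n k) \<le> Bd" by (rule mult_left_le_imp_le)
  then show ?thesis by (simp only: Bd_def)
qed

lemma small_sum_limit:
  "\<exists>\<epsilon>. 0 < \<epsilon> \<and> \<epsilon> < fb_kappa \<and> (\<forall>s. (\<lambda>n. \<Sum>k | real k < \<epsilon> * real n. of_real (2 * pi) * fb_coeff s n k * fb_center s n) \<longlonglongrightarrow> 0)"
proof -
  obtain A where A: "0 \<le> A" "\<And>n. 0 < n \<Longrightarrow> - 2 * log_qprod (saddle_idx n) (ln 2 / real (saddle_idx n)) \<le> A * real n"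
    using log_qprod_saddle_ge by blast
  have kap: "0 < fb_kappa" "fb_kappa < 1 / 2" by (rule fb_kappa_pos, rule fb_kappa_bounds)
  \<comment> \<open>Chosen so that the common index l \<le> 2 \<epsilon> n satisfies l / l0 \<le>
    exp (- A - 1), with l0 the saddle index: then n ln (l / l0) \<le> - (A + 1) n outweighs the A n
    from \<open>log_qprod_saddle_ge\<close>, and the remaining exp (- n) beats exp (c sqrt
    n).\<close>
  define \<epsilon> where "\<epsilon> = fb_kappa * exp (- A - 1) / 2"
  have ex: "exp (- A - 1) \<le> 1" using A by simp
  have \<epsilon>: "0 < \<epsilon>" "\<epsilon> \<le> fb_kappa / 2" using kap ex by (auto simp: \<epsilon>_def)
  have lim: "(\<lambda>n. \<Sum>k | real k < \<epsilon> * real n. of_real (2 * pi) * fb_coeff s n k * fb_center s n) \<longlonglongrightarrow> 0" for s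
  proof (rule Lim_null_comparison)
    define U where "U = norm s * exp (norm s)"
    define c where "c = norm s + 6 * U + norm s * (fb_kappa / ln 2)"
    have "(\<lambda>n. U / sqrt (real n)) \<longlonglongrightarrow> 0" by real_asymp
    then have "\<forall>\<^sub>F n in sequentially. U / sqrt (real n) < 1 / 2" by (rule order_tendstoD) simp
    moreover have "filterlim (\<lambda>n. \<epsilon> * real n) at_top sequentially" using \<epsilon>(1) by real_asymp
    then have "\<forall>\<^sub>F n in sequentially. max 1 K \<le> \<epsilon> * real n" by (simp add: filterlim_at_top)
    ultimately show "\<forall>\<^sub>F n in sequentially. norm (\<Sum>k | real k < \<epsilon> * real n. of_real (2 * pi) * fb_coeff s n k * fb_center s n)
        \<le> real n * (4 * pi * exp (C / \<epsilon>) * exp (c * sqrt (real n) - real n))"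
      using eventually_gt_at_top[of 0]
    proof eventually_elim
      case (elim n)
      define l where "l = nat \<lceil>\<epsilon> * real n\<rceil>"
      have en: "1 \<le> \<epsilon> * n" "K \<le> \<epsilon> * n" using elim(2) by auto
      have l: "\<epsilon> * n \<le> l" "l \<le> \<epsilon> * n + 1" unfolding l_def using en by linarith+
      then have l2: "real l \<le> 2 * \<epsilon> * n" using en by linarith
      have "2 * \<epsilon> * n \<le> fb_kappa * n" using \<epsilon>(2) by (intro mult_right_mono) auto
      moreover have "fb_kappa * n \<le> 1 / 2 * n" using kap by (intro mult_right_mono) auto
      ultimately have l3: "real l \<le> fb_kappa * n" "l \<le> n" using l2 by linarith+
      have Kl: "K \<le> l" "0 < l" using l en by linarith+
      define l0 where "l0 = saddle_idx n"
      have l0: "fb_kappa * n < l0" using saddle_idx_bounds by (simp add: l0_def)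
      have Kl0: "K \<le> l0" "real l \<le> l0" "0 < l0" using l0 l3 Kl by linarith+
      have center: "norm (fb_center s n) \<le> exp (norm s * (fb_kappa / ln 2) * sqrt n) / fb_mass n l0"
      proof -
        have "- (s * of_real (fb_kappa / ln 2 * real n) / of_real (sqrt (real n))) = - (s * of_real (fb_kappa / ln 2 * (real n / sqrt n)))" by simp
        also have "\<dots> = - (s * of_real (fb_kappa / ln 2 * sqrt n))" by (simp only: real_div_sqrt[of n, OF of_nat_0_le_iff])
        finally have "norm (exp (- (s * of_real (fb_kappa / ln 2 * real n) / of_real (sqrt (real n))))) = exp (Re (- (s * of_real (fb_kappa / ln 2 * sqrt n))))"
          by (simp only: norm_exp_eq_Re)
        also have "\<dots> \<le> exp (norm (- (s * of_real (fb_kappa / ln 2 * sqrt n))))" by (simp only: exp_le_cancel_iff complex_Re_le_cmod)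
        also have "norm (- (s * of_real (fb_kappa / ln 2 * sqrt n))) = norm s * (fb_kappa / ln 2) * sqrt n"
          using kap ln2_pos unfolding norm_minus_cancel norm_mult norm_of_real by simp
        finally have "norm (exp (- (s * of_real (fb_kappa / ln 2 * real n) / of_real (sqrt (real n))))) \<le> exp (norm s * (fb_kappa / ln 2) * sqrt n)" .
        moreover have m0: "0 < fb_mass n l0" by (simp add: fb_mass_def)
        ultimately show ?thesis
          unfolding fb_center_def l0_def[symmetric] norm_divide norm_of_real by (simp add: divide_right_mono)
      qed
      have mass: "1 / rad l ^ n / fb_mass n l0 \<le> exp (C / \<epsilon> - real n)"
      proof -
        have r: "0 < rad l" "0 < rad_corr l" using rad_pos rad_corr_pos Kl by auto
        have "rad l = ln 2 / (l * rad_corr l)" using r(1) Kl ln2_pos by (simp add: rad_corr_def)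
        then have lnr: "ln (rad l) = ln (ln 2) - (ln l + ln (rad_corr l))"
          using r Kl ln2_pos by (simp add: ln_div ln_mult)
        have "1 / rad l ^ n = exp (- (real n * ln (rad l)))" using r(1) by (simp add: exp_minus exp_of_nat_mult inverse_eq_divide)
        then have "1 / rad l ^ n / fb_mass n l0 = exp (- (real n * ln (rad l)) - (saddle_log n l0 + real n * ln (rad_corr l0) - real n * ln (ln 2)))"
          by (simp only: fb_mass_def exp_diff)
        also have "- (real n * ln (rad l)) - (saddle_log n l0 + real n * ln (rad_corr l0) - real n * ln (ln 2))
          = real n * (ln l - ln l0) + real n * (ln (rad_corr l) - ln (rad_corr l0)) + - 2 * log_qprod l0 (ln 2 / l0)"
          unfolding lnr saddle_log_def by (simp add: algebra_simps)
        also have "\<dots> \<le> real n * (- A - 1) + C / \<epsilon> + A * real n"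
        proof (intro add_mono mult_left_mono)
          have "ln l - ln l0 = ln (l / l0)" using Kl Kl0 by (simp add: ln_div)
          also have "\<dots> \<le> ln (exp (- A - 1))"
          proof -
            have "real l / l0 \<le> (2 * \<epsilon> * n) / (fb_kappa * n)" using l2 l0 kap elim(3) \<epsilon> by (intro frac_le) auto
            also have "\<dots> = exp (- A - 1)" using kap elim(3) by (simp add: \<epsilon>_def)
            finally show ?thesis using Kl Kl0 by (intro ln_mono) auto
          qed
          finally show "ln l - ln l0 \<le> - A - 1" by simp
          have "ln (rad_corr l) - ln (rad_corr l0) \<le> C * \<bar>1 / l - 1 / l0\<bar>" using rad_corr_Lipschitz[OF Kl(1) Kl0(1)] by linarith
          also have "\<dots> \<le> C * (1 / (\<epsilon> * n))"
          proof (intro mult_left_mono C_nonneg)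
            have "1 / real l0 \<le> 1 / l" using Kl Kl0 by (intro divide_left_mono) auto
            moreover have "1 / real l \<le> 1 / (\<epsilon> * n)" using l en Kl \<epsilon> elim(3) by (intro divide_left_mono mult_pos_pos) auto
            moreover have "0 \<le> 1 / real l0" by simp
            ultimately show "\<bar>1 / real l - 1 / real l0\<bar> \<le> 1 / (\<epsilon> * n)" by linarith
          qed
          finally have "real n * (ln (rad_corr l) - ln (rad_corr l0)) \<le> n * (C * (1 / (\<epsilon> * n)))" by (intro mult_left_mono) auto
          then show "real n * (ln (rad_corr l) - ln (rad_corr l0)) \<le> C / \<epsilon>" using elim(3) by simp
          show "- 2 * log_qprod l0 (ln 2 / l0) \<le> A * real n" unfolding l0_def by (rule A(2)[OF elim(3)])
        qed simp
        finally show ?thesis by (simp add: algebra_simps)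
      qed
      have tm: "norm (of_real (2 * pi) * fb_coeff s n k * fb_center s n) \<le> 4 * pi * exp (C / \<epsilon>) * exp (c * sqrt (real n) - real n)"
        if k: "k \<in> {k. real k < \<epsilon> * n}" for k
      proof -
        have kl: "k < l" using k l by simp
        have u: "norm (exp (s / of_real (sqrt (real n))) - 1) \<le> U / sqrt (real n)"
          unfolding U_def by (rule norm_exp_scaled_le(1)) (use elim(3) in simp)
        have "norm (fb_coeff s n k) \<le> 2 * exp ((norm s + 6 * U) * sqrt (real n)) / rad l ^ n"
          by (rule small_term_bound[OF elim(3) kl l3(2) Kl(1) u less_imp_le[OF elim(1)]])
        then have "norm (fb_coeff s n k) * norm (fb_center s n) \<le> (2 * exp ((norm s + 6 * U) * sqrt (real n)) / rad l ^ n) * (exp (norm s * (fb_kappa / ln 2) * sqrt n) / fb_mass n l0)"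
          by (rule mult_mono[OF _ center]) (use rad_pos[OF Kl(1)] in auto)
        also have "\<dots> = 2 * (exp ((norm s + 6 * U) * sqrt (real n)) * exp (norm s * (fb_kappa / ln 2) * sqrt n)) * (1 / rad l ^ n / fb_mass n l0)"
          by simp
        also have "exp ((norm s + 6 * U) * sqrt (real n)) * exp (norm s * (fb_kappa / ln 2) * sqrt n) = exp (c * sqrt n)"
          by (simp only: c_def distrib_right exp_add)
        also have "2 * exp (c * sqrt n) * (1 / rad l ^ n / fb_mass n l0) \<le> 2 * exp (c * sqrt n) * exp (C / \<epsilon> - real n)"
          by (intro mult_left_mono mass) simp
        also have "\<dots> = 2 * (exp (C / \<epsilon>) * exp (c * sqrt (real n) - real n))"
          by (simp add: exp_diff)
        finally have "2 * pi * (norm (fb_coeff s n k) * norm (fb_center s n)) \<le> 2 * pi * (2 * (exp (C / \<epsilon>) * exp (c * sqrt (real n) - real n)))"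
          by (intro mult_left_mono) auto
        then show ?thesis by (simp add: norm_mult mult_ac)
      qed
      have sub: "{k. real k < \<epsilon> * n} \<subseteq> {..<l}" using l by auto
      have "norm (\<Sum>k | real k < \<epsilon> * real n. of_real (2 * pi) * fb_coeff s n k * fb_center s n)
          \<le> real (card {k. real k < \<epsilon> * n}) * (4 * pi * exp (C / \<epsilon>) * exp (c * sqrt (real n) - real n))"
        by (rule sum_norm_bound[OF tm])
      also have "\<dots> \<le> real n * (4 * pi * exp (C / \<epsilon>) * exp (c * sqrt (real n) - real n))"
        using card_mono[OF finite_lessThan sub] l3(2) by (intro mult_right_mono) auto
      finally show ?case .
    qed
    show "(\<lambda>n. real n * (4 * pi * exp (C / \<epsilon>) * exp (c * sqrt (real n) - real n))) \<longlonglongrightarrow> 0" by real_asymp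
  qed
  show ?thesis using \<epsilon> kap lim by (intro exI[of _ \<epsilon>]) auto
qed

end

context fishburn_saddle
begin

lemma gf_limit:
  fixes s :: complex
  shows "(\<lambda>n. of_real (2 * pi) * (\<Sum>A\<in>fishburn_matrices n. of_real (FM_weight lam A) * exp (s / of_real (sqrt (real n))) ^ dim_row A) * fb_center s n)
    \<longlonglongrightarrow> integral\<^sup>L lborel (\<lambda>x. integral\<^sup>L lborel (fb_limit s x))"
proof -
  obtain \<epsilon> where \<epsilon>: "0 < \<epsilon>" "\<epsilon> < fb_kappa"
    and small: "(\<lambda>n. \<Sum>k | real k < \<epsilon> * real n. of_real (2 * pi) * fb_coeff s n k * fb_center s n) \<longlonglongrightarrow> 0"
    using small_sum_limit by blast
  have e1: "\<epsilon> < 1" using \<epsilon>(2) fb_kappa_bounds(1) by linarith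
  have "of_real (2 * pi) * (\<Sum>A\<in>fishburn_matrices n. of_real (FM_weight lam A) * exp (s / of_real (sqrt (real n))) ^ dim_row A) * fb_center s n
      = (\<Sum>k | \<epsilon> * real n \<le> real k \<and> 2 * k \<le> n. of_real (2 * pi) * fb_coeff s n k * fb_center s n)
        + (\<Sum>k | real k < \<epsilon> * real n. of_real (2 * pi) * fb_coeff s n k * fb_center s n)" for n
  proof -
    let ?F = "{k. \<epsilon> * real n \<le> real k \<and> 2 * k \<le> n}" and ?S = "{k. real k < \<epsilon> * real n}"
    have S: "?S \<subseteq> {..n}"
    proof
      fix k assume "k \<in> ?S"
      then have "real k < \<epsilon> * n" by simp
      also have "\<epsilon> * n \<le> 1 * real n" using e1 by (intro mult_right_mono) auto
      finally show "k \<in> {..n}" by simp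
    qed
    have F: "?F \<subseteq> {..n}" by auto
    have fin: "finite ?F" "finite ?S" using finite_subset[OF F] finite_subset[OF S] by auto
    \<comment> \<open>Outside both ranges 2 k > n, and the summand is divisible by X^(2 k).\<close>
    have zero: "fb_coeff s n k = 0" if "k \<in> {..n} - (?F \<union> ?S)" for k
    proof -
      have "n < 2 * k" using that by auto
      moreover have "fps_X ^ (2 * k) dvd fishburn_term lam_fps (exp (s / of_real (sqrt (real n)))) k"
        by (rule fps_X_power_dvd_fishburn_term) (simp add: lam_fps_def lam_0)
      ultimately show ?thesis unfolding fb_coeff_def by (intro fps_nth_eq_0_if_X_power_dvd)
    qed
    have "of_real (2 * pi) * (\<Sum>A\<in>fishburn_matrices n. of_real (FM_weight lam A) * exp (s / of_real (sqrt (real n))) ^ dim_row A) * fb_center s n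
      = (\<Sum>k\<le>n. of_real (2 * pi) * fb_coeff s n k * fb_center s n)"
      unfolding fishburn_matrices_gf[of lam, OF lam_0] fb_coeff_def lam_fps_def by (simp only: sum_distrib_left sum_distrib_right)
    also have "\<dots> = (\<Sum>k\<in>?F \<union> ?S. of_real (2 * pi) * fb_coeff s n k * fb_center s n)"
      by (rule sum.mono_neutral_right) (use F S zero in auto)
    also have "\<dots> = (\<Sum>k\<in>?F. of_real (2 * pi) * fb_coeff s n k * fb_center s n) + (\<Sum>k\<in>?S. of_real (2 * pi) * fb_coeff s n k * fb_center s n)"
      by (rule sum.union_disjoint) (use fin in auto)
    finally show ?thesis .
  qed
  then show ?thesis using tendsto_add[OF window_sum_limit[OF \<epsilon>, of s] small] by simp
qed

end

section \<open>Convergence of the moment generating function\<close>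

lemma fb_mean: "fb_kappa / ln 2 = 6 / pi\<^sup>2"
  by (simp add: fb_kappa_def)

lemma fb_variance: "fb_kappa / (2 * ln 2) + fb_kappa * (fb_kappa - ln 2) / (ln 2)\<^sup>2 = 3 * (12 - pi\<^sup>2) / pi ^ 4"
proof -
  have "fb_kappa / (2 * ln 2) + fb_kappa * (fb_kappa - ln 2) / (ln 2)\<^sup>2 = (fb_kappa / ln 2) / 2 + (fb_kappa / ln 2) * (fb_kappa / ln 2 - 1)"
    using ln2_pos by (simp add: field_simps power2_eq_square)
  also have "\<dots> = 3 * (12 - pi\<^sup>2) / pi ^ 4"
    unfolding fb_mean by (simp add: field_simps power2_eq_square power4_eq_xxxx)
  finally show ?thesis .
qed

text \<open>Dividing by the case s = 0 turns weights into probabilities and removes the mass and the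
  Gaussian normalisation P, of which only P > 0 matters.\<close>

lemma (in fishburn_weights) gf_ratio_limit:
  fixes s :: complex
  shows "(\<lambda>n. (\<Sum>A\<in>fishburn_matrices n. of_real (FM_weight lam A) * exp (s * of_real ((real (dim_row A) - 6 / pi\<^sup>2 * real n) / sqrt (real n))))
      / of_real (\<Sum>A\<in>fishburn_matrices n. FM_weight lam A))
    \<longlonglongrightarrow> exp (s\<^sup>2 * of_real (3 * (12 - pi\<^sup>2) / pi ^ 4 / 2))"
proof -
  from saddle_circle obtain K :: nat and C :: real where
    KC: "0 < K \<and> 0 \<le> C \<and> (\<forall>k\<ge>K. 0 < rad k \<and> rad k < rad_conv \<and> rLam (rad k) = exp (ln 2 / k) \<and> 0 < rad_corr k
     \<and> (\<forall>t. norm (circ_corr k t) \<le> C * \<bar>t\<bar> / k)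
     \<and> (\<forall>t j. Lam (of_real (rad k) * cis t) ^ j = exp (of_real (node k j) * (cis t * (1 + circ_corr k t)))))
     \<and> (\<forall>k\<ge>K. \<forall>k'\<ge>K. \<bar>ln (rad_corr k) - ln (rad_corr k')\<bar> \<le> C * \<bar>1 / k - 1 / k'\<bar>)"
    by (elim exE) (rule that)
  note A = KC[THEN conjunct2, THEN conjunct2, THEN conjunct1, rule_format]
  note B = KC[THEN conjunct2, THEN conjunct2, THEN conjunct2, rule_format]
  interpret fishburn_saddle Lam lam K C
  proof
    show "0 < K" "0 \<le> C" using KC by blast+
    fix k assume k: "K \<le> k"
    note Ak = A[OF k]
    show "0 < rad k" by (rule Ak[THEN conjunct1])
    show "rad k < rad_conv" by (rule Ak[THEN conjunct2, THEN conjunct1])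
    show "rLam (rad k) = exp (ln 2 / real k)" by (rule Ak[THEN conjunct2, THEN conjunct2, THEN conjunct1])
    show "0 < rad_corr k" by (rule Ak[THEN conjunct2, THEN conjunct2, THEN conjunct2, THEN conjunct1])
    show "norm (circ_corr k t) \<le> C * \<bar>t\<bar> / k" for t by (rule Ak[THEN conjunct2, THEN conjunct2, THEN conjunct2, THEN conjunct2, THEN conjunct1, THEN spec])
    show "Lam (of_real (rad k) * cis t) ^ j = exp (of_real (node k j) * circ_arg k t)" for t j
      unfolding circ_arg_def by (rule Ak[THEN conjunct2, THEN conjunct2, THEN conjunct2, THEN conjunct2, THEN conjunct2, THEN spec, THEN spec])
    show "\<bar>ln (rad_corr k) - ln (rad_corr k')\<bar> \<le> C * \<bar>1 / real k - 1 / real k'\<bar>" if "K \<le> k'" for k'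
      by (rule B[OF k that])
  qed
  define P where "P = 2 * sqrt (2 * pi / (4 * ln 2 * fb_kappa - 1)) * sqrt (2 * pi / ((1 + 1 / (4 * ln 2 * fb_kappa - 1)) / fb_kappa\<^sup>2))"
  have P: "0 < P" using fb_kappa_bounds fb_kappa_pos unfolding P_def by (intro mult_pos_pos real_sqrt_gt_zero divide_pos_pos add_pos_pos) auto
  define S where "S n A = (real (dim_row A) - 6 / pi\<^sup>2 * real n) / sqrt (real n)" for n :: nat and A :: "nat mat"
  define num where "num s n = of_real (2 * pi) * (\<Sum>A\<in>fishburn_matrices n. of_real (FM_weight lam A) * exp (s / of_real (sqrt (real n))) ^ dim_row A) * fb_center s n" for s :: complex and n :: nat
  have num: "num s \<longlonglongrightarrow> of_real P * exp (s\<^sup>2 * of_real (3 * (12 - pi\<^sup>2) / pi ^ 4 / 2))" for s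
    using gf_limit[of s] unfolding num_def[symmetric] has_bochner_integral_integral_eq[OF fb_limit_double_integral] fb_variance P_def[symmetric] .
  have num_eq: "num s n = of_real (2 * pi) / of_real (fb_mass n (saddle_idx n)) * (\<Sum>A\<in>fishburn_matrices n. of_real (FM_weight lam A) * exp (s * of_real (S n A)))" for s n
  proof -
    have tm: "exp (s / of_real (sqrt (real n))) ^ d * exp (- (s * of_real (fb_kappa / ln 2 * real n) / of_real (sqrt (real n))))
       = exp (s * of_real ((real d - 6 / pi\<^sup>2 * real n) / sqrt (real n)))" for d
      unfolding exp_of_nat_mult[symmetric] exp_add[symmetric] fb_mean
      by (simp add: right_diff_distrib diff_divide_distrib mult.commute)
    have "num s n = of_real (2 * pi) / of_real (fb_mass n (saddle_idx n)) * (\<Sum>A\<in>fishburn_matrices n. of_real (FM_weight lam A) *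
        (exp (s / of_real (sqrt (real n))) ^ dim_row A * exp (- (s * of_real (fb_kappa / ln 2 * real n) / of_real (sqrt (real n))))))"
      unfolding num_def fb_center_def by (simp add: sum_distrib_right sum_distrib_left sum_divide_distrib mult_ac)
    then show ?thesis unfolding tm S_def .
  qed
  have "(\<lambda>n. num s n / num 0 n) \<longlonglongrightarrow> of_real P * exp (s\<^sup>2 * of_real (3 * (12 - pi\<^sup>2) / pi ^ 4 / 2)) / (of_real P * exp (0\<^sup>2 * of_real (3 * (12 - pi\<^sup>2) / pi ^ 4 / 2)))"
    using P by (intro tendsto_divide num) auto
  moreover have "num s n / num 0 n = (\<Sum>A\<in>fishburn_matrices n. of_real (FM_weight lam A) * exp (s * of_real (S n A))) / of_real (\<Sum>A\<in>fishburn_matrices n. FM_weight lam A)" for n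
  proof -
    have c: "complex_of_real (2 * pi) / of_real (fb_mass n (saddle_idx n)) \<noteq> 0" by (simp add: fb_mass_def)
    have "num 0 n = of_real (2 * pi) / of_real (fb_mass n (saddle_idx n)) * of_real (\<Sum>A\<in>fishburn_matrices n. FM_weight lam A)"
      unfolding num_eq by simp
    then show ?thesis unfolding num_eq[of s] by (simp only: mult_divide_mult_cancel_left[OF c])
  qed
  moreover have "of_real P * exp (s\<^sup>2 * of_real (3 * (12 - pi\<^sup>2) / pi ^ 4 / 2)) / (of_real P * exp (0\<^sup>2 * of_real (3 * (12 - pi\<^sup>2) / pi ^ 4 / 2)))
      = exp (s\<^sup>2 * of_real (3 * (12 - pi\<^sup>2) / pi ^ 4 / 2))" using P by simp
  ultimately show ?thesis unfolding S_def by (simp only:)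
qed

section \<open>Limit law and moments\<close>

text \<open>Two limits in succession: n \<rightarrow> \<infinity> for fixed s, then s \<rightarrow>
  0. It serves to extract limits of moments from limits of exponential moments.\<close>

lemma squeeze_family:
  fixes a :: "nat \<Rightarrow> real" and U D :: "nat \<Rightarrow> real \<Rightarrow> real"
  assumes up: "\<And>n s. 0 < s \<Longrightarrow> a n \<le> U n s" and U: "\<And>s. 0 < s \<Longrightarrow> (\<lambda>n. U n s) \<longlonglongrightarrow> u s" and u: "(u \<longlongrightarrow> L) (at_right 0)"
    and low: "\<And>n s. 0 < s \<Longrightarrow> D n s \<le> a n" and D: "\<And>s. 0 < s \<Longrightarrow> (\<lambda>n. D n s) \<longlonglongrightarrow> d s" and d: "(d \<longlongrightarrow> L) (at_right 0)"
  shows "a \<longlonglongrightarrow> L"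
proof (rule order_tendstoI)
  have pos: "\<forall>\<^sub>F s in at_right 0. 0 < (s :: real)" by (rule eventually_at_right_less)
  fix y assume y: "y < L"
  obtain s where s: "y < d s" "0 < s"
    using eventually_happens'[OF trivial_limit_at_right_real eventually_conj[OF order_tendstoD(1)[OF d y] pos]] by blast
  from order_tendstoD(1)[OF D[OF s(2)] s(1)] show "\<forall>\<^sub>F n in sequentially. y < a n"
    by eventually_elim (rule less_le_trans[OF _ low[OF s(2)]])
next
  have pos: "\<forall>\<^sub>F s in at_right 0. 0 < (s :: real)" by (rule eventually_at_right_less)
  fix y assume y: "L < y"
  obtain s where s: "u s < y" "0 < s"
    using eventually_happens'[OF trivial_limit_at_right_real eventually_conj[OF order_tendstoD(2)[OF u y] pos]] by blast
  from order_tendstoD(2)[OF U[OF s(2)] s(1)] show "\<forall>\<^sub>F n in sequentially. a n < y"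
    by eventually_elim (rule le_less_trans[OF up[OF s(2)]])
qed

text \<open>The fourth order Taylor remainder of exp is nonnegative, and the odd terms cancel
  between y and - y.\<close>

lemma cosh_ge_quadratic: "1 + y\<^sup>2 / 2 \<le> (exp y + exp (- y)) / (2 :: real)"
proof -
  have *: "1 + y + y\<^sup>2 / 2 + y ^ 3 / 6 \<le> exp y" for y :: real
  proof -
    obtain t where "exp y = (\<Sum>m<4. y ^ m / fact m) + exp t / fact 4 * y ^ 4"
      using Maclaurin_exp_le[of y 4] by blast
    moreover have "0 \<le> exp t / fact 4 * y ^ 4" by simp
    ultimately show ?thesis by (simp add: lessThan_nat_numeral fact_numeral)
  qed
  from *[of y] *[of "- y"] show ?thesis by simp
qed

lemma cos_ge_quadratic: "1 - y\<^sup>2 / 2 \<le> cos (y :: real)"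
proof -
  have "(sin (y / 2))\<^sup>2 \<le> (y / 2)\<^sup>2" using abs_sin_x_le_abs_x[of "y / 2"] by (simp only: abs_le_square_iff)
  then show ?thesis using cos_double_sin[of "y / 2"] by (simp add: power_divide)
qed

context fishburn_weights
begin

section \<open>Moments of the rescaled dimension\<close>

abbreviation FM_space :: "nat \<Rightarrow> nat mat measure" where "FM_space n \<equiv> measure_pmf (random_FM lam n)"

definition dev :: "nat \<Rightarrow> nat mat \<Rightarrow> real" where
  "dev n A = (real (dim_row A) - 6 / pi\<^sup>2 * real n) / sqrt (real n)"

abbreviation fb_var :: real where "fb_var \<equiv> 3 * (12 - pi\<^sup>2) / pi ^ 4"

lemma fb_var_pos: "0 < fb_var"
proof -
  have "pi * pi < 326 / 100 * (326 / 100)" using pi_less_3_26 by (intro mult_strict_mono) auto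
  then show ?thesis by (simp add: power2_eq_square)
qed

lemma set_pmf_random_FM: "set_pmf (random_FM lam n) \<subseteq> fishburn_matrices n"
  by (auto simp: set_pmf_eq pmf_random_FM[OF lam_0 lam_1 lam_nonneg])

lemma integrable_FM:
  fixes f :: "nat mat \<Rightarrow> 'b :: {banach, second_countable_topology}"
  shows "integrable (FM_space n) f"
  by (intro integrable_measure_pmf_finite finite_subset[OF set_pmf_random_FM finite_fishburn_matrices])

lemma exp_dev_limit:
  fixes s :: complex
  shows "(\<lambda>n. LINT A|FM_space n. exp (s * of_real (dev n A))) \<longlonglongrightarrow> exp (s\<^sup>2 * of_real (fb_var / 2))"
proof -
  have "(LINT A|FM_space n. exp (s * of_real (dev n A))) =
      (\<Sum>A\<in>fishburn_matrices n. of_real (FM_weight lam A) * exp (s * of_real (dev n A))) / of_real (\<Sum>A\<in>fishburn_matrices n. FM_weight lam A)" for n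
  proof -
    have "(LINT A|FM_space n. exp (s * of_real (dev n A))) = (\<Sum>A\<in>fishburn_matrices n. pmf (random_FM lam n) A *\<^sub>R exp (s * of_real (dev n A)))"
      by (rule integral_measure_pmf[OF finite_fishburn_matrices]) (use set_pmf_random_FM in blast)
    also have "\<dots> = (\<Sum>A\<in>fishburn_matrices n. of_real (FM_weight lam A) * exp (s * of_real (dev n A)) / of_real (\<Sum>A\<in>fishburn_matrices n. FM_weight lam A))"
      by (intro sum.cong refl) (simp add: pmf_random_FM[OF lam_0 lam_1 lam_nonneg] scaleR_conv_of_real)
    finally show ?thesis by (simp only: sum_divide_distrib)
  qed
  then show ?thesis using gf_ratio_limit[of s] unfolding dev_def by (simp only:)
qed

lemma real_exp_dev_limit:
  fixes s :: real
  shows "(\<lambda>n. LINT A|FM_space n. exp (s * dev n A)) \<longlonglongrightarrow> exp (s\<^sup>2 * (fb_var / 2))"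
proof -
  have "exp (complex_of_real s * of_real (dev n A)) = of_real (exp (s * dev n A))" for n A
    by (simp only: of_real_mult[symmetric] exp_of_real)
  then have "(\<lambda>n. complex_of_real (LINT A|FM_space n. exp (s * dev n A))) \<longlonglongrightarrow> exp ((of_real s)\<^sup>2 * of_real (fb_var / 2))"
    using exp_dev_limit[of "of_real s"] by (simp only: integral_complex_of_real)
  moreover have "exp ((of_real s)\<^sup>2 * of_real (fb_var / 2)) = complex_of_real (exp (s\<^sup>2 * (fb_var / 2)))"
    by (simp only: of_real_mult[symmetric] of_real_power[symmetric] exp_of_real)
  ultimately show ?thesis by (simp only: tendsto_of_real_iff)
qed

lemma cos_dev_limit: "(\<lambda>n. LINT A|FM_space n. cos (t * dev n A)) \<longlonglongrightarrow> exp (- (t\<^sup>2 * (fb_var / 2)))"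
proof -
  have "(\<lambda>n. Re (LINT A|FM_space n. exp (\<i> * of_real t * of_real (dev n A)))) \<longlonglongrightarrow> Re (exp ((\<i> * of_real t)\<^sup>2 * of_real (fb_var / 2)))"
    by (intro tendsto_Re exp_dev_limit)
  moreover have "Re (LINT A|FM_space n. exp (\<i> * of_real t * of_real (dev n A))) = (LINT A|FM_space n. cos (t * dev n A))" for n
    by (subst integral_Re[symmetric, OF integrable_FM]) (simp add: Re_exp)
  moreover have "(\<i> * of_real t)\<^sup>2 * of_real (fb_var / 2) = complex_of_real (- (t\<^sup>2 * (fb_var / 2)))"
    by (simp add: power_mult_distrib)
  then have "Re (exp ((\<i> * of_real t)\<^sup>2 * of_real (fb_var / 2))) = exp (- (t\<^sup>2 * (fb_var / 2)))"
    by (simp only: exp_of_real Re_complex_of_real)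
  ultimately show ?thesis by (simp only:)
qed

text \<open>Weak convergence alone does not control moments. The inequality 1 + y \<le> exp y, at y
  = s dev and y = - s dev, encloses the mean between difference quotients of the moment generating
  function, whose limits are of order s.\<close>

lemma mean_dev_limit: "(\<lambda>n. LINT A|FM_space n. dev n A) \<longlonglongrightarrow> 0"
proof (rule squeeze_family)
  have lin: "1 + s * (LINT A|FM_space n. dev n A) \<le> (LINT A|FM_space n. exp (s * dev n A))" for s n
  proof -
    have "(LINT A|FM_space n. 1 + s * dev n A) \<le> (LINT A|FM_space n. exp (s * dev n A))"
      by (intro integral_mono integrable_FM exp_ge_add_one_self)
    then show ?thesis by (simp add: integrable_FM)
  qed
  show "(LINT A|FM_space n. dev n A) \<le> ((LINT A|FM_space n. exp (s * dev n A)) - 1) / s" if "0 < s" for s n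
    using lin[of s n] that by (simp add: field_simps)
  show "(1 - (LINT A|FM_space n. exp (- s * dev n A))) / s \<le> (LINT A|FM_space n. dev n A)" if "0 < s" for s n
    using lin[of "- s" n] that by (simp add: field_simps)
  show "(\<lambda>n. ((LINT A|FM_space n. exp (s * dev n A)) - 1) / s) \<longlonglongrightarrow> (exp (s\<^sup>2 * (fb_var / 2)) - 1) / s" if "0 < s" for s
    using that by (intro tendsto_divide tendsto_diff real_exp_dev_limit tendsto_const) auto
  show "(\<lambda>n. (1 - (LINT A|FM_space n. exp (- s * dev n A))) / s) \<longlonglongrightarrow> (1 - exp ((- s)\<^sup>2 * (fb_var / 2))) / s" if "0 < s" for s
    using that by (intro tendsto_divide tendsto_diff real_exp_dev_limit tendsto_const) auto
  have gen: "((\<lambda>s. (exp (s\<^sup>2 * (c / 2)) - 1) / s) \<longlongrightarrow> 0) (at_right 0)"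
    "((\<lambda>s. (1 - exp ((- s)\<^sup>2 * (c / 2))) / s) \<longlongrightarrow> 0) (at_right 0)" if "0 < c" for c :: real
    using that by real_asymp+
  show "((\<lambda>s. (exp (s\<^sup>2 * (fb_var / 2)) - 1) / s) \<longlongrightarrow> 0) (at_right 0)" by (rule gen(1)[OF fb_var_pos])
  show "((\<lambda>s. (1 - exp ((- s)\<^sup>2 * (fb_var / 2))) / s) \<longlongrightarrow> 0) (at_right 0)" by (rule gen(2)[OF fb_var_pos])
qed

text \<open>1 + y^2 / 2 \<le> cosh y bounds the second moment from above by the moment generating
  function at real arguments, and 1 - y^2 / 2 \<le> cos y bounds it from below at imaginary
  ones.\<close>

lemma second_moment_dev_limit: "(\<lambda>n. LINT A|FM_space n. (dev n A)\<^sup>2) \<longlonglongrightarrow> fb_var"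
proof (rule squeeze_family)
  have up: "1 + s\<^sup>2 / 2 * (LINT A|FM_space n. (dev n A)\<^sup>2) \<le> ((LINT A|FM_space n. exp (s * dev n A)) + (LINT A|FM_space n. exp (- s * dev n A))) / 2" for s n
  proof -
    have "(LINT A|FM_space n. 1 + s\<^sup>2 / 2 * (dev n A)\<^sup>2) \<le> (LINT A|FM_space n. (exp (s * dev n A) + exp (- s * dev n A)) / 2)"
      using cosh_ge_quadratic[of "s * dev n _"] by (intro integral_mono integrable_FM) (simp add: power_mult_distrib)
    then show ?thesis by (simp add: integrable_FM)
  qed
  have low: "1 - s\<^sup>2 / 2 * (LINT A|FM_space n. (dev n A)\<^sup>2) \<le> (LINT A|FM_space n. cos (s * dev n A))" for s n
  proof -
    have "(LINT A|FM_space n. 1 - s\<^sup>2 / 2 * (dev n A)\<^sup>2) \<le> (LINT A|FM_space n. cos (s * dev n A))"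
      using cos_ge_quadratic[of "s * dev n _"] by (intro integral_mono integrable_FM) (simp add: power_mult_distrib)
    then show ?thesis by (simp add: integrable_FM)
  qed
  show "(LINT A|FM_space n. (dev n A)\<^sup>2) \<le> ((LINT A|FM_space n. exp (s * dev n A)) + (LINT A|FM_space n. exp (- s * dev n A)) - 2) / s\<^sup>2" if "0 < s" for s n
    using up[of s n] that by (simp add: field_simps)
  show "2 * (1 - (LINT A|FM_space n. cos (s * dev n A))) / s\<^sup>2 \<le> (LINT A|FM_space n. (dev n A)\<^sup>2)" if "0 < s" for s n
    using low[of s n] that by (simp add: field_simps)
  show "(\<lambda>n. ((LINT A|FM_space n. exp (s * dev n A)) + (LINT A|FM_space n. exp (- s * dev n A)) - 2) / s\<^sup>2)
      \<longlonglongrightarrow> (exp (s\<^sup>2 * (fb_var / 2)) + exp ((- s)\<^sup>2 * (fb_var / 2)) - 2) / s\<^sup>2" if "0 < s" for s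
    using that by (intro tendsto_divide tendsto_diff tendsto_add real_exp_dev_limit tendsto_const) auto
  show "(\<lambda>n. 2 * (1 - (LINT A|FM_space n. cos (s * dev n A))) / s\<^sup>2) \<longlonglongrightarrow> 2 * (1 - exp (- (s\<^sup>2 * (fb_var / 2)))) / s\<^sup>2" if "0 < s" for s
    using that by (intro tendsto_divide tendsto_mult tendsto_diff cos_dev_limit tendsto_const) auto
  have gen: "((\<lambda>s. (exp (s\<^sup>2 * (c / 2)) + exp ((- s)\<^sup>2 * (c / 2)) - 2) / s\<^sup>2) \<longlongrightarrow> c) (at_right 0)"
    "((\<lambda>s. 2 * (1 - exp (- (s\<^sup>2 * (c / 2)))) / s\<^sup>2) \<longlongrightarrow> c) (at_right 0)" if "0 < c" for c :: real
    using that by real_asymp+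
  show "((\<lambda>s. (exp (s\<^sup>2 * (fb_var / 2)) + exp ((- s)\<^sup>2 * (fb_var / 2)) - 2) / s\<^sup>2) \<longlongrightarrow> fb_var) (at_right 0)" by (rule gen(1)[OF fb_var_pos])
  show "((\<lambda>s. 2 * (1 - exp (- (s\<^sup>2 * (fb_var / 2)))) / s\<^sup>2) \<longlongrightarrow> fb_var) (at_right 0)" by (rule gen(2)[OF fb_var_pos])
qed

end

theorem theorem1p1:
  fixes Lam :: "complex \<Rightarrow> complex" and lam :: "nat \<Rightarrow> real"
  assumes "Lam analytic_on {0}"
    and "fps_expansion Lam 0 = Abs_fps (\<lambda>j. complex_of_real (lam j))"
    and "lam 0 = 1"
    and "0 < lam 1"
    and "\<And>j. 0 \<le> lam j"
  shows "let \<mu> = 6 / pi\<^sup>2; \<sigma> = sqrt (3 * (12 - pi\<^sup>2) / pi ^ 4) in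
    weak_conv_m
      (\<lambda>n. distr (measure_pmf (FM_dimension lam n)) borel
              (\<lambda>X. (real X - \<mu> * real n) / (\<sigma> * sqrt (real n))))
      std_normal_distribution
    \<and> (\<lambda>n. measure_pmf.expectation (FM_dimension lam n) real / real n) \<longlonglongrightarrow> \<mu>
    \<and> (\<lambda>n. measure_pmf.variance (FM_dimension lam n) real / real n) \<longlonglongrightarrow> \<sigma>\<^sup>2"
proof -
  interpret fishburn_weights Lam lam by unfold_locales (use assms in auto)
  define \<sigma> where "\<sigma> = sqrt (3 * (12 - pi\<^sup>2) / pi ^ 4)"
  have \<sigma>: "0 < \<sigma>" "\<sigma>\<^sup>2 = fb_var" using fb_var_pos by (simp_all add: \<sigma>_def)
  have weak: "weak_conv_m (\<lambda>n. distr (measure_pmf (FM_dimension lam n)) borel (\<lambda>X. (real X - 6 / pi\<^sup>2 * real n) / (\<sigma> * sqrt (real n)))) std_normal_distribution"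
  proof (rule levy_continuity)
    show "real_distribution (distr (measure_pmf (FM_dimension lam n)) borel (\<lambda>X. (real X - 6 / pi\<^sup>2 * real n) / (\<sigma> * sqrt (real n))))" for n
      unfolding real_distribution_def real_distribution_axioms_def
      by (auto intro!: measure_pmf.prob_space_distr)
    show "real_distribution std_normal_distribution" by (rule real_dist_normal_dist)
    fix t :: real
    \<comment> \<open>\<open>dev\<close> is normalised by sqrt n only, so the argument t / \<sigma>
      supplies the missing factor.\<close>
    have "char (distr (measure_pmf (FM_dimension lam n)) borel (\<lambda>X. (real X - 6 / pi\<^sup>2 * real n) / (\<sigma> * sqrt (real n)))) t
        = (LINT A|FM_space n. exp (\<i> * of_real (t / \<sigma>) * of_real (dev n A)))" for n
    proof -
      have arg: "\<i> * of_real (t * ((real d - 6 / pi\<^sup>2 * real n) / (\<sigma> * sqrt (real n))))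
          = \<i> * of_real (t / \<sigma>) * of_real ((real d - 6 / pi\<^sup>2 * real n) / sqrt (real n))" for d :: nat
        by simp
      have "char (distr (measure_pmf (FM_dimension lam n)) borel (\<lambda>X. (real X - 6 / pi\<^sup>2 * real n) / (\<sigma> * sqrt (real n)))) t
         = (LINT A|FM_space n. iexp (t * ((real (dim_row A) - 6 / pi\<^sup>2 * real n) / (\<sigma> * sqrt (real n)))))"
        unfolding char_def FM_dimension_def by (subst integral_distr) simp_all
      then show ?thesis unfolding dev_def arg .
    qed
    moreover have "exp ((\<i> * of_real (t / \<sigma>))\<^sup>2 * of_real (fb_var / 2)) = char std_normal_distribution t"
    proof -
      have sq: "(\<i> * of_real a)\<^sup>2 * of_real c = complex_of_real (- (a\<^sup>2 * c))" for a c :: real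
        by (simp add: power_mult_distrib)
      have "(\<i> * of_real (t / \<sigma>))\<^sup>2 * of_real (fb_var / 2) = complex_of_real (- ((t / \<sigma>)\<^sup>2 * (\<sigma>\<^sup>2 / 2)))"
        unfolding \<sigma>(2)[symmetric] by (rule sq)
      also have "(t / \<sigma>)\<^sup>2 * (\<sigma>\<^sup>2 / 2) = t\<^sup>2 / 2" using \<sigma>(1) by (simp add: power_divide)
      finally show ?thesis by (simp only: char_std_normal_distribution exp_of_real minus_divide_left)
    qed
    ultimately show "(\<lambda>n. char (distr (measure_pmf (FM_dimension lam n)) borel (\<lambda>X. (real X - 6 / pi\<^sup>2 * real n) / (\<sigma> * sqrt (real n)))) t) \<longlonglongrightarrow> char std_normal_distribution t"
      using exp_dev_limit[of "\<i> * of_real (t / \<sigma>)"] by (simp only:)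
  qed
  define m where "m n = (LINT A|FM_space n. dev n A)" for n
  have dim: "real (dim_row A) = 6 / pi\<^sup>2 * real n + sqrt (real n) * dev n A" if "0 < n" for n A
    using that by (simp add: dev_def)
  have ex: "measure_pmf.expectation (FM_dimension lam n) real = 6 / pi\<^sup>2 * real n + sqrt (real n) * m n" if "0 < n" for n
    unfolding FM_dimension_def m_def integral_map_pmf dim[OF that] by (simp add: integrable_FM)
  have mean: "(\<lambda>n. measure_pmf.expectation (FM_dimension lam n) real / real n) \<longlonglongrightarrow> 6 / pi\<^sup>2"
  proof -
    have "(\<lambda>n. 6 / pi\<^sup>2 + 1 / sqrt (real n) * m n) \<longlonglongrightarrow> 6 / pi\<^sup>2 + 0 * 0"
      unfolding m_def by (intro tendsto_add tendsto_mult tendsto_const mean_dev_limit) real_asymp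
    moreover have "\<forall>\<^sub>F n in sequentially. 6 / pi\<^sup>2 + 1 / sqrt (real n) * m n = measure_pmf.expectation (FM_dimension lam n) real / real n"
      using eventually_gt_at_top[of 0] by eventually_elim (simp add: ex field_simps)
    ultimately have "(\<lambda>n. measure_pmf.expectation (FM_dimension lam n) real / real n) \<longlonglongrightarrow> 6 / pi\<^sup>2 + 0 * 0"
      by (rule Lim_transform_eventually)
    then show ?thesis by simp
  qed
  have variance: "(\<lambda>n. measure_pmf.variance (FM_dimension lam n) real / real n) \<longlonglongrightarrow> \<sigma>\<^sup>2"
  proof -
    \<comment> \<open>The variance divided by n is the variance of \<open>dev\<close>, that is, its
      second moment minus the square of its mean.\<close>
    have "(\<lambda>n. (LINT A|FM_space n. (dev n A)\<^sup>2) - (m n)\<^sup>2) \<longlonglongrightarrow> fb_var - 0\<^sup>2"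
      unfolding m_def by (intro tendsto_diff tendsto_power second_moment_dev_limit mean_dev_limit)
    moreover have "\<forall>\<^sub>F n in sequentially. (LINT A|FM_space n. (dev n A)\<^sup>2) - (m n)\<^sup>2 = measure_pmf.variance (FM_dimension lam n) real / real n"
      using eventually_gt_at_top[of 0]
    proof eventually_elim
      case (elim n)
      have "measure_pmf.variance (FM_dimension lam n) real = (LINT A|FM_space n. (real (dim_row A) - measure_pmf.expectation (FM_dimension lam n) real)\<^sup>2)"
        unfolding FM_dimension_def integral_map_pmf ..
      also have "\<dots> = (LINT A|FM_space n. real n * ((dev n A)\<^sup>2 - 2 * m n * dev n A + (m n)\<^sup>2))"
      proof (rule Bochner_Integration.integral_cong[OF refl])
        fix A
        have "real (dim_row A) - measure_pmf.expectation (FM_dimension lam n) real = sqrt (real n) * (dev n A - m n)"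
          unfolding ex[OF elim] dim[OF elim, of A] by (simp add: algebra_simps)
        then show "(real (dim_row A) - measure_pmf.expectation (FM_dimension lam n) real)\<^sup>2 = real n * ((dev n A)\<^sup>2 - 2 * m n * dev n A + (m n)\<^sup>2)"
          by (simp add: power_mult_distrib power2_diff mult_ac)
      qed
      also have "\<dots> = real n * ((LINT A|FM_space n. (dev n A)\<^sup>2) - 2 * m n * m n + (m n)\<^sup>2)"
        unfolding m_def by (simp add: integrable_FM)
      finally show ?case using elim by (simp add: power2_eq_square)
    qed
    ultimately have "(\<lambda>n. measure_pmf.variance (FM_dimension lam n) real / real n) \<longlonglongrightarrow> fb_var - 0\<^sup>2"
      by (rule Lim_transform_eventually)
    then show ?thesis by (simp add: \<sigma>(2))
  qed
  show ?thesis unfolding Let_def \<sigma>_def[symmetric] using weak mean variance by (intro conjI)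
qed

end
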